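(* Let $(M^7,g,\omega^3,\nabla)$ be a $7$-dimensional compact nearly parallel $G_2$-manifold and let $\nabla$ be the unique $G_2$-connection with totally skew-symmetric torsion. Then every $\nabla$-harmonic spinor $\Psi$ is $\nabla$-parallel. Moreover, the space of $\nabla$-parallel spinors is one-dimensional.
   Context: On $\mathbb R^7$ let $\omega^3=e_{127}+e_{135}-e_{146}-e_{236}-e_{245}+e_{347}+e_{567}$, $e_{ijk}=e_i\wedge e_j\wedge e_k$. A $G_2$-structure on an oriented Riemannian $7$-manifold $(M^7,g)$ is a $3$-form $\omega^3$ having this form in suitable local oriented orthonormal frames. It is nearly parallel if $\nabla^g_X\omega^3=-\frac\lambda4(X\lrcorner*\omega^3)$ for all $X$ with a constant $\lambda$ ($\nabla^g$ the Levi-Civita connection, $*$ the Hodge star); then $d\omega^3=-\lambda\,( *\omega^3)$. The unique affine connection $\nabla$ with $\nabla\omega^3=0$ whose torsion $T$ is a $3$-form is $g(\nabla_XY,Z)=g(\nabla^g_XY,Z)+\frac12T(X,Y,Z)$ with $T=-\frac\lambda6\,\omega^3$. Spinors are sections of the spinor bundle of the spin structure induced by the $G_2$-structure, with the connection induced by $\nabla$; Clifford multiplication satisfies $X\cdot X=-g(X,X)$ and the spin representation is chosen so that $e_1\cdots e_7$ acts as the identity. The Dirac operator of $\nabla$ is $D\Psi=\sum_ie_i\cdot\nabla_{e_i}\Psi$; $\Psi$ is $\nabla$-harmonic if $D\Psi=0$ and $\nabla$-parallel if $\nabla\Psi=0$. Dimension is over the field of scalars of the spinor bundle used (real or complex)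.
   Formalization: The one-dimensionality of the space of ∇-parallel spinors is stated only for λ ≠ 0, since for λ = 0 the flat 7-torus has an 8-dimensional space of parallel spinors; the manifold is taken to be connected. That harmonic spinors are parallel is stated for every λ. *)

theory Defs
  imports "HOL-Analysis.Analysis" "HOL-Library.Function_Algebras"
begin

text \<open>
  The manifold is a type \<open>'m\<close>, with a smooth structure given by an atlas of charts into
  \<open>real^7\<close>. The numeral type \<open>7\<close> indexes the coordinates as 1, ..., 7, where \<open>7 = 0\<close>.
\<close>

primrec Ck_on :: "nat \<Rightarrow> 'a::real_normed_vector set \<Rightarrow> ('a \<Rightarrow> 'b::real_normed_vector) \<Rightarrow> bool" where
  "Ck_on 0 S f \<longleftrightarrow> continuous_on S f"
| "Ck_on (Suc k) S f \<longleftrightarrow>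
     (\<forall>x\<in>S. f differentiable (at x)) \<and> (\<forall>v. Ck_on k S (\<lambda>x. frechet_derivative f (at x) v))"

text \<open>Used for open \<open>S\<close> in a finite-dimensional space only.\<close>

definition Cinf_on :: "'a::real_normed_vector set \<Rightarrow> ('a \<Rightarrow> 'b::real_normed_vector) \<Rightarrow> bool" where
  "Cinf_on S f \<longleftrightarrow> (\<forall>k. Ck_on k S f)"

type_synonym 'm chart = "'m set \<times> ('m \<Rightarrow> real^7)"

definition oriented_atlas :: "'m::topological_space chart set \<Rightarrow> bool" where
  "oriented_atlas A \<longleftrightarrow>
     (\<forall>(U, \<phi>)\<in>A. open U \<and> open (\<phi> ` U) \<and> homeomorphism U (\<phi> ` U) \<phi> (inv_into U \<phi>)) \<and>
     (\<Union>(U, \<phi>)\<in>A. U) = UNIV \<and>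
     (\<forall>(U, \<phi>)\<in>A. \<forall>(V, \<psi>)\<in>A.
        Cinf_on (\<phi> ` (U \<inter> V)) (\<psi> \<circ> inv_into U \<phi>) \<and>
        (\<forall>x\<in>\<phi> ` (U \<inter> V).
           det (matrix (frechet_derivative (\<psi> \<circ> inv_into U \<phi>) (at x))) > 0))"

definition smooth_map :: "'m::topological_space chart set \<Rightarrow> 'm set \<Rightarrow> ('m \<Rightarrow> 'b::real_normed_vector) \<Rightarrow> bool"
  where "smooth_map A U f \<longleftrightarrow> (\<forall>(V, \<phi>)\<in>A. Cinf_on (\<phi> ` (U \<inter> V)) (f \<circ> inv_into V \<phi>))"

definition smooth_near :: "'m::topological_space chart set \<Rightarrow> 'm \<Rightarrow> ('m \<Rightarrow> real) \<Rightarrow> bool" where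
  "smooth_near A p f \<longleftrightarrow> (\<exists>U. open U \<and> p \<in> U \<and> smooth_map A U f)"

text \<open>
  Tangent vectors at \<open>p\<close> are derivations of the algebra of germs of smooth functions at \<open>p\<close>,
  applied to representatives of the germs. The value on functions that are not smooth near \<open>p\<close>
  is normalised to 0.
\<close>

type_synonym 'm tvec = "('m \<Rightarrow> real) \<Rightarrow> real"

definition tangent_space :: "'m::topological_space chart set \<Rightarrow> 'm \<Rightarrow> 'm tvec set" where
  "tangent_space A p = {v.
     (\<forall>f. \<not> smooth_near A p f \<longrightarrow> v f = 0) \<and>
     (\<forall>f h. smooth_near A p f \<and> smooth_near A p h \<longrightarrow>
        (\<forall>a b. v (\<lambda>q. a * f q + b * h q) = a * v f + b * v h) \<and>
        v (\<lambda>q. f q * h q) = f p * v h + h p * v f \<and>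
        ((\<forall>\<^sub>F q in nhds p. f q = h q) \<longrightarrow> v f = v h))}"

definition lincomb :: "real \<Rightarrow> 'm tvec \<Rightarrow> real \<Rightarrow> 'm tvec \<Rightarrow> 'm tvec" where
  "lincomb a v b w = (\<lambda>f. a * v f + b * w f)"

text \<open>A vector field on \<open>U\<close> is a total function whose values off \<open>U\<close> are irrelevant.\<close>

definition vector_field :: "'m::topological_space chart set \<Rightarrow> 'm set \<Rightarrow> ('m \<Rightarrow> 'm tvec) \<Rightarrow> bool" where
  "vector_field A U X \<longleftrightarrow>
     (\<forall>p\<in>U. X p \<in> tangent_space A p) \<and>
     (\<forall>V f. open V \<and> V \<subseteq> U \<and> smooth_map A V f \<longrightarrow> smooth_map A V (\<lambda>p. X p f))"

definition lie_bracket ::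
  "'m::topological_space chart set \<Rightarrow> ('m \<Rightarrow> 'm tvec) \<Rightarrow> ('m \<Rightarrow> 'm tvec) \<Rightarrow> 'm \<Rightarrow> 'm tvec" where
  "lie_bracket A X Y p =
     (\<lambda>f. if smooth_near A p f then X p (\<lambda>q. Y q f) - Y p (\<lambda>q. X q f) else 0)"

definition riemannian_metric ::
  "'m::topological_space chart set \<Rightarrow> ('m \<Rightarrow> 'm tvec \<Rightarrow> 'm tvec \<Rightarrow> real) \<Rightarrow> bool" where
  "riemannian_metric A g \<longleftrightarrow>
     (\<forall>p. \<forall>u\<in>tangent_space A p. \<forall>v\<in>tangent_space A p. \<forall>w\<in>tangent_space A p.
        (\<forall>a b. g p (lincomb a u b v) w = a * g p u w + b * g p v w) \<and> g p u v = g p v u) \<and>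
     (\<forall>p. \<forall>v\<in>tangent_space A p. v \<noteq> 0 \<longrightarrow> g p v v > 0) \<and>
     (\<forall>U X Y. open U \<and> vector_field A U X \<and> vector_field A U Y \<longrightarrow>
        smooth_map A U (\<lambda>p. g p (X p) (Y p)))"

type_synonym 'm form3 = "'m \<Rightarrow> 'm tvec \<Rightarrow> 'm tvec \<Rightarrow> 'm tvec \<Rightarrow> real"

definition three_form :: "'m::topological_space chart set \<Rightarrow> 'm form3 \<Rightarrow> bool" where
  "three_form A om \<longleftrightarrow>
     (\<forall>p. \<forall>u\<in>tangent_space A p. \<forall>v\<in>tangent_space A p. \<forall>w\<in>tangent_space A p.
        om p u v w = - om p v u w \<and> om p u v w = - om p u w v \<and>
        (\<forall>u'\<in>tangent_space A p. \<forall>a b.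
           om p (lincomb a u b u') v w = a * om p u v w + b * om p u' v w)) \<and>
     (\<forall>U X Y Z. open U \<and> vector_field A U X \<and> vector_field A U Y \<and> vector_field A U Z \<longrightarrow>
        smooth_map A U (\<lambda>p. om p (X p) (Y p) (Z p)))"

definition oriented_orthonormal ::
  "'m::topological_space chart set \<Rightarrow> ('m \<Rightarrow> 'm tvec \<Rightarrow> 'm tvec \<Rightarrow> real) \<Rightarrow> 'm \<Rightarrow> (7 \<Rightarrow> 'm tvec) \<Rightarrow> bool" where
  "oriented_orthonormal A g p e \<longleftrightarrow>
     (\<forall>i. e i \<in> tangent_space A p) \<and>
     (\<forall>i j. g p (e i) (e j) = (if i = j then 1 else 0)) \<and>
     (\<forall>(U, \<phi>)\<in>A. p \<in> U \<longrightarrow> det (\<chi> i j. e i (\<lambda>q. \<phi> q $ j)) > 0)"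

text \<open>
  The Hodge star of a 3-form in dimension 7, normalised by
  \<open>*(e\<^sub>1 \<and> e\<^sub>2 \<and> e\<^sub>3) = e\<^sub>4 \<and> e\<^sub>5 \<and> e\<^sub>6 \<and> e\<^sub>7\<close> for oriented orthonormal frames. The determinant is
  the volume form on \<open>e\<^sub>i, e\<^sub>j, e\<^sub>k, v\<^sub>1, ..., v\<^sub>4\<close>, and 1/6 compensates for summing over all
  \<open>i, j, k\<close> instead of \<open>i < j < k\<close>. The result does not depend on the frame.
\<close>

definition hodge_star ::
  "'m::topological_space chart set \<Rightarrow> ('m \<Rightarrow> 'm tvec \<Rightarrow> 'm tvec \<Rightarrow> real) \<Rightarrow> 'm form3 \<Rightarrow>
   'm \<Rightarrow> 'm tvec \<Rightarrow> 'm tvec \<Rightarrow> 'm tvec \<Rightarrow> 'm tvec \<Rightarrow> real" where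
  "hodge_star A g om p v1 v2 v3 v4 =
     (let e = (SOME e. oriented_orthonormal A g p e);
          co = (\<lambda>v. \<chi> a. g p v (e a))
      in (1/6) * (\<Sum>i\<in>UNIV. \<Sum>j\<in>UNIV. \<Sum>k\<in>UNIV. om p (e i) (e j) (e k) *
           det (vector [axis i 1, axis j 1, axis k 1, co v1, co v2, co v3, co v4] :: real^7^7)))"

text \<open>
  A connection is given by \<open>\<nabla>\<^sub>v Y = nab p v Y\<close> for a tangent vector \<open>v\<close> at \<open>p\<close> and a vector
  field \<open>Y\<close> defined on some open neighbourhood of \<open>p\<close>.
\<close>

type_synonym 'm conn = "'m \<Rightarrow> 'm tvec \<Rightarrow> ('m \<Rightarrow> 'm tvec) \<Rightarrow> 'm tvec"

definition affine_connection :: "'m::topological_space chart set \<Rightarrow> 'm conn \<Rightarrow> bool" where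
  "affine_connection A nab \<longleftrightarrow>
     (\<forall>U Y Z p. open U \<and> p \<in> U \<and> vector_field A U Y \<and> vector_field A U Z \<longrightarrow>
        (\<forall>v\<in>tangent_space A p.
           nab p v Y \<in> tangent_space A p \<and>
           (\<forall>w\<in>tangent_space A p. \<forall>a b.
              nab p (lincomb a v b w) Y = lincomb a (nab p v Y) b (nab p w Y)) \<and>
           nab p v (\<lambda>q. lincomb 1 (Y q) 1 (Z q)) = lincomb 1 (nab p v Y) 1 (nab p v Z) \<and>
           (\<forall>f. smooth_map A U f \<longrightarrow>
              nab p v (\<lambda>q. lincomb (f q) (Y q) 0 0) = lincomb (v f) (Y p) (f p) (nab p v Y)) \<and>
           ((\<forall>q\<in>U. Y q = Z q) \<longrightarrow> nab p v Y = nab p v Z))) \<and>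
     (\<forall>U X Y. open U \<and> vector_field A U X \<and> vector_field A U Y \<longrightarrow>
        vector_field A U (\<lambda>p. nab p (X p) Y))"

definition torsion ::
  "'m::topological_space chart set \<Rightarrow> 'm conn \<Rightarrow> ('m \<Rightarrow> 'm tvec) \<Rightarrow> ('m \<Rightarrow> 'm tvec) \<Rightarrow> 'm \<Rightarrow> 'm tvec" where
  "torsion A nab X Y p = nab p (X p) Y - nab p (Y p) X - lie_bracket A X Y p"

definition levi_civita ::
  "'m::topological_space chart set \<Rightarrow> ('m \<Rightarrow> 'm tvec \<Rightarrow> 'm tvec \<Rightarrow> real) \<Rightarrow> 'm conn \<Rightarrow> bool" where
  "levi_civita A g nab \<longleftrightarrow> affine_connection A nab \<and>
     (\<forall>U X Y p. open U \<and> p \<in> U \<and> vector_field A U X \<and> vector_field A U Y \<longrightarrow>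
        torsion A nab X Y p = 0 \<and>
        (\<forall>v\<in>tangent_space A p.
           v (\<lambda>q. g q (X q) (Y q)) = g p (nab p v X) (Y p) + g p (X p) (nab p v Y)))"

definition nabla_form3 ::
  "'m conn \<Rightarrow> 'm form3 \<Rightarrow> 'm \<Rightarrow> 'm tvec \<Rightarrow>
   ('m \<Rightarrow> 'm tvec) \<Rightarrow> ('m \<Rightarrow> 'm tvec) \<Rightarrow> ('m \<Rightarrow> 'm tvec) \<Rightarrow> real" where
  "nabla_form3 nab om p v X Y Z =
     v (\<lambda>q. om q (X q) (Y q) (Z q))
     - om p (nab p v X) (Y p) (Z p) - om p (X p) (nab p v Y) (Z p) - om p (X p) (Y p) (nab p v Z)"

definition wedge3 :: "7 \<Rightarrow> 7 \<Rightarrow> 7 \<Rightarrow> real^7 \<Rightarrow> real^7 \<Rightarrow> real^7 \<Rightarrow> real" where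
  "wedge3 i j k x y z =
     det (vector [vector [x $ i, x $ j, x $ k],
                  vector [y $ i, y $ j, y $ k],
                  vector [z $ i, z $ j, z $ k]] :: real^3^3)"

definition omega0 :: "real^7 \<Rightarrow> real^7 \<Rightarrow> real^7 \<Rightarrow> real" where
  "omega0 x y z =
     wedge3 1 2 7 x y z + wedge3 1 3 5 x y z - wedge3 1 4 6 x y z - wedge3 2 3 6 x y z
     - wedge3 2 4 5 x y z + wedge3 3 4 7 x y z + wedge3 5 6 7 x y z"

definition adapted_frame ::
  "'m::topological_space chart set \<Rightarrow> ('m \<Rightarrow> 'm tvec \<Rightarrow> 'm tvec \<Rightarrow> real) \<Rightarrow> 'm form3 \<Rightarrow>
   'm \<Rightarrow> (7 \<Rightarrow> 'm tvec) \<Rightarrow> bool" where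
  "adapted_frame A g om p e \<longleftrightarrow> oriented_orthonormal A g p e \<and>
     (\<forall>i j k. om p (e i) (e j) (e k) = omega0 (axis i 1) (axis j 1) (axis k 1))"

definition local_adapted_frame ::
  "'m::topological_space chart set \<Rightarrow> ('m \<Rightarrow> 'm tvec \<Rightarrow> 'm tvec \<Rightarrow> real) \<Rightarrow> 'm form3 \<Rightarrow>
   'm set \<Rightarrow> (7 \<Rightarrow> 'm \<Rightarrow> 'm tvec) \<Rightarrow> bool" where
  "local_adapted_frame A g om U e \<longleftrightarrow> open U \<and>
     (\<forall>i. vector_field A U (e i)) \<and> (\<forall>p\<in>U. adapted_frame A g om p (\<lambda>i. e i p))"

definition G2_structure ::
  "'m::topological_space chart set \<Rightarrow> ('m \<Rightarrow> 'm tvec \<Rightarrow> 'm tvec \<Rightarrow> real) \<Rightarrow> 'm form3 \<Rightarrow> bool" where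
  "G2_structure A g om \<longleftrightarrow> three_form A om \<and>
     (\<forall>p. \<exists>U e. p \<in> U \<and> local_adapted_frame A g om U e)"

definition nearly_parallel ::
  "'m::topological_space chart set \<Rightarrow> ('m \<Rightarrow> 'm tvec \<Rightarrow> 'm tvec \<Rightarrow> real) \<Rightarrow> 'm form3 \<Rightarrow>
   'm conn \<Rightarrow> real \<Rightarrow> bool" where
  "nearly_parallel A g om nabg lam \<longleftrightarrow>
     (\<forall>U X Y Z p. open U \<and> p \<in> U \<and> vector_field A U X \<and> vector_field A U Y \<and> vector_field A U Z \<longrightarrow>
        (\<forall>v\<in>tangent_space A p.
           nabla_form3 nabg om p v X Y Z = - (lam / 4) * hodge_star A g om p v (X p) (Y p) (Z p)))"

text \<open>
  An affine connection with \<open>\<nabla>\<omega> = 0\<close> whose torsion \<open>T(X,Y,Z) = g(T(X,Y),Z)\<close> is a 3-form.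
  Antisymmetry in \<open>X, Y\<close> is automatic, and so is \<open>\<nabla>g = 0\<close>, because \<open>\<omega>\<close> determines \<open>g\<close>.
\<close>

definition G2_skew_connection ::
  "'m::topological_space chart set \<Rightarrow> ('m \<Rightarrow> 'm tvec \<Rightarrow> 'm tvec \<Rightarrow> real) \<Rightarrow> 'm form3 \<Rightarrow>
   'm conn \<Rightarrow> bool" where
  "G2_skew_connection A g om nab \<longleftrightarrow> affine_connection A nab \<and>
     (\<forall>U X Y Z p. open U \<and> p \<in> U \<and> vector_field A U X \<and> vector_field A U Y \<and> vector_field A U Z \<longrightarrow>
        (\<forall>v\<in>tangent_space A p. nabla_form3 nab om p v X Y Z = 0) \<and>
        g p (torsion A nab X Y p) (Z p) = - g p (torsion A nab X Z p) (Y p))"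

text \<open>
  The class constraint on the field of scalars \<open>'k\<close> has the instances \<open>real\<close> and \<open>complex\<close>.
  The Clifford algebra of \<open>\<real>\<^sup>7\<close> acts on \<open>'k^8\<close>, with \<open>gam i\<close> the Clifford multiplication
  by \<open>e\<^sub>i\<close>. Such representations are unique up to isomorphism.
\<close>

definition spin_representation :: "(7 \<Rightarrow> 'k::{real_normed_field,euclidean_space}^8^8) \<Rightarrow> bool" where
  "spin_representation gam \<longleftrightarrow>
     (\<forall>i j. gam i ** gam j + gam j ** gam i = (if i = j then - 2 *\<^sub>R mat 1 else 0)) \<and>
     gam 1 ** gam 2 ** gam 3 ** gam 4 ** gam 5 ** gam 6 ** gam 7 = mat 1"

definition clifford :: "(7 \<Rightarrow> 'k::{real_normed_field,euclidean_space}^8^8) \<Rightarrow> real^7 \<Rightarrow> 'k^8^8" where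
  "clifford gam x = (\<Sum>i\<in>UNIV. (x $ i) *\<^sub>R gam i)"

text \<open>\<open>Spin(7)\<close> consists of the products of an even number of unit vectors.\<close>

inductive_set Spin7 :: "(7 \<Rightarrow> 'k::{real_normed_field,euclidean_space}^8^8) \<Rightarrow> ('k^8^8) set"
  for gam where
  one: "mat 1 \<in> Spin7 gam"
| mult: "a \<in> Spin7 gam \<Longrightarrow> norm x = 1 \<Longrightarrow> norm y = 1 \<Longrightarrow>
           clifford gam x ** clifford gam y ** a \<in> Spin7 gam"

definition G2 :: "(real^7^7) set" where
  "G2 = {h. orthogonal_matrix h \<and> det h = 1 \<and>
     (\<forall>x y z. omega0 (h *v x) (h *v y) (h *v z) = omega0 x y z)}"

text \<open>
  The lift of the inclusion of \<open>G\<^sub>2\<close> in \<open>SO(7)\<close> along the covering \<open>Spin(7) \<rightarrow> SO(7)\<close>,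
  \<open>a \<mapsto> (x \<mapsto> a x a\<^sup>-\<^sup>1)\<close>. It exists and is unique because \<open>G\<^sub>2\<close> is simply connected.
\<close>

definition G2_lift ::
  "(7 \<Rightarrow> 'k::{real_normed_field,euclidean_space}^8^8) \<Rightarrow> (real^7^7 \<Rightarrow> 'k^8^8) \<Rightarrow> bool" where
  "G2_lift gam kap \<longleftrightarrow> continuous_on G2 kap \<and>
     (\<forall>h\<in>G2. kap h \<in> Spin7 gam \<and>
        (\<forall>x. kap h ** clifford gam x = clifford gam (h *v x) ** kap h)) \<and>
     (\<forall>h\<in>G2. \<forall>h'\<in>G2. kap (h ** h') = kap h ** kap h')"

definition frame_act :: "(7 \<Rightarrow> 'm tvec) \<Rightarrow> real^7^7 \<Rightarrow> 7 \<Rightarrow> 'm tvec" where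
  "frame_act e h i = (\<lambda>f. \<Sum>j\<in>UNIV. (h $ j $ i) * e j f)"

text \<open>
  The spin structure induced by the \<open>G\<^sub>2\<close>-structure is the extension of the bundle of adapted
  frames along the lift \<open>kap\<close>. Its spinor bundle is associated to the adapted frames by \<open>kap\<close>,
  and sections are the \<open>G\<^sub>2\<close>-equivariant functions \<open>\<Psi>(p, e)\<close> of adapted frames \<open>e\<close> at \<open>p\<close>,
  that is \<open>\<Psi>(p, e h) = kap(h)\<^sup>-\<^sup>1 \<Psi>(p, e)\<close>. Off the adapted frames \<open>\<Psi>\<close> is normalised to 0, so
  that the total function is determined by the section.
\<close>

type_synonym ('m, 'k) spinor = "'m \<Rightarrow> (7 \<Rightarrow> 'm tvec) \<Rightarrow> 'k^8"

definition spinor_field ::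
  "'m::topological_space chart set \<Rightarrow> ('m \<Rightarrow> 'm tvec \<Rightarrow> 'm tvec \<Rightarrow> real) \<Rightarrow> 'm form3 \<Rightarrow>
   (real^7^7 \<Rightarrow> 'k::{real_normed_field,euclidean_space}^8^8) \<Rightarrow> ('m, 'k) spinor \<Rightarrow> bool" where
  "spinor_field A g om kap \<Psi> \<longleftrightarrow>
     (\<forall>p e. \<not> adapted_frame A g om p e \<longrightarrow> \<Psi> p e = 0) \<and>
     (\<forall>p e. \<forall>h\<in>G2. adapted_frame A g om p e \<longrightarrow> kap h *v \<Psi> p (frame_act e h) = \<Psi> p e) \<and>
     (\<forall>U e. local_adapted_frame A g om U e \<longrightarrow> smooth_map A U (\<lambda>p. \<Psi> p (\<lambda>i. e i p)))"

text \<open>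
  The spinor derivative in a local adapted frame \<open>e\<close>:
  \<open>\<nabla>\<^sub>v \<Psi> = v(\<Psi>) + 1/4 \<Sum>\<^sub>i\<^sub>j g(\<nabla>\<^sub>v e\<^sub>i, e\<^sub>j) e\<^sub>i e\<^sub>j \<Psi>\<close>, where \<open>v\<close> differentiates the real components
  of \<open>\<Psi>\<close>. This is the section \<open>\<nabla>\<^sub>v \<Psi>\<close> evaluated at the frame \<open>e\<close>.
\<close>

definition spinor_nabla ::
  "('m \<Rightarrow> 'm tvec \<Rightarrow> 'm tvec \<Rightarrow> real) \<Rightarrow> 'm conn \<Rightarrow>
   (7 \<Rightarrow> 'k::{real_normed_field,euclidean_space}^8^8) \<Rightarrow>
   (7 \<Rightarrow> 'm \<Rightarrow> 'm tvec) \<Rightarrow> 'm \<Rightarrow> 'm tvec \<Rightarrow> ('m, 'k) spinor \<Rightarrow> 'k^8" where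
  "spinor_nabla g nab gam e p v \<Psi> =
     (\<Sum>b\<in>Basis. v (\<lambda>q. \<Psi> q (\<lambda>i. e i q) \<bullet> b) *\<^sub>R b)
     + (1/4) *\<^sub>R (\<Sum>i\<in>UNIV. \<Sum>j\<in>UNIV.
         g p (nab p v (e i)) (e j p) *\<^sub>R ((gam i ** gam j) *v \<Psi> p (\<lambda>i. e i p)))"

definition dirac ::
  "('m \<Rightarrow> 'm tvec \<Rightarrow> 'm tvec \<Rightarrow> real) \<Rightarrow> 'm conn \<Rightarrow>
   (7 \<Rightarrow> 'k::{real_normed_field,euclidean_space}^8^8) \<Rightarrow>
   (7 \<Rightarrow> 'm \<Rightarrow> 'm tvec) \<Rightarrow> 'm \<Rightarrow> ('m, 'k) spinor \<Rightarrow> 'k^8" where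
  "dirac g nab gam e p \<Psi> = (\<Sum>i\<in>UNIV. gam i *v spinor_nabla g nab gam e p (e i p) \<Psi>)"

definition harmonic_spinor ::
  "'m::topological_space chart set \<Rightarrow> ('m \<Rightarrow> 'm tvec \<Rightarrow> 'm tvec \<Rightarrow> real) \<Rightarrow> 'm form3 \<Rightarrow> 'm conn \<Rightarrow>
   (7 \<Rightarrow> 'k::{real_normed_field,euclidean_space}^8^8) \<Rightarrow> (real^7^7 \<Rightarrow> 'k^8^8) \<Rightarrow>
   ('m, 'k) spinor \<Rightarrow> bool" where
  "harmonic_spinor A g om nab gam kap \<Psi> \<longleftrightarrow> spinor_field A g om kap \<Psi> \<and>
     (\<forall>U e. local_adapted_frame A g om U e \<longrightarrow> (\<forall>p\<in>U. dirac g nab gam e p \<Psi> = 0))"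

definition parallel_spinor ::
  "'m::topological_space chart set \<Rightarrow> ('m \<Rightarrow> 'm tvec \<Rightarrow> 'm tvec \<Rightarrow> real) \<Rightarrow> 'm form3 \<Rightarrow> 'm conn \<Rightarrow>
   (7 \<Rightarrow> 'k::{real_normed_field,euclidean_space}^8^8) \<Rightarrow> (real^7^7 \<Rightarrow> 'k^8^8) \<Rightarrow>
   ('m, 'k) spinor \<Rightarrow> bool" where
  "parallel_spinor A g om nab gam kap \<Psi> \<longleftrightarrow> spinor_field A g om kap \<Psi> \<and>
     (\<forall>U e. local_adapted_frame A g om U e \<longrightarrow>
        (\<forall>p\<in>U. \<forall>v\<in>tangent_space A p. spinor_nabla g nab gam e p v \<Psi> = 0))"

definition spinor_scale :: "'k::{real_normed_field,euclidean_space} \<Rightarrow> ('m, 'k) spinor \<Rightarrow> ('m, 'k) spinor" where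
  "spinor_scale c \<Psi> = (\<lambda>p e. c *s \<Psi> p e)"

lemma vector_space_spinor_scale:
  "vector_space (spinor_scale :: 'k::{real_normed_field,euclidean_space} \<Rightarrow> ('m, 'k) spinor \<Rightarrow> _)"
  by unfold_locales
    (auto simp: spinor_scale_def fun_eq_iff vec_eq_iff algebra_simps)

end

theory Submission
  imports Defs
begin

text \<open>
  The stabiliser \<open>G\<^sub>2\<close> of \<open>\<omega>\<close> fixes a line \<open>s\<^sub>0\<close> in the spin module, and every spinor is
  \<open>f s\<^sub>0 + X s\<^sub>0\<close> for a unique scalar \<open>f\<close> and vector \<open>X\<close> (with scalar coefficients). Since \<open>\<nabla>\<close> is a
  \<open>G\<^sub>2\<close>-connection, \<open>\<nabla>\<close> acts on \<open>f\<close> and \<open>X\<close> separately, and the Dirac equation becomes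
  \<open>div X = 0\<close> and \<open>grad f = - curl X\<close>, where \<open>curl\<close> contracts \<open>\<nabla>X\<close> with \<open>\<omega>\<close>
  (\<open>dirac_parts\<close>).

  The nearly parallel equation makes the torsion of \<open>\<nabla>\<close> equal to \<open>t \<omega>\<close> with \<open>t = - \<lambda>/6\<close>
  (\<open>torsion_constant\<close>), which is \<open>\<nabla>\<close>-parallel. The curvature takes values in the Lie algebra of
  \<open>G\<^sub>2\<close> and satisfies a Bianchi identity whose inhomogeneous part is quadratic in \<open>t \<omega>\<close>. These two
  facts determine the contractions of the curvature with \<open>\<omega>\<close> and \<open>*\<omega>\<close>. Two consequences follow.

  First, \<open>div curl X = 0\<close> whenever \<open>div X = 0\<close>, so \<open>f\<close> is harmonic (\<open>laplacian_curl\<close>) and hence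
  constant by the strong maximum principle on a compact connected manifold. Therefore \<open>curl X = 0\<close>.

  Second, if \<open>div X\<close> and \<open>curl X\<close> vanish, then
  \<open>\<Delta>|X|\<^sup>2 = 2|\<nabla>X|\<^sup>2 + 48 t\<^sup>2|X|\<^sup>2\<close> (\<open>laplacian_norm\<close>). So \<open>|X|\<^sup>2\<close> is subharmonic, again constant,
  and the right-hand side vanishes: \<open>\<nabla>X = 0\<close>, which proves that the spinor is parallel, and
  \<open>\<lambda> X = 0\<close>. If \<open>\<lambda> \<noteq> 0\<close> only the spinors \<open>c s\<^sub>0\<close> with constant \<open>c\<close> remain, and these are
  parallel.

  The maximum principle replaces integration over the manifold, so that the whole argument is local
  apart from the existence of a maximum. For \<open>f\<close> and \<open>|X|\<^sup>2\<close> to be functions on the manifold, the lift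
  of \<open>G\<^sub>2\<close> to the spin group has to fix \<open>s\<^sub>0\<close> and not only its line; this is where the absence of
  nontrivial sign characters of \<open>G\<^sub>2\<close> enters (\<open>Gw_character_trivial\<close>).
\<close>

section \<open>Smooth functions on open sets and the Hadamard lemma\<close>

lemma linear_basis_expansion:
  fixes L :: "'a::euclidean_space \<Rightarrow> 'b::real_vector"
  assumes "linear L"
  shows "L u = (\<Sum>b\<in>Basis. (u \<bullet> b) *\<^sub>R L b)"
proof -
  have "L u = L (\<Sum>b\<in>Basis. (u \<bullet> b) *\<^sub>R b)" by (simp only: euclidean_representation)
  also have "\<dots> = (\<Sum>b\<in>Basis. (u \<bullet> b) *\<^sub>R L b)"
    by (simp only: linear_sum[OF assms] linear_scale[OF assms])
  finally show ?thesis .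
qed

lemma Ck_on_cong:
  assumes "open S" "\<And>x. x \<in> S \<Longrightarrow> f x = h x"
  shows "Ck_on k S f \<longleftrightarrow> Ck_on k S h"
  using assms(2)
proof (induction k arbitrary: f h)
  case 0
  then show ?case by (simp cong: continuous_on_cong)
next
  case (Suc k)
  have hd: "(f has_derivative D) (at x) \<longleftrightarrow> (h has_derivative D) (at x)" if "x \<in> S" for x D
    using has_derivative_transform_within_open[of f D x UNIV S h]
      has_derivative_transform_within_open[of h D x UNIV S f] assms(1) Suc.prems that by auto
  have fd: "frechet_derivative f (at x) = frechet_derivative h (at x)" if "x \<in> S" for x
    unfolding frechet_derivative_def using hd[OF that] by simp
  have "f differentiable (at x) \<longleftrightarrow> h differentiable (at x)" if "x \<in> S" for x
    unfolding differentiable_def using hd[OF that] by simp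
  moreover have "Ck_on k S (\<lambda>x. frechet_derivative f (at x) v) \<longleftrightarrow> Ck_on k S (\<lambda>x. frechet_derivative h (at x) v)" for v
    by (rule Suc.IH) (simp add: fd)
  ultimately show ?case by auto
qed

lemma Ck_on_subset: "Ck_on k S f \<Longrightarrow> T \<subseteq> S \<Longrightarrow> Ck_on k T f"
  by (induction k arbitrary: f) (auto intro: continuous_on_subset)

lemma Ck_on_SucD: "Ck_on (Suc k) S f \<Longrightarrow> Ck_on k S f"
proof (induction k arbitrary: f)
  case 0
  then show ?case
    by (auto intro!: continuous_at_imp_continuous_on differentiable_imp_continuous_within)
next
  case (Suc k)
  have "Ck_on (Suc k) S (\<lambda>x. frechet_derivative f (at x) v)" for v
    using Suc.prems by (simp only: Ck_on.simps(2)[of "Suc k"])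
  then have "Ck_on k S (\<lambda>x. frechet_derivative f (at x) v)" for v
    by (rule Suc.IH)
  then show ?case using Suc.prems by auto
qed

text \<open>Any family of derivatives whose directional values are of class \<open>C\<^sup>k\<close> certifies \<open>C\<^sup>k\<^sup>+\<^sup>1\<close>; this avoids
  computing with \<open>frechet_derivative\<close> itself.\<close>

lemma Ck_on_SucI:
  assumes "open S" "\<And>x. x \<in> S \<Longrightarrow> (f has_derivative D x) (at x)" "\<And>v. Ck_on k S (\<lambda>x. D x v)"
  shows "Ck_on (Suc k) S f"
proof -
  have fd: "frechet_derivative f (at x) = D x" if "x \<in> S" for x
    using frechet_derivative_at[OF assms(2)[OF that]] by simp
  have "Ck_on k S (\<lambda>x. frechet_derivative f (at x) v)" for v
    using assms(3)[of v] by (subst Ck_on_cong[OF assms(1)]) (auto simp: fd)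
  then show ?thesis using assms(2) by (auto simp: differentiable_def)
qed

lemma Ck_on_SucE:
  assumes "Ck_on (Suc k) S f"
  shows "\<And>x. x \<in> S \<Longrightarrow> (f has_derivative frechet_derivative f (at x)) (at x)"
    "\<And>v. Ck_on k S (\<lambda>x. frechet_derivative f (at x) v)"
  using assms frechet_derivative_works by auto

lemma Ck_on_const: "open S \<Longrightarrow> Ck_on k S (\<lambda>x. c)"
proof (induction k arbitrary: c)
  case (Suc k)
  show ?case by (rule Ck_on_SucI[OF Suc.prems, where D="\<lambda>x v. 0"]) (use Suc in auto)
qed simp

lemma Ck_on_bounded_linear:
  assumes "open S" "bounded_linear L"
  shows "Ck_on k S L"
proof (cases k)
  case 0
  then show ?thesis using assms(2) by (simp add: linear_continuous_on)
next
  case (Suc m)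
  show ?thesis unfolding Suc
    by (rule Ck_on_SucI[OF assms(1), where D="\<lambda>x. L"])
       (use assms Ck_on_const in \<open>auto intro: bounded_linear_imp_has_derivative\<close>)
qed

lemma Ck_on_add: "open S \<Longrightarrow> Ck_on k S f \<Longrightarrow> Ck_on k S h \<Longrightarrow> Ck_on k S (\<lambda>x. f x + h x)"
proof (induction k arbitrary: f h)
  case 0 then show ?case by (auto intro: continuous_intros)
next
  case (Suc k)
  note D = Ck_on_SucE[OF Suc.prems(2)] Ck_on_SucE[OF Suc.prems(3)]
  show ?case
    by (rule Ck_on_SucI[OF Suc.prems(1), OF has_derivative_add[OF D(1) D(3)]])
       (use Suc.IH Suc.prems D in auto)
qed

lemma Ck_on_linear_comp: "open S \<Longrightarrow> bounded_linear L \<Longrightarrow> Ck_on k S f \<Longrightarrow> Ck_on k S (\<lambda>x. L (f x))"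
proof (induction k arbitrary: f)
  case 0 then show ?case by (auto intro: continuous_intros bounded_linear.continuous_on)
next
  case (Suc k)
  note D = Ck_on_SucE[OF Suc.prems(3)]
  show ?case
    by (rule Ck_on_SucI[OF Suc.prems(1), OF bounded_linear.has_derivative[OF Suc.prems(2) D(1)]])
       (use Suc.IH Suc.prems D in auto)
qed

lemma Ck_on_scaleR: "open S \<Longrightarrow> Ck_on k S f \<Longrightarrow> Ck_on k S h \<Longrightarrow> Ck_on k S (\<lambda>x. f x *\<^sub>R h x)"
proof (induction k arbitrary: f h)
  case 0 then show ?case by (auto intro: continuous_intros)
next
  case (Suc k)
  note D = Ck_on_SucE[OF Suc.prems(2)] Ck_on_SucE[OF Suc.prems(3)]
  note L = Suc.prems(2,3)[THEN Ck_on_SucD]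
  show ?case
    by (rule Ck_on_SucI[OF Suc.prems(1), OF has_derivative_scaleR[OF D(1) D(3)]])
       (use Suc.IH Suc.prems(1) D L in \<open>auto intro!: Ck_on_add\<close>)
qed

lemma Ck_on_sum: "open S \<Longrightarrow> (\<And>i. i \<in> I \<Longrightarrow> Ck_on k S (f i)) \<Longrightarrow> Ck_on k S (\<lambda>x. \<Sum>i\<in>I. f i x)"
  by (induction I rule: infinite_finite_induct) (auto intro: Ck_on_add Ck_on_const)

lemma Ck_on_compose:
  fixes f :: "'b::euclidean_space \<Rightarrow> 'c::real_normed_vector" and h :: "'a::real_normed_vector \<Rightarrow> 'b"
  assumes S: "open S" and h: "Ck_on k S h" and T: "open T" and f: "Ck_on k T f" and sub: "h ` S \<subseteq> T"
  shows "Ck_on k S (\<lambda>x. f (h x))"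
  using h f
proof (induction k arbitrary: f)
  case 0 then show ?case using sub by (auto intro: continuous_on_compose2)
next
  case (Suc k)
  note D = Ck_on_SucE[OF Suc.prems(2)] Ck_on_SucE[OF Suc.prems(1)]
  have der: "((\<lambda>x. f (h x)) has_derivative
     (\<lambda>v. \<Sum>b\<in>Basis. (frechet_derivative h (at x) v \<bullet> b) *\<^sub>R frechet_derivative f (at (h x)) b)) (at x)"
    if x: "x \<in> S" for x
  proof -
    have hx: "h x \<in> T" using sub x by auto
    have lin: "linear (frechet_derivative f (at (h x)))"
      using D(1)[OF hx] has_derivative_linear by blast
    show ?thesis
      by (rule has_derivative_eq_rhs[OF has_derivative_compose[OF D(3)[OF x] D(1)[OF hx]]])
         (rule ext, rule linear_basis_expansion[OF lin])
  qed
  show ?case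
  proof (rule Ck_on_SucI[OF S der])
    fix v
    have "Ck_on k S (\<lambda>x. frechet_derivative h (at x) v \<bullet> b)" for b
      by (rule Ck_on_linear_comp[OF S bounded_linear_inner_left D(4)])
    moreover have "Ck_on k S (\<lambda>x. frechet_derivative f (at (h x)) b)" for b
      using Suc.IH[OF Ck_on_SucD[OF Suc.prems(1)] D(2)] .
    ultimately show "Ck_on k S (\<lambda>x. \<Sum>b\<in>Basis. (frechet_derivative h (at x) v \<bullet> b) *\<^sub>R frechet_derivative f (at (h x)) b)"
      by (intro Ck_on_sum Ck_on_scaleR S)
  qed auto
qed

lemma Cinf_on_cong: "open S \<Longrightarrow> (\<And>x. x \<in> S \<Longrightarrow> f x = h x) \<Longrightarrow> Cinf_on S f \<longleftrightarrow> Cinf_on S h"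
  unfolding Cinf_on_def using Ck_on_cong by blast

lemma Cinf_on_subset: "Cinf_on S f \<Longrightarrow> T \<subseteq> S \<Longrightarrow> Cinf_on T f"
  unfolding Cinf_on_def using Ck_on_subset by blast

lemma Cinf_on_const: "open S \<Longrightarrow> Cinf_on S (\<lambda>x. c)"
  unfolding Cinf_on_def using Ck_on_const by blast

lemma Cinf_on_add: "open S \<Longrightarrow> Cinf_on S f \<Longrightarrow> Cinf_on S h \<Longrightarrow> Cinf_on S (\<lambda>x. f x + h x)"
  unfolding Cinf_on_def using Ck_on_add by blast

lemma Cinf_on_linear_comp: "open S \<Longrightarrow> bounded_linear L \<Longrightarrow> Cinf_on S f \<Longrightarrow> Cinf_on S (\<lambda>x. L (f x))"
  unfolding Cinf_on_def using Ck_on_linear_comp by blast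

lemma Cinf_on_bounded_linear: "open S \<Longrightarrow> bounded_linear L \<Longrightarrow> Cinf_on S L"
  unfolding Cinf_on_def using Ck_on_bounded_linear by blast

lemma Cinf_on_mult:
  fixes f h :: "_ \<Rightarrow> real"
  shows "open S \<Longrightarrow> Cinf_on S f \<Longrightarrow> Cinf_on S h \<Longrightarrow> Cinf_on S (\<lambda>x. f x * h x)"
  unfolding Cinf_on_def using Ck_on_scaleR[of S _ f h] by simp

lemma Cinf_on_compose:
  fixes f :: "'b::euclidean_space \<Rightarrow> 'c::real_normed_vector" and h :: "'a::real_normed_vector \<Rightarrow> 'b"
  shows "open S \<Longrightarrow> Cinf_on S h \<Longrightarrow> open T \<Longrightarrow> Cinf_on T f \<Longrightarrow> h ` S \<subseteq> T \<Longrightarrow> Cinf_on S (\<lambda>x. f (h x))"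
  unfolding Cinf_on_def using Ck_on_compose by blast

lemma Cinf_on_derivative: "Cinf_on S f \<Longrightarrow> Cinf_on S (\<lambda>x. frechet_derivative f (at x) v)"
  unfolding Cinf_on_def using Ck_on_SucE(2) by blast

lemma Cinf_on_has_derivative: "Cinf_on S f \<Longrightarrow> x \<in> S \<Longrightarrow> (f has_derivative frechet_derivative f (at x)) (at x)"
  unfolding Cinf_on_def using Ck_on_SucE(1) by blast

lemma Cinf_on_continuous: "Cinf_on S f \<Longrightarrow> continuous_on S f"
  unfolding Cinf_on_def using Ck_on.simps(1) by blast

text \<open>Differentiation under the integral. The weight \<open>t ^ j\<close> is there for the induction: each
  derivative of the integrand in \<open>x\<close> produces one more factor \<open>t\<close>.\<close>

lemma Ck_on_ray_integral:
  fixes H :: "'a::euclidean_space \<Rightarrow> real"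
  assumes "Ck_on (Suc k) (ball x0 r) H"
  shows "Ck_on k (ball x0 r) (\<lambda>x. integral {0..1} (\<lambda>t. t ^ j * H (x0 + t *\<^sub>R (x - x0))))"
  using assms
proof (induction k arbitrary: H j)
  have seg: "x0 + t *\<^sub>R (x - x0) \<in> ball x0 r" if "x \<in> ball x0 r" "t \<in> {0..1}" for x :: 'a and t :: real
  proof -
    have "dist x0 (x0 + t *\<^sub>R (x - x0)) = t * dist x0 x"
      using that by (simp add: dist_norm norm_minus_commute)
    also have "\<dots> \<le> dist x0 x" using that by (simp add: mult_left_le_one_le)
    finally show ?thesis using that by simp
  qed
  have cont: "continuous_on (ball x0 r \<times> cbox 0 1) (\<lambda>(x, t::real). t ^ j * H (x0 + t *\<^sub>R (x - x0)))"
    if "continuous_on (ball x0 r) H" for H :: "'a \<Rightarrow> real" and j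
    unfolding split_beta
    by (intro continuous_intros continuous_on_compose2[OF that]) (use seg in auto)
  case 0
  have "continuous_on (ball x0 r) H" using Ck_on_SucD[OF 0] by simp
  from integral_continuous_on_param[OF cont[OF this]] show ?case by simp
next
  case (Suc k)
  have seg: "x0 + t *\<^sub>R (x - x0) \<in> ball x0 r" if "x \<in> ball x0 r" "t \<in> {0..1}" for x :: 'a and t :: real
  proof -
    have "dist x0 (x0 + t *\<^sub>R (x - x0)) = t * dist x0 x"
      using that by (simp add: dist_norm norm_minus_commute)
    also have "\<dots> \<le> dist x0 x" using that by (simp add: mult_left_le_one_le)
    finally show ?thesis using that by simp
  qed
  have cont: "continuous_on (ball x0 r \<times> cbox 0 1) (\<lambda>(x, t::real). t ^ j * H (x0 + t *\<^sub>R (x - x0)))"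
    if "continuous_on (ball x0 r) H" for H :: "'a \<Rightarrow> real" and j
    unfolding split_beta
    by (intro continuous_intros continuous_on_compose2[OF that]) (use seg in auto)
  note D = Ck_on_SucE[OF Suc.prems]
  define DH where "DH y = frechet_derivative H (at y)" for y
  define fx where "fx x t = t ^ Suc j *\<^sub>R Blinfun (DH (x0 + t *\<^sub>R (x - x0)))" for x and t :: real
  have bl: "bounded_linear (DH y)" if "y \<in> ball x0 r" for y
    using D(1)[OF that] has_derivative_bounded_linear unfolding DH_def by blast
  have fxa: "blinfun_apply (fx x t) v = t ^ Suc j * DH (x0 + t *\<^sub>R (x - x0)) v"
    if "x \<in> ball x0 r" "t \<in> {0..1}" for x t v
    using bounded_linear_Blinfun_apply[OF bl[OF seg[OF that]]] by (simp add: fx_def blinfun.scaleR_left)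
  have cDH: "continuous_on (ball x0 r) (\<lambda>y. DH y v)" for v
    using Ck_on_SucE(1)[OF D(2)[of v]] unfolding DH_def
    by (meson continuous_at_imp_continuous_on has_derivative_continuous)
  have cfx: "continuous_on (ball x0 r \<times> cbox 0 1) (\<lambda>(x, t). fx x t)"
  proof (rule continuous_on_blinfun_componentwise)
    fix i :: 'a
    show "continuous_on (ball x0 r \<times> cbox 0 1) (\<lambda>x. blinfun_apply (case x of (x, t) \<Rightarrow> fx x t) i)"
      by (rule continuous_on_eq[OF cont[OF cDH, of "Suc j" i]]) (auto simp: fxa split_beta)
  qed
  have der: "((\<lambda>x. integral (cbox 0 1) (\<lambda>t. t ^ j * H (x0 + t *\<^sub>R (x - x0)))) has_derivative
         blinfun_apply (integral (cbox 0 1) (fx x))) (at x)" if x: "x \<in> ball x0 r" for x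
  proof -
    have "((\<lambda>x. integral (cbox 0 1) (\<lambda>t. t ^ j * H (x0 + t *\<^sub>R (x - x0)))) has_derivative
         blinfun_apply (integral (cbox 0 1) (fx x))) (at x within ball x0 r)"
    proof (rule leibniz_rule[OF _ _ cfx x])
      fix x and t :: real assume xt: "x \<in> ball x0 r" "t \<in> cbox 0 1"
      then have xt': "t \<in> {0..1}" by simp
      have a: "((\<lambda>x. x0 + t *\<^sub>R (x - x0)) has_derivative (\<lambda>v. t *\<^sub>R v)) (at x)"
        by (auto intro!: derivative_eq_intros)
      have lin: "linear (DH (x0 + t *\<^sub>R (x - x0)))" using bl[OF seg[OF xt(1) xt']] bounded_linear.linear by blast
      have "((\<lambda>x. t ^ j * H (x0 + t *\<^sub>R (x - x0))) has_derivative (\<lambda>v. t ^ j * DH (x0 + t *\<^sub>R (x - x0)) (t *\<^sub>R v))) (at x)"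
        using has_derivative_mult_right[OF has_derivative_compose[OF a D(1)[OF seg[OF xt(1) xt']]], of "t ^ j"]
        unfolding DH_def .
      moreover have "(\<lambda>v. t ^ j * DH (x0 + t *\<^sub>R (x - x0)) (t *\<^sub>R v)) = blinfun_apply (fx x t)"
        by (auto simp: fun_eq_iff fxa[OF xt(1) xt'] linear_scale[OF lin])
      ultimately show "((\<lambda>x. t ^ j * H (x0 + t *\<^sub>R (x - x0))) has_derivative blinfun_apply (fx x t)) (at x within ball x0 r)"
        by (simp add: has_derivative_at_withinI)
    next
      fix x assume x: "x \<in> ball x0 r"
      have cH: "continuous_on (ball x0 r) H" 
        using D(1) by (meson continuous_at_imp_continuous_on has_derivative_continuous)
      have "continuous_on (cbox 0 1) (\<lambda>t. t ^ j * H (x0 + t *\<^sub>R (x - x0)))"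
        by (intro continuous_intros continuous_on_compose2[OF cH]) (use seg x in auto)
      then show "(\<lambda>t. t ^ j * H (x0 + t *\<^sub>R (x - x0))) integrable_on cbox 0 1"
        by (rule integrable_continuous)
    qed simp
    then show ?thesis by (simp only: at_within_open[OF x open_ball])
  qed
  have ap: "blinfun_apply (integral (cbox 0 1) (fx x)) v
      = integral {0..1} (\<lambda>t. t ^ Suc j * DH (x0 + t *\<^sub>R (x - x0)) v)" if x: "x \<in> ball x0 r" for x v
  proof -
    have "continuous_on (cbox 0 (1::real)) (\<lambda>t. (x, t))"
      by (rule continuous_on_Pair[OF continuous_on_const continuous_on_id])
    moreover have "Pair x ` cbox 0 (1::real) \<subseteq> ball x0 r \<times> cbox 0 1" using x by auto
    ultimately have "continuous_on (cbox 0 1) (fx x)"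
      using continuous_on_compose2[OF cfx, of "cbox 0 1" "Pair x"] by simp
    then have "fx x integrable_on cbox 0 1" by (rule integrable_continuous)
    then have "blinfun_apply (integral (cbox 0 1) (fx x)) v = integral (cbox 0 1) (\<lambda>t. blinfun_apply (fx x t) v)"
      by (rule blinfun_apply_integral)
    also have "\<dots> = integral {0..1} (\<lambda>t. t ^ Suc j * DH (x0 + t *\<^sub>R (x - x0)) v)"
      by (auto intro!: integral_cong simp: fxa[OF x])
    finally show ?thesis .
  qed
  show ?case
  proof (rule Ck_on_SucI[OF open_ball])
    show "((\<lambda>x. integral {0..1} (\<lambda>t. t ^ j * H (x0 + t *\<^sub>R (x - x0)))) has_derivative
         blinfun_apply (integral (cbox 0 1) (fx x))) (at x)" if "x \<in> ball x0 r" for x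
      using der[OF that] by simp
    fix v
    have "Ck_on k (ball x0 r) (\<lambda>x. integral {0..1} (\<lambda>t. t ^ Suc j * DH (x0 + t *\<^sub>R (x - x0)) v))"
      using Suc.IH[OF D(2)[of v], of "Suc j"] unfolding DH_def .
    then show "Ck_on k (ball x0 r) (\<lambda>x. blinfun_apply (integral (cbox 0 1) (fx x)) v)"
      by (subst Ck_on_cong[OF open_ball, where h = "\<lambda>x. integral {0..1} (\<lambda>t. t ^ Suc j * DH (x0 + t *\<^sub>R (x - x0)) v)"])
        (rule ap, assumption, assumption)
  qed
qed

text \<open>This is what makes a derivation at a point depend on a function only through its differential in a
  chart.\<close>

lemma Hadamard:
  fixes F :: "'a::euclidean_space \<Rightarrow> real"
  assumes F: "Cinf_on (ball x0 r) F"
  obtains G where "\<And>b. b \<in> Basis \<Longrightarrow> Cinf_on (ball x0 r) (G b)"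
    and "\<And>x. x \<in> ball x0 r \<Longrightarrow> F x = F x0 + (\<Sum>b\<in>Basis. ((x - x0) \<bullet> b) * G b x)"
    and "\<And>b. G b x0 = frechet_derivative F (at x0) b"
proof
  define G where "G b x = integral {0..1} (\<lambda>t. frechet_derivative F (at (x0 + t *\<^sub>R (x - x0))) b)" for b x
  show "Cinf_on (ball x0 r) (G b)" for b
    unfolding Cinf_on_def
  proof
    fix k
    have "Ck_on (Suc k) (ball x0 r) (\<lambda>x. frechet_derivative F (at x) b)"
      using Cinf_on_derivative[OF F] unfolding Cinf_on_def by blast
    from Ck_on_ray_integral[OF this, of 0] show "Ck_on k (ball x0 r) (G b)"
      by (simp add: G_def[abs_def])
  qed
  show "G b x0 = frechet_derivative F (at x0) b" for b
    by (simp add: G_def)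
  fix x assume x: "x \<in> ball x0 r"
  have seg: "x0 + t *\<^sub>R (x - x0) \<in> ball x0 r" if "t \<in> {0..1}" for t :: real
  proof -
    have "dist x0 (x0 + t *\<^sub>R (x - x0)) = t * dist x0 x"
      using that by (simp add: dist_norm norm_minus_commute)
    also have "\<dots> \<le> dist x0 x" using that by (simp add: mult_left_le_one_le)
    finally show ?thesis using x by simp
  qed
  let ?D = "\<lambda>t. frechet_derivative F (at (x0 + t *\<^sub>R (x - x0)))"
  have lin: "linear (?D t)" if "t \<in> {0..1}" for t
    using Cinf_on_has_derivative[OF F seg[OF that]] has_derivative_linear by blast
  have "((\<lambda>t. ?D t (x - x0)) has_integral F (x0 + 1 *\<^sub>R (x - x0)) - F (x0 + 0 *\<^sub>R (x - x0))) {0..1}"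
  proof (rule fundamental_theorem_of_calculus)
    fix t :: real assume t: "t \<in> {0..1}"
    have "((\<lambda>t. x0 + t *\<^sub>R (x - x0)) has_derivative (\<lambda>s. s *\<^sub>R (x - x0))) (at t)"
      by (auto intro!: derivative_eq_intros)
    from has_derivative_compose[OF this Cinf_on_has_derivative[OF F seg[OF t]]]
    have "((\<lambda>t. F (x0 + t *\<^sub>R (x - x0))) has_derivative (\<lambda>s. s *\<^sub>R ?D t (x - x0))) (at t)"
      by (simp add: linear_scale[OF lin[OF t]])
    then show "((\<lambda>t. F (x0 + t *\<^sub>R (x - x0))) has_vector_derivative ?D t (x - x0)) (at t within {0..1})"
      by (simp add: has_vector_derivative_def has_derivative_at_withinI)
  qed simp
  then have I: "integral {0..1} (\<lambda>t. ?D t (x - x0)) = F x - F x0" by (simp add: integral_unique)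
  have int: "(\<lambda>t. ?D t b) integrable_on {0..1}" for b
  proof -
    have c: "continuous_on (ball x0 r) (\<lambda>y. frechet_derivative F (at y) b)"
      by (intro Cinf_on_continuous Cinf_on_derivative F)
    have "continuous_on {0..1} (\<lambda>t. ?D t b)"
      by (intro continuous_on_compose2[OF c] continuous_intros) (use seg in auto)
    then show ?thesis by (rule integrable_continuous_interval)
  qed
  have "?D t (x - x0) = (\<Sum>b\<in>Basis. ((x - x0) \<bullet> b) * ?D t b)" if "t \<in> {0..1}" for t
    using linear_basis_expansion[OF lin[OF that], of "x - x0"] by (simp only: real_scaleR_def)
  then have "integral {0..1} (\<lambda>t. ?D t (x - x0)) = integral {0..1} (\<lambda>t. \<Sum>b\<in>Basis. ((x - x0) \<bullet> b) * ?D t b)"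
    by (intro integral_cong) auto
  also have "\<dots> = (\<Sum>b\<in>Basis. ((x - x0) \<bullet> b) * G b x)"
    by (subst integral_sum) (auto simp: G_def intro!: integrable_on_mult_right int)
  finally show "F x = F x0 + (\<Sum>b\<in>Basis. ((x - x0) \<bullet> b) * G b x)" using I by simp
qed

section \<open>The cross product of the seven-dimensional space\<close>

lemma exhaust_7: "(x::7) = 1 \<or> x = 2 \<or> x = 3 \<or> x = 4 \<or> x = 5 \<or> x = 6 \<or> x = 7"
proof (induct x)
  case (of_int z)
  then have "0 \<le> z" and "z < 7" by simp_all
  then have "z = 0 \<or> z = 1 \<or> z = 2 \<or> z = 3 \<or> z = 4 \<or> z = 5 \<or> z = 6" by arith
  then show ?case by auto
qed

lemma forall_7: "(\<forall>i::7. P i) \<longleftrightarrow> P 1 \<and> P 2 \<and> P 3 \<and> P 4 \<and> P 5 \<and> P 6 \<and> P 7"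
  by (metis exhaust_7)

lemma UNIV_7: "UNIV = {1, 2, 3, 4, 5, 6, 7::7}"
  using exhaust_7 by auto

lemma sum_7: "sum f (UNIV::7 set) = f 1 + f 2 + f 3 + f 4 + f 5 + f 6 + f 7"
  unfolding UNIV_7 by (simp add: ac_simps)

lemma omega0_expand: "omega0 x y z =
   (x$1*(y$2*z$7 - y$7*z$2) + x$2*(y$7*z$1 - y$1*z$7) + x$7*(y$1*z$2 - y$2*z$1))
 + (x$1*(y$3*z$5 - y$5*z$3) + x$3*(y$5*z$1 - y$1*z$5) + x$5*(y$1*z$3 - y$3*z$1))
 - (x$1*(y$4*z$6 - y$6*z$4) + x$4*(y$6*z$1 - y$1*z$6) + x$6*(y$1*z$4 - y$4*z$1))
 - (x$2*(y$3*z$6 - y$6*z$3) + x$3*(y$6*z$2 - y$2*z$6) + x$6*(y$2*z$3 - y$3*z$2))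
 - (x$2*(y$4*z$5 - y$5*z$4) + x$4*(y$5*z$2 - y$2*z$5) + x$5*(y$2*z$4 - y$4*z$2))
 + (x$3*(y$4*z$7 - y$7*z$4) + x$4*(y$7*z$3 - y$3*z$7) + x$7*(y$3*z$4 - y$4*z$3))
 + (x$5*(y$6*z$7 - y$7*z$6) + x$6*(y$7*z$5 - y$5*z$7) + x$7*(y$5*z$6 - y$6*z$5))"
  unfolding omega0_def wedge3_def det_3 by (simp add: algebra_simps)

definition cross7 :: "real^7 \<Rightarrow> real^7 \<Rightarrow> real^7" where
  "cross7 x y = (\<chi> k. omega0 x y (axis k 1))"

lemma cross7_nth:
  "cross7 x y $ 1 = x$2*y$7 - x$7*y$2 + (x$3*y$5 - x$5*y$3) - (x$4*y$6 - x$6*y$4)"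
  "cross7 x y $ 2 = x$7*y$1 - x$1*y$7 - (x$3*y$6 - x$6*y$3) - (x$4*y$5 - x$5*y$4)"
  "cross7 x y $ 3 = x$5*y$1 - x$1*y$5 - (x$6*y$2 - x$2*y$6) + (x$4*y$7 - x$7*y$4)"
  "cross7 x y $ 4 = - (x$6*y$1 - x$1*y$6) - (x$5*y$2 - x$2*y$5) + (x$7*y$3 - x$3*y$7)"
  "cross7 x y $ 5 = x$1*y$3 - x$3*y$1 - (x$2*y$4 - x$4*y$2) + (x$6*y$7 - x$7*y$6)"
  "cross7 x y $ 6 = - (x$1*y$4 - x$4*y$1) - (x$2*y$3 - x$3*y$2) + (x$7*y$5 - x$5*y$7)"
  "cross7 x y $ 7 = x$1*y$2 - x$2*y$1 + (x$3*y$4 - x$4*y$3) + (x$5*y$6 - x$6*y$5)"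
  by (simp_all add: cross7_def omega0_expand axis_def)

lemma inner_7: "(x::real^7) \<bullet> y = x$1*y$1 + x$2*y$2 + x$3*y$3 + x$4*y$4 + x$5*y$5 + x$6*y$6 + x$7*y$7"
  by (simp add: inner_vec_def sum_7)

lemma omega0_cross7: "omega0 x y z = cross7 x y \<bullet> z"
  by (simp add: omega0_expand inner_7 cross7_nth algebra_simps)

text \<open>The composition property of the octonions in terms of the cross product; the contraction formulas below
  rest on it.\<close>

lemma cross7_cross7: "cross7 x (cross7 x y) = (x \<bullet> y) *\<^sub>R x - (x \<bullet> x) *\<^sub>R y"
  by (simp add: vec_eq_iff forall_7 inner_7 cross7_nth algebra_simps)

text \<open>The structure constants of the cross product, i.e. the coefficients of the three-form.\<close>

definition w :: "7 \<Rightarrow> 7 \<Rightarrow> 7 \<Rightarrow> real" where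
  "w i j k = omega0 (axis i 1) (axis j 1) (axis k 1)"

lemma w_skew: "w j i k = - w i j k" "w i k j = - w i j k" "w i i k = 0" "w i j j = 0" "w i j i = 0"
  by (simp_all add: w_def omega0_expand algebra_simps)

lemma cross7_axis_nth: "cross7 (axis i 1) (axis j 1) $ k = w i j k"
  by (simp add: cross7_def w_def)

lemma w_table:
  "w 1 2 k = (if k = 7 then 1 else 0)"
  "w 1 3 k = (if k = 5 then 1 else 0)"
  "w 1 4 k = (if k = 6 then -1 else 0)"
  "w 1 5 k = (if k = 3 then -1 else 0)"
  "w 1 6 k = (if k = 4 then 1 else 0)"
  "w 1 7 k = (if k = 2 then -1 else 0)"
  "w 2 1 k = (if k = 7 then -1 else 0)"
  "w 2 3 k = (if k = 6 then -1 else 0)"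
  "w 2 4 k = (if k = 5 then -1 else 0)"
  "w 2 5 k = (if k = 4 then 1 else 0)"
  "w 2 6 k = (if k = 3 then 1 else 0)"
  "w 2 7 k = (if k = 1 then 1 else 0)"
  "w 3 1 k = (if k = 5 then -1 else 0)"
  "w 3 2 k = (if k = 6 then 1 else 0)"
  "w 3 4 k = (if k = 7 then 1 else 0)"
  "w 3 5 k = (if k = 1 then 1 else 0)"
  "w 3 6 k = (if k = 2 then -1 else 0)"
  "w 3 7 k = (if k = 4 then -1 else 0)"
  "w 4 1 k = (if k = 6 then 1 else 0)"
  "w 4 2 k = (if k = 5 then 1 else 0)"
  "w 4 3 k = (if k = 7 then -1 else 0)"
  "w 4 5 k = (if k = 2 then -1 else 0)"
  "w 4 6 k = (if k = 1 then -1 else 0)"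
  "w 4 7 k = (if k = 3 then 1 else 0)"
  "w 5 1 k = (if k = 3 then 1 else 0)"
  "w 5 2 k = (if k = 4 then -1 else 0)"
  "w 5 3 k = (if k = 1 then -1 else 0)"
  "w 5 4 k = (if k = 2 then 1 else 0)"
  "w 5 6 k = (if k = 7 then 1 else 0)"
  "w 5 7 k = (if k = 6 then -1 else 0)"
  "w 6 1 k = (if k = 4 then -1 else 0)"
  "w 6 2 k = (if k = 3 then -1 else 0)"
  "w 6 3 k = (if k = 2 then 1 else 0)"
  "w 6 4 k = (if k = 1 then 1 else 0)"
  "w 6 5 k = (if k = 7 then -1 else 0)"
  "w 6 7 k = (if k = 5 then 1 else 0)"
  "w 7 1 k = (if k = 2 then 1 else 0)"
  "w 7 2 k = (if k = 1 then -1 else 0)"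
  "w 7 3 k = (if k = 4 then 1 else 0)"
  "w 7 4 k = (if k = 3 then -1 else 0)"
  "w 7 5 k = (if k = 6 then 1 else 0)"
  "w 7 6 k = (if k = 5 then -1 else 0)"
  by (use exhaust_7[of k] in \<open>elim disjE; simp add: cross7_axis_nth[symmetric] cross7_nth axis_def\<close>)+

lemma cross7_linear:
  "cross7 (x + x') y = cross7 x y + cross7 x' y" "cross7 x (y + y') = cross7 x y + cross7 x y'"
  "cross7 (c *\<^sub>R x) y = c *\<^sub>R cross7 x y" "cross7 x (c *\<^sub>R y) = c *\<^sub>R cross7 x y"
  "cross7 (- x) y = - cross7 x y" "cross7 x (- y) = - cross7 x y"
  "cross7 (x - x') y = cross7 x y - cross7 x' y" "cross7 x (y - y') = cross7 x y - cross7 x y'"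
  "cross7 0 y = 0" "cross7 x 0 = 0" "cross7 x x = 0"
  by (simp_all add: vec_eq_iff forall_7 cross7_nth algebra_simps)

lemma cross7_commute: "cross7 y x = - cross7 x y"
  by (simp add: vec_eq_iff forall_7 cross7_nth algebra_simps)

lemma inner_cross7_self: "cross7 x y \<bullet> x = 0" "cross7 x y \<bullet> y = 0"
  by (simp_all add: inner_7 cross7_nth algebra_simps)

lemma inner_cross7_swap: "cross7 x y \<bullet> z = - (cross7 x z \<bullet> y)"
  using inner_cross7_self(2)[of x "y + z"]
  by (simp add: cross7_linear inner_add_left inner_add_right inner_cross7_self)

lemma inner_cross7_same: "cross7 x y \<bullet> cross7 x z = (x \<bullet> x) * (y \<bullet> z) - (x \<bullet> y) * (x \<bullet> z)"
  by (subst inner_cross7_swap)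
     (simp add: cross7_cross7 inner_diff_left inner_diff_right inner_commute)

lemma inner_cross7_cross7:
  "cross7 x y \<bullet> cross7 x' z + cross7 x' y \<bullet> cross7 x z
   = 2 * (x \<bullet> x') * (y \<bullet> z) - (x \<bullet> y) * (x' \<bullet> z) - (x' \<bullet> y) * (x \<bullet> z)"
  using inner_cross7_same[of "x + x'" y z] inner_cross7_same[of x y z] inner_cross7_same[of x' y z]
  by (simp add: cross7_linear inner_add_left inner_add_right inner_commute[of x' x] algebra_simps)

lemma cross7_cross7_polar:
  "cross7 x (cross7 x' y) + cross7 x' (cross7 x y) = (x \<bullet> y) *\<^sub>R x' + (x' \<bullet> y) *\<^sub>R x - (2 * (x \<bullet> x')) *\<^sub>R y"
  using cross7_cross7[of "x + x'" y] cross7_cross7[of x y] cross7_cross7[of x' y]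
  by (simp add: cross7_linear inner_add_left inner_add_right inner_commute[of x' x] mult_2 algebra_simps)

definition d7 :: "7 \<Rightarrow> 7 \<Rightarrow> real" where "d7 i j = (if i = j then 1 else 0)"

lemma d7_simps: "d7 i i = 1" "d7 i j = d7 j i"
  by (auto simp: d7_def)

lemma sum_d7 [simp]:
  "(\<Sum>j\<in>UNIV. d7 i j * f j) = f i" "(\<Sum>j\<in>UNIV. d7 j i * f j) = f i"
  "(\<Sum>j\<in>UNIV. f j * d7 i j) = f i" "(\<Sum>j\<in>UNIV. f j * d7 j i) = f i"
  by (simp_all add: d7_def if_distrib[of "\<lambda>x. x * _"] if_distrib[of "\<lambda>x. _ * x"] cong: if_cong)

lemma axis_inner_axis: "(axis i 1 :: real^7) \<bullet> axis j 1 = d7 i j"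
  by (simp add: inner_axis_axis d7_def)

text \<open>The coefficients of the Hodge dual four-form, given by the contraction identity that they satisfy
  instead of by a list; that this is the Hodge dual is shown in \<open>star_w_psi\<close>.\<close>

definition psi :: "7 \<Rightarrow> 7 \<Rightarrow> 7 \<Rightarrow> 7 \<Rightarrow> real" where
  "psi i j k l = (\<Sum>m\<in>UNIV. w i j m * w k l m) - d7 i k * d7 j l + d7 i l * d7 j k"

lemma psi_skew: "psi j i k l = - psi i j k l" "psi i k j l = - psi i j k l" "psi i j l k = - psi i j k l"
proof -
  show "psi j i k l = - psi i j k l" "psi i j l k = - psi i j k l"
    by (simp_all add: psi_def w_skew(1)[of j i] w_skew(1)[of l k] sum_negf)
  have S: "(\<Sum>m\<in>UNIV. w i j m * w k l m) = cross7 (axis i 1) (axis j 1) \<bullet> cross7 (axis k 1) (axis l 1)" for i j k l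
    by (simp add: inner_vec_def cross7_axis_nth)
  show "psi i k j l = - psi i j k l"
    using inner_cross7_cross7[of "axis i 1" "axis j 1" "axis l 1" "axis k 1"]
      cross7_commute[of "axis k 1" "axis l 1"] cross7_commute[of "axis j 1" "axis l 1"]
      inner_commute[of "cross7 (axis j 1) (axis l 1)" "cross7 (axis i 1) (axis k 1)"]
    d7_simps(2)[of j k]
    by (simp add: psi_def S axis_inner_axis d7_simps(2)[of l] algebra_simps)
qed

lemma sum_w_w: "(\<Sum>i\<in>UNIV. \<Sum>j\<in>UNIV. w i j k * w i j l) = 6 * d7 k l"
proof -
  have "(\<Sum>j\<in>UNIV. w i j k * w i j l) = d7 k l - d7 i k * d7 i l" for i
  proof -
    have "(\<Sum>j\<in>UNIV. w i j k * w i j l) = cross7 (axis i 1) (axis k 1) \<bullet> cross7 (axis i 1) (axis l 1)"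
      by (simp add: inner_vec_def cross7_axis_nth w_skew(2)[of i _ k] w_skew(2)[of i _ l])
    then show ?thesis by (simp add: inner_cross7_same axis_inner_axis d7_simps)
  qed
  then show ?thesis by (simp add: sum_subtractf) 
qed

text \<open>Contractions in three indices are rearranged with this rotation, since exchanging two adjacent sums
  repeatedly is hard to direct.\<close>

lemma sum_rot: "(\<Sum>a\<in>A. \<Sum>b\<in>B. \<Sum>c\<in>C. f a b c) = (\<Sum>c\<in>C. \<Sum>a\<in>A. \<Sum>b\<in>B. f a b c)"
  for f :: "_ \<Rightarrow> _ \<Rightarrow> _ \<Rightarrow> 'z::comm_monoid_add"
proof -
  have "(\<Sum>a\<in>A. \<Sum>b\<in>B. \<Sum>c\<in>C. f a b c) = (\<Sum>a\<in>A. \<Sum>c\<in>C. \<Sum>b\<in>B. f a b c)"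
    by (rule sum.cong[OF refl], rule sum.swap)
  also have "\<dots> = (\<Sum>c\<in>C. \<Sum>a\<in>A. \<Sum>b\<in>B. f a b c)" by (rule sum.swap)
  finally show ?thesis .
qed

lemma sum_w_psi: "(\<Sum>i\<in>UNIV. \<Sum>j\<in>UNIV. w i j n * psi i j l m) = 4 * w l m n"
proof -
  have "(\<Sum>i\<in>UNIV. \<Sum>j\<in>UNIV. w i j n * psi i j l m)
    = (\<Sum>i\<in>UNIV. \<Sum>j\<in>UNIV. (\<Sum>p\<in>UNIV. w i j n * (w i j p * w l m p)) - d7 i l * (d7 j m * w i j n) + d7 i m * (d7 j l * w i j n))"
    by (simp add: psi_def algebra_simps sum_distrib_left)
  also have "\<dots> = (\<Sum>i\<in>UNIV. \<Sum>j\<in>UNIV. \<Sum>p\<in>UNIV. w i j n * (w i j p * w l m p)) - w l m n + w m l n"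
    by (simp add: sum_subtractf sum.distrib sum_distrib_left[symmetric])
  also have "(\<Sum>i\<in>UNIV. \<Sum>j\<in>UNIV. \<Sum>p\<in>UNIV. w i j n * (w i j p * w l m p))
     = (\<Sum>p\<in>UNIV. \<Sum>i\<in>UNIV. \<Sum>j\<in>UNIV. w i j n * (w i j p * w l m p))"
    by (rule sum_rot)
  also have "\<dots> = (\<Sum>p\<in>UNIV. (\<Sum>i\<in>UNIV. \<Sum>j\<in>UNIV. w i j n * w i j p) * w l m p)"
    by (simp add: sum_distrib_right mult.assoc)
  also have "\<dots> = 6 * w l m n"
    unfolding sum_w_w by (simp add: mult.assoc sum_distrib_left[symmetric])
  finally show ?thesis by (simp add: w_skew(1)[of m l])
qed

text \<open>The derivation action of an endomorphism on the three-form. Its kernel is the Lie algebra of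
  the stabiliser.\<close>

definition w_action :: "(7 \<Rightarrow> 7 \<Rightarrow> real) \<Rightarrow> 7 \<Rightarrow> 7 \<Rightarrow> 7 \<Rightarrow> real" where
  "w_action A j k l = (\<Sum>m\<in>UNIV. A j m * w m k l + A k m * w j m l + A l m * w j k m)"

lemma w_cyc: "w i j k = w j k i"
  using w_skew(1)[of j i k] w_skew(2)[of j i k] by simp

lemma sum_w_w': "(\<Sum>i\<in>UNIV. \<Sum>j\<in>UNIV. w k i j * w l i j) = 6 * d7 k l"
  using sum_w_w[of k l] by (simp add: w_cyc[of k] w_cyc[of l])

lemma sum_w_w_psi: "(\<Sum>m\<in>UNIV. w i j m * w k l m) = psi i j k l + d7 i k * d7 j l - d7 i l * d7 j k"
  by (simp add: psi_def)

text \<open>An endomorphism annihilating the three-form is skew and has no component in the seven-dimensional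
  part of the skew endomorphisms. Contracting the equation with \<open>w\<close> gives one linear relation between
  the endomorphism, its trace and its contraction with \<open>psi\<close>; the symmetric and the skew part of that relation
  yield the two claims.\<close>

lemma w_action_zero:
  assumes "\<And>j k l. w_action A j k l = 0"
  shows "A k j = - A j k" and "(\<Sum>j\<in>UNIV. \<Sum>k\<in>UNIV. A j k * w j k n) = 0"
proof -
  define tr where "tr = (\<Sum>j\<in>UNIV. A j j)"
  have key: "4 * A j p + 2 * (d7 j p * tr) + 2 * (\<Sum>l\<in>UNIV. \<Sum>m\<in>UNIV. A l m * psi j m p l) = 0" for j p
  proof -
    have "0 = (\<Sum>l\<in>UNIV. \<Sum>k\<in>UNIV. w_action A j l k * w p l k)" by (simp add: assms)
    also have "\<dots> = (\<Sum>l\<in>UNIV. \<Sum>k\<in>UNIV. \<Sum>m\<in>UNIV. A j m * (w m l k * w p l k))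
       + (\<Sum>l\<in>UNIV. \<Sum>k\<in>UNIV. \<Sum>m\<in>UNIV. A l m * (w j m k * w p l k))
       + (\<Sum>l\<in>UNIV. \<Sum>k\<in>UNIV. \<Sum>m\<in>UNIV. A k m * (w j l m * w p l k))"
      by (simp add: w_action_def sum_distrib_right distrib_right mult.assoc sum.distrib)
    also have "(\<Sum>l\<in>UNIV. \<Sum>k\<in>UNIV. \<Sum>m\<in>UNIV. A j m * (w m l k * w p l k)) = 6 * A j p"
      by (subst sum_rot) (simp add: sum_distrib_left[symmetric] sum_w_w' mult.left_commute[of _ 6])
    also have "(\<Sum>l\<in>UNIV. \<Sum>k\<in>UNIV. \<Sum>m\<in>UNIV. A k m * (w j l m * w p l k))
       = (\<Sum>k\<in>UNIV. \<Sum>l\<in>UNIV. \<Sum>m\<in>UNIV. A k m * (w j l m * w p l k))"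
      by (rule sum.swap)
    also have "\<dots> = (\<Sum>l\<in>UNIV. \<Sum>k\<in>UNIV. \<Sum>m\<in>UNIV. A l m * (w j m k * w p l k))"
    proof (intro sum.cong refl)
      fix l k m show "A l m * (w j k m * w p k l) = A l m * (w j m k * w p l k)"
        using w_skew(2)[of j k m] w_skew(2)[of p k l] by simp
    qed
    also have "(\<Sum>l\<in>UNIV. \<Sum>k\<in>UNIV. \<Sum>m\<in>UNIV. A l m * (w j m k * w p l k))
       = (\<Sum>l\<in>UNIV. \<Sum>m\<in>UNIV. A l m * (\<Sum>k\<in>UNIV. w j m k * w p l k))"
    proof (rule sum.cong[OF refl])
      fix l
      show "(\<Sum>k\<in>UNIV. \<Sum>m\<in>UNIV. A l m * (w j m k * w p l k))
         = (\<Sum>m\<in>UNIV. A l m * (\<Sum>k\<in>UNIV. w j m k * w p l k))"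
        by (subst sum.swap) (simp add: sum_distrib_left)
    qed
    also have "\<dots> = (\<Sum>l\<in>UNIV. \<Sum>m\<in>UNIV. A l m * psi j m p l + d7 j p * (d7 m l * A l m) - d7 j l * (d7 m p * A l m))"
      by (simp add: sum_w_w_psi algebra_simps)
    also have "\<dots> = (\<Sum>l\<in>UNIV. \<Sum>m\<in>UNIV. A l m * psi j m p l) + d7 j p * tr - A j p"
      by (simp add: sum.distrib sum_subtractf sum_distrib_left[symmetric] tr_def)
    finally show ?thesis by (simp add: algebra_simps)
  qed
  have sym: "A j p + A p j = - (d7 j p * tr)" for j p
  proof -
    have "(\<Sum>l\<in>UNIV. \<Sum>m\<in>UNIV. A l m * psi p m j l) = - (\<Sum>l\<in>UNIV. \<Sum>m\<in>UNIV. A l m * psi j m p l)"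
      unfolding sum_negf[symmetric]
    proof (intro sum.cong refl)
      fix l m
      have "psi p m j l = - psi j m p l"
        using psi_skew(1)[of j p m l] psi_skew(2)[of p j m l] psi_skew(2)[of j p m l] by simp
      then show "A l m * psi p m j l = - (A l m * psi j m p l)" by simp
    qed
    then show ?thesis using key[of j p] key[of p j] by (simp add: d7_simps(2)[of p j])
  qed
  have "(\<Sum>j\<in>UNIV. A j j + A j j) = (\<Sum>j\<in>(UNIV::7 set). - (d7 j j * tr))"
    by (simp only: sym)
  then have tr0: "tr = 0" by (simp add: sum_distrib_left[symmetric] tr_def[symmetric] d7_simps(1))
  have skew: "A k j = - A j k" for j k using sym[of j k] tr0 by simp
  then show "A k j = - A j k" .
  define B where "B n = (\<Sum>j\<in>UNIV. \<Sum>k\<in>UNIV. A j k * w j k n)" for n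
  have wB: "(\<Sum>n\<in>UNIV. w j p n * B n) = 0" for j p
  proof -
    have "(\<Sum>l\<in>UNIV. \<Sum>m\<in>UNIV. A l m * psi j m p l) = (\<Sum>l\<in>UNIV. \<Sum>m\<in>UNIV. A l m * psi j p l m)"
    proof (intro sum.cong refl)
      fix l m
      have "psi j m p l = psi j p l m" using psi_skew(2)[of j p m l] psi_skew(3)[of j p m l] by simp
      then show "A l m * psi j m p l = A l m * psi j p l m" by simp
    qed
    also have "\<dots> = (\<Sum>l\<in>UNIV. \<Sum>m\<in>UNIV. A l m * (\<Sum>n\<in>UNIV. w j p n * w l m n) - d7 j l * (d7 p m * A l m) + d7 p l * (d7 j m * A l m))"
      by (simp add: psi_def algebra_simps)
    also have "\<dots> = (\<Sum>l\<in>UNIV. \<Sum>m\<in>UNIV. \<Sum>n\<in>UNIV. w j p n * (A l m * w l m n)) - A j p + A p j"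
      by (simp add: sum.distrib sum_subtractf sum_distrib_left mult.left_commute)
        (simp add: sum_distrib_left[symmetric])
    also have "(\<Sum>l\<in>UNIV. \<Sum>m\<in>UNIV. \<Sum>n\<in>UNIV. w j p n * (A l m * w l m n)) = (\<Sum>n\<in>UNIV. w j p n * B n)"
      by (subst sum_rot) (simp add: sum_distrib_left B_def)
    finally show ?thesis using key[of j p] skew[of p j] tr0 by simp
  qed
  have "6 * B q = (\<Sum>n\<in>UNIV. (\<Sum>j\<in>UNIV. \<Sum>p\<in>UNIV. w j p q * w j p n) * B n)" for q
    by (simp add: sum_w_w mult.assoc sum_distrib_left[symmetric])
  also have "\<dots> q = (\<Sum>n\<in>UNIV. \<Sum>j\<in>UNIV. \<Sum>p\<in>UNIV. w j p q * (w j p n * B n))" for q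
    by (simp add: sum_distrib_right mult.assoc)
  also have "\<dots> q = (\<Sum>j\<in>UNIV. \<Sum>p\<in>UNIV. \<Sum>n\<in>UNIV. w j p q * (w j p n * B n))" for q
    by (rule sum_rot[symmetric])
  also have "\<dots> q = 0" for q
    by (simp add: sum_distrib_left[symmetric] wB)
  finally show "(\<Sum>j\<in>UNIV. \<Sum>k\<in>UNIV. A j k * w j k n) = 0" unfolding B_def by simp
qed

text \<open>A totally skew torsion is determined by a \<open>G\<^sub>2\<close>-connection: a three-form all of whose slices lie in the
  Lie algebra of the stabiliser is zero. This yields the uniqueness of the characteristic connection, and
  it is used to identify the torsion.\<close>

lemma g2_valued_three_form_zero:
  assumes s: "\<And>i j k. K j i k = - K i j k" and act: "\<And>i j k l. w_action (K i) j k l = 0"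
  shows "K i j k = 0"
proof -
  define Y where "Y i j a b = (\<Sum>m\<in>UNIV. K i j m * w m a b)" for i j a b
  have Ys: "Y j i a b = - Y i j a b" "Y i j b a = - Y i j a b" for i j a b
    by (simp_all add: Y_def s[of j i] w_skew(2)[of _ b a] sum_negf)
  have Yc: "Y i j a b + Y i a b j + Y i b j a = 0" for i j a b
    using act[of i j a b]
    by (simp add: Y_def w_action_def sum.distrib w_cyc[of j _ b] w_cyc[of j a])
      (simp add: w_cyc[of a _ j] w_cyc[of _ j a])
  have pair: "Y i j a b = Y a b i j" for i j a b
    using Yc[of i j a b] Yc[of j i b a] Yc[of a b i j] Yc[of b a j i]
      Yc[of a i j b] Yc[of b i j a] Yc[of i a b j] Yc[of j a b i]
      Ys[of i j a b] Ys[of i j b a] Ys[of j i a b] Ys[of a b i j] Ys[of a b j i] Ys[of b a i j]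
      Ys[of i a j b] Ys[of i a b j] Ys[of a i j b] Ys[of j b i a] Ys[of j b a i] Ys[of b j i a]
      Ys[of i b j a] Ys[of i b a j] Ys[of b i j a] Ys[of j a i b] Ys[of j a b i] Ys[of a j i b]
    by linarith
  have "6 * K i j n = (\<Sum>m\<in>UNIV. K i j m * (\<Sum>a\<in>UNIV. \<Sum>b\<in>UNIV. w m a b * w n a b))" for n
    by (simp add: sum_w_w' mult.left_commute[of _ 6] sum_distrib_left[symmetric])
  also have "\<dots> n = (\<Sum>m\<in>UNIV. \<Sum>a\<in>UNIV. \<Sum>b\<in>UNIV. (K i j m * w m a b) * w n a b)" for n
    by (simp add: sum_distrib_left mult.assoc)
  also have "\<dots> n = (\<Sum>a\<in>UNIV. \<Sum>b\<in>UNIV. Y i j a b * w n a b)" for n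
    by (subst sum_rot[symmetric]) (simp add: sum_distrib_right Y_def)
  also have "\<dots> n = (\<Sum>a\<in>UNIV. \<Sum>b\<in>UNIV. \<Sum>m\<in>UNIV. K a b m * w m i j * w n a b)" for n
    unfolding pair[of i j] by (simp add: sum_distrib_right Y_def)
  also have "\<dots> n = (\<Sum>m\<in>UNIV. (\<Sum>a\<in>UNIV. \<Sum>b\<in>UNIV. K m a b * w a b n) * w m i j)" for n
  proof -
    have "K a b m * w m i j * w n a b = K m a b * w a b n * w m i j" for a b m
      using s[of m a b] act w_action_zero(1)[of "K a" b m] by (simp add: w_cyc[of n] s[of a])
    then show ?thesis unfolding sum_distrib_right
      by (subst sum_rot) (intro sum.cong refl)
  qed
  also have "\<dots> n = 0" for n
    using w_action_zero(2)[of "K m" n for m] act by simp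
  finally show ?thesis by simp
qed

section \<open>The stabiliser of the three-form has no sign characters\<close>

text \<open>An orthonormal pair; together with its cross product it spans a copy of the imaginary quaternions.\<close>

definition on_pair :: "real^7 \<Rightarrow> real^7 \<Rightarrow> bool" where
  "on_pair a b \<longleftrightarrow> a \<bullet> a = 1 \<and> b \<bullet> b = 1 \<and> a \<bullet> b = 0"

definition qproj :: "real^7 \<Rightarrow> real^7 \<Rightarrow> real^7 \<Rightarrow> real^7" where
  "qproj a b x = (x \<bullet> a) *\<^sub>R a + (x \<bullet> b) *\<^sub>R b + (x \<bullet> cross7 a b) *\<^sub>R cross7 a b"

definition qperp :: "real^7 \<Rightarrow> real^7 \<Rightarrow> real^7 \<Rightarrow> bool" where
  "qperp a b y \<longleftrightarrow> y \<bullet> a = 0 \<and> y \<bullet> b = 0 \<and> y \<bullet> cross7 a b = 0"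

text \<open>The identity on the quaternionic three-space of the pair and minus the identity on its orthogonal
  complement. These involutions preserve the three-form and generate its stabiliser.\<close>

definition qrefl :: "real^7 \<Rightarrow> real^7 \<Rightarrow> real^7 \<Rightarrow> real^7" where
  "qrefl a b x = 2 *\<^sub>R qproj a b x - x"

lemma on_pair_cross:
  assumes "on_pair a b"
  shows "cross7 a b \<bullet> cross7 a b = 1" "cross7 a b \<bullet> a = 0" "cross7 a b \<bullet> b = 0"
    "a \<bullet> cross7 a b = 0" "b \<bullet> cross7 a b = 0" "b \<bullet> a = 0" "a \<bullet> a = 1" "b \<bullet> b = 1" "a \<bullet> b = 0"
    "cross7 a (cross7 a b) = - b" "cross7 b (cross7 a b) = a"
    "cross7 (cross7 a b) a = b" "cross7 (cross7 a b) b = - a"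
proof -
  show 1: "a \<bullet> a = 1" "b \<bullet> b = 1" "a \<bullet> b = 0" "b \<bullet> a = 0"
    using assms by (auto simp: on_pair_def inner_commute)
  show "cross7 a b \<bullet> cross7 a b = 1" by (simp add: inner_cross7_same 1)
  show "cross7 a b \<bullet> a = 0" "cross7 a b \<bullet> b = 0" by (rule inner_cross7_self)+
  then show "a \<bullet> cross7 a b = 0" "b \<bullet> cross7 a b = 0" by (simp_all add: inner_commute)
  show 2: "cross7 a (cross7 a b) = - b" by (simp add: cross7_cross7 1)
  have "cross7 b (cross7 b a) = - a" by (simp add: cross7_cross7 1)
  then show 3: "cross7 b (cross7 a b) = a" by (simp add: cross7_commute[of a b] cross7_linear)
  show "cross7 (cross7 a b) a = b" "cross7 (cross7 a b) b = - a"
    using cross7_commute[of "cross7 a b" a] cross7_commute[of "cross7 a b" b] 2 3 by simp_all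
qed

lemma qperp_cross:
  assumes ab: "on_pair a b" and y: "qperp a b y"
  shows "qperp a b (cross7 a y)" "qperp a b (cross7 b y)"
    "cross7 a (cross7 a y) = - y" "cross7 b (cross7 b y) = - y"
    "cross7 b (cross7 a y) = - cross7 a (cross7 b y)"
proof -
  note p = on_pair_cross[OF ab]
  have y': "a \<bullet> y = 0" "b \<bullet> y = 0" "cross7 a b \<bullet> y = 0" "y \<bullet> a = 0" "y \<bullet> b = 0" "y \<bullet> cross7 a b = 0"
    using y by (auto simp: qperp_def inner_commute)
  show "qperp a b (cross7 a y)"
    using inner_cross7_swap[of a y b] by (simp add: qperp_def inner_cross7_self inner_cross7_same y' p)
  have "cross7 b y \<bullet> a = 0" using inner_cross7_swap[of b y a] cross7_commute[of b a] y' by simp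
  moreover have "cross7 b y \<bullet> cross7 a b = 0"
    by (simp add: cross7_commute[of a b] inner_cross7_same y' p)
  ultimately show "qperp a b (cross7 b y)" by (simp add: qperp_def inner_cross7_self)
  show "cross7 a (cross7 a y) = - y" "cross7 b (cross7 b y) = - y" by (simp_all add: cross7_cross7 y' p)
  show "cross7 b (cross7 a y) = - cross7 a (cross7 b y)"
    using cross7_cross7_polar[of a b y] by (simp add: y' p eq_neg_iff_add_eq_0 add.commute)
qed

lemma omega0_move:
  assumes "y \<bullet> a = 0" "z \<bullet> a = 0" "u \<bullet> a = 0"
  shows "cross7 (cross7 a y) z \<bullet> u = cross7 y z \<bullet> cross7 a u"
proof -
  have "cross7 z (cross7 a y) + cross7 a (cross7 z y) = (z \<bullet> y) *\<^sub>R a"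
    using cross7_cross7_polar[of z a y] assms by (simp add: inner_commute)
  then have "cross7 (cross7 a y) z = cross7 a (cross7 z y) - (z \<bullet> y) *\<^sub>R a"
    using cross7_commute[of z "cross7 a y"] by (simp add: algebra_simps)
  then have "cross7 (cross7 a y) z \<bullet> u = cross7 a (cross7 z y) \<bullet> u"
    using assms(3) by (simp add: inner_diff_left inner_commute[of a u])
  also have "\<dots> = - (cross7 a u \<bullet> cross7 z y)" by (rule inner_cross7_swap)
  also have "\<dots> = cross7 y z \<bullet> cross7 a u" by (simp add: cross7_commute[of z y] inner_commute)
  finally show ?thesis .
qed

lemma omega0_qperp_zero:
  assumes ab: "on_pair a b" and "qperp a b y" "qperp a b z" "qperp a b u"
  shows "cross7 y z \<bullet> u = 0"
proof -
  note q = qperp_cross[OF ab]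
  have qp: "y \<bullet> a = 0" "y \<bullet> b = 0" if "qperp a b y" for y using that by (auto simp: qperp_def)
  have swap12: "cross7 y z \<bullet> u = - (cross7 z y \<bullet> u)" for y z u by (simp add: cross7_commute[of y z])
  have K: "cross7 y z \<bullet> cross7 a (cross7 b u) = 0" if h: "qperp a b y" "qperp a b z" "qperp a b u" for y z u
  proof -
    have "cross7 (cross7 a (cross7 b y)) z \<bullet> u = cross7 (cross7 b y) z \<bullet> cross7 a u"
      by (rule omega0_move) (use h q qp in auto)
    also have "\<dots> = cross7 y z \<bullet> cross7 b (cross7 a u)"
      by (rule omega0_move) (use h q qp in auto)
    also have "\<dots> = - (cross7 y z \<bullet> cross7 a (cross7 b u))" using q(5)[OF h(3)] by simp
    finally have 1: "cross7 (cross7 a (cross7 b y)) z \<bullet> u = - (cross7 y z \<bullet> cross7 a (cross7 b u))" .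
    have "cross7 (cross7 a (cross7 b y)) z \<bullet> u = - (cross7 (cross7 a (cross7 b y)) u \<bullet> z)"
      by (rule inner_cross7_swap)
    also have "cross7 (cross7 a (cross7 b y)) u \<bullet> z = cross7 (cross7 b y) u \<bullet> cross7 a z"
      by (rule omega0_move) (use h q qp in auto)
    also have "\<dots> = - (cross7 (cross7 b y) (cross7 a z) \<bullet> u)" by (rule inner_cross7_swap)
    also have "cross7 (cross7 b y) (cross7 a z) \<bullet> u = cross7 y (cross7 a z) \<bullet> cross7 b u"
      by (rule omega0_move) (use h q qp in auto)
    also have "\<dots> = - (cross7 (cross7 a z) y \<bullet> cross7 b u)" by (rule swap12)
    also have "cross7 (cross7 a z) y \<bullet> cross7 b u = cross7 z y \<bullet> cross7 a (cross7 b u)"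
      by (rule omega0_move) (use h q qp in auto)
    also have "\<dots> = - (cross7 y z \<bullet> cross7 a (cross7 b u))" by (rule swap12)
    finally show ?thesis using 1 by simp
  qed
  have "cross7 a (cross7 b (cross7 a (cross7 b u))) = - u"
    using q(5)[OF q(2)[OF assms(4)]] q(4)[OF assms(4)] q(3)[OF assms(4)] by (simp add: cross7_linear)
  moreover have "cross7 y z \<bullet> cross7 a (cross7 b (cross7 a (cross7 b u))) = 0"
    by (rule K) (use assms q in auto)
  ultimately show ?thesis by simp
qed

lemma qproj_linear: "qproj a b (x + y) = qproj a b x + qproj a b y" "qproj a b (c *\<^sub>R x) = c *\<^sub>R qproj a b x"
  "qproj a b (- x) = - qproj a b x" "qproj a b (x - y) = qproj a b x - qproj a b y"
  by (simp_all add: qproj_def inner_add_left inner_diff_left algebra_simps)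

lemma qproj_perp: "qperp a b y \<Longrightarrow> qproj a b y = 0"
  by (simp add: qproj_def qperp_def)

lemma qproj_basis:
  assumes "on_pair a b" 
  shows "qproj a b a = a" "qproj a b b = b" "qproj a b (cross7 a b) = cross7 a b"
  by (simp_all add: qproj_def on_pair_cross[OF assms])

lemma qperp_diff: "on_pair a b \<Longrightarrow> qperp a b (x - qproj a b x)"
  by (simp add: qperp_def qproj_def inner_diff_left inner_add_left on_pair_cross)

lemma inner_qproj_qperp: "qperp a b y \<Longrightarrow> qproj a b x \<bullet> y = 0" "qperp a b y \<Longrightarrow> y \<bullet> qproj a b x = 0"
  by (simp_all add: qperp_def qproj_def inner_add_left inner_add_right inner_commute)

lemma omega0_qproj_qproj_qperp:
  assumes ab: "on_pair a b" and u: "qperp a b u"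
  shows "cross7 (qproj a b x) (qproj a b y) \<bullet> u = 0"
proof -
  have "a \<bullet> u = 0" "b \<bullet> u = 0" "cross7 a b \<bullet> u = 0" "cross7 b a \<bullet> u = 0"
    using u cross7_commute[of b a] by (auto simp: qperp_def inner_commute)
  then show ?thesis
    by (simp add: qproj_def cross7_linear inner_add_left inner_diff_left on_pair_cross[OF ab])
qed

definition Gw :: "(real^7^7) set" where
  "Gw = {h. orthogonal_matrix h \<and> (\<forall>x y z. omega0 (h *v x) (h *v y) (h *v z) = omega0 x y z)}"

definition R :: "real^7 \<Rightarrow> real^7 \<Rightarrow> real^7^7" where "R a b = matrix (qrefl a b)"

lemma linear_qrefl: "linear (qrefl a b)"
  by (rule linearI) (simp_all add: qrefl_def qproj_linear algebra_simps)

lemma R_mult: "R a b *v x = qrefl a b x"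
  by (simp add: R_def linear_qrefl matrix_works)

lemma qrefl_split: 
  "qrefl a b x = qproj a b x - (x - qproj a b x)"
  by (simp add: qrefl_def scaleR_2)

lemma inner_qrefl: 
  assumes ab: "on_pair a b"
  shows "qrefl a b x \<bullet> qrefl a b y = x \<bullet> y"
proof -
  define v u v' u' where "v = qproj a b x" "u = x - qproj a b x" "v' = qproj a b y" "u' = y - qproj a b y"
  note d = this
  have z: "v \<bullet> u' = 0" "u \<bullet> v' = 0" using inner_qproj_qperp qperp_diff[OF ab] unfolding d by blast+
  have "x = v + u" "y = v' + u'" "qrefl a b x = v - u" "qrefl a b y = v' - u'"
    by (simp_all add: d qrefl_split)
  then show ?thesis using z by (simp add: inner_add_left inner_add_right inner_diff_left inner_diff_right)
qed

text \<open>The three-form has only terms with an even number of entries orthogonal to the quaternionic subspace,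
  and so the sign changes cancel.\<close>

lemma omega0_qrefl:
  assumes ab: "on_pair a b"
  shows "omega0 (qrefl a b x) (qrefl a b y) (qrefl a b z) = omega0 x y z"
proof -
  define P Q where "P = (\<lambda>x. qproj a b x)" and "Q = (\<lambda>x. x - qproj a b x)"
  have q: "qperp a b (Q x)" for x unfolding Q_def by (rule qperp_diff[OF ab])
  have "cross7 (P x) (P y) \<bullet> Q z = 0" "cross7 (Q x) (Q y) \<bullet> Q z = 0" for x y z
    using omega0_qproj_qproj_qperp[OF ab q] omega0_qperp_zero[OF ab q q q] by (auto simp: P_def)
  moreover from this have "cross7 (P x) (Q y) \<bullet> P z = 0" for x y z
    using inner_cross7_swap[of "P x" "Q y" "P z"] by simp
  moreover from this have "cross7 (Q x) (P y) \<bullet> P z = 0" for x y z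
    using cross7_commute[of "Q x" "P y"] by simp
  ultimately have z: "cross7 (P x) (P y) \<bullet> Q z = 0" "cross7 (Q x) (Q y) \<bullet> Q z = 0"
    "cross7 (P x) (Q y) \<bullet> P z = 0" "cross7 (Q x) (P y) \<bullet> P z = 0" for x y z by blast+
  have "x = P x + Q x" "qrefl a b x = P x - Q x" for x by (simp_all add: P_def Q_def qrefl_split)
  note s = this
  have "omega0 (qrefl a b x) (qrefl a b y) (qrefl a b z) = cross7 (P x - Q x) (P y - Q y) \<bullet> (P z - Q z)"
    by (simp only: omega0_cross7 s(2))
  also have "\<dots> = cross7 (P x + Q x) (P y + Q y) \<bullet> (P z + Q z)"
    by (simp add: cross7_linear inner_add_left inner_add_right inner_diff_left inner_diff_right z)
  also have "\<dots> = omega0 x y z" by (simp only: omega0_cross7 s(1)[symmetric])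
  finally show ?thesis .
qed

lemma R_in_Gw: "on_pair a b \<Longrightarrow> R a b \<in> Gw"
  using orthogonal_transformation_matrix[of "qrefl a b"] inner_qrefl[of a b] linear_qrefl
  by (auto simp: Gw_def R_mult omega0_qrefl orthogonal_transformation_def R_def[symmetric])

lemma Gw_mult: "h \<in> Gw \<Longrightarrow> k \<in> Gw \<Longrightarrow> h ** k \<in> Gw"
  by (auto simp: Gw_def orthogonal_matrix_mul matrix_vector_mul_assoc[symmetric])

lemma Gw_one: "mat 1 \<in> Gw" by (simp add: Gw_def orthogonal_matrix_id)

lemma Gw_inner: "h \<in> Gw \<Longrightarrow> (h *v x) \<bullet> (h *v y) = x \<bullet> y"
  using orthogonal_transformation_matrix[of "(*v) h"]
  by (auto simp: Gw_def orthogonal_transformation_def)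

lemma Gw_transpose: "h \<in> Gw \<Longrightarrow> transpose h ** h = mat 1 \<and> h ** transpose h = mat 1"
  by (auto simp: Gw_def orthogonal_matrix_def)

lemma Gw_transpose_in: assumes "h \<in> Gw" shows "transpose h \<in> Gw"
proof -
  have "h *v (transpose h *v x) = x" for x
    using Gw_transpose[OF assms] by (metis matrix_vector_mul_assoc matrix_vector_mul_lid)
  then show ?thesis using assms
    by (auto simp: Gw_def orthogonal_matrix_transpose) metis
qed

lemma Gw_cross7:
  assumes h: "h \<in> Gw"
  shows "cross7 (h *v x) (h *v y) = h *v cross7 x y"
proof -
  have "cross7 (h *v x) (h *v y) \<bullet> (h *v z) = (h *v cross7 x y) \<bullet> (h *v z)" for z
    using h by (simp add: Gw_inner omega0_cross7[symmetric]) (simp add: Gw_def)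
  moreover have "h *v (transpose h *v z) = z" for z
    using Gw_transpose[OF h] by (metis matrix_vector_mul_assoc matrix_vector_mul_lid)
  ultimately have "cross7 (h *v x) (h *v y) \<bullet> z = (h *v cross7 x y) \<bullet> z" for z by metis
  then show ?thesis using vector_eq_rdot by blast
qed

lemma Gw_on_pair: "h \<in> Gw \<Longrightarrow> on_pair a b \<Longrightarrow> on_pair (h *v a) (h *v b)"
  by (simp add: on_pair_def Gw_inner)

text \<open>Since the stabiliser acts transitively on orthonormal pairs, this makes all the involutions of this kind
  conjugate, and a character takes a single value on them.\<close>

lemma R_conj:
  assumes h: "h \<in> Gw"
  shows "h ** R a b ** transpose h = R (h *v a) (h *v b)"
proof (rule matrix_eq[THEN iffD2], rule allI)
  fix x
  have t: "h *v (transpose h *v x) = x" 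
    using Gw_transpose[OF h] by (metis matrix_vector_mul_assoc matrix_vector_mul_lid)
  define y where "y = transpose h *v x"
  have x: "x = h *v y" using t by (simp add: y_def)
  have "(h ** R a b ** transpose h) *v x = h *v qrefl a b y"
    by (simp add: matrix_vector_mul_assoc[symmetric] R_mult y_def)
  also have "\<dots> = qrefl (h *v a) (h *v b) x"
    by (simp add: qrefl_def qproj_def x Gw_inner[OF h] Gw_cross7[OF h] matrix_vector_mult_diff_distrib
        matrix_vector_right_distrib matrix_vector_mult_scaleR)
  finally show "(h ** R a b ** transpose h) *v x = R (h *v a) (h *v b) *v x" by (simp add: R_mult)
qed

lemma ex_unit_orth:
  fixes xs :: "(real^7) list"
  assumes "length xs < 7"
  shows "\<exists>u. u \<bullet> u = 1 \<and> (\<forall>s\<in>set xs. u \<bullet> s = 0)"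
proof -
  let ?S = "set xs"
  have "dim ?S < DIM(real^7)"
    using assms dim_le_card'[of ?S] card_length[of xs] by simp
  then obtain v where v: "v \<noteq> 0" "\<And>y. y \<in> span ?S \<Longrightarrow> orthogonal v y"
    using orthogonal_to_subspace_exists by blast
  have "(v /\<^sub>R norm v) \<bullet> (v /\<^sub>R norm v) = 1" using v(1) by (simp add: dot_square_norm power2_eq_square)
  moreover have "(v /\<^sub>R norm v) \<bullet> s = 0" if "s \<in> ?S" for s
    using v(2)[OF span_base[OF that]] by (simp add: orthogonal_def)
  ultimately show ?thesis by blast
qed

lemma ex_unit_orth3: "\<exists>u::real^7. u \<bullet> u = 1 \<and> u \<bullet> a = 0 \<and> u \<bullet> b = 0 \<and> u \<bullet> c = 0"
  using ex_unit_orth[of "[a, b, c]"] by simp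

lemma ex_unit_orth5:
  "\<exists>u::real^7. u \<bullet> u = 1 \<and> u \<bullet> a = 0 \<and> u \<bullet> b = 0 \<and> u \<bullet> c = 0 \<and> u \<bullet> d = 0 \<and> u \<bullet> e = 0"
  using ex_unit_orth[of "[a, b, c, d, e]"] by simp

lemma R_fix: "on_pair a b \<Longrightarrow> R a b *v a = a \<and> R a b *v b = b"
  by (simp add: R_mult qrefl_def qproj_basis scaleR_2)

lemma R_neg: "qperp a b x \<Longrightarrow> R a b *v x = - x"
  by (simp add: R_mult qrefl_def qproj_perp)

text \<open>The half-turn whose three-space contains \<open>n\<close> and \<open>x + y\<close> exchanges \<open>x\<close> and \<open>y\<close>, because \<open>x - y\<close> is
  orthogonal to that space.\<close>

lemma R_move_sum:
  assumes n: "n \<bullet> n = 1" and x: "x \<bullet> x = 1" "x \<bullet> n = 0" and y: "y \<bullet> y = 1" "y \<bullet> n = 0"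
    and o: "cross7 n x \<bullet> y = 0" and s: "x + y \<noteq> 0"
  obtains b where "on_pair n b" "R n b *v x = y"
    "\<And>v. v \<bullet> n = 0 \<Longrightarrow> v \<bullet> x = 0 \<Longrightarrow> v \<bullet> y = 0 \<Longrightarrow> cross7 n v \<bullet> x = 0 \<Longrightarrow> cross7 n v \<bullet> y = 0 \<Longrightarrow> R n b *v v = - v"
proof
  define c where "c = inverse (norm (x + y))"
  have c: "c \<noteq> 0" using s by (simp add: c_def)
  let ?b = "c *\<^sub>R (x + y)"
  have "norm ?b = 1" using s by (simp add: c_def)
  then show pair: "on_pair n ?b"
    using n x y by (simp add: on_pair_def dot_square_norm inner_add_right inner_commute)
  have "cross7 n y \<bullet> x = 0" using o inner_cross7_swap[of n y x] by simp
  then have "qperp n ?b (x - y)"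
    using x y o by (simp add: qperp_def inner_diff_left inner_diff_right inner_add_right cross7_linear inner_commute[of _ "cross7 _ _"] inner_cross7_self inner_commute[of y x])
  from R_neg[OF this] have 1: "R n ?b *v (x - y) = - (x - y)" .
  have "c *\<^sub>R (R n ?b *v (x + y)) = c *\<^sub>R (x + y)"
    using R_fix[OF pair] by (simp only: matrix_vector_mult_scaleR)
  then have 2: "R n ?b *v (x + y) = x + y" using c by simp
  have "x = (1/2) *\<^sub>R ((x + y) + (x - y))" by (simp add: scaleR_2[symmetric])
  then have "R n ?b *v x = (1/2) *\<^sub>R (R n ?b *v (x + y) + R n ?b *v (x - y))"
    by (metis matrix_vector_mult_scaleR matrix_vector_right_distrib)
  also have "\<dots> = (1/2) *\<^sub>R (2 *\<^sub>R y)" unfolding 1 2 by (simp add: scaleR_2)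
  finally show "R n ?b *v x = y" by simp
  fix v assume v: "v \<bullet> n = 0" "v \<bullet> x = 0" "v \<bullet> y = 0" "cross7 n v \<bullet> x = 0" "cross7 n v \<bullet> y = 0"
  have "qperp n ?b v"
    using v inner_cross7_swap[of n x v] inner_cross7_swap[of n y v]
    by (simp add: qperp_def inner_add_right cross7_linear inner_commute[of v "cross7 _ _"])
  then show "R n ?b *v v = - v" by (rule R_neg)
qed

lemma R_move:
  assumes n: "n \<bullet> n = 1" and x: "x \<bullet> x = 1" "x \<bullet> n = 0" and y: "y \<bullet> y = 1" "y \<bullet> n = 0"
    and o: "cross7 n x \<bullet> y = 0"
  obtains b where "on_pair n b" "R n b *v x = y"
proof (cases "x + y = 0")
  case False
  then show ?thesis using R_move_sum[OF assms] that by blast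
next
  case True
  obtain b where b: "b \<bullet> b = 1" "b \<bullet> n = 0" "b \<bullet> x = 0" "b \<bullet> cross7 n x = 0"
    using ex_unit_orth3[of "n" "x" "cross7 n x"] by blast
  have "qperp n b x"
    using b x inner_cross7_swap[of n b x] inner_commute[of x b] inner_commute[of x "cross7 n b"]
      inner_commute[of "cross7 n x" b] by (simp add: qperp_def)
  moreover have "y = - x" using True by (simp add: add_eq_0_iff)
  ultimately have "R n b *v x = y" using R_neg by simp
  moreover have "on_pair n b" using b n by (simp add: on_pair_def inner_commute)
  ultimately show ?thesis using that by blast
qed

inductive_set Rgen :: "(real^7^7) set" where
  one: "mat 1 \<in> Rgen"
| step: "on_pair a b \<Longrightarrow> h \<in> Rgen \<Longrightarrow> R a b ** h \<in> Rgen"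

lemma Rgen_Gw: "h \<in> Rgen \<Longrightarrow> h \<in> Gw"
  by (induction rule: Rgen.induct) (auto intro: Gw_one Gw_mult R_in_Gw)

lemma R_Rgen: "on_pair a b \<Longrightarrow> R a b \<in> Rgen"
  using Rgen.step[OF _ Rgen.one] by simp

lemma Rgen_mult: "h \<in> Rgen \<Longrightarrow> k \<in> Rgen \<Longrightarrow> h ** k \<in> Rgen"
  by (induction rule: Rgen.induct) (auto intro: Rgen.step simp: matrix_mul_assoc[symmetric])

text \<open>Transitivity on unit vectors, then on unit vectors orthogonal to one fixed vector, then on the complement
  of a quaternionic subspace: the usual tower of fibrations for the stabiliser.\<close>

lemma Rgen_unit:
  assumes "x \<bullet> x = 1" "y \<bullet> y = 1"
  obtains h where "h \<in> Rgen" "h *v x = y"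
proof -
  obtain n where n: "n \<bullet> n = 1" "n \<bullet> x = 0" "n \<bullet> y = 0" "n \<bullet> cross7 x y = 0"
    using ex_unit_orth3[of "x" "y" "cross7 x y"] by blast
  have "cross7 n x \<bullet> y = 0"
    using n(4) inner_cross7_swap[of x n y] cross7_commute[of x n] by (simp add: inner_commute)
  then obtain b where "on_pair n b" "R n b *v x = y"
    using R_move[of n x y] assms n by (auto simp: inner_commute)
  then show ?thesis using that R_Rgen by blast
qed

lemma Rgen_fix_unit:
  assumes "n \<bullet> n = 1" "x \<bullet> x = 1" "x \<bullet> n = 0" "y \<bullet> y = 1" "y \<bullet> n = 0"
  obtains h where "h \<in> Rgen" "h *v n = n" "h *v x = y"
proof -
  obtain z where z: "z \<bullet> z = 1" "z \<bullet> n = 0" "z \<bullet> cross7 n x = 0" "z \<bullet> cross7 n y = 0"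
    using ex_unit_orth3[of "n" "cross7 n x" "cross7 n y"] by blast
  have o: "cross7 n x \<bullet> z = 0" "cross7 n z \<bullet> y = 0"
    using z inner_cross7_swap[of n z y] by (simp_all add: inner_commute)
  obtain b where "on_pair n b" "R n b *v x = z"
    using R_move[OF assms(1-3) z(1,2) o(1)] .
  moreover obtain c where "on_pair n c" "R n c *v z = y"
    using R_move[OF assms(1) z(1,2) assms(4,5) o(2)] .
  moreover from calculation have "R n c ** R n b \<in> Rgen" using R_Rgen Rgen_mult by blast
  ultimately show ?thesis
    using that[of "R n c ** R n b"] R_fix by (simp add: matrix_vector_mul_assoc[symmetric])
qed

lemma Rgen_fix_pair:
  assumes ab: "on_pair a b" and x: "x \<bullet> x = 1" "qperp a b x" and y: "y \<bullet> y = 1" "qperp a b y"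
  obtains h where "h \<in> Rgen" "h *v a = a" "h *v b = b" "h *v x = y"
proof -
  consider "x = y" | "x = - y" | "x \<noteq> y" "x \<noteq> - y" by blast
  then show ?thesis
  proof cases
    case 1 then show ?thesis using that[of "mat 1"] Rgen.one by simp
  next
    case 2 then show ?thesis using that[OF R_Rgen[OF ab]] R_fix[OF ab] R_neg[OF x(2)] by simp
  next
    case 3
    have "x \<bullet> y \<noteq> 1" "x \<bullet> y \<noteq> -1"
    proof -
      have "(x - y) \<bullet> (x - y) = 2 - 2 * (x \<bullet> y)" "(x + y) \<bullet> (x + y) = 2 + 2 * (x \<bullet> y)"
        using x y by (simp_all add: inner_diff_left inner_diff_right inner_add_left inner_add_right inner_commute[of y x])
      moreover have "x - y \<noteq> 0" "x + y \<noteq> 0" using 3 by (auto simp: add_eq_0_iff)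
      ultimately show "x \<bullet> y \<noteq> 1" "x \<bullet> y \<noteq> -1" by auto
    qed
    then have "(x \<bullet> y)\<^sup>2 \<noteq> 1" by (simp add: power2_eq_1_iff)
    then have m0: "cross7 x y \<noteq> 0"
      using inner_cross7_same[of x y y] x y by (auto simp: power2_eq_square)
    define c where "c = inverse (norm (cross7 x y))"
    define n where "n = c *\<^sub>R cross7 x y"
    have "norm n = 1" using m0 by (simp add: n_def c_def)
    then have nn: "n \<bullet> n = 1" by (simp add: dot_square_norm)
    have nP: "qproj a b n = n"
    proof -
      let ?u = "n - qproj a b n"
      have u: "qperp a b ?u" by (rule qperp_diff[OF ab])
      have "n \<bullet> ?u = 0" using omega0_qperp_zero[OF ab x(2) y(2) u] by (simp add: n_def)
      moreover have "qproj a b n \<bullet> ?u = 0" using inner_qproj_qperp(1)[OF u] .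
      ultimately have "?u \<bullet> ?u = 0" by (simp add: inner_diff_left)
      then show ?thesis by simp
    qed
    obtain d where d: "d \<bullet> d = 1" "d \<bullet> a = 0" "d \<bullet> b = 0" "d \<bullet> cross7 a b = 0" "d \<bullet> x = 0" "d \<bullet> y = 0"
      using ex_unit_orth5[of "a" "b" "cross7 a b" "x" "y"] by blast
    have dq: "qperp a b d" using d by (simp add: qperp_def)
    have perp_n: "u \<bullet> n = 0" if "qperp a b u" for u using inner_qproj_qperp(2)[OF that, of n] nP by simp
    have nx: "cross7 n x = c *\<^sub>R (y - (x \<bullet> y) *\<^sub>R x)"
      by (simp add: n_def cross7_linear cross7_commute[of "cross7 x y" x] cross7_cross7 x)
    have ny: "cross7 n y = c *\<^sub>R ((x \<bullet> y) *\<^sub>R y - x)"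
    proof -
      have "cross7 (cross7 x y) y = cross7 y (cross7 y x)"
        using cross7_commute[of "cross7 x y" y] cross7_commute[of x y] by (simp add: cross7_linear)
      then show ?thesis by (simp add: n_def cross7_linear cross7_cross7 y inner_commute)
    qed
    have nxd: "cross7 n x \<bullet> d = 0" using d by (simp add: nx inner_diff_left inner_diff_right inner_commute)
    have ndy: "cross7 n d \<bullet> y = 0"
      using inner_cross7_swap[of n d y] d by (simp add: ny inner_diff_left inner_diff_right inner_commute)
    have s: "x + d \<noteq> 0" "d + y \<noteq> 0"
    proof -
      have "(x + d) \<bullet> (x + d) = 2" "(d + y) \<bullet> (d + y) = 2"
        using d x y by (simp_all add: inner_add_left inner_add_right inner_commute[of x d] inner_commute[of y d])
      then show "x + d \<noteq> 0" "d + y \<noteq> 0" by auto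
    qed
    note pn = perp_n[OF x(2)] perp_n[OF y(2)] perp_n[OF dq]
    obtain b1 where b1: "on_pair n b1" "R n b1 *v x = d"
      "\<And>v. v \<bullet> n = 0 \<Longrightarrow> v \<bullet> x = 0 \<Longrightarrow> v \<bullet> d = 0 \<Longrightarrow> cross7 n v \<bullet> x = 0 \<Longrightarrow> cross7 n v \<bullet> d = 0 \<Longrightarrow> R n b1 *v v = - v"
      by (rule R_move_sum[OF nn x(1) pn(1) d(1) pn(3) nxd s(1)]) (rule that)
    obtain b2 where b2: "on_pair n b2" "R n b2 *v d = y"
      "\<And>v. v \<bullet> n = 0 \<Longrightarrow> v \<bullet> d = 0 \<Longrightarrow> v \<bullet> y = 0 \<Longrightarrow> cross7 n v \<bullet> d = 0 \<Longrightarrow> cross7 n v \<bullet> y = 0 \<Longrightarrow> R n b2 *v v = - v"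
      by (rule R_move_sum[OF nn d(1) pn(3) y(1) pn(2) ndy s(2)]) (rule that)
    let ?g = "R n b2 ** R n b1"
    have gn: "?g *v n = n" using R_fix[OF b1(1)] R_fix[OF b2(1)] by (simp add: matrix_vector_mul_assoc[symmetric])
    have gv: "?g *v v = v" if v: "qproj a b v = v" "v \<bullet> n = 0" for v
    proof -
      have o: "v \<bullet> u = 0" "cross7 n v \<bullet> u = 0" if "qperp a b u" for u
        using inner_qproj_qperp(1)[OF that, of v] omega0_qproj_qproj_qperp[OF ab that, of n v] v nP by simp_all
      have "R n b1 *v v = - v" "R n b2 *v v = - v"
        using b1(3)[of v] b2(3)[of v] o x y dq v(2) by simp_all
      then show ?thesis
        using matrix_vector_mult_scaleR[of "R n b2" "-1" v] by (simp add: matrix_vector_mul_assoc[symmetric])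
    qed
    have gV: "?g *v v = v" if v: "qproj a b v = v" for v
    proof -
      have "?g *v (v - (v \<bullet> n) *\<^sub>R n) = v - (v \<bullet> n) *\<^sub>R n"
        by (rule gv) (simp_all add: qproj_linear v nP inner_diff_left nn)
      then show ?thesis by (simp add: matrix_vector_mult_diff_distrib matrix_vector_mult_scaleR gn)
    qed
    have "?g \<in> Rgen" using R_Rgen Rgen_mult b1(1) b2(1) by blast
    moreover have "?g *v x = y" using b1(2) b2(2) by (simp add: matrix_vector_mul_assoc[symmetric])
    ultimately show ?thesis using that[of ?g] gV qproj_basis[OF ab] by blast
  qed
qed

lemma matrix_eq_on_axes:
  fixes h :: "real^7^7"
  assumes "\<And>i. h *v axis i 1 = axis i 1"
  shows "h = mat 1"
proof -
  have "column i h = axis i 1" for i using assms[of i] by (simp add: matrix_vector_mult_basis)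
  then show ?thesis by (simp add: vec_eq_iff column_def mat_def axis_def)
qed

lemma cross7_axes:
  "cross7 (axis 1 1) (axis 2 1) = axis 7 1" "cross7 (axis 1 1) (axis 3 1) = axis 5 1"
  "cross7 (axis 2 1) (axis 3 1) = - axis 6 1" "cross7 (axis 7 1) (axis 3 1) = axis 4 1"
  "cross7 (axis 1 1) (axis 4 1) = - axis 6 1"
  by (simp_all add: vec_eq_iff forall_7 cross7_axis_nth w_table) (simp_all add: axis_def)

text \<open>The vectors \<open>e\<^sub>1\<close>, \<open>e\<^sub>2\<close>, \<open>e\<^sub>3\<close> generate the algebra of octonions, so an automorphism fixing them is the
  identity.\<close>

lemma Gw_eq_one:
  assumes h: "h \<in> Gw" and f: "h *v axis 1 1 = axis 1 1" "h *v axis 2 1 = axis 2 1" "h *v axis 3 1 = axis 3 1"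
  shows "h = mat 1"
proof (rule matrix_eq_on_axes)
  note c = Gw_cross7[OF h]
  have 7: "h *v axis 7 1 = axis 7 1" using c[of "axis 1 1" "axis 2 1"] f cross7_axes(1) by simp
  have 5: "h *v axis 5 1 = axis 5 1" using c[of "axis 1 1" "axis 3 1"] f cross7_axes(2) by simp
  have "h *v (- axis 6 1) = - axis 6 1" using c[of "axis 2 1" "axis 3 1"] f cross7_axes(3) by simp
  then have 6: "h *v axis 6 1 = axis 6 1" by (simp add: vec.neg)
  have 4: "h *v axis 4 1 = axis 4 1" using c[of "axis 7 1" "axis 3 1"] f 7 cross7_axes(4) by simp
  show "h *v axis i 1 = axis i 1" for i using exhaust_7[of i] f 4 5 6 7 by auto
qed

lemma axes_pair: "i \<noteq> j \<Longrightarrow> on_pair (axis i 1) (axis j 1)"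
  by (simp add: on_pair_def inner_axis_axis)

text \<open>The relation between the involutions that forces every character to be trivial.\<close>

lemma R_axes: "R (axis 1 1) (axis 2 1) ** R (axis 1 1) (axis 3 1) = R (axis 1 1) (axis 4 1)"
proof (rule matrix_eq[THEN iffD2], rule allI)
  fix x :: "real^7"
  show "(R (axis 1 1) (axis 2 1) ** R (axis 1 1) (axis 3 1)) *v x = R (axis 1 1) (axis 4 1) *v x"
    by (simp add: matrix_vector_mul_assoc[symmetric] R_mult qrefl_def qproj_def cross7_axes inner_axis
        vec_eq_iff forall_7) (simp add: axis_def)
qed

lemma Gw_reduce:
  assumes h: "h \<in> Gw"
  obtains r where "r \<in> Rgen" "r ** h = mat 1"
proof -
  let ?e1 = "axis 1 1 :: real^7" let ?e2 = "axis 2 1 :: real^7" let ?e3 = "axis 3 1 :: real^7"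
  have e: "?e1 \<bullet> ?e1 = 1" "?e2 \<bullet> ?e2 = 1" "?e3 \<bullet> ?e3 = 1" "?e2 \<bullet> ?e1 = 0" by (simp_all add: inner_axis_axis)
  obtain r1 where r1: "r1 \<in> Rgen" "r1 *v (h *v ?e1) = ?e1"
    using Rgen_unit[of "h *v ?e1" ?e1] Gw_inner[OF h] e by auto
  define h1 where "h1 = r1 ** h"
  have h1: "h1 \<in> Gw" "h1 *v ?e1 = ?e1"
    using r1 Rgen_Gw Gw_mult[OF _ h] by (auto simp: h1_def matrix_vector_mul_assoc[symmetric])
  have "(h1 *v ?e2) \<bullet> ?e1 = 0" using Gw_inner[OF h1(1), of ?e2 ?e1] h1(2) e by simp
  then obtain r2 where r2: "r2 \<in> Rgen" "r2 *v ?e1 = ?e1" "r2 *v (h1 *v ?e2) = ?e2"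
    using Rgen_fix_unit[of ?e1 "h1 *v ?e2" ?e2] Gw_inner[OF h1(1)] e by auto
  define h2 where "h2 = r2 ** h1"
  have h2: "h2 \<in> Gw" "h2 *v ?e1 = ?e1" "h2 *v ?e2 = ?e2"
    using r2 Rgen_Gw Gw_mult[OF _ h1(1)] h1(2) by (auto simp: h2_def matrix_vector_mul_assoc[symmetric])
  have pair: "on_pair ?e1 ?e2" by (rule axes_pair) simp
  have q3: "qperp ?e1 ?e2 ?e3" by (simp add: qperp_def cross7_axes inner_axis_axis)
  have "h2 *v cross7 ?e1 ?e2 = cross7 ?e1 ?e2" using Gw_cross7[OF h2(1), of ?e1 ?e2] h2 by simp
  then have "qperp ?e1 ?e2 (h2 *v ?e3)"
    using q3 Gw_inner[OF h2(1), of ?e3 ?e1] Gw_inner[OF h2(1), of ?e3 ?e2]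
      Gw_inner[OF h2(1), of ?e3 "cross7 ?e1 ?e2"] h2 by (simp add: qperp_def)
  then obtain r3 where r3: "r3 \<in> Rgen" "r3 *v ?e1 = ?e1" "r3 *v ?e2 = ?e2" "r3 *v (h2 *v ?e3) = ?e3"
    using Rgen_fix_pair[OF pair, of "h2 *v ?e3" ?e3] Gw_inner[OF h2(1)] e q3 by auto
  have "r3 ** h2 = mat 1"
    using r3 h2 Rgen_Gw Gw_mult by (intro Gw_eq_one) (auto simp: matrix_vector_mul_assoc[symmetric])
  then have "(r3 ** r2 ** r1) ** h = mat 1" by (simp add: h2_def h1_def matrix_mul_assoc)
  moreover have "r3 ** r2 ** r1 \<in> Rgen" using r1 r2 r3 Rgen_mult by blast
  ultimately show ?thesis using that by blast
qed

text \<open>A character takes a common value on all the involutions, and the product of two of them can again be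
  such an involution, so this value is idempotent and hence \<open>1\<close>. The involutions generate the group.\<close>

theorem Gw_character_trivial:
  fixes chi :: "real^7^7 \<Rightarrow> 'a::field"
  assumes mult: "\<And>h k. h \<in> Gw \<Longrightarrow> k \<in> Gw \<Longrightarrow> chi (h ** k) = chi h * chi k"
    and sq: "\<And>h. h \<in> Gw \<Longrightarrow> chi h * chi h = 1"
    and h: "h \<in> Gw"
  shows "chi h = 1"
proof -
  have one: "chi (mat 1) = 1"
    using mult[OF Gw_one Gw_one] sq[OF Gw_one] by simp
  let ?e = "\<lambda>i. axis i 1 :: real^7"
  define eps where "eps = chi (R (?e 1) (?e 2))"
  have conj: "chi (R a b) = eps" if ab: "on_pair a b" for a b
  proof -
    have e: "?e 1 \<bullet> ?e 1 = 1" "?e 2 \<bullet> ?e 2 = 1" "?e 2 \<bullet> ?e 1 = 0" by (simp_all add: inner_axis_axis)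
    obtain r1 where r1: "r1 \<in> Rgen" "r1 *v a = ?e 1"
      using Rgen_unit[of a "?e 1"] ab e by (auto simp: on_pair_def)
    note ab1 = Gw_on_pair[OF Rgen_Gw[OF r1(1)] ab]
    obtain r2 where r2: "r2 \<in> Rgen" "r2 *v ?e 1 = ?e 1" "r2 *v (r1 *v b) = ?e 2"
      using Rgen_fix_unit[of "?e 1" "r1 *v b" "?e 2"] ab1 e r1 by (auto simp: on_pair_def inner_commute)
    define g where "g = r2 ** r1"
    have g: "g \<in> Gw" "g *v a = ?e 1" "g *v b = ?e 2"
      using r1 r2 Rgen_Gw Rgen_mult by (auto simp: g_def matrix_vector_mul_assoc[symmetric])
    have "eps = chi (g ** R a b ** transpose g)" by (simp add: R_conj[OF g(1)] g eps_def)
    also have "\<dots> = chi g * chi (R a b) * chi (transpose g)"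
      using g(1) R_in_Gw[OF ab] Gw_transpose_in mult Gw_mult by simp
    also have "\<dots> = chi (R a b) * (chi g * chi (transpose g))" by simp
    also have "chi g * chi (transpose g) = 1"
      using mult[OF g(1) Gw_transpose_in[OF g(1)]] Gw_transpose[OF g(1)] one by simp
    finally show ?thesis by simp
  qed
  \<comment> \<open>The half-turns for \<open>(e\<^sub>1, e\<^sub>2)\<close> and \<open>(e\<^sub>1, e\<^sub>3)\<close> compose to the one for \<open>(e\<^sub>1, e\<^sub>4)\<close>.\<close>
  have "eps * eps = eps"
    using mult[OF R_in_Gw R_in_Gw, of "?e 1" "?e 2" "?e 1" "?e 3"] R_axes
      conj[of "?e 1" "?e 2"] conj[of "?e 1" "?e 3"] conj[of "?e 1" "?e 4"] axes_pair by simp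
  then have eps1: "eps = 1"
    using sq[OF R_in_Gw[of "?e 1" "?e 2"]] axes_pair[of 1 2] by (simp add: eps_def)
  have gen: "chi r = 1" if "r \<in> Rgen" for r using that
    by induction (use one mult R_in_Gw Rgen_Gw conj eps1 in auto)
  obtain r where r: "r \<in> Rgen" "r ** h = mat 1" using Gw_reduce[OF h] .
  have "chi (r ** h) = chi r * chi h" using mult Rgen_Gw[OF r(1)] h by blast
  then show ?thesis using gen[OF r(1)] r(2) one by simp
qed

text \<open>The determinant is itself a sign character, so the stabiliser preserves the orientation.\<close>

lemma Gw_det: "h \<in> Gw \<Longrightarrow> det h = 1"
proof (rule Gw_character_trivial[of det])
  show "det h * det h = 1" if "h \<in> Gw" for h
    using that det_orthogonal_matrix[of h] by (auto simp: Gw_def)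
qed (auto simp: det_mul)

lemma G2_eq: "G2 = Gw"
  using Gw_det by (auto simp: G2_def Gw_def)

section \<open>Curvature identities of a connection with values in the Lie algebra of the stabiliser\<close>

lemma axis_expansion: "(\<Sum>j\<in>UNIV. x $ j *\<^sub>R axis j 1) = (x :: real^'n)"
  using basis_expansion[of x] by (simp add: scalar_mult_eq_scaleR)

lemma cross7_sum: "cross7 (sum f I) y = (\<Sum>i\<in>I. cross7 (f i) y)" "cross7 y (sum f I) = (\<Sum>i\<in>I. cross7 y (f i))"
  by (induction I rule: infinite_finite_induct) (simp_all add: cross7_linear)

lemma psi_cyc: "psi l i c d = psi l c d i" "psi l i c d = psi i c l d" "psi l i c d = psi c d l i"
  "psi i k a b = psi a k b i"
proof -
  show 1: "psi l i c d = psi l c d i" for l i c d using psi_skew(2)[of l i c d] psi_skew(3)[of l c i d] by simp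
  show 2: "psi l i c d = psi i c l d" for l i c d using psi_skew(1)[of i l c d] psi_skew(2)[of i l c d] by simp
  show "psi l i c d = psi c d l i" using 2[of l i c d] 1[of i c l d] 2[of i l d c] psi_skew(1)[of i l d c]
      psi_skew(1)[of l i c d] psi_skew(2)[of l i c d] psi_skew(2)[of l c i d] psi_skew(1)[of l c i d] psi_skew(3)[of c l i d]
      psi_skew(2)[of c l d i] psi_skew(2)[of c l i d] psi_skew(3)[of c l d i] psi_skew(3)[of c d l i] 
    by (smt (verit) psi_skew)
  show "psi i k a b = psi a k b i"
    using 1[of k i a b] psi_skew(1)[of k i a b] psi_skew(1)[of k a b i] by simp
qed

text \<open>The Lie algebra of the stabiliser is an eigenspace of the contraction with the four-form.\<close>

lemma g2_psi:
  assumes "\<And>j k l. w_action B j k l = 0"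
  shows "(\<Sum>a\<in>UNIV. \<Sum>b\<in>UNIV. psi l i a b * B a b) = - 2 * B l i"
proof -
  have "(\<Sum>a\<in>UNIV. \<Sum>b\<in>UNIV. psi l i a b * B a b)
     = (\<Sum>a\<in>UNIV. \<Sum>b\<in>UNIV. (\<Sum>n\<in>UNIV. w l i n * (B a b * w a b n)) - d7 l a * (d7 i b * B a b) + d7 i a * (d7 l b * B a b))"
    by (simp add: psi_def algebra_simps sum_distrib_left d7_simps(2)[of i] d7_simps(2)[of l])
  also have "\<dots> = (\<Sum>a\<in>UNIV. \<Sum>b\<in>UNIV. \<Sum>n\<in>UNIV. w l i n * (B a b * w a b n)) - B l i + B i l"
    by (simp add: sum.distrib sum_subtractf sum_distrib_left[symmetric])
  also have "(\<Sum>a\<in>UNIV. \<Sum>b\<in>UNIV. \<Sum>n\<in>UNIV. w l i n * (B a b * w a b n)) = 0"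
    by (subst sum_rot) (simp add: sum_distrib_left[symmetric] w_action_zero(2)[OF assms])
  finally show ?thesis using w_action_zero(1)[OF assms, of i l] by simp
qed

lemma cyc_contraction:
  fixes F G :: "7 \<Rightarrow> 7 \<Rightarrow> 7 \<Rightarrow> real"
  assumes "\<And>i a b. F a b i = F i a b"
  shows "(\<Sum>i\<in>UNIV. \<Sum>a\<in>UNIV. \<Sum>b\<in>UNIV. F i a b * (G i a b + G a b i + G b i a))
    = 3 * (\<Sum>i\<in>UNIV. \<Sum>a\<in>UNIV. \<Sum>b\<in>UNIV. F i a b * G i a b)"
proof -
  have 1: "(\<Sum>i\<in>UNIV. \<Sum>a\<in>UNIV. \<Sum>b\<in>UNIV. F i a b * G b i a) = (\<Sum>i\<in>UNIV. \<Sum>a\<in>UNIV. \<Sum>b\<in>UNIV. F i a b * G i a b)"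
    by (subst sum_rot) (simp add: assms)
  have "(\<Sum>i\<in>UNIV. \<Sum>a\<in>UNIV. \<Sum>b\<in>UNIV. F i a b * G a b i) = (\<Sum>i\<in>UNIV. \<Sum>a\<in>UNIV. \<Sum>b\<in>UNIV. F a b i * G a b i)"
    by (simp add: assms)
  also have "\<dots> = (\<Sum>i\<in>UNIV. \<Sum>a\<in>UNIV. \<Sum>b\<in>UNIV. F i a b * G i a b)" by (rule sum_rot[symmetric])
  finally show ?thesis using 1 by (simp add: distrib_left sum.distrib)
qed

lemma antisym_contraction:
  fixes F G :: "7 \<Rightarrow> 7 \<Rightarrow> real"
  assumes "\<And>i a. F a i = - F i a"
  shows "(\<Sum>i\<in>UNIV. \<Sum>a\<in>UNIV. F i a * (G i a - G a i)) = 2 * (\<Sum>i\<in>UNIV. \<Sum>a\<in>UNIV. F i a * G i a)"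
proof -
  have "(\<Sum>i\<in>UNIV. \<Sum>a\<in>UNIV. F i a * G a i) = (\<Sum>a\<in>UNIV. \<Sum>i\<in>UNIV. F i a * G a i)" by (rule sum.swap)
  also have "\<dots> = - (\<Sum>a\<in>UNIV. \<Sum>i\<in>UNIV. F a i * G a i)" by (subst assms) (simp add: sum_negf)
  finally show ?thesis by (simp add: right_diff_distrib sum_subtractf)
qed

lemma sum_w_psi': "(\<Sum>i\<in>UNIV. \<Sum>a\<in>UNIV. psi i k a b * w i a m) = - 4 * w k b m"
proof -
  have "(\<Sum>i\<in>UNIV. \<Sum>a\<in>UNIV. psi i k a b * w i a m) = - (\<Sum>i\<in>UNIV. \<Sum>a\<in>UNIV. w i a m * psi i a k b)"
    by (simp add: psi_skew(2)[of _ _ k] sum_negf mult.commute)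
  then show ?thesis by (simp add: sum_w_psi)
qed

lemma sum_w_w'': "(\<Sum>b\<in>UNIV. \<Sum>m\<in>UNIV. w k b m * w m b l) = - 6 * d7 k l"
proof -
  have "w k b m * w m b l = - (w k b m * w l b m)" for b m
    using w_cyc[of l m b] w_skew(2)[of l b m] by simp
  then show ?thesis by (simp add: sum_negf sum_w_w')
qed

context
  fixes t :: real and R :: "7 \<Rightarrow> 7 \<Rightarrow> 7 \<Rightarrow> 7 \<Rightarrow> real" and H :: "7 \<Rightarrow> 7 \<Rightarrow> 7 \<Rightarrow> real" and B :: "7 \<Rightarrow> 7 \<Rightarrow> real"
    and X :: "7 \<Rightarrow> real"
  assumes Rg: "\<And>i a j k l. w_action (R i a) j k l = 0"
    and Rs: "\<And>i a l b. R a i l b = - R i a l b"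
    and Bianchi: "\<And>i j l k. R i j l k + R j l i k + R l i j k
        = t\<^sup>2 * (\<Sum>m\<in>UNIV. w i j m * w m l k + w j l m * w m i k + w l i m * w m j k)"
    and comm: "\<And>i a b. H i a b - H a i b = (\<Sum>l\<in>UNIV. R i a l b * X l) - t * (\<Sum>m\<in>UNIV. w i a m * B m b)"
begin

text \<open>The assumptions of this context hold for the curvature \<open>R\<close>, the first covariant derivative \<open>B\<close> and the
  second covariant derivative \<open>H\<close> of a vector field \<open>X\<close> at one point, if the connection preserves the
  three-form and has torsion \<open>t w\<close>. What remains is linear algebra at that point.\<close>

lemma R_skew34: "R i a b l = - R i a l b"
  by (rule w_action_zero(1)[OF Rg])

text \<open>A contraction with a cyclically invariant coefficient is a third of the contraction of the cyclic sum, and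
  the Bianchi identity evaluates the latter without curvature.\<close>

lemma curvature_contract:
  assumes F: "\<And>i a b. F a b i = F i a b" 
  shows "(\<Sum>i\<in>UNIV. \<Sum>a\<in>UNIV. \<Sum>b\<in>UNIV. F i a b * R i a l b)
    = - t\<^sup>2 * (\<Sum>b\<in>UNIV. \<Sum>m\<in>UNIV. (\<Sum>i\<in>UNIV. \<Sum>a\<in>UNIV. F i a b * w i a m) * w m b l)"
proof -
  define W where "W i a b = (\<Sum>m\<in>UNIV. w i a m * w m b l)" for i a b
  have "3 * (\<Sum>i\<in>UNIV. \<Sum>a\<in>UNIV. \<Sum>b\<in>UNIV. F i a b * R i a b l)
     = (\<Sum>i\<in>UNIV. \<Sum>a\<in>UNIV. \<Sum>b\<in>UNIV. F i a b * (R i a b l + R a b i l + R b i a l))"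
    by (rule cyc_contraction[OF F, symmetric])
  also have "\<dots> = (\<Sum>i\<in>UNIV. \<Sum>a\<in>UNIV. \<Sum>b\<in>UNIV. t\<^sup>2 * (F i a b * (W i a b + W a b i + W b i a)))"
  proof (intro sum.cong refl)
    fix i a b
    have "R i a b l + R a b i l + R b i a l = t\<^sup>2 * (W i a b + W a b i + W b i a)"
      by (simp only: Bianchi W_def sum.distrib)
    then show "F i a b * (R i a b l + R a b i l + R b i a l) = t\<^sup>2 * (F i a b * (W i a b + W a b i + W b i a))"
      by (simp only: mult.left_commute)
  qed
  also have "\<dots> = t\<^sup>2 * (\<Sum>i\<in>UNIV. \<Sum>a\<in>UNIV. \<Sum>b\<in>UNIV. F i a b * (W i a b + W a b i + W b i a))"
    by (simp only: sum_distrib_left)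
  also have "\<dots> = t\<^sup>2 * (3 * (\<Sum>i\<in>UNIV. \<Sum>a\<in>UNIV. \<Sum>b\<in>UNIV. F i a b * W i a b))"
    by (simp only: cyc_contraction[OF F])
  finally have 1: "(\<Sum>i\<in>UNIV. \<Sum>a\<in>UNIV. \<Sum>b\<in>UNIV. F i a b * R i a b l) = t\<^sup>2 * (\<Sum>i\<in>UNIV. \<Sum>a\<in>UNIV. \<Sum>b\<in>UNIV. F i a b * W i a b)"
    by simp
  have "(\<Sum>i\<in>UNIV. \<Sum>a\<in>UNIV. \<Sum>b\<in>UNIV. F i a b * W i a b)
      = (\<Sum>b\<in>UNIV. \<Sum>i\<in>UNIV. \<Sum>a\<in>UNIV. \<Sum>m\<in>UNIV. F i a b * w i a m * w m b l)"
    by (subst sum_rot) (simp add: W_def sum_distrib_left mult.assoc)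
  also have "\<dots> = (\<Sum>b\<in>UNIV. \<Sum>m\<in>UNIV. \<Sum>i\<in>UNIV. \<Sum>a\<in>UNIV. F i a b * w i a m * w m b l)"
    by (rule sum.cong[OF refl], rule sum_rot)
  also have "\<dots> = (\<Sum>b\<in>UNIV. \<Sum>m\<in>UNIV. (\<Sum>i\<in>UNIV. \<Sum>a\<in>UNIV. F i a b * w i a m) * w m b l)"
    by (simp add: sum_distrib_right)
  finally show ?thesis using 1 R_skew34[of _ _ _ l] by (simp add: sum_negf)
qed

lemma psi_R: "(\<Sum>i\<in>UNIV. \<Sum>a\<in>UNIV. \<Sum>b\<in>UNIV. psi i k a b * R i a l b) = - 24 * t\<^sup>2 * d7 k l"
proof -
  have "(\<Sum>i\<in>UNIV. \<Sum>a\<in>UNIV. \<Sum>b\<in>UNIV. psi i k a b * R i a l b)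
    = - t\<^sup>2 * (\<Sum>b\<in>UNIV. \<Sum>m\<in>UNIV. (\<Sum>i\<in>UNIV. \<Sum>a\<in>UNIV. psi i k a b * w i a m) * w m b l)"
    by (rule curvature_contract) (rule psi_cyc(4)[symmetric])
  also have "\<dots> = 4 * t\<^sup>2 * (\<Sum>b\<in>UNIV. \<Sum>m\<in>UNIV. w k b m * w m b l)"
    by (simp add: sum_w_psi' sum_negf sum_distrib_left[symmetric] mult.assoc)
  finally show ?thesis by (simp add: sum_w_w'')
qed

lemma w_R: "(\<Sum>i\<in>UNIV. \<Sum>a\<in>UNIV. \<Sum>b\<in>UNIV. w i a b * R i a l b) = 0"
proof -
  have "(\<Sum>i\<in>UNIV. \<Sum>a\<in>UNIV. \<Sum>b\<in>UNIV. w i a b * R i a l b)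
    = - t\<^sup>2 * (\<Sum>b\<in>UNIV. \<Sum>m\<in>UNIV. (\<Sum>i\<in>UNIV. \<Sum>a\<in>UNIV. w i a b * w i a m) * w m b l)"
    by (rule curvature_contract) (rule w_cyc[symmetric])
  also have "\<dots> = - t\<^sup>2 * (\<Sum>b\<in>UNIV. 6 * w b b l)"
    by (simp only: sum_w_w mult.assoc sum_distrib_left[symmetric] sum_d7)
  also have "\<dots> = 0" by (simp add: w_skew(3))
  finally show ?thesis .
qed

text \<open>The connection is Einstein. Since the curvature is \<open>G\<^sub>2\<close>-valued, its trace can be expressed by its contraction with the
  four-form, which the Bianchi identity determines.\<close>

lemma Ricci: "(\<Sum>i\<in>UNIV. R i k l i) = 12 * t\<^sup>2 * d7 k l"
proof -
  define S1 where "S1 = (\<Sum>i\<in>UNIV. \<Sum>c\<in>UNIV. \<Sum>d\<in>UNIV. psi l i c d * R k i c d)"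
  have "2 * R i k l i = (\<Sum>c\<in>UNIV. \<Sum>d\<in>UNIV. psi l i c d * R k i c d)" for i
    using g2_psi[OF Rg, of l i k i] Rs[of i k l i] by simp
  then have ric: "2 * (\<Sum>i\<in>UNIV. R i k l i) = S1" by (simp add: S1_def sum_distrib_left)
  have 3: "(\<Sum>i\<in>UNIV. \<Sum>c\<in>UNIV. \<Sum>d\<in>UNIV. psi l i c d * R c k i d) = S1"
  proof -
    have "psi l c i d * R i k c d = psi l i c d * R k i c d" for c i d
      using psi_skew(2)[of l c i d] Rs[of i k c d] by simp
    then show ?thesis unfolding S1_def by (subst sum.swap) simp
  qed
  have 2: "(\<Sum>i\<in>UNIV. \<Sum>c\<in>UNIV. \<Sum>d\<in>UNIV. psi l i c d * R i c k d) = 24 * t\<^sup>2 * d7 l k"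
    using psi_R[of l k] by (simp add: psi_skew(1)[of l] sum_negf)
  define Z1 where "Z1 = (\<Sum>i\<in>UNIV. \<Sum>c\<in>UNIV. \<Sum>d\<in>UNIV. \<Sum>m\<in>UNIV. psi l i c d * (w k i m * w m c d))"
  have Z1: "Z1 = 24 * d7 k l"
  proof -
    have "(\<Sum>c\<in>UNIV. \<Sum>d\<in>UNIV. \<Sum>m\<in>UNIV. psi l i c d * (w k i m * w m c d)) = (\<Sum>m\<in>UNIV. w k i m * (4 * w l i m))" for i
    proof -
      have eq: "psi l i c d * (w k i m * w m c d) = w k i m * (w c d m * psi c d l i)" for c d m
        using psi_cyc(3)[of l i c d] w_cyc[of m c d] by simp
      have "(\<Sum>c\<in>UNIV. \<Sum>d\<in>UNIV. \<Sum>m\<in>UNIV. psi l i c d * (w k i m * w m c d))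
        = (\<Sum>m\<in>UNIV. \<Sum>c\<in>UNIV. \<Sum>d\<in>UNIV. w k i m * (w c d m * psi c d l i))"
        unfolding eq by (rule sum_rot)
      then have "(\<Sum>c\<in>UNIV. \<Sum>d\<in>UNIV. \<Sum>m\<in>UNIV. psi l i c d * (w k i m * w m c d))
        = (\<Sum>m\<in>UNIV. w k i m * (\<Sum>c\<in>UNIV. \<Sum>d\<in>UNIV. w c d m * psi c d l i))"
        by (simp only: sum_distrib_left)
      then show ?thesis by (simp add: sum_w_psi)
    qed
    then show ?thesis using sum_w_w'[of k l] by (simp add: Z1_def sum_distrib_left[symmetric] mult.left_commute[of _ 4])
  qed
  have Z3: "(\<Sum>i\<in>UNIV. \<Sum>c\<in>UNIV. \<Sum>d\<in>UNIV. \<Sum>m\<in>UNIV. psi l i c d * (w c k m * w m i d)) = Z1"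
  proof -
    have eq: "psi l c i d * (w i k m * w m c d) = psi l i c d * (w k i m * w m c d)" for c i d m
      using psi_skew(2)[of l c i d] w_skew(1)[of i k m] by simp
    have "(\<Sum>i\<in>UNIV. \<Sum>c\<in>UNIV. \<Sum>d\<in>UNIV. \<Sum>m\<in>UNIV. psi l i c d * (w c k m * w m i d))
      = (\<Sum>i\<in>UNIV. \<Sum>c\<in>UNIV. \<Sum>d\<in>UNIV. \<Sum>m\<in>UNIV. psi l c i d * (w i k m * w m c d))"
      by (rule sum.swap)
    then show ?thesis unfolding Z1_def by (simp only: eq)
  qed
  have Z2: "(\<Sum>i\<in>UNIV. \<Sum>c\<in>UNIV. \<Sum>d\<in>UNIV. \<Sum>m\<in>UNIV. psi l i c d * (w i c m * w m k d)) = 24 * d7 k l"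
  proof -
    have "(\<Sum>i\<in>UNIV. \<Sum>c\<in>UNIV. \<Sum>d\<in>UNIV. \<Sum>m\<in>UNIV. psi l i c d * (w i c m * w m k d))
      = (\<Sum>d\<in>UNIV. \<Sum>m\<in>UNIV. \<Sum>i\<in>UNIV. \<Sum>c\<in>UNIV. psi l i c d * (w i c m * w m k d))"
      by (subst sum_rot) (rule sum.cong[OF refl], rule sum_rot)
    also have "\<dots> = (\<Sum>d\<in>UNIV. \<Sum>m\<in>UNIV. (\<Sum>i\<in>UNIV. \<Sum>c\<in>UNIV. w i c m * psi i c l d) * w k d m)"
    proof -
      have eq: "psi l i c d * (w i c m * w m k d) = w i c m * psi i c l d * w k d m" for i c d m
        using psi_cyc(2)[of l i c d] w_cyc[of m k d] by simp
      show ?thesis by (simp only: eq sum_distrib_right)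
    qed
    also have "\<dots> = 24 * d7 k l"
      using sum_w_w'[of l k] by (simp add: sum_w_psi mult.assoc sum_distrib_left[symmetric] d7_simps(2)[of l])
    finally show ?thesis .
  qed
  have "S1 + 24 * t\<^sup>2 * d7 l k + S1 = (\<Sum>i\<in>UNIV. \<Sum>c\<in>UNIV. \<Sum>d\<in>UNIV. psi l i c d * (R k i c d + R i c k d + R c k i d))"
    using 2 3 by (simp add: S1_def distrib_left sum.distrib)
  also have "\<dots> = t\<^sup>2 * ((\<Sum>i\<in>UNIV. \<Sum>c\<in>UNIV. \<Sum>d\<in>UNIV. \<Sum>m\<in>UNIV. psi l i c d * (w k i m * w m c d))
     + (\<Sum>i\<in>UNIV. \<Sum>c\<in>UNIV. \<Sum>d\<in>UNIV. \<Sum>m\<in>UNIV. psi l i c d * (w i c m * w m k d))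
     + (\<Sum>i\<in>UNIV. \<Sum>c\<in>UNIV. \<Sum>d\<in>UNIV. \<Sum>m\<in>UNIV. psi l i c d * (w c k m * w m i d)))"
    by (simp add: Bianchi sum.distrib[symmetric] sum_distrib_left distrib_left mult.left_commute)
  also have "\<dots> = t\<^sup>2 * (72 * d7 k l)" by (simp only: Z2 Z3 Z1_def[symmetric] Z1) simp
  finally show ?thesis using ric by (simp add: d7_simps(2)[of l])
qed

text \<open>Only the commutator of the second derivatives contributes to \<open>div curl X\<close>: its curvature part vanishes by
  \<open>w_R\<close> and its torsion part is a multiple of the divergence.\<close>

lemma w_H_zero:
  assumes divB: "(\<Sum>a\<in>UNIV. B a a) = 0"
  shows "(\<Sum>i\<in>UNIV. \<Sum>a\<in>UNIV. \<Sum>b\<in>UNIV. w i a b * H i a b) = 0"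
proof -
  have "(\<Sum>i\<in>UNIV. \<Sum>a\<in>UNIV. w i a b * (H i a b - H a i b)) = 2 * (\<Sum>i\<in>UNIV. \<Sum>a\<in>UNIV. w i a b * H i a b)" for b
    by (rule antisym_contraction) (rule w_skew(1))
  then have "2 * (\<Sum>i\<in>UNIV. \<Sum>a\<in>UNIV. \<Sum>b\<in>UNIV. w i a b * H i a b)
     = (\<Sum>b\<in>UNIV. \<Sum>i\<in>UNIV. \<Sum>a\<in>UNIV. w i a b * (H i a b - H a i b))"
    by (subst sum_rot) (simp add: sum_distrib_left)
  also have "\<dots> = (\<Sum>b\<in>UNIV. \<Sum>i\<in>UNIV. \<Sum>a\<in>UNIV. \<Sum>l\<in>UNIV. X l * (w i a b * R i a l b))
     - t * (\<Sum>b\<in>UNIV. \<Sum>i\<in>UNIV. \<Sum>a\<in>UNIV. \<Sum>m\<in>UNIV. B m b * (w i a b * w i a m))"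
    by (simp add: comm right_diff_distrib sum_subtractf sum_distrib_left mult_ac)
  also have "(\<Sum>b\<in>UNIV. \<Sum>i\<in>UNIV. \<Sum>a\<in>UNIV. \<Sum>m\<in>UNIV. B m b * (w i a b * w i a m)) = (\<Sum>b\<in>UNIV. \<Sum>m\<in>UNIV. B m b * (6 * d7 b m))"
    by (rule sum.cong[OF refl], subst sum_rot) (simp add: sum_distrib_left[symmetric] sum_w_w)
  also have "\<dots> = 0" using divB by (simp add: mult.left_commute[of _ 6] sum_distrib_left[symmetric])
  also have "(\<Sum>b\<in>UNIV. \<Sum>i\<in>UNIV. \<Sum>a\<in>UNIV. \<Sum>l\<in>UNIV. X l * (w i a b * R i a l b))
     = (\<Sum>l\<in>UNIV. X l * (\<Sum>i\<in>UNIV. \<Sum>a\<in>UNIV. \<Sum>b\<in>UNIV. w i a b * R i a l b))"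
  proof -
    have "(\<Sum>b\<in>UNIV. \<Sum>i\<in>UNIV. \<Sum>a\<in>UNIV. \<Sum>l\<in>UNIV. X l * (w i a b * R i a l b))
      = (\<Sum>b\<in>UNIV. \<Sum>l\<in>UNIV. \<Sum>i\<in>UNIV. \<Sum>a\<in>UNIV. X l * (w i a b * R i a l b))"
      by (rule sum.cong[OF refl], rule sum_rot)
    also have "\<dots> = (\<Sum>l\<in>UNIV. \<Sum>b\<in>UNIV. \<Sum>i\<in>UNIV. \<Sum>a\<in>UNIV. X l * (w i a b * R i a l b))" by (rule sum.swap)
    also have "\<dots> = (\<Sum>l\<in>UNIV. \<Sum>i\<in>UNIV. \<Sum>a\<in>UNIV. \<Sum>b\<in>UNIV. X l * (w i a b * R i a l b))"
      by (rule sum.cong[OF refl], rule sum_rot[symmetric])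
    finally show ?thesis by (simp add: sum_distrib_left)
  qed
  finally show ?thesis by (simp add: w_R)
qed

text \<open>The formula for \<open>curl curl X\<close>. A product of two \<open>w\<close> is \<open>psi\<close> plus the metric terms of
  \<open>sum_w_w_psi\<close>; the metric terms give the rough Laplacian and the gradient of the divergence with a Ricci term, and
  \<open>psi\<close> sees only the commutator of second derivatives.\<close>

lemma rough_laplacian:
  assumes curlH: "\<And>i m. (\<Sum>a\<in>UNIV. \<Sum>b\<in>UNIV. w a b m * H i a b) = 0"
    and divH: "\<And>i. (\<Sum>a\<in>UNIV. H i a a) = 0"
    and curlB: "\<And>m. (\<Sum>a\<in>UNIV. \<Sum>b\<in>UNIV. w a b m * B a b) = 0"
  shows "(\<Sum>i\<in>UNIV. H i i k) = 24 * t\<^sup>2 * X k"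
proof -
  have "0 = (\<Sum>i\<in>UNIV. \<Sum>m\<in>UNIV. w i k m * (\<Sum>a\<in>UNIV. \<Sum>b\<in>UNIV. w a b m * H i a b))" by (simp add: curlH)
  also have "\<dots> = (\<Sum>i\<in>UNIV. \<Sum>m\<in>UNIV. \<Sum>a\<in>UNIV. \<Sum>b\<in>UNIV. w i k m * w a b m * H i a b)"
    by (simp add: sum_distrib_left mult.assoc)
  also have "\<dots> = (\<Sum>i\<in>UNIV. \<Sum>a\<in>UNIV. \<Sum>b\<in>UNIV. \<Sum>m\<in>UNIV. w i k m * w a b m * H i a b)"
    by (rule sum.cong[OF refl], rule sum_rot[symmetric])
  also have "\<dots> = (\<Sum>i\<in>UNIV. \<Sum>a\<in>UNIV. \<Sum>b\<in>UNIV. psi i k a b * H i a b + d7 i a * (d7 k b * H i a b) - d7 k a * (d7 i b * H i a b))"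
    by (simp only: sum_distrib_right[symmetric] sum_w_w_psi) (simp add: algebra_simps)
  also have "\<dots> = (\<Sum>i\<in>UNIV. \<Sum>a\<in>UNIV. \<Sum>b\<in>UNIV. psi i k a b * H i a b) + (\<Sum>i\<in>UNIV. H i i k) - (\<Sum>i\<in>UNIV. H i k i)"
    by (simp add: sum.distrib sum_subtractf sum_distrib_left[symmetric])
  also have "(\<Sum>i\<in>UNIV. H i k i) = 12 * t\<^sup>2 * X k"
  proof -
    have H: "H i k i = H k i i + ((\<Sum>l\<in>UNIV. R i k l i * X l) - t * (\<Sum>m\<in>UNIV. w i k m * B m i))" for i
      using comm[of i k i] by simp
    have "(\<Sum>i\<in>UNIV. \<Sum>m\<in>UNIV. w i k m * B m i) = (\<Sum>m\<in>UNIV. \<Sum>i\<in>UNIV. w m i k * B m i)"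
      by (subst sum.swap) (simp add: w_cyc[of _ _ k])
    then have c: "(\<Sum>i\<in>UNIV. \<Sum>m\<in>UNIV. w i k m * B m i) = 0" by (simp add: curlB)
    have "(\<Sum>i\<in>UNIV. \<Sum>l\<in>UNIV. R i k l i * X l) = (\<Sum>l\<in>UNIV. (\<Sum>i\<in>UNIV. R i k l i) * X l)"
      by (subst sum.swap) (simp add: sum_distrib_right)
    also have "\<dots> = 12 * t\<^sup>2 * X k" by (simp add: Ricci mult.assoc sum_distrib_left[symmetric])
    finally show ?thesis
      by (simp add: H sum.distrib sum_subtractf divH c sum_distrib_left[symmetric])
  qed
  also have "(\<Sum>i\<in>UNIV. \<Sum>a\<in>UNIV. \<Sum>b\<in>UNIV. psi i k a b * H i a b) = - 12 * t\<^sup>2 * X k"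
  proof -
    have "psi a k i b = - psi i k a b" for a i b
      using psi_skew(2)[of a k i b] psi_skew(1)[of a i k b] psi_skew(2)[of i a k b] by simp
    then have "(\<Sum>i\<in>UNIV. \<Sum>a\<in>UNIV. psi i k a b * (H i a b - H a i b)) = 2 * (\<Sum>i\<in>UNIV. \<Sum>a\<in>UNIV. psi i k a b * H i a b)" for b
      by (intro antisym_contraction)
    then have "2 * (\<Sum>i\<in>UNIV. \<Sum>a\<in>UNIV. \<Sum>b\<in>UNIV. psi i k a b * H i a b)
       = (\<Sum>b\<in>UNIV. \<Sum>i\<in>UNIV. \<Sum>a\<in>UNIV. psi i k a b * (H i a b - H a i b))"
      by (subst sum_rot) (simp add: sum_distrib_left)
    also have "\<dots> = (\<Sum>b\<in>UNIV. \<Sum>i\<in>UNIV. \<Sum>a\<in>UNIV. \<Sum>l\<in>UNIV. X l * (psi i k a b * R i a l b))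
       - t * (\<Sum>b\<in>UNIV. \<Sum>i\<in>UNIV. \<Sum>a\<in>UNIV. \<Sum>m\<in>UNIV. B m b * (psi i k a b * w i a m))"
      by (simp add: comm right_diff_distrib sum_subtractf sum_distrib_left mult_ac)
    also have "(\<Sum>b\<in>UNIV. \<Sum>i\<in>UNIV. \<Sum>a\<in>UNIV. \<Sum>m\<in>UNIV. B m b * (psi i k a b * w i a m)) = (\<Sum>b\<in>UNIV. \<Sum>m\<in>UNIV. B m b * (- 4 * w k b m))"
      by (rule sum.cong[OF refl], subst sum_rot) (simp add: sum_distrib_left[symmetric] sum_w_psi')
    also have "\<dots> = 4 * (\<Sum>m\<in>UNIV. \<Sum>b\<in>UNIV. w m b k * B m b)"
    proof -
      have eq: "B m b * (- 4 * w k b m) = 4 * (w m b k * B m b)" for m b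
        using w_cyc[of k b m] w_skew(1)[of m b k] by simp
      have "(\<Sum>b\<in>UNIV. \<Sum>m\<in>UNIV. B m b * (- 4 * w k b m)) = (\<Sum>m\<in>UNIV. \<Sum>b\<in>UNIV. B m b * (- 4 * w k b m))"
        by (rule sum.swap)
      then show ?thesis by (simp only: eq sum_distrib_left)
    qed
    also have "\<dots> = 0" by (simp add: curlB)
    also have "(\<Sum>b\<in>UNIV. \<Sum>i\<in>UNIV. \<Sum>a\<in>UNIV. \<Sum>l\<in>UNIV. X l * (psi i k a b * R i a l b))
       = (\<Sum>l\<in>UNIV. X l * (\<Sum>i\<in>UNIV. \<Sum>a\<in>UNIV. \<Sum>b\<in>UNIV. psi i k a b * R i a l b))"
    proof -
      have "(\<Sum>b\<in>UNIV. \<Sum>i\<in>UNIV. \<Sum>a\<in>UNIV. \<Sum>l\<in>UNIV. X l * (psi i k a b * R i a l b))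
        = (\<Sum>b\<in>UNIV. \<Sum>l\<in>UNIV. \<Sum>i\<in>UNIV. \<Sum>a\<in>UNIV. X l * (psi i k a b * R i a l b))"
        by (rule sum.cong[OF refl], rule sum_rot)
      also have "\<dots> = (\<Sum>l\<in>UNIV. \<Sum>b\<in>UNIV. \<Sum>i\<in>UNIV. \<Sum>a\<in>UNIV. X l * (psi i k a b * R i a l b))" by (rule sum.swap)
      also have "\<dots> = (\<Sum>l\<in>UNIV. \<Sum>i\<in>UNIV. \<Sum>a\<in>UNIV. \<Sum>b\<in>UNIV. X l * (psi i k a b * R i a l b))"
        by (rule sum.cong[OF refl], rule sum_rot[symmetric])
      finally show ?thesis by (simp add: sum_distrib_left)
    qed
    also have "\<dots> = - 24 * t\<^sup>2 * X k"
    proof -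
      have "X l * (- 24 * t\<^sup>2 * d7 k l) = (- 24 * t\<^sup>2) * (X l * d7 k l)" for l by simp
      then show ?thesis by (simp only: psi_R sum_distrib_left[symmetric] sum_d7)
    qed
    finally show ?thesis by simp
  qed
  finally show ?thesis by simp
qed

end

section \<open>Derivations, vector fields and the strong maximum principle\<close>

lemma sum_Basis_axis: "(\<Sum>b\<in>(Basis::(real^'n) set). f b) = (\<Sum>j\<in>UNIV. f (axis j 1))"
proof -
  have B: "(Basis::(real^'n) set) = range (\<lambda>j. axis j 1)" by (auto simp: Basis_vec_def)
  have i: "inj (\<lambda>j. axis j 1 :: real^'n)" by (auto simp: inj_def axis_eq_axis)
  show ?thesis unfolding B by (subst sum.reindex[OF i]) simp
qed

text \<open>Only one direction is differentiated twice, since a vector field is followed in a single direction in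
  \<open>tv_max\<close>.\<close>

lemma second_derivative_test_max:
  fixes F :: "'a::real_normed_vector \<Rightarrow> real"
  assumes S: "open S" "x \<in> S" and max: "\<And>y. y \<in> S \<Longrightarrow> F y \<le> F x"
    and D: "\<And>y. y \<in> S \<Longrightarrow> (F has_derivative DF y) (at y)"
    and D2: "((\<lambda>y. DF y \<xi>) has_derivative D2) (at x)"
  shows "DF x = (\<lambda>v. 0)" "D2 \<xi> \<le> 0"
proof -
  show z: "DF x = (\<lambda>v. 0)"
    using differential_zero_maxmin[of x S F "DF x"] assms by blast
  show "D2 \<xi> \<le> 0"
  proof (rule ccontr)
    assume "\<not> D2 \<xi> \<le> 0"
    define g where "g s = F (x + s *\<^sub>R \<xi>)" for s :: real
    define g' where "g' s = DF (x + s *\<^sub>R \<xi>) \<xi>" for s :: real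
    have line: "((\<lambda>s. x + s *\<^sub>R \<xi>) has_derivative (\<lambda>s. s *\<^sub>R \<xi>)) (at s)" for s
      by (auto intro!: derivative_eq_intros)
    have "open ((\<lambda>s::real. x + s *\<^sub>R \<xi>) -` S)"
      by (intro open_vimage S continuous_intros)
    moreover have "0 \<in> (\<lambda>s::real. x + s *\<^sub>R \<xi>) -` S" using S(2) by simp
    ultimately obtain r where r: "r > 0" "ball 0 r \<subseteq> (\<lambda>s::real. x + s *\<^sub>R \<xi>) -` S"
      by (rule openE)
    have rs: "x + s *\<^sub>R \<xi> \<in> S" if "\<bar>s\<bar> < r" for s using r(2) that by (auto simp: dist_norm)
    have g: "(g has_real_derivative g' s) (at s)" if "\<bar>s\<bar> < r" for s
    proof -
      have lin: "linear (DF (x + s *\<^sub>R \<xi>))" using D[OF rs[OF that]] has_derivative_linear by blast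
      have "(g has_derivative (\<lambda>t. DF (x + s *\<^sub>R \<xi>) (t *\<^sub>R \<xi>))) (at s)"
        unfolding g_def by (rule has_derivative_compose[OF line D[OF rs[OF that]]])
      moreover have "(\<lambda>t. DF (x + s *\<^sub>R \<xi>) (t *\<^sub>R \<xi>)) = (*) (g' s)"
        by (auto simp: g'_def linear_scale[OF lin])
      ultimately show ?thesis by (simp add: has_field_derivative_def)
    qed
    have g2: "(g' has_real_derivative D2 \<xi>) (at 0)"
    proof -
      have lin: "linear D2" using D2 has_derivative_linear by blast
      have "((\<lambda>y. DF y \<xi>) has_derivative D2) (at (x + 0 *\<^sub>R \<xi>))" using D2 by simp
      then have "(g' has_derivative (\<lambda>t. D2 (t *\<^sub>R \<xi>))) (at 0)"
        unfolding g'_def by (rule has_derivative_compose[OF line])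
      moreover have "(\<lambda>t. D2 (t *\<^sub>R \<xi>)) = (*) (D2 \<xi>)"
        by (auto simp: linear_scale[OF lin])
      ultimately show ?thesis by (simp add: has_field_derivative_def)
    qed
    obtain d where d: "d > 0" "\<And>h. 0 < h \<Longrightarrow> h < d \<Longrightarrow> g' 0 < g' (0 + h)"
      using DERIV_pos_inc_right[OF g2] \<open>\<not> D2 \<xi> \<le> 0\<close> by auto
    define s where "s = min r d / 2"
    have s: "0 < s" "s < r" "s < d" using r(1) d(1) by (auto simp: s_def)
    obtain c where c: "0 < c" "c < s" "g s - g 0 = (s - 0) * g' c"
      using MVT2[of 0 s g g'] g s by (auto simp: abs_if)
    have "g' c > 0" using d(2)[of c] c s z by (simp add: g'_def)
    then have "s * g' c > 0" using s by simp
    then have "g s > g 0" using c by simp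
    moreover have "g s \<le> g 0" using max[OF rs[of s]] s by (simp add: g_def)
    ultimately show False by simp
  qed
qed

context
  fixes A :: "'m::t2_space chart set"
  assumes atlas: "oriented_atlas A"
begin

lemma chart:
  assumes "(V, \<phi>) \<in> A"
  shows "open V" "open (\<phi> ` V)" "homeomorphism V (\<phi> ` V) \<phi> (inv_into V \<phi>)"
  using atlas assms by (auto simp: oriented_atlas_def)

lemma chart_inv: "(V, \<phi>) \<in> A \<Longrightarrow> q \<in> V \<Longrightarrow> inv_into V \<phi> (\<phi> q) = q"
  using chart(3)[of V \<phi>] by (auto simp: homeomorphism_def)

lemma chart_exists: obtains V \<phi> where "(V, \<phi>) \<in> A" "p \<in> V"
proof -
  have "p \<in> (\<Union>(U, \<phi>)\<in>A. U)" using atlas by (simp add: oriented_atlas_def)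
  then show ?thesis using that by auto
qed

lemma transition: "(V, \<phi>) \<in> A \<Longrightarrow> (V', \<psi>) \<in> A \<Longrightarrow> Cinf_on (\<psi> ` (V' \<inter> V)) (\<phi> \<circ> inv_into V' \<psi>)"
  using atlas unfolding oriented_atlas_def by fast

lemma open_chart_image:
  assumes "(V, \<phi>) \<in> A" "open U"
  shows "open (\<phi> ` (U \<inter> V))"
proof -
  have "openin (top_of_set V) (U \<inter> V)" using assms(2) by (metis inf_commute openin_open)
  then have "openin (top_of_set (\<phi> ` V)) (\<phi> ` (U \<inter> V))"
    using homeomorphism_imp_open_map[OF chart(3)[OF assms(1)]] by blast
  then show ?thesis using chart(2)[OF assms(1)] openin_open_eq by blast
qed

lemma smooth_map_subset: "smooth_map A U f \<Longrightarrow> U' \<subseteq> U \<Longrightarrow> smooth_map A U' f"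
  unfolding smooth_map_def by (fastforce intro: Cinf_on_subset)

lemma smooth_map_cong:
  assumes "open U" "\<And>q. q \<in> U \<Longrightarrow> f q = h q" "smooth_map A U f"
  shows "smooth_map A U h"
  unfolding smooth_map_def
proof (clarify)
  fix V \<phi> assume V: "(V, \<phi>) \<in> A"
  have "Cinf_on (\<phi> ` (U \<inter> V)) (f \<circ> inv_into V \<phi>)" using assms(3) V by (auto simp: smooth_map_def)
  then show "Cinf_on (\<phi> ` (U \<inter> V)) (h \<circ> inv_into V \<phi>)"
    by (subst Cinf_on_cong[OF open_chart_image[OF V assms(1)], where h = "f \<circ> inv_into V \<phi>"])
       (auto simp: chart_inv[OF V] assms(2))
qed

lemma smooth_map_const: "open U \<Longrightarrow> smooth_map A U (\<lambda>q. c)"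
  unfolding smooth_map_def o_def using Cinf_on_const open_chart_image by blast

lemma smooth_map_add: "open U \<Longrightarrow> smooth_map A U f \<Longrightarrow> smooth_map A U h \<Longrightarrow> smooth_map A U (\<lambda>q. f q + h q)"
  unfolding smooth_map_def o_def using Cinf_on_add open_chart_image by (fast intro: Cinf_on_add)

lemma smooth_map_mult: "open U \<Longrightarrow> smooth_map A U f \<Longrightarrow> smooth_map A U h \<Longrightarrow> smooth_map A U (\<lambda>q. f q * h q :: real)"
  unfolding smooth_map_def o_def using open_chart_image by (fast intro: Cinf_on_mult)

lemma smooth_map_linear: "open U \<Longrightarrow> bounded_linear L \<Longrightarrow> smooth_map A U f \<Longrightarrow> smooth_map A U (\<lambda>q. L (f q))"
  unfolding smooth_map_def o_def using open_chart_image by (fast intro: Cinf_on_linear_comp)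

lemma smooth_map_cmult: "open U \<Longrightarrow> smooth_map A U f \<Longrightarrow> smooth_map A U (\<lambda>q. c * f q :: real)"
  by (intro smooth_map_mult smooth_map_const)

lemma smooth_map_minus: "open U \<Longrightarrow> smooth_map A U f \<Longrightarrow> smooth_map A U (\<lambda>q. - f q :: real)"
  using smooth_map_cmult[of U f "-1"] by simp

lemma smooth_map_diff: "open U \<Longrightarrow> smooth_map A U f \<Longrightarrow> smooth_map A U h \<Longrightarrow> smooth_map A U (\<lambda>q. f q - h q :: real)"
  using smooth_map_add[of U f "\<lambda>q. - h q"] smooth_map_minus by simp

lemma smooth_map_sum:
  "open U \<Longrightarrow> (\<And>i. i \<in> I \<Longrightarrow> smooth_map A U (f i)) \<Longrightarrow> smooth_map A U (\<lambda>q. \<Sum>i\<in>I. f i q :: real)"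
  by (induction I rule: infinite_finite_induct) (auto intro: smooth_map_const smooth_map_add)

lemma smooth_map_chart:
  assumes V: "(V, \<phi>) \<in> A" and T: "open T" and G: "Cinf_on T G" and U: "U \<subseteq> V" "\<phi> ` U \<subseteq> T" "open U"
  shows "smooth_map A U (\<lambda>q. G (\<phi> q))"
  unfolding smooth_map_def
proof clarify
  fix V' \<psi> assume V': "(V', \<psi>) \<in> A"
  have "Cinf_on (\<psi> ` (U \<inter> V')) (\<phi> \<circ> inv_into V' \<psi>)"
    using transition[OF V V'] U(1) by (auto intro: Cinf_on_subset)
  moreover have "(\<phi> \<circ> inv_into V' \<psi>) ` (\<psi> ` (U \<inter> V')) \<subseteq> T"
    using U(2) chart_inv[OF V'] by auto
  ultimately have "Cinf_on (\<psi> ` (U \<inter> V')) (\<lambda>x. G ((\<phi> \<circ> inv_into V' \<psi>) x))"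
    by (intro Cinf_on_compose[OF open_chart_image[OF V' U(3)] _ T G])
  then show "Cinf_on (\<psi> ` (U \<inter> V')) ((\<lambda>q. G (\<phi> q)) \<circ> inv_into V' \<psi>)" by (simp add: o_def)
qed

lemma smooth_map_coordinate: "(V, \<phi>) \<in> A \<Longrightarrow> smooth_map A V (\<lambda>q. \<phi> q $ j)"
  using smooth_map_chart[of V \<phi> "\<phi> ` V" "\<lambda>x. x $ j" V] chart[of V \<phi>]
    Cinf_on_bounded_linear[OF _ bounded_linear_vec_nth] by auto

lemma continuous_on_chart: "(V, \<phi>) \<in> A \<Longrightarrow> continuous_on V \<phi>"
  using chart(3) by (auto simp: homeomorphism_def)

lemma open_chart_vimage: 
  assumes "(V, \<phi>) \<in> A" "open T" shows "open {q \<in> V. \<phi> q \<in> T}"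
proof -
  have "open (\<phi> -` T \<inter> V)"
    using continuous_on_open_vimage[OF chart(1)[OF assms(1)]] continuous_on_chart[OF assms(1)] assms(2) by blast
  moreover have "\<phi> -` T \<inter> V = {q \<in> V. \<phi> q \<in> T}" by auto
  ultimately show ?thesis by simp
qed

lemma smooth_map_continuous:
  assumes "open U" "smooth_map A U f"
  shows "continuous_on U f"
proof (rule continuous_at_imp_continuous_on, rule ballI)
  fix p assume p: "p \<in> U"
  obtain V \<phi> where V: "(V, \<phi>) \<in> A" "p \<in> V" by (rule chart_exists)
  have "continuous_on (\<phi> ` (U \<inter> V)) (f \<circ> inv_into V \<phi>)"
    using assms(2) V(1) Cinf_on_continuous unfolding smooth_map_def by blast
  then have "continuous_on (U \<inter> V) (\<lambda>q. (f \<circ> inv_into V \<phi>) (\<phi> q))"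
    by (rule continuous_on_compose2) (auto intro: continuous_on_subset[OF continuous_on_chart[OF V(1)]])
  then have "continuous_on (U \<inter> V) f"
    by (rule continuous_on_eq) (simp add: chart_inv[OF V(1)])
  then show "isCont f p"
    using p V chart(1)[OF V(1)] assms(1) by (simp add: continuous_on_eq_continuous_at open_Int)
qed

lemma smooth_nearI: "open U \<Longrightarrow> p \<in> U \<Longrightarrow> smooth_map A U f \<Longrightarrow> smooth_near A p f"
  by (auto simp: smooth_near_def)

lemma smooth_near_add: 
  assumes "smooth_near A p f" "smooth_near A p h" shows "smooth_near A p (\<lambda>q. f q + h q)"
proof -
  obtain U W where "open U" "p \<in> U" "smooth_map A U f" "open W" "p \<in> W" "smooth_map A W h"
    using assms by (auto simp: smooth_near_def)
  then show ?thesis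
    by (intro smooth_nearI[of "U \<inter> W"] smooth_map_add) (auto intro: smooth_map_subset)
qed

lemma smooth_near_mult: 
  assumes "smooth_near A p f" "smooth_near A p h" shows "smooth_near A p (\<lambda>q. f q * h q)"
proof -
  obtain U W where "open U" "p \<in> U" "smooth_map A U f" "open W" "p \<in> W" "smooth_map A W h"
    using assms by (auto simp: smooth_near_def)
  then show ?thesis
    by (intro smooth_nearI[of "U \<inter> W"] smooth_map_mult) (auto intro: smooth_map_subset)
qed

lemma smooth_near_const: "smooth_near A p (\<lambda>q. c)"
  by (rule smooth_nearI[of UNIV]) (auto intro: smooth_map_const)

lemma smooth_near_sum: "(\<And>i. i \<in> I \<Longrightarrow> smooth_near A p (f i)) \<Longrightarrow> smooth_near A p (\<lambda>q. \<Sum>i\<in>I. f i q)"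
  by (induction I rule: infinite_finite_induct) (auto intro: smooth_near_const smooth_near_add)

context
  fixes p v assumes v: "v \<in> tangent_space A p"
begin

lemma tv_lin: "smooth_near A p f \<Longrightarrow> smooth_near A p h \<Longrightarrow> v (\<lambda>q. a * f q + b * h q) = a * v f + b * v h"
  and tv_mult: "smooth_near A p f \<Longrightarrow> smooth_near A p h \<Longrightarrow> v (\<lambda>q. f q * h q) = f p * v h + h p * v f"
  and tv_germ: "smooth_near A p f \<Longrightarrow> smooth_near A p h \<Longrightarrow> (\<forall>\<^sub>F q in nhds p. f q = h q) \<Longrightarrow> v f = v h"
  and tv_rough: "\<not> smooth_near A p f \<Longrightarrow> v f = 0"
  using v unfolding tangent_space_def by blast+

lemma tv_const: "v (\<lambda>q. c) = 0"
proof -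
  have "v (\<lambda>q. 1) = 0" using tv_mult[OF smooth_near_const[of p 1] smooth_near_const[of p 1]] by simp
  then show ?thesis using tv_lin[OF smooth_near_const[of p 1] smooth_near_const[of p 1], of c 0] by simp
qed

lemma tv_add: "smooth_near A p f \<Longrightarrow> smooth_near A p h \<Longrightarrow> v (\<lambda>q. f q + h q) = v f + v h"
  using tv_lin[of f h 1 1] by simp

lemma tv_cmult: "smooth_near A p f \<Longrightarrow> v (\<lambda>q. c * f q) = c * v f"
  using tv_lin[of f f c 0] by simp

lemma tv_sum: "(\<And>i. i \<in> I \<Longrightarrow> smooth_near A p (f i)) \<Longrightarrow> v (\<lambda>q. \<Sum>i\<in>I. f i q) = (\<Sum>i\<in>I. v (f i))"
  by (induction I rule: infinite_finite_induct) (auto simp: tv_const tv_add smooth_near_sum)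

lemma tv_local: "open U \<Longrightarrow> p \<in> U \<Longrightarrow> smooth_map A U f \<Longrightarrow> (\<And>q. q \<in> U \<Longrightarrow> f q = h q) \<Longrightarrow> v f = v h"
  by (rule tv_germ) (auto intro: smooth_nearI smooth_map_cong simp: eventually_nhds)

text \<open>A derivation of germs is determined by its values on the coordinates, by the Hadamard expansion.\<close>

lemma tv_chart:
  assumes V: "(V, \<phi>) \<in> A" "p \<in> V" and T: "open T" "\<phi> p \<in> T" and G: "Cinf_on T G"
  shows "v (\<lambda>q. G (\<phi> q)) = (\<Sum>j\<in>UNIV. v (\<lambda>q. \<phi> q $ j) * frechet_derivative G (at (\<phi> p)) (axis j 1))"
proof -
  obtain r where r: "r > 0" "ball (\<phi> p) r \<subseteq> T" using T openE by blast
  have GB: "Cinf_on (ball (\<phi> p) r) G" using G r(2) by (rule Cinf_on_subset)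
  obtain H where H: "\<And>b. b \<in> Basis \<Longrightarrow> Cinf_on (ball (\<phi> p) r) (H b)"
    "\<And>x. x \<in> ball (\<phi> p) r \<Longrightarrow> G x = G (\<phi> p) + (\<Sum>b\<in>Basis. ((x - \<phi> p) \<bullet> b) * H b x)"
    "\<And>b. H b (\<phi> p) = frechet_derivative G (at (\<phi> p)) b"
    using Hadamard[OF GB] by blast
  define U where "U = {q \<in> V. \<phi> q \<in> ball (\<phi> p) r}"
  have U: "open U" "p \<in> U" "U \<subseteq> V" "\<phi> ` U \<subseteq> ball (\<phi> p) r"
    using open_chart_vimage[OF V(1) open_ball] V r by (auto simp: U_def)
  have sH: "smooth_map A U (\<lambda>q. H (axis j 1) (\<phi> q))" for j
    by (rule smooth_map_chart[OF V(1) open_ball H(1) U(3,4,1)]) (auto simp: axis_in_Basis_iff)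
  have sG: "smooth_map A U (\<lambda>q. G (\<phi> q))"
    by (rule smooth_map_chart[OF V(1) open_ball GB U(3,4,1)])
  have sx: "smooth_map A U (\<lambda>q. \<phi> q $ j)" for j
    using smooth_map_coordinate[OF V(1)] U(3) smooth_map_subset by blast
  have n: "smooth_near A p f" if "smooth_map A U f" for f using smooth_nearI[OF U(1,2) that] .
  have sd: "smooth_map A U (\<lambda>q. \<phi> q $ j - \<phi> p $ j)" for j
    using smooth_map_diff[OF U(1) sx smooth_map_const[OF U(1)]] .
  have vd: "v (\<lambda>q. \<phi> q $ j - \<phi> p $ j) = v (\<lambda>q. \<phi> q $ j)" for j
    using tv_lin[OF n[OF sx[of j]] smooth_near_const[of p "\<phi> p $ j"], of 1 "-1"] tv_const by simp
  have "v (\<lambda>q. G (\<phi> q)) = v (\<lambda>q. G (\<phi> p) + (\<Sum>j\<in>UNIV. (\<phi> q $ j - \<phi> p $ j) * H (axis j 1) (\<phi> q)))"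
  proof (rule tv_local[OF U(1,2) sG])
    fix q assume "q \<in> U"
    then have "\<phi> q \<in> ball (\<phi> p) r" using U(4) by blast
    from H(2)[OF this] show "G (\<phi> q) = G (\<phi> p) + (\<Sum>j\<in>UNIV. (\<phi> q $ j - \<phi> p $ j) * H (axis j 1) (\<phi> q))"
      by (simp add: sum_Basis_axis inner_axis)
  qed
  also have "\<dots> = v (\<lambda>q. G (\<phi> p)) + (\<Sum>j\<in>UNIV. v (\<lambda>q. (\<phi> q $ j - \<phi> p $ j) * H (axis j 1) (\<phi> q)))"
    by (subst tv_add, rule smooth_near_const)
       (auto intro!: smooth_near_sum smooth_near_mult n[OF sd] n[OF sH] tv_sum)
  also have "\<dots> = (\<Sum>j\<in>UNIV. v (\<lambda>q. \<phi> q $ j) * frechet_derivative G (at (\<phi> p)) (axis j 1))"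
    by (simp add: tv_const tv_mult[OF n[OF sd] n[OF sH]] vd H(3)) (simp add: mult.commute)
  finally show ?thesis .
qed

lemma tv_chart':
  assumes V: "(V, \<phi>) \<in> A" "p \<in> V" and U: "open U" "p \<in> U" and f: "smooth_map A U f"
  shows "v f = (\<Sum>j\<in>UNIV. v (\<lambda>q. \<phi> q $ j) * frechet_derivative (f \<circ> inv_into V \<phi>) (at (\<phi> p)) (axis j 1))"
proof -
  have G: "Cinf_on (\<phi> ` (U \<inter> V)) (f \<circ> inv_into V \<phi>)" using f V by (auto simp: smooth_map_def)
  have "v f = v (\<lambda>q. (f \<circ> inv_into V \<phi>) (\<phi> q))"
    by (rule tv_local[of "U \<inter> V"]) (use U V chart[OF V(1)] f chart_inv[OF V(1)] in \<open>auto intro: smooth_map_subset\<close>)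
  then show ?thesis using tv_chart[OF V open_chart_image[OF V(1) U(1)] _ G] U V by auto
qed

end

text \<open>At an interior maximum the first derivative along a vector field vanishes, so the first-order part of
  \<open>X (X h)\<close> drops out and the Hessian in a chart decides the sign.\<close>

lemma tv_max:
  assumes U: "open U" "p \<in> U" and X: "vector_field A U X" and h: "smooth_map A U h"
    and max: "\<And>q. q \<in> U \<Longrightarrow> h q \<le> h p"
  shows "X p h = 0" "X p (\<lambda>q. X q h) \<le> 0"
proof -
  obtain V \<phi> where V: "(V, \<phi>) \<in> A" "p \<in> V" by (rule chart_exists)
  define W where "W = U \<inter> V"
  have W: "open W" "p \<in> W" "W \<subseteq> V" "W \<subseteq> U" using U V chart(1)[OF V(1)] by (auto simp: W_def)
  define F where "F = h \<circ> inv_into V \<phi>"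
  have oT: "open (\<phi> ` W)" unfolding W_def by (rule open_chart_image[OF V(1) U(1)])
  have F: "Cinf_on (\<phi> ` W) F" using h V by (auto simp: smooth_map_def F_def W_def)
  define P where "P j y = frechet_derivative F (at y) (axis j 1)" for j y
  define \<xi> where "\<xi> j q = X q (\<lambda>q. \<phi> q $ j)" for j q
  have Xt: "X q \<in> tangent_space A q" if "q \<in> U" for q using X that by (auto simp: vector_field_def)
  have P: "Cinf_on (\<phi> ` W) (P j)" for j unfolding P_def by (rule Cinf_on_derivative[OF F])
  have Xh: "X q h = (\<Sum>j\<in>UNIV. \<xi> j q * P j (\<phi> q))" if q: "q \<in> W" for q
    using tv_chart'[OF Xt V(1) _ U(1) _ h] W q by (auto simp: \<xi>_def P_def F_def)
  have sxi: "smooth_map A W (\<xi> j)" for j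
    using X W smooth_map_subset[OF smooth_map_coordinate[OF V(1), of j] W(3)]
    unfolding vector_field_def \<xi>_def by blast
  have sP: "smooth_map A W (\<lambda>q. P j (\<phi> q))" for j
    by (rule smooth_map_chart[OF V(1) oT P W(3) order.refl W(1)])
  have n: "smooth_near A p f" if "smooth_map A W f" for f using smooth_nearI[OF W(1,2) that] .
  note Xp = Xt[OF U(2)]
  define z :: "real^7" where "z = (\<chi> j. \<xi> j p)"
  have lin: "linear (frechet_derivative F (at y))" if "y \<in> \<phi> ` W" for y
    using Cinf_on_has_derivative[OF F that] has_derivative_linear by blast
  have Fz: "frechet_derivative F (at y) z = (\<Sum>j\<in>UNIV. \<xi> j p * P j y)" if "y \<in> \<phi> ` W" for y
    using linear_basis_expansion[OF lin[OF that], of z] by (simp add: sum_Basis_axis inner_axis z_def P_def)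
  have C: "Cinf_on (\<phi> ` W) (\<lambda>y. frechet_derivative F (at y) z)" by (rule Cinf_on_derivative[OF F])
  have pW: "\<phi> p \<in> \<phi> ` W" using W by blast
  note test = second_derivative_test_max[OF oT pW _ Cinf_on_has_derivative[OF F] Cinf_on_has_derivative[OF C pW]]
  have mx: "F y \<le> F (\<phi> p)" if "y \<in> \<phi> ` W" for y
  proof -
    from that obtain q where q: "q \<in> W" "y = \<phi> q" by blast
    then have "q \<in> U" "q \<in> V" using W by auto
    then show ?thesis using max chart_inv[OF V(1)] V(2) q by (simp add: F_def)
  qed
  have P0: "P j (\<phi> p) = 0" for j using test(1)[OF mx] by (simp add: P_def)
  then show "X p h = 0" using Xh[OF W(2)] by simp
  have "X p (\<lambda>q. X q h) = X p (\<lambda>q. \<Sum>j\<in>UNIV. \<xi> j q * P j (\<phi> q))"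
  proof (rule tv_local[OF Xp W(1,2), symmetric])
    show "smooth_map A W (\<lambda>q. \<Sum>j\<in>UNIV. \<xi> j q * P j (\<phi> q))"
      by (intro smooth_map_sum smooth_map_mult W sxi sP)
  qed (simp add: Xh)
  also have "\<dots> = (\<Sum>j\<in>UNIV. \<xi> j p * X p (\<lambda>q. P j (\<phi> q)))"
    by (subst tv_sum[OF Xp]) (auto intro!: smooth_near_mult n[OF sxi] n[OF sP] simp: tv_mult[OF Xp n[OF sxi] n[OF sP]] P0)
  also have "\<dots> = (\<Sum>j\<in>UNIV. \<xi> j p * (\<Sum>k\<in>UNIV. \<xi> k p * frechet_derivative (P j) (at (\<phi> p)) (axis k 1)))"
  proof (intro sum.cong refl arg_cong2[where f = "(*)"])
    show "X p (\<lambda>q. P j (\<phi> q)) = (\<Sum>k\<in>UNIV. \<xi> k p * frechet_derivative (P j) (at (\<phi> p)) (axis k 1))" for j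
      unfolding \<xi>_def by (rule tv_chart[OF Xp V oT pW P])
  qed
  also have "\<dots> = (\<Sum>j\<in>UNIV. \<xi> j p * frechet_derivative (P j) (at (\<phi> p)) z)"
  proof -
    have "frechet_derivative (P j) (at (\<phi> p)) z = (\<Sum>k\<in>UNIV. \<xi> k p * frechet_derivative (P j) (at (\<phi> p)) (axis k 1))" for j
    proof -
      have "frechet_derivative (P j) (at (\<phi> p)) z = (\<Sum>b\<in>Basis. (z \<bullet> b) *\<^sub>R frechet_derivative (P j) (at (\<phi> p)) b)"
        by (rule linear_basis_expansion[OF has_derivative_linear[OF Cinf_on_has_derivative[OF P pW]]])
      also have "\<dots> = (\<Sum>k\<in>UNIV. \<xi> k p * frechet_derivative (P j) (at (\<phi> p)) (axis k 1))"
        by (simp only: sum_Basis_axis inner_axis z_def real_scaleR_def vec_lambda_beta) simp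
      finally show ?thesis .
    qed
    then show ?thesis by simp
  qed
  also have "\<dots> = frechet_derivative (\<lambda>y. frechet_derivative F (at y) z) (at (\<phi> p)) z"
  proof -
    have "((\<lambda>y. \<Sum>j\<in>UNIV. \<xi> j p * P j y) has_derivative (\<lambda>u. \<Sum>j\<in>UNIV. \<xi> j p * frechet_derivative (P j) (at (\<phi> p)) u)) (at (\<phi> p))"
      by (intro has_derivative_sum has_derivative_mult_right Cinf_on_has_derivative[OF P pW])
    then have "((\<lambda>y. frechet_derivative F (at y) z) has_derivative (\<lambda>u. \<Sum>j\<in>UNIV. \<xi> j p * frechet_derivative (P j) (at (\<phi> p)) u)) (at (\<phi> p))"
      by (rule has_derivative_transform_within_open[OF _ oT pW]) (simp add: Fz)
    from fun_cong[OF frechet_derivative_at[OF this], of z] show ?thesis by (simp only:)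
  qed
  also have "\<dots> \<le> 0" by (rule test(2)[OF mx])
  finally show "X p (\<lambda>q. X q h) \<le> 0" .
qed

lemma vector_field_smooth:
  "vector_field A U X \<Longrightarrow> open W \<Longrightarrow> W \<subseteq> U \<Longrightarrow> smooth_map A W f \<Longrightarrow> smooth_map A W (\<lambda>q. X q f)"
  by (auto simp: vector_field_def)

lemma vector_field_subset:
  assumes "vector_field A U X" "U' \<subseteq> U"
  shows "vector_field A U' X"
  unfolding vector_field_def
proof (intro conjI ballI allI impI)
  show "X p \<in> tangent_space A p" if "p \<in> U'" for p
    using assms that by (auto simp: vector_field_def)
  fix V and f :: "'m \<Rightarrow> real" assume "open V \<and> V \<subseteq> U' \<and> smooth_map A V f"
  then have "open V \<and> V \<subseteq> U \<and> smooth_map A V f" using assms(2) by auto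
  then show "smooth_map A V (\<lambda>p. X p f)" using assms(1) unfolding vector_field_def by blast
qed

lemma vector_field_tangent: "vector_field A U X \<Longrightarrow> q \<in> U \<Longrightarrow> X q \<in> tangent_space A q"
  by (auto simp: vector_field_def)

lemma vector_field_second_comb:
  assumes W: "open W" "W \<subseteq> U" "q \<in> W" and X: "vector_field A U X"
    and f: "smooth_map A W f" and h: "smooth_map A W h"
  shows "X q (\<lambda>r. X r (\<lambda>t. f t + c * h t)) = X q (\<lambda>r. X r f) + c * X q (\<lambda>r. X r h)"
    and "X q (\<lambda>t. f t + c * h t) = X q f + c * X q h"
proof -
  have 1: "X r (\<lambda>t. f t + c * h t) = X r f + c * X r h" if "r \<in> W" for r
    using tv_lin[OF vector_field_tangent[OF X] smooth_nearI[OF W(1) that f] smooth_nearI[OF W(1) that h], of 1 c]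
      that W(2) by auto
  then show "X q (\<lambda>t. f t + c * h t) = X q f + c * X q h" using W(3) .
  have q: "X q \<in> tangent_space A q" using vector_field_tangent[OF X] W by blast
  note sX = vector_field_smooth[OF X W(1,2) f] vector_field_smooth[OF X W(1,2) h]
  have "X q (\<lambda>r. X r (\<lambda>t. f t + c * h t)) = X q (\<lambda>r. 1 * X r f + c * X r h)"
    by (rule tv_local[OF q W(1,3), symmetric])
       (auto simp: 1 intro!: smooth_map_add smooth_map_cmult W(1) sX)
  also have "\<dots> = X q (\<lambda>r. X r f) + c * X q (\<lambda>r. X r h)"
    using tv_lin[OF q smooth_nearI[OF W(1,3) sX(1)] smooth_nearI[OF W(1,3) sX(2)], of 1 c] by simp
  finally show "X q (\<lambda>r. X r (\<lambda>t. f t + c * h t)) = X q (\<lambda>r. X r f) + c * X q (\<lambda>r. X r h)" .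
qed

lemma vector_field_second_square:
  assumes W: "open W" "W \<subseteq> U" "q \<in> W" and X: "vector_field A U X"
    and s: "smooth_map A W s"
  shows "X q (\<lambda>r. X r (\<lambda>t. s t * s t)) = 2 * s q * X q (\<lambda>r. X r s) + 2 * (X q s)\<^sup>2"
    and "X q (\<lambda>t. s t * s t) = 2 * s q * X q s"
proof -
  have 1: "X r (\<lambda>t. s t * s t) = 2 * s r * X r s" if "r \<in> W" for r
    using tv_mult[OF vector_field_tangent[OF X] smooth_nearI[OF W(1) that s] smooth_nearI[OF W(1) that s]]
      that W(2) by auto
  then show "X q (\<lambda>t. s t * s t) = 2 * s q * X q s" using W(3) .
  have q: "X q \<in> tangent_space A q" using vector_field_tangent[OF X] W by blast
  note sX = vector_field_smooth[OF X W(1,2) s]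
  have "X q (\<lambda>r. X r (\<lambda>t. s t * s t)) = X q (\<lambda>r. 2 * (s r * X r s))"
    by (rule tv_local[OF q W(1,3), symmetric])
       (auto simp: 1 intro!: smooth_map_mult smooth_map_cmult W(1) sX s)
  also have "\<dots> = 2 * X q (\<lambda>r. s r * X r s)"
    by (rule tv_cmult[OF q smooth_nearI[OF W(1,3)]]) (intro smooth_map_mult W(1) sX s)
  also have "\<dots> = 2 * s q * X q (\<lambda>r. X r s) + 2 * (X q s)\<^sup>2"
    using tv_mult[OF q smooth_nearI[OF W(1,3) s] smooth_nearI[OF W(1,3) sX]] by (simp add: power2_eq_square)
  finally show "X q (\<lambda>r. X r (\<lambda>t. s t * s t)) = 2 * s q * X q (\<lambda>r. X r s) + 2 * (X q s)\<^sup>2" .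
qed

text \<open>A second-order operator as a sum of squares of vector fields plus first-order terms with free
  coefficients. The maximum principle holds for all of these, so that it can be applied before the
  Laplacian of a connection is identified.\<close>

definition frame_laplacian ::
  "(7 \<Rightarrow> 'm \<Rightarrow> 'm tvec) \<Rightarrow> (7 \<Rightarrow> 'm \<Rightarrow> real) \<Rightarrow> ('m \<Rightarrow> real) \<Rightarrow> 'm \<Rightarrow> real" where
  "frame_laplacian e b f q = (\<Sum>i\<in>UNIV. e i q (\<lambda>r. e i r f)) + (\<Sum>k\<in>UNIV. b k q * e k q f)"

lemma frame_laplacian_smooth:
  assumes "open W" "W \<subseteq> U" "\<And>i. vector_field A U (e i)" "\<And>k. smooth_map A U (b k)" "smooth_map A W f"
  shows "smooth_map A W (frame_laplacian e b f)"
  unfolding frame_laplacian_def[abs_def] using assms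
  by (intro smooth_map_add smooth_map_sum smooth_map_mult)
     (auto intro: vector_field_smooth smooth_map_subset)

lemma frame_laplacian_comb:
  assumes "open W" "W \<subseteq> U" "q \<in> W" "\<And>i. vector_field A U (e i)" "smooth_map A W f" "smooth_map A W h"
  shows "frame_laplacian e b (\<lambda>t. f t + c * h t) q = frame_laplacian e b f q + c * frame_laplacian e b h q"
  unfolding frame_laplacian_def using vector_field_second_comb[OF assms(1-3) assms(4) assms(5,6)]
  by (simp add: sum.distrib sum_distrib_left algebra_simps)

lemma frame_laplacian_square:
  assumes "open W" "W \<subseteq> U" "q \<in> W" "\<And>i. vector_field A U (e i)" "smooth_map A W s"
  shows "frame_laplacian e b (\<lambda>t. s t * s t) q = 2 * s q * frame_laplacian e b s q + 2 * (\<Sum>i\<in>UNIV. (e i q s)\<^sup>2)"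
  unfolding frame_laplacian_def using vector_field_second_square[OF assms(1-3) assms(4) assms(5)]
  by (simp add: sum.distrib sum_distrib_left algebra_simps)

text \<open>The boundary point argument of Hopf. If the function is below its maximum somewhere near \<open>p\<close>, a ball free of
  maximum points touches the set of maximum points at some \<open>z\<close>. Adding a small multiple of a strictly
  subharmonic barrier that is negative outside the ball near \<open>z\<close> gives an interior maximum near \<open>z\<close>, at which the
  operator would be both positive and nonpositive.\<close>

lemma strong_max_local:
  fixes u :: "'m \<Rightarrow> real"
  assumes U: "open U" "p \<in> U" and u: "smooth_map A U u" and e: "\<And>i. vector_field A U (e i)"
    and b: "\<And>k. smooth_map A U (b k)" and L: "\<And>q. q \<in> U \<Longrightarrow> frame_laplacian e b u q \<ge> 0"
    and V: "(V, \<phi>) \<in> A" "p \<in> V"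
    and nd: "\<And>q. q \<in> U \<inter> V \<Longrightarrow> det (\<chi> i j. e i q (\<lambda>r. \<phi> r $ j)) \<noteq> 0"
    and max: "\<And>q. q \<in> U \<Longrightarrow> u q \<le> u p"
  shows "\<exists>N. open N \<and> p \<in> N \<and> (\<forall>q\<in>N. u q = u p)"
proof -
  define W where "W = U \<inter> V"
  have W: "open W" "p \<in> W" "W \<subseteq> V" "W \<subseteq> U" using U V chart(1)[OF V(1)] by (auto simp: W_def)
  have oW: "open (\<phi> ` W)" unfolding W_def by (rule open_chart_image[OF V(1) U(1)])
  define g where "g = inv_into V \<phi>"
  have g: "g (\<phi> q) = q" if "q \<in> V" for q using chart_inv[OF V(1) that] by (simp add: g_def)
  have gW: "g x \<in> W" "\<phi> (g x) = x" if "x \<in> \<phi> ` W" for x using that g W(3) by auto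
  define f where "f x = u (g x)" for x
  have cg: "continuous_on (\<phi> ` V) g" using chart(3)[OF V(1)] by (auto simp: homeomorphism_def g_def)
  have cf: "continuous_on (\<phi> ` W) f"
    unfolding f_def
    by (rule continuous_on_compose2[OF smooth_map_continuous[OF U(1) u] continuous_on_subset[OF cg]]) (use gW W in auto)
  obtain R where R: "R > 0" "ball (\<phi> p) R \<subseteq> \<phi> ` W" using openE[OF oW, of "\<phi> p"] W(2) by auto
  define N where "N = {q \<in> V. \<phi> q \<in> ball (\<phi> p) (R/2)}"
  have oN: "open N" "p \<in> N" unfolding N_def using V R by (auto intro: open_chart_vimage[OF V(1) open_ball] simp del: mem_ball)
  have "\<forall>q\<in>N. u q = u p"
  proof (rule ccontr)
    assume "\<not> (\<forall>q\<in>N. u q = u p)"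
    then obtain q where q: "q \<in> N" "u q \<noteq> u p" by blast
    define y where "y = \<phi> q"
    define m where "m = u p"
    have yR: "dist y (\<phi> p) < R/2" using q by (simp add: N_def y_def dist_commute)
    have ball_sub: "cball y (dist y (\<phi> p)) \<subseteq> ball (\<phi> p) R"
    proof
      fix x assume "x \<in> cball y (dist y (\<phi> p))"
      then have "dist (\<phi> p) x \<le> dist y (\<phi> p) + dist y (\<phi> p)"
        using dist_triangle[of "\<phi> p" x y] by (simp add: dist_commute)
      then show "x \<in> ball (\<phi> p) R" using yR by simp
    qed
    have fm: "f x \<le> m" if "x \<in> \<phi> ` W" for x using gW[OF that] max W(4) by (auto simp: f_def m_def)
    have fy: "f y \<noteq> m" using q g by (auto simp: f_def y_def m_def N_def)
    define K where "K = {x \<in> cball y (dist y (\<phi> p)). f x = m}"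
    have "continuous_on (cball y (dist y (\<phi> p))) f"
      using cf ball_sub R(2) continuous_on_subset by blast
    then have "closed K"
      unfolding K_def by (intro continuous_closed_preimage_constant closed_cball)
    moreover have "bounded K" unfolding K_def by (rule bounded_subset[OF bounded_cball]) auto
    ultimately have "compact K" by (simp add: compact_eq_bounded_closed)
    moreover have "\<phi> p \<in> K" using g V by (simp add: K_def f_def m_def)
    ultimately obtain z where z: "z \<in> K" "\<And>x. x \<in> K \<Longrightarrow> dist y z \<le> dist y x"
      using distance_attains_inf[of K y] compact_imp_closed by blast
    define \<rho> where "\<rho> = dist y z"
    have zW: "z \<in> \<phi> ` W" using z(1) ball_sub R(2) unfolding K_def by blast
    have fz: "f z = m" using z(1) by (simp add: K_def)
    have zy: "z \<noteq> y" using fz fy by auto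
    have rho: "\<rho> \<le> dist y (\<phi> p)" using z(1) by (simp add: K_def \<rho>_def)
    have flt: "f x < m" if "dist y x < \<rho>" for x
    proof -
      have "x \<in> cball y (dist y (\<phi> p))" using that rho by simp
      moreover have "x \<notin> K" using z(2)[of x] that by (auto simp: \<rho>_def)
      ultimately have "f x \<noteq> m" "x \<in> \<phi> ` W" using ball_sub R(2) by (auto simp: K_def)
      then show ?thesis using fm[of x] by simp
    qed
    \<comment> \<open>The term in \<open>z\<close> makes \<open>S\<close> negative on the touching sphere except at \<open>z\<close> itself, so that
      \<open>S \<ge> 0\<close> forces \<open>f < m\<close> away from \<open>z\<close>; the gradient at \<open>z\<close> still is not zero.\<close>
    define S where "S x = \<rho>\<^sup>2 - (x - y) \<bullet> (x - y) - (x - z) \<bullet> (x - z)" for x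
    have Sz: "S z = 0" by (simp add: S_def \<rho>_def dist_norm norm_minus_commute[of y z] power2_norm_eq_inner)
    have Spos: "f x < m" if "S x \<ge> 0" "x \<noteq> z" for x
    proof -
      have "(x - z) \<bullet> (x - z) > 0" using that(2) by simp
      then have "(x - y) \<bullet> (x - y) < \<rho>\<^sup>2" using that(1) unfolding S_def by linarith
      then have "(dist y x)\<^sup>2 < \<rho>\<^sup>2" by (simp add: dist_norm power2_norm_eq_inner norm_minus_commute[of y x])
      then have "dist y x < \<rho>" by (rule power_less_imp_less_base) (simp add: \<rho>_def)
      then show ?thesis by (rule flt)
    qed
    have dS: "(S has_derivative (\<lambda>v. - 2 * ((x - y) \<bullet> v) - 2 * ((x - z) \<bullet> v))) (at x)" for x
      unfolding S_def by (auto intro!: derivative_eq_intros simp: inner_commute algebra_simps)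
    have CS: "Cinf_on UNIV S"
    proof -
      have sq: "Cinf_on UNIV (\<lambda>x::real^7. (x - a) \<bullet> (x - a))" for a
      proof -
        have "Cinf_on UNIV (\<lambda>x::real^7. \<Sum>j\<in>UNIV. (x $ j + - a $ j) * (x $ j + - a $ j))"
          unfolding Cinf_on_def
          by (intro allI Ck_on_sum open_UNIV, subst real_scaleR_def[symmetric])
             (intro Ck_on_scaleR Ck_on_add Ck_on_const Ck_on_bounded_linear bounded_linear_vec_nth open_UNIV)
        then show ?thesis by (simp add: inner_vec_def)
      qed
      have "Cinf_on UNIV (\<lambda>x. (\<rho>\<^sup>2 + (-1) * ((x - y) \<bullet> (x - y))) + (-1) * ((x - z) \<bullet> (x - z)))"
        by (intro Cinf_on_add Cinf_on_mult Cinf_on_const open_UNIV sq)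
      then show ?thesis by (simp add: S_def[abs_def])
    qed
    define s where "s q = S (\<phi> q)" for q
    have ss: "smooth_map A W s"
      unfolding s_def by (rule smooth_map_chart[OF V(1) open_UNIV CS W(3) _ W(1)]) simp
    define P where "P = g z"
    have P: "P \<in> W" "\<phi> P = z" using gW[OF zW] by (auto simp: P_def)
    have eT: "e i q \<in> tangent_space A q" if "q \<in> W" for i q
      using vector_field_tangent[OF e] W(4) that by blast
    have es: "e i P s = (\<Sum>j\<in>UNIV. e i P (\<lambda>q. \<phi> q $ j) * (- 2 * ((z - y) $ j)))" for i
    proof -
      have "frechet_derivative S (at z) = (\<lambda>v. - 2 * ((z - y) \<bullet> v) - 2 * ((z - z) \<bullet> v))"
        by (rule frechet_derivative_at[OF dS, symmetric])
      then show ?thesis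
        unfolding s_def using tv_chart[OF eT[OF P(1)] V(1) _ open_UNIV _ CS] P W(3)
        by (auto simp: inner_axis)
    qed
    define a0 where "a0 = (\<Sum>i\<in>UNIV. (e i P s)\<^sup>2)"
    have "a0 > 0"
    proof (rule ccontr)
      assume "\<not> a0 > 0"
      then have "a0 = 0" unfolding a0_def by (simp add: sum_nonneg order.antisym not_less)
      then have z0: "e i P s = 0" for i unfolding a0_def by (simp add: sum_nonneg_eq_0_iff)
      define M :: "real^7^7" where "M = (\<chi> i j. e i P (\<lambda>q. \<phi> q $ j))"
      have "M *v (z - y) = 0"
      proof -
        have "(M *v (z - y)) $ i = 0" for i
        proof -
          have "0 = (\<Sum>j\<in>UNIV. e i P (\<lambda>q. \<phi> q $ j) * (- 2 * ((z - y) $ j)))"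
            using es[of i] z0[of i] by simp
          also have "\<dots> = - 2 * (\<Sum>j\<in>UNIV. e i P (\<lambda>q. \<phi> q $ j) * ((z - y) $ j))"
            by (simp only: mult.left_commute[of _ "- 2"] sum_distrib_left[symmetric])
          finally show ?thesis by (simp add: M_def matrix_vector_mult_def)
        qed
        then show ?thesis by (simp add: vec_eq_iff)
      qed
      moreover have "invertible M" using nd[of P] P W by (simp add: M_def invertible_det_nz W_def)
      ultimately have "z - y = 0"
        by (metis invertible_def matrix_vector_mul_assoc matrix_vector_mul_lid matrix_vector_mult_0_right)
      then show False using zy by simp
    qed
    \<comment> \<open>At \<open>z\<close> the operator maps \<open>S + C S\<^sup>2\<close> to its value on \<open>S\<close> plus \<open>2 C a0\<close>, which is positive for this
      \<open>C\<close>.\<close>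
    define C where "C = (1 + \<bar>frame_laplacian e b s P\<bar>) / a0"
    have C: "C > 0" using \<open>a0 > 0\<close> by (simp add: C_def add_pos_nonneg)
    define w where "w q = s q + C * (s q * s q)" for q
    have sw: "smooth_map A W w" unfolding w_def by (intro smooth_map_add smooth_map_cmult smooth_map_mult W(1) ss)
    have Lw: "frame_laplacian e b w P > 0"
    proof -
      have s2: "smooth_map A W (\<lambda>t. s t * s t)" by (intro smooth_map_mult W(1) ss)
      have "s P = 0" using Sz P by (simp add: s_def)
      then have "frame_laplacian e b w P = frame_laplacian e b s P + C * (2 * a0)"
        unfolding w_def using frame_laplacian_comb[OF W(1,4) P(1) e ss s2]
          frame_laplacian_square[OF W(1,4) P(1) e ss] by (simp add: a0_def)
      moreover have "C * a0 = 1 + \<bar>frame_laplacian e b s P\<bar>" using \<open>a0 > 0\<close> by (simp add: C_def)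
      ultimately show ?thesis by simp
    qed
    define G where "G = {x \<in> \<phi> ` W. frame_laplacian e b w (g x) > 0 \<and> 1 + C * S x > 0}"
    have "continuous_on (\<phi> ` W) (\<lambda>x. frame_laplacian e b w (g x))"
      by (rule continuous_on_compose2[OF smooth_map_continuous[OF W(1) frame_laplacian_smooth[OF W(1,4) e b sw]] continuous_on_subset[OF cg]])
         (use gW W in auto)
    moreover have "continuous_on (\<phi> ` W) (\<lambda>x. 1 + C * S x)"
      unfolding S_def by (intro continuous_intros)
    ultimately have "open G"
    proof -
      assume c: "continuous_on (\<phi> ` W) (\<lambda>x. frame_laplacian e b w (g x))" "continuous_on (\<phi> ` W) (\<lambda>x. 1 + C * S x)"
      have "G = (\<phi> ` W \<inter> (\<lambda>x. frame_laplacian e b w (g x)) -` {0<..}) \<inter> (\<phi> ` W \<inter> (\<lambda>x. 1 + C * S x) -` {0<..})"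
        by (auto simp: G_def)
      then show "open G"
        using continuous_open_preimage[OF c(1) oW open_greaterThan[of 0]]
          continuous_open_preimage[OF c(2) oW open_greaterThan[of 0]] by (simp add: open_Int)
    qed
    moreover have "z \<in> G" using zW Lw C Sz by (simp add: G_def P_def)
    ultimately obtain \<delta> where d: "\<delta> > 0" "cball z \<delta> \<subseteq> G" by (metis open_contains_cball)
    define wr where "wr x = S x + C * (S x * S x)" for x
    have wr: "w (g x) = wr x" if "x \<in> \<phi> ` W" for x using gW[OF that] by (simp add: w_def wr_def s_def)
    have dW: "cball z \<delta> \<subseteq> \<phi> ` W" using d(2) by (auto simp: G_def)
    have cwr: "continuous_on X wr" for X unfolding wr_def S_def by (intro continuous_intros)
    define K1 where "K1 = {x \<in> sphere z \<delta>. S x \<ge> 0}"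
    have cK1: "compact K1"
    proof -
      have "continuous_on UNIV S" by (rule Cinf_on_continuous[OF CS])
      then have "closed {x. S x \<ge> 0}" by (intro closed_Collect_le continuous_on_const)
      then have "compact (sphere z \<delta> \<inter> {x. S x \<ge> 0})" by (intro compact_Int_closed compact_sphere)
      moreover have "sphere z \<delta> \<inter> {x. S x \<ge> 0} = K1" by (auto simp: K1_def)
      ultimately show ?thesis by simp
    qed
    have K1W: "K1 \<subseteq> \<phi> ` W" using dW sphere_cball by (auto simp: K1_def)
    obtain \<epsilon> where eps: "\<epsilon> > 0" "\<And>x. x \<in> K1 \<Longrightarrow> f x + \<epsilon> * wr x < m"
    proof (cases "K1 = {}")
      case True then show ?thesis using that[of 1] by simp
    next
      case False
      obtain x1 where x1: "x1 \<in> K1" "\<And>x. x \<in> K1 \<Longrightarrow> f x \<le> f x1"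
        using continuous_attains_sup[OF cK1 False continuous_on_subset[OF cf K1W]] by blast
      obtain x2 where x2: "x2 \<in> K1" "\<And>x. x \<in> K1 \<Longrightarrow> wr x \<le> wr x2"
        using continuous_attains_sup[OF cK1 False cwr] by blast
      have "x1 \<noteq> z" using x1(1) d(1) by (auto simp: K1_def)
      then have lt: "f x1 < m" using Spos x1(1) by (auto simp: K1_def)
      define \<epsilon> where "\<epsilon> = (m - f x1) / (1 + \<bar>wr x2\<bar>)"
      have e0: "\<epsilon> > 0" using lt by (simp add: \<epsilon>_def add_pos_nonneg)
      have "f x + \<epsilon> * wr x < m" if "x \<in> K1" for x
      proof -
        have "\<epsilon> * wr x \<le> \<epsilon> * \<bar>wr x2\<bar>" using x2(2)[OF that] e0 by (intro mult_left_mono) auto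
        also have "\<dots> < \<epsilon> * (1 + \<bar>wr x2\<bar>)" using e0 by simp
        also have "\<dots> = m - f x1" by (simp add: \<epsilon>_def)
        finally show ?thesis using x1(2)[OF that] by simp
      qed
      then show ?thesis using that e0 by blast
    qed
    have sph: "f x + \<epsilon> * wr x < m" if "x \<in> sphere z \<delta>" for x
    proof (cases "S x \<ge> 0")
      case True then show ?thesis using eps(2) that by (simp add: K1_def)
    next
      case False
      have "x \<in> G" using d(2) that sphere_cball by blast
      then have "1 + C * S x > 0" "x \<in> \<phi> ` W" by (auto simp: G_def)
      then have "S x * (1 + C * S x) < 0" using False by (simp add: mult_neg_pos)
      then have "wr x < 0" by (simp add: wr_def algebra_simps)
      then show ?thesis using fm[OF \<open>x \<in> \<phi> ` W\<close>] mult_pos_neg[OF eps(1)] by fastforce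
    qed
    have "continuous_on (cball z \<delta>) (\<lambda>x. f x + \<epsilon> * wr x)"
      by (intro continuous_intros continuous_on_subset[OF cf dW] cwr)
    then obtain x0 where x0: "x0 \<in> cball z \<delta>" "\<And>x. x \<in> cball z \<delta> \<Longrightarrow> f x + \<epsilon> * wr x \<le> f x0 + \<epsilon> * wr x0"
      using continuous_attains_sup[of "cball z \<delta>" "\<lambda>x. f x + \<epsilon> * wr x"] d(1) by auto
    have "f z + \<epsilon> * wr z = m" by (simp add: fz wr_def Sz)
    then have "m \<le> f x0 + \<epsilon> * wr x0" using x0(2)[of z] d(1) by simp
    then have "x0 \<notin> sphere z \<delta>" using sph by fastforce
    then have x0b: "x0 \<in> ball z \<delta>" using x0(1) by simp
    define U' where "U' = {q \<in> W. \<phi> q \<in> ball z \<delta>}"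
    have U': "open U'" "U' \<subseteq> W"
    proof -
      have "U' = W \<inter> {q \<in> V. \<phi> q \<in> ball z \<delta>}" using W(3) by (auto simp: U'_def)
      then show "open U'" using open_Int[OF W(1) open_chart_vimage[OF V(1) open_ball[of z \<delta>]]] by simp
    qed (auto simp: U'_def)
    define q0 where "q0 = g x0"
    have q0: "q0 \<in> W" "\<phi> q0 = x0" using gW dW x0(1) by (auto simp: q0_def)
    have q0U: "q0 \<in> U'" using q0 x0b by (simp add: U'_def)
    define h where "h q = u q + \<epsilon> * w q" for q
    have su: "smooth_map A W u" using smooth_map_subset[OF u W(4)] .
    have sh: "smooth_map A U' h"
      unfolding h_def by (rule smooth_map_subset[OF smooth_map_add[OF W(1) su smooth_map_cmult[OF W(1) sw]] U'(2)])
    have hm: "h q \<le> h q0" if "q \<in> U'" for q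
    proof -
      have q': "q \<in> W" "\<phi> q \<in> cball z \<delta>" using that by (auto simp: U'_def)
      have "h r = f (\<phi> r) + \<epsilon> * wr (\<phi> r)" if "r \<in> W" for r
        using that W(3) g[of r] by (auto simp: h_def f_def w_def wr_def s_def)
      then show ?thesis using x0(2)[OF q'(2)] q'(1) q0 by simp
    qed
    have eU': "vector_field A U' (e i)" for i
      by (rule vector_field_subset[OF e]) (use U'(2) W(4) in blast)
    have "frame_laplacian e b h q0 \<le> 0"
      unfolding frame_laplacian_def
      using tv_max[OF U'(1) q0U eU' sh hm] by (simp add: sum_nonpos)
    moreover have "frame_laplacian e b h q0 = frame_laplacian e b u q0 + \<epsilon> * frame_laplacian e b w q0"
      unfolding h_def by (rule frame_laplacian_comb[OF W(1,4) q0(1) e su sw])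
    moreover have "frame_laplacian e b u q0 \<ge> 0" using L q0 W(4) by blast
    moreover have "frame_laplacian e b w q0 > 0" using d(2) x0(1) by (auto simp: G_def q0_def)
    ultimately show False using eps(1) mult_pos_pos[of \<epsilon> "frame_laplacian e b w q0"] by linarith
  qed
  then show ?thesis using oN by blast
qed

text \<open>The set where the maximum is attained is closed, and open by \<open>strong_max_local\<close>.\<close>

lemma strong_max_principle:
  fixes u :: "'m \<Rightarrow> real"
  assumes comp: "compact (UNIV :: 'm set)" and conn: "connected (UNIV :: 'm set)"
    and loc: "\<And>p. \<exists>U e b. open U \<and> p \<in> U \<and> smooth_map A U u \<and> (\<forall>i. vector_field A U (e i)) \<and>
       (\<forall>k. smooth_map A U (b k)) \<and> (\<forall>q\<in>U. frame_laplacian e b u q \<ge> 0) \<and>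
       (\<forall>(V, \<phi>)\<in>A. \<forall>q\<in>U \<inter> V. det (\<chi> i j. e i q (\<lambda>r. \<phi> r $ j)) \<noteq> 0)"
  shows "\<exists>c. \<forall>p. u p = c"
proof -
  have cont: "continuous_on UNIV u"
  proof (rule continuous_at_imp_continuous_on, rule ballI)
    fix p
    obtain U where U: "open U" "p \<in> U" "smooth_map A U u"
      using loc[of p] by (elim exE conjE) (rule that)
    have "continuous_on U u" by (rule smooth_map_continuous[OF U(1,3)])
    then show "isCont u p" using continuous_on_eq_continuous_at[OF U(1)] U(2) by blast
  qed
  obtain p0 where p0: "\<And>q. u q \<le> u p0"
    using continuous_attains_sup[OF comp _ cont] by auto
  have "open {p. u p = u p0}"
  proof (subst open_subopen, rule ballI)
    fix p assume "p \<in> {p. u p = u p0}"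
    then have p: "u p = u p0" by simp
    obtain U e b where U: "open U" "p \<in> U" "smooth_map A U u" "\<And>i. vector_field A U (e i)"
       "\<And>k. smooth_map A U (b k)" "\<And>q. q \<in> U \<Longrightarrow> frame_laplacian e b u q \<ge> 0"
       and nd: "\<forall>(V, \<phi>)\<in>A. \<forall>q\<in>U \<inter> V. det (\<chi> i j. e i q (\<lambda>r. \<phi> r $ j)) \<noteq> 0"
      using loc[of p] by blast
    obtain V \<phi> where V: "(V, \<phi>) \<in> A" "p \<in> V" by (rule chart_exists)
    have "\<exists>N. open N \<and> p \<in> N \<and> (\<forall>q\<in>N. u q = u p)"
      by (rule strong_max_local[OF U V]) (use nd V p0 p in auto)
    then show "\<exists>T. open T \<and> p \<in> T \<and> T \<subseteq> {p. u p = u p0}" using p by auto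
  qed
  moreover have "closed {p. u p = u p0}"
    using continuous_closed_preimage_constant[OF cont closed_UNIV] by simp
  ultimately have "openin (top_of_set UNIV) {p. u p = u p0}" "closedin (top_of_set UNIV) {p. u p = u p0}"
    by simp_all
  with conn have "{p. u p = u p0} = {} \<or> {p. u p = u p0} = UNIV"
    unfolding connected_clopen by (metis (no_types))
  then show ?thesis by blast
qed

end

section \<open>Calculus in an adapted frame\<close>

lemma lin_axes_zero:
  fixes f :: "real^'n \<Rightarrow> real"
  assumes "linear f" "\<And>j. f (axis j 1) = 0"
  shows "f x = 0"
proof -
  have "f x = (\<Sum>b\<in>Basis. (x \<bullet> b) *\<^sub>R f b)" by (rule linear_basis_expansion[OF assms(1)])
  also have "\<dots> = 0" by (simp only: sum_Basis_axis assms(2)) simp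
  finally show ?thesis .
qed

definition endo :: "(7 \<Rightarrow> 7 \<Rightarrow> real) \<Rightarrow> real^7 \<Rightarrow> real^7" where
  "endo P x = (\<chi> m. \<Sum>j\<in>UNIV. x $ j * P j m)"

lemma linear_endo: "linear (endo P)"
  by (rule linearI) (simp_all add: endo_def vec_eq_iff distrib_right sum.distrib sum_distrib_left mult.assoc)

lemma endo_axis: "endo P (axis j 1) = (\<chi> m. P j m)"
  by (simp add: endo_def vec_eq_iff axis_def if_distrib[of "\<lambda>r. r * _"] cong: if_cong)

lemma cross7_sum1: "cross7 (\<chi> m. f m) (axis k 1) \<bullet> axis l 1 = (\<Sum>m\<in>UNIV. f m * w m k l)"
proof -
  have "(\<chi> m. f m) = (\<Sum>m\<in>UNIV. f m *\<^sub>R axis m 1)"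
    using axis_expansion[of "\<chi> m. f m"] by simp
  then show ?thesis by (simp add: cross7_sum cross7_linear inner_sum_left cross7_axis_nth inner_axis)
qed

lemma w_action_axes:
  "w_action P j k l = cross7 (endo P (axis j 1)) (axis k 1) \<bullet> axis l 1
     + cross7 (axis j 1) (endo P (axis k 1)) \<bullet> axis l 1 + cross7 (axis j 1) (axis k 1) \<bullet> endo P (axis l 1)"
proof -
  have 2: "cross7 (axis j 1) (\<chi> m. P k m) \<bullet> axis l 1 = (\<Sum>m\<in>UNIV. P k m * w j m l)"
    using cross7_sum1[of "P k" j l] cross7_commute[of "axis j 1" "\<chi> m. P k m"]
    by (simp add: w_skew(1)[of _ j] sum_negf)
  have 3: "cross7 (axis j 1) (axis k 1) \<bullet> (\<chi> m. P l m) = (\<Sum>m\<in>UNIV. P l m * w j k m)"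
    by (simp add: inner_vec_def cross7_axis_nth mult.commute)
  show ?thesis unfolding endo_axis cross7_sum1 2 3 by (simp add: w_action_def sum.distrib)
qed

text \<open>The action in terms of the trilinear form of the cross product; in this form the commutator is
  computed by evaluating at images of vectors.\<close>

lemma w_action_derivation:
  assumes "\<And>j k l. w_action P j k l = 0"
  shows "cross7 (endo P x) y \<bullet> z + cross7 x (endo P y) \<bullet> z + cross7 x y \<bullet> endo P z = 0"
proof -
  note L = linear_add[OF linear_endo] linear_scale[OF linear_endo] cross7_linear inner_add_left inner_add_right
  have 0: "cross7 (endo P (axis j 1)) (axis k 1) \<bullet> axis l 1
     + cross7 (axis j 1) (endo P (axis k 1)) \<bullet> axis l 1 + cross7 (axis j 1) (axis k 1) \<bullet> endo P (axis l 1) = 0" for j k l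
    using assms[of j k l] by (simp only: w_action_axes)
  have 1: "cross7 (endo P x) (axis k 1) \<bullet> axis l 1
     + cross7 x (endo P (axis k 1)) \<bullet> axis l 1 + cross7 x (axis k 1) \<bullet> endo P (axis l 1) = 0" for x k l
    by (rule lin_axes_zero[of "\<lambda>x. cross7 (endo P x) (axis k 1) \<bullet> axis l 1
     + cross7 x (endo P (axis k 1)) \<bullet> axis l 1 + cross7 x (axis k 1) \<bullet> endo P (axis l 1)", OF _ 0])
      (rule linearI; simp add: L algebra_simps)
  have 2: "cross7 (endo P x) y \<bullet> axis l 1
     + cross7 x (endo P y) \<bullet> axis l 1 + cross7 x y \<bullet> endo P (axis l 1) = 0" for x y l
    by (rule lin_axes_zero[of "\<lambda>y. cross7 (endo P x) y \<bullet> axis l 1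
     + cross7 x (endo P y) \<bullet> axis l 1 + cross7 x y \<bullet> endo P (axis l 1)", OF _ 1])
      (rule linearI; simp add: L algebra_simps)
  show ?thesis
    by (rule lin_axes_zero[of "\<lambda>z. cross7 (endo P x) y \<bullet> z
     + cross7 x (endo P y) \<bullet> z + cross7 x y \<bullet> endo P z", OF _ 2])
      (rule linearI; simp add: L algebra_simps)
qed

text \<open>The stabiliser is a Lie algebra. Used for the quadratic terms of the curvature.\<close>

lemma w_action_commutator:
  assumes P: "\<And>j k l. w_action P j k l = 0" and Q: "\<And>j k l. w_action Q j k l = 0"
  shows "w_action (\<lambda>a b. \<Sum>m\<in>UNIV. P a m * Q m b - Q a m * P m b) j k l = 0"
proof -
  have e: "endo (\<lambda>a b. \<Sum>m\<in>UNIV. P a m * Q m b - Q a m * P m b) (axis j 1)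
     = endo Q (endo P (axis j 1)) - endo P (endo Q (axis j 1))" for j
    by (simp add: endo_axis) (simp add: endo_def vec_eq_iff sum_subtractf)
  show ?thesis
    unfolding w_action_axes e
    using w_action_derivation[OF P, of "endo Q (axis j 1)" "axis k 1" "axis l 1"]
      w_action_derivation[OF P, of "axis j 1" "endo Q (axis k 1)" "axis l 1"]
      w_action_derivation[OF P, of "axis j 1" "axis k 1" "endo Q (axis l 1)"]
      w_action_derivation[OF Q, of "endo P (axis j 1)" "axis k 1" "axis l 1"]
      w_action_derivation[OF Q, of "axis j 1" "endo P (axis k 1)" "axis l 1"]
      w_action_derivation[OF Q, of "axis j 1" "axis k 1" "endo P (axis l 1)"]
    by (simp add: cross7_linear inner_diff_left inner_diff_right)
qed

lemma w_action_linear: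
  "w_action (\<lambda>a b. P a b + Q a b) j k l = w_action P j k l + w_action Q j k l"
  "w_action (\<lambda>a b. P a b - Q a b) j k l = w_action P j k l - w_action Q j k l"
  "w_action (\<lambda>a b. r * P a b) j k l = r * w_action P j k l"
  by (simp_all add: w_action_def sum.distrib sum_subtractf sum_distrib_left algebra_simps)

lemma w_action_sum: "w_action (\<lambda>a b. \<Sum>m\<in>I. P m a b) j k l = (\<Sum>m\<in>I. w_action (P m) j k l)"
  by (induction I rule: infinite_finite_induct) (simp_all add: w_action_linear, simp_all add: w_action_def)

text \<open>The covariant derivative of \<open>X\<close> along \<open>e\<^sub>i\<close>, component \<open>j\<close>, where \<open>N i k j\<close> is the component
  \<open>j\<close> of the derivative of \<open>e\<^sub>k\<close> along \<open>e\<^sub>i\<close>.\<close>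

definition cov_deriv :: "(7 \<Rightarrow> 'm \<Rightarrow> 'm tvec) \<Rightarrow> (7 \<Rightarrow> 7 \<Rightarrow> 7 \<Rightarrow> 'm \<Rightarrow> real) \<Rightarrow> (7 \<Rightarrow> 'm \<Rightarrow> real) \<Rightarrow> 7 \<Rightarrow> 7 \<Rightarrow> 'm \<Rightarrow> real" where
  B_def: "cov_deriv e N X i j q = e i q (X j) + (\<Sum>k\<in>UNIV. N i k j q * X k q)"

definition frame_curl :: "(7 \<Rightarrow> 'm \<Rightarrow> 'm tvec) \<Rightarrow> (7 \<Rightarrow> 7 \<Rightarrow> 7 \<Rightarrow> 'm \<Rightarrow> real) \<Rightarrow> (7 \<Rightarrow> 'm \<Rightarrow> real) \<Rightarrow> 7 \<Rightarrow> 'm \<Rightarrow> real" where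
  curl_def: "frame_curl e N X m q = (\<Sum>a\<in>UNIV. \<Sum>b\<in>UNIV. w a b m * cov_deriv e N X a b q)"

definition frame_div :: "(7 \<Rightarrow> 'm \<Rightarrow> 'm tvec) \<Rightarrow> (7 \<Rightarrow> 7 \<Rightarrow> 7 \<Rightarrow> 'm \<Rightarrow> real) \<Rightarrow> (7 \<Rightarrow> 'm \<Rightarrow> real) \<Rightarrow> 'm \<Rightarrow> real" where
  dvg_def: "frame_div e N X q = (\<Sum>a\<in>UNIV. cov_deriv e N X a a q)"

text \<open>With these first-order coefficients, \<open>frame_laplacian\<close> is the trace of the Hessian: the derivative of
  \<open>e\<^sub>k\<close> along itself has components \<open>N k k l = - N k l k\<close>.\<close>

definition trace_coeff :: "(7 \<Rightarrow> 7 \<Rightarrow> 7 \<Rightarrow> 'm \<Rightarrow> real) \<Rightarrow> 7 \<Rightarrow> 'm \<Rightarrow> real" where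
  lap_coeff_def: "trace_coeff N l q = (\<Sum>k\<in>UNIV. N k l k q)"

context
  fixes A :: "'m::t2_space chart set" and U :: "'m set" and e :: "7 \<Rightarrow> 'm \<Rightarrow> 'm tvec"
    and c N :: "7 \<Rightarrow> 7 \<Rightarrow> 7 \<Rightarrow> 'm \<Rightarrow> real" and t :: real
  assumes atlas: "oriented_atlas A" and U: "open U" and e: "\<And>i. vector_field A U (e i)"
    and cs: "\<And>i j k. smooth_map A U (c i j k)" and Ns: "\<And>i j k. smooth_map A U (N i j k)"
    and bracket: "\<And>i j f q. smooth_map A U f \<Longrightarrow> q \<in> U \<Longrightarrow>
       e i q (\<lambda>r. e j r f) - e j q (\<lambda>r. e i r f) = (\<Sum>k\<in>UNIV. c i j k q * e k q f)"
    and nd: "\<And>a q k. q \<in> U \<Longrightarrow> (\<And>f. smooth_map A U f \<Longrightarrow> (\<Sum>k\<in>UNIV. a k * e k q f) = 0) \<Longrightarrow> a k = (0::real)"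
    and g2: "\<And>i q j k l. q \<in> U \<Longrightarrow> w_action (\<lambda>a b. N i a b q) j k l = 0"
    and tors: "\<And>i j k q. q \<in> U \<Longrightarrow> N i j k q - N j i k q - c i j k q = t * w i j k"
begin

lemma E_smooth: "smooth_map A U f \<Longrightarrow> smooth_map A U (\<lambda>q. e i q f)"
  using vector_field_smooth[OF atlas e U order.refl] .

lemma E_tan: "q \<in> U \<Longrightarrow> e i q \<in> tangent_space A q"
  using vector_field_tangent[OF atlas e] .

lemma E_near: "q \<in> U \<Longrightarrow> smooth_map A U f \<Longrightarrow> smooth_near A q f"
  using smooth_nearI[OF atlas U] .

lemma E_add: "q \<in> U \<Longrightarrow> smooth_map A U f \<Longrightarrow> smooth_map A U h \<Longrightarrow> e i q (\<lambda>r. f r + h r) = e i q f + e i q h"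
  using tv_add[OF atlas E_tan E_near E_near] .

lemma E_mult: "q \<in> U \<Longrightarrow> smooth_map A U f \<Longrightarrow> smooth_map A U h \<Longrightarrow> e i q (\<lambda>r. f r * h r) = f q * e i q h + h q * e i q f"
  using tv_mult[OF atlas E_tan E_near E_near] .

lemma E_cmult: "q \<in> U \<Longrightarrow> smooth_map A U f \<Longrightarrow> e i q (\<lambda>r. a * f r) = a * e i q f"
  using tv_cmult[OF atlas E_tan E_near] .

lemma E_const: "q \<in> U \<Longrightarrow> e i q (\<lambda>r. a) = 0"
  using tv_const[OF atlas E_tan] .

lemma E_diff: "q \<in> U \<Longrightarrow> smooth_map A U f \<Longrightarrow> smooth_map A U h \<Longrightarrow> e i q (\<lambda>r. f r - h r) = e i q f - e i q h"
  using E_add[of q f "\<lambda>r. - 1 * h r" i] E_cmult[of q h i "-1"] smooth_map_cmult[OF atlas U, of h "-1"] by simp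

lemma E_sum: "q \<in> U \<Longrightarrow> (\<And>m. m \<in> I \<Longrightarrow> smooth_map A U (f m)) \<Longrightarrow> e i q (\<lambda>r. \<Sum>m\<in>I. f m r) = (\<Sum>m\<in>I. e i q (f m))"
  using tv_sum[OF atlas E_tan E_near] .

lemma E_cong: "q \<in> U \<Longrightarrow> smooth_map A U f \<Longrightarrow> (\<And>r. r \<in> U \<Longrightarrow> f r = h r) \<Longrightarrow> e i q f = e i q h"
  using tv_local[OF atlas E_tan U] .

lemmas sm = smooth_map_add[OF atlas U] smooth_map_mult[OF atlas U] smooth_map_cmult[OF atlas U]
  smooth_map_sum[OF atlas U] smooth_map_diff[OF atlas U] smooth_map_const[OF atlas U] E_smooth cs Ns

text \<open>The component along \<open>e\<^sub>k\<close> of the curvature of \<open>e\<^sub>i\<close>, \<open>e\<^sub>j\<close> applied to \<open>e\<^sub>l\<close>; the functions \<open>c\<close> are the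
  structure functions of the frame.\<close>

definition Riem :: "7 \<Rightarrow> 7 \<Rightarrow> 7 \<Rightarrow> 7 \<Rightarrow> 'm \<Rightarrow> real" where
  "Riem i j l k q = e i q (N j l k) - e j q (N i l k)
     + (\<Sum>m\<in>UNIV. N j l m q * N i m k q - N i l m q * N j m k q) - (\<Sum>m\<in>UNIV. c i j m q * N m l k q)"

lemma N_skew: "q \<in> U \<Longrightarrow> N i k j q = - N i j k q"
  using w_action_zero(1)[of "\<lambda>a b. N i a b q" k j] g2 by simp

lemma c_eq: "q \<in> U \<Longrightarrow> c i j k q = N i j k q - N j i k q - t * w i j k"
  using tors[of q i j k] by simp

lemma E_g2:
  assumes q: "q \<in> U"
  shows "w_action (\<lambda>a b. e i q (N j a b)) j' k' l' = 0"
proof -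
  have "0 = e i q (\<lambda>r. \<Sum>m\<in>UNIV. (w m k' l' * N j j' m r + w j' m l' * N j k' m r) + w j' k' m * N j l' m r)"
  proof -
    have "e i q (\<lambda>r. \<Sum>m\<in>UNIV. (w m k' l' * N j j' m r + w j' m l' * N j k' m r) + w j' k' m * N j l' m r) = e i q (\<lambda>r. 0)"
      by (rule E_cong[OF q]) (use g2 in \<open>auto intro!: sm simp: w_action_def mult.commute\<close>)
    then show ?thesis using E_const[OF q] by simp
  qed
  also have "\<dots> = (\<Sum>m\<in>UNIV. (w m k' l' * e i q (N j j' m) + w j' m l' * e i q (N j k' m)) + w j' k' m * e i q (N j l' m))"
    by (subst E_sum[OF q]) (auto intro!: sm simp: E_add[OF q] E_cmult[OF q] sm)
  finally show ?thesis by (simp add: w_action_def mult.commute)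
qed

text \<open>Derivatives of the connection coefficients stay in the linear subspace of endomorphisms annihilating the
  three-form, and their commutators stay in it as well.\<close>

lemma R_g2: "q \<in> U \<Longrightarrow> w_action (\<lambda>a b. Riem i j a b q) j' k' l' = 0"
  unfolding Riem_def
  using w_action_commutator[OF g2 g2, of q q j i j' k' l']
  by (simp add: w_action_linear w_action_sum E_g2 g2)

lemma R_skew12: "q \<in> U \<Longrightarrow> Riem j i l k q = - Riem i j l k q"
  unfolding Riem_def by (simp add: c_eq w_skew(1)[of j i] sum_subtractf sum.distrib sum_negf algebra_simps)

text \<open>The Jacobi identity of derivations, with both sides expanded in the frame and coefficients compared.\<close>

lemma Jacobi:
  assumes q: "q \<in> U"
  shows "(e i q (c j k l) + (\<Sum>m\<in>UNIV. c j k m q * c i m l q)) + (e j q (c k i l) + (\<Sum>m\<in>UNIV. c k i m q * c j m l q))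
     + (e k q (c i j l) + (\<Sum>m\<in>UNIV. c i j m q * c k m l q)) = 0"
proof -
  define J where "J i j k l = e i q (c j k l) + (\<Sum>m\<in>UNIV. c j k m q * c i m l q)" for i j k l
  define T where "T f i j k = e i q (\<lambda>r. e j r (\<lambda>r. e k r f))" for f i j k
  have J: "(\<Sum>l\<in>UNIV. J i j k l * e l q f) = T f i j k - T f i k j - T f j k i + T f k j i"
    if f: "smooth_map A U f" for f i j k
  proof -
    have "T f i j k - T f i k j = e i q (\<lambda>r. e j r (\<lambda>r. e k r f) - e k r (\<lambda>r. e j r f))"
      unfolding T_def by (rule E_diff[OF q, symmetric]) (intro sm f)+
    also have "\<dots> = e i q (\<lambda>r. \<Sum>m\<in>UNIV. c j k m r * e m r f)"
      by (rule E_cong[OF q]) (auto intro!: sm f simp: bracket[OF f])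
    also have "\<dots> = (\<Sum>m\<in>UNIV. e i q (\<lambda>r. c j k m r * e m r f))"
      by (rule E_sum[OF q]) (intro sm f)
    also have "\<dots> = (\<Sum>m\<in>UNIV. c j k m q * e i q (\<lambda>r. e m r f) + e m q f * e i q (c j k m))"
      by (rule sum.cong[OF refl], rule E_mult[OF q]) (intro sm f)+
    finally have 1: "T f i j k - T f i k j = (\<Sum>m\<in>UNIV. c j k m q * e i q (\<lambda>r. e m r f) + e m q f * e i q (c j k m))" .
    have 2: "T f j k i - T f k j i = (\<Sum>m\<in>UNIV. c j k m q * e m q (\<lambda>r. e i r f))"
      unfolding T_def by (rule bracket[OF E_smooth[OF f] q])
    have "(\<Sum>m\<in>UNIV. c j k m q * (e i q (\<lambda>r. e m r f) - e m q (\<lambda>r. e i r f)))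
        = (\<Sum>m\<in>UNIV. \<Sum>l\<in>UNIV. c j k m q * c i m l q * e l q f)"
      by (simp add: bracket[OF f q] sum_distrib_left mult.assoc)
    also have "\<dots> = (\<Sum>l\<in>UNIV. (\<Sum>m\<in>UNIV. c j k m q * c i m l q) * e l q f)"
      by (subst sum.swap) (simp add: sum_distrib_right)
    finally have 3: "(\<Sum>m\<in>UNIV. c j k m q * (e i q (\<lambda>r. e m r f) - e m q (\<lambda>r. e i r f)))
        = (\<Sum>l\<in>UNIV. (\<Sum>m\<in>UNIV. c j k m q * c i m l q) * e l q f)" .
    show ?thesis
      using 1 2 3 by (simp add: J_def distrib_right sum.distrib right_diff_distrib sum_subtractf mult.commute[of "e _ q f"])
  qed
  have "J i j k l + J j k i l + J k i j l = 0"
  proof (rule nd[OF q, of "\<lambda>l. J i j k l + J j k i l + J k i j l"])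
    fix f :: "'m \<Rightarrow> real" assume f: "smooth_map A U f"
    show "(\<Sum>l\<in>UNIV. (J i j k l + J j k i l + J k i j l) * e l q f) = 0"
    proof -
      have "(\<Sum>l\<in>UNIV. (J i j k l + J j k i l + J k i j l) * e l q f)
        = (\<Sum>l\<in>UNIV. J i j k l * e l q f) + (\<Sum>l\<in>UNIV. J j k i l * e l q f) + (\<Sum>l\<in>UNIV. J k i j l * e l q f)"
        by (simp only: distrib_right sum.distrib)
      then show ?thesis unfolding J[OF f] by simp
    qed
  qed
  then show ?thesis by (simp add: J_def)
qed

text \<open>The Jacobi identity with the structure functions replaced by the connection and the torsion. The
  terms linear in \<open>t\<close> are the action of the connection on the three-form and vanish.\<close>

lemma Bianchi:
  assumes q: "q \<in> U"
  shows "Riem i j l k q + Riem j l i k q + Riem l i j k q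
        = t\<^sup>2 * (\<Sum>m\<in>UNIV. w i j m * w m l k + w j l m * w m i k + w l i m * w m j k)"
proof -
  have Ec: "e i q (c j l k) = e i q (N j l k) - e i q (N l j k)" for i j l k
  proof -
    have "e i q (c j l k) = e i q (\<lambda>r. (N j l k r - N l j k r) - t * w j l k)"
      by (rule E_cong[OF q cs]) (simp add: c_eq)
    also have "\<dots> = e i q (N j l k) - e i q (N l j k)"
      by (subst E_diff[OF q]) (auto intro!: sm simp: E_diff[OF q Ns Ns] E_const[OF q])
    finally show ?thesis .
  qed
  define WA where "WA i j l k m = N i j m q * w m l k + N i l m q * w j m k + N i k m q * w j l m" for i j l k m
  have WA: "(\<Sum>m\<in>UNIV. WA i j l k m) = 0" for i j l k
    using g2[OF q, of i j l k] by (simp add: w_action_def WA_def)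
  have per: "- (c j l m q * c i m k q + c l i m q * c j m k q + c i j m q * c l m k q)
     + ((N j l m q * N i m k q - N i l m q * N j m k q) + (N l i m q * N j m k q - N j i m q * N l m k q)
     + (N i j m q * N l m k q - N l j m q * N i m k q)) - (c i j m q * N m l k q + c j l m q * N m i k q + c l i m q * N m j k q)
     = t\<^sup>2 * (w i j m * w m l k + w j l m * w m i k + w l i m * w m j k) - t * (WA i j l k m + WA j l i k m + WA l i j k m)" for m
  proof -
    have s: "w l m k = - w m l k" "w j m k = - w m j k" "w i m k = - w m i k" "w l j m = - w j l m" "w j i m = - w i j m" "w i l m = - w l i m"
      by (rule w_skew(1))+
    show ?thesis
      unfolding WA_def c_eq[OF q] N_skew[OF q, of _ k m] s
      by (simp add: power2_eq_square algebra_simps)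
  qed
  have "Riem i j l k q + Riem j l i k q + Riem l i j k q =
     (e i q (c j l k) + e j q (c l i k) + e l q (c i j k))
     + (\<Sum>m\<in>UNIV. ((N j l m q * N i m k q - N i l m q * N j m k q) + (N l i m q * N j m k q - N j i m q * N l m k q)
     + (N i j m q * N l m k q - N l j m q * N i m k q)) - (c i j m q * N m l k q + c j l m q * N m i k q + c l i m q * N m j k q))"
    unfolding Riem_def Ec by (simp add: sum.distrib sum_subtractf)
  also have "e i q (c j l k) + e j q (c l i k) + e l q (c i j k)
     = (\<Sum>m\<in>UNIV. - (c j l m q * c i m k q + c l i m q * c j m k q + c i j m q * c l m k q))"
    using Jacobi[OF q, of i j l k] by (simp add: sum.distrib sum_negf sum_subtractf)
  finally have "Riem i j l k q + Riem j l i k q + Riem l i j k q = (\<Sum>m\<in>UNIV. t\<^sup>2 * (w i j m * w m l k + w j l m * w m i k + w l i m * w m j k) - t * (WA i j l k m + WA j l i k m + WA l i j k m))"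
    unfolding sum.distrib[symmetric] per[symmetric] by (simp add: algebra_simps)
  also have "\<dots> = t\<^sup>2 * (\<Sum>m\<in>UNIV. w i j m * w m l k + w j l m * w m i k + w l i m * w m j k) - t * ((\<Sum>m\<in>UNIV. WA i j l k m) + (\<Sum>m\<in>UNIV. WA j l i k m) + (\<Sum>m\<in>UNIV. WA l i j k m))"
    by (simp only: sum_subtractf sum_distrib_left[symmetric] sum.distrib)
  finally show ?thesis by (simp add: WA)
qed

context
  fixes X :: "7 \<Rightarrow> 'm \<Rightarrow> real"
  assumes X: "\<And>k. smooth_map A U (X k)"
begin

abbreviation "B \<equiv> cov_deriv e N X"

text \<open>The second covariant derivative of \<open>X\<close>.\<close>

definition H :: "7 \<Rightarrow> 7 \<Rightarrow> 7 \<Rightarrow> 'm \<Rightarrow> real" where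
  "H i a b q = e i q (B a b) + (\<Sum>m\<in>UNIV. N i m a q * B m b q + N i m b q * B a m q)"

lemma B_smooth: "smooth_map A U (B i j)"
  unfolding B_def[abs_def] by (intro sm X)

lemma E_B:
  assumes q: "q \<in> U"
  shows "e i q (B a b) = e i q (\<lambda>r. e a r (X b)) + (\<Sum>k\<in>UNIV. N a k b q * e i q (X k) + X k q * e i q (N a k b))"
proof -
  have "e i q (B a b) = e i q (\<lambda>r. e a r (X b) + (\<Sum>k\<in>UNIV. N a k b r * X k r))" by (simp add: B_def[abs_def])
  also have "\<dots> = e i q (\<lambda>r. e a r (X b)) + (\<Sum>k\<in>UNIV. e i q (\<lambda>r. N a k b r * X k r))"
    by (subst E_add[OF q]) (auto intro!: sm X E_sum[OF q])
  finally show ?thesis by (simp add: E_mult[OF q Ns X])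
qed

text \<open>The Ricci identity for a connection with torsion.\<close>

lemma H_comm:
  assumes q: "q \<in> U"
  shows "H i a b q - H a i b q = (\<Sum>l\<in>UNIV. Riem i a l b q * X l q) - t * (\<Sum>m\<in>UNIV. w i a m * B m b q)"
proof -
  have quad: "(\<Sum>m\<in>UNIV. N i m b q * (\<Sum>k\<in>UNIV. N a k m q * X k q)) = (\<Sum>k\<in>UNIV. (\<Sum>m\<in>UNIV. N a k m q * N i m b q) * X k q)" for i a
    unfolding sum_distrib_left sum_distrib_right by (subst sum.swap) (simp add: mult_ac)
  have cN: "(\<Sum>m\<in>UNIV. c i a m q * (\<Sum>k\<in>UNIV. N m k b q * X k q)) = (\<Sum>k\<in>UNIV. (\<Sum>m\<in>UNIV. c i a m q * N m k b q) * X k q)"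
    unfolding sum_distrib_left sum_distrib_right by (subst sum.swap) (simp add: mult_ac)
  have RX: "(\<Sum>l\<in>UNIV. Riem i a l b q * X l q) = (\<Sum>l\<in>UNIV. X l q * e i q (N a l b)) - (\<Sum>l\<in>UNIV. X l q * e a q (N i l b))
     + (\<Sum>m\<in>UNIV. N i m b q * (\<Sum>k\<in>UNIV. N a k m q * X k q)) - (\<Sum>m\<in>UNIV. N a m b q * (\<Sum>k\<in>UNIV. N i k m q * X k q))
     - (\<Sum>m\<in>UNIV. c i a m q * (\<Sum>k\<in>UNIV. N m k b q * X k q))"
    unfolding quad cN Riem_def by (simp add: sum_subtractf sum.distrib algebra_simps)
  have NB: "(\<Sum>m\<in>UNIV. N i m b q * B a m q) = (\<Sum>m\<in>UNIV. N i m b q * e a q (X m)) + (\<Sum>m\<in>UNIV. N i m b q * (\<Sum>k\<in>UNIV. N a k m q * X k q))" for i a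
    by (simp add: B_def distrib_left sum.distrib)
  have cB: "(\<Sum>m\<in>UNIV. c i a m q * B m b q) = (\<Sum>m\<in>UNIV. c i a m q * e m q (X b)) + (\<Sum>m\<in>UNIV. c i a m q * (\<Sum>k\<in>UNIV. N m k b q * X k q))"
    by (simp add: B_def distrib_left sum.distrib)
  have tB: "(\<Sum>m\<in>UNIV. N i m a q * B m b q) - (\<Sum>m\<in>UNIV. N a m i q * B m b q)
     = - (\<Sum>m\<in>UNIV. c i a m q * B m b q) - t * (\<Sum>m\<in>UNIV. w i a m * B m b q)"
  proof -
    have "N i m a q * B m b q - N a m i q * B m b q = - (c i a m q * B m b q) - t * (w i a m * B m b q)" for m
      unfolding c_eq[OF q, of i a m] N_skew[OF q, of i m a] N_skew[OF q, of a m i] by (simp add: algebra_simps)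
    then show ?thesis unfolding sum_subtractf[symmetric] sum_negf[symmetric] sum_distrib_left by simp
  qed
  have br: "e i q (\<lambda>r. e a r (X b)) - e a q (\<lambda>r. e i r (X b)) = (\<Sum>m\<in>UNIV. c i a m q * e m q (X b))"
    by (rule bracket[OF X q])
  show ?thesis
    unfolding H_def E_B[OF q] sum.distrib using RX NB[of i a] NB[of a i] cB tB br by linarith
qed

abbreviation "curl \<equiv> frame_curl e N X"

abbreviation "dvg \<equiv> frame_div e N X"

lemma div_H:
  assumes q: "q \<in> U"
  shows "(\<Sum>a\<in>UNIV. H i a a q) = e i q dvg"
proof -
  have "(\<Sum>a\<in>UNIV. \<Sum>m\<in>UNIV. N i m a q * B a m q) = (\<Sum>a\<in>UNIV. \<Sum>m\<in>UNIV. - (N i m a q * B m a q))"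
  proof -
    have "(\<Sum>a\<in>UNIV. \<Sum>m\<in>UNIV. N i m a q * B a m q) = (\<Sum>a\<in>UNIV. \<Sum>m\<in>UNIV. N i a m q * B m a q)"
      by (rule sum.swap)
    also have "\<dots> = (\<Sum>a\<in>UNIV. \<Sum>m\<in>UNIV. - (N i m a q * B m a q))"
      by (intro sum.cong refl) (subst N_skew[OF q], simp)
    finally show ?thesis .
  qed
  moreover have "e i q dvg = (\<Sum>a\<in>UNIV. e i q (B a a))"
    unfolding dvg_def[abs_def] by (rule E_sum[OF q B_smooth])
  ultimately show ?thesis by (simp add: H_def sum.distrib sum_negf)
qed

text \<open>Contraction with the three-form commutes with covariant differentiation, as the three-form is parallel.\<close>

lemma curl_H:
  assumes q: "q \<in> U"
  shows "(\<Sum>a\<in>UNIV. \<Sum>b\<in>UNIV. w a b m * H i a b q) = e i q (curl m) + (\<Sum>n\<in>UNIV. N i n m q * curl n q)"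
proof -
  have 1: "e i q (curl m) = (\<Sum>a\<in>UNIV. \<Sum>b\<in>UNIV. w a b m * e i q (B a b))"
    unfolding curl_def[abs_def]
    by (subst E_sum[OF q]) (auto intro!: sm B_smooth sum.cong simp: E_sum[OF q] E_cmult[OF q B_smooth] sm B_smooth)
  have 2: "(\<Sum>a\<in>UNIV. \<Sum>b\<in>UNIV. \<Sum>n\<in>UNIV. w a b m * (N i n a q * B n b q))
     = (\<Sum>n\<in>UNIV. \<Sum>b\<in>UNIV. (\<Sum>a\<in>UNIV. N i n a q * w a b m) * B n b q)"
  proof -
    have "(\<Sum>a\<in>UNIV. \<Sum>b\<in>UNIV. \<Sum>n\<in>UNIV. w a b m * (N i n a q * B n b q)) = (\<Sum>b\<in>UNIV. \<Sum>n\<in>UNIV. \<Sum>a\<in>UNIV. w a b m * (N i n a q * B n b q))"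
      by (rule sum_rot[symmetric])
    also have "\<dots> = (\<Sum>n\<in>UNIV. \<Sum>b\<in>UNIV. \<Sum>a\<in>UNIV. w a b m * (N i n a q * B n b q))" by (rule sum.swap)
    finally show ?thesis by (simp only: sum_distrib_right sum_distrib_left mult_ac)
  qed
  have 3: "(\<Sum>a\<in>UNIV. \<Sum>b\<in>UNIV. \<Sum>n\<in>UNIV. w a b m * (N i n b q * B a n q))
     = (\<Sum>a\<in>UNIV. \<Sum>n\<in>UNIV. (\<Sum>b\<in>UNIV. N i n b q * w a b m) * B a n q)"
    by (rule sum.cong[OF refl], subst sum.swap) (simp only: sum_distrib_right sum_distrib_left mult_ac)
  have 4: "(\<Sum>a\<in>UNIV. N i n a q * w a b m) + (\<Sum>a\<in>UNIV. N i b a q * w n a m) = - (\<Sum>a\<in>UNIV. N i m a q * w n b a)" for n b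
    using g2[OF q, of i n b m] by (simp add: w_action_def sum.distrib)
  have "(\<Sum>a\<in>UNIV. \<Sum>b\<in>UNIV. w a b m * H i a b q) = e i q (curl m)
     + (\<Sum>a\<in>UNIV. \<Sum>b\<in>UNIV. \<Sum>n\<in>UNIV. w a b m * (N i n a q * B n b q))
     + (\<Sum>a\<in>UNIV. \<Sum>b\<in>UNIV. \<Sum>n\<in>UNIV. w a b m * (N i n b q * B a n q))"
    unfolding 1 H_def by (simp add: distrib_left sum.distrib sum_distrib_left)
  also have "\<dots> = e i q (curl m) + (\<Sum>n\<in>UNIV. \<Sum>b\<in>UNIV. ((\<Sum>a\<in>UNIV. N i n a q * w a b m) + (\<Sum>a\<in>UNIV. N i b a q * w n a m)) * B n b q)"
    unfolding 2 3 by (simp add: distrib_right sum.distrib)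
  also have "\<dots> = e i q (curl m) + (\<Sum>n\<in>UNIV. \<Sum>b\<in>UNIV. \<Sum>a\<in>UNIV. N i a m q * (w n b a * B n b q))"
    unfolding 4 by (simp add: sum_distrib_right N_skew[OF q, of i _ m] sum_negf mult.assoc)
  also have "(\<Sum>n\<in>UNIV. \<Sum>b\<in>UNIV. \<Sum>a\<in>UNIV. N i a m q * (w n b a * B n b q)) = (\<Sum>a\<in>UNIV. N i a m q * curl a q)"
    by (subst sum_rot) (simp add: curl_def sum_distrib_left)
  finally show ?thesis .
qed

abbreviation "lap_coeff \<equiv> trace_coeff N"

lemma laplacian_curl:
  assumes q: "q \<in> U" and dv: "\<And>r. r \<in> U \<Longrightarrow> dvg r = 0"
    and f: "smooth_map A U f" and fc: "\<And>k r. r \<in> U \<Longrightarrow> e k r f = - curl k r"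
  shows "frame_laplacian e lap_coeff f q = 0"
proof -
  have "(\<Sum>i\<in>UNIV. \<Sum>a\<in>UNIV. \<Sum>b\<in>UNIV. w i a b * H i a b q) = 0"
    by (rule w_H_zero[where R = "\<lambda>i a l b. Riem i a l b q" and B = "\<lambda>a b. B a b q" and X = "\<lambda>l. X l q" and t = t])
       (rule R_g2[OF q] R_skew12[OF q] Bianchi[OF q] H_comm[OF q] dv[OF q, unfolded dvg_def])+
  also have "(\<Sum>i\<in>UNIV. \<Sum>a\<in>UNIV. \<Sum>b\<in>UNIV. w i a b * H i a b q) = (\<Sum>i\<in>UNIV. e i q (curl i) + (\<Sum>n\<in>UNIV. N i n i q * curl n q))"
    unfolding curl_H[OF q, symmetric] by (intro sum.cong refl arg_cong2[where f = "(*)"] w_cyc w_cyc[symmetric])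
  also have "\<dots> = - frame_laplacian e lap_coeff f q"
  proof -
    have "e i q (curl i) = - e i q (\<lambda>r. e i r f)" for i
    proof -
      have "e i q (\<lambda>r. - 1 * e i r f) = e i q (curl i)"
        by (rule E_cong[OF q]) (intro sm f, simp add: fc)
      then show ?thesis using E_cmult[OF q E_smooth[OF f], of i "-1" i] by simp
    qed
    moreover have "(\<Sum>i\<in>UNIV. \<Sum>n\<in>UNIV. N i n i q * curl n q) = - (\<Sum>k\<in>UNIV. lap_coeff k q * e k q f)"
      by (subst sum.swap) (simp add: fc[OF q] lap_coeff_def sum_distrib_right sum_negf)
    ultimately show ?thesis by (simp add: frame_laplacian_def[OF atlas] sum.distrib sum_negf sum_subtractf)
  qed
  finally show ?thesis by simp
qed

text \<open>The Bochner formula: the Laplacian of \<open>|X|\<^sup>2\<close> is twice \<open>|\<nabla>X|\<^sup>2\<close> plus twice the pairing of \<open>X\<close> with its rough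
  Laplacian, and the latter is \<open>24 t\<^sup>2 X\<close>.\<close>

lemma laplacian_norm:
  assumes q: "q \<in> U" and dv: "\<And>r. r \<in> U \<Longrightarrow> dvg r = 0" and cl: "\<And>k r. r \<in> U \<Longrightarrow> curl k r = 0"
  shows "frame_laplacian e lap_coeff (\<lambda>r. \<Sum>k\<in>UNIV. X k r * X k r) q
     = 2 * (\<Sum>i\<in>UNIV. \<Sum>k\<in>UNIV. B i k q * B i k q) + 48 * t\<^sup>2 * (\<Sum>k\<in>UNIV. X k q * X k q)"
proof -
  have dz: "e i q dvg = 0" for i
    using E_cong[OF q, of dvg "\<lambda>r. 0" i] E_const[OF q] dv by (simp add: dvg_def[abs_def] sm B_smooth)
  have cz: "e i q (curl m) = 0" for i m
    using E_cong[OF q, of "curl m" "\<lambda>r. 0" i] E_const[OF q] cl by (simp add: curl_def[abs_def] sm B_smooth)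
  have rough: "(\<Sum>i\<in>UNIV. H i i k q) = 24 * t\<^sup>2 * X k q" for k
    by (rule rough_laplacian[where R = "\<lambda>i a l b. Riem i a l b q" and B = "\<lambda>a b. B a b q" and X = "\<lambda>l. X l q" and t = t and H = "\<lambda>i a b. H i a b q"])
       (rule R_g2[OF q] R_skew12[OF q] Bianchi[OF q] H_comm[OF q] cl[OF q, unfolded curl_def]
         | simp add: curl_H[OF q] cl[OF q] cz | simp add: div_H[OF q] dz)+
  have skew0: "(\<Sum>k\<in>UNIV. \<Sum>m\<in>UNIV. N i m k r * (Y k * Z m)) + (\<Sum>k\<in>UNIV. \<Sum>m\<in>UNIV. N i m k r * (Z k * Y m)) = 0"
    if r: "r \<in> U" for i r and Y Z :: "7 \<Rightarrow> real"
  proof -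
    have "(\<Sum>k\<in>UNIV. \<Sum>m\<in>UNIV. N i m k r * (Z k * Y m)) = (\<Sum>m\<in>UNIV. \<Sum>k\<in>UNIV. N i m k r * (Z k * Y m))" by (rule sum.swap)
    also have "\<dots> = - (\<Sum>m\<in>UNIV. \<Sum>k\<in>UNIV. N i k m r * (Y m * Z k))"
      unfolding sum_negf[symmetric]
    proof (intro sum.cong refl)
      fix m k show "N i m k r * (Z k * Y m) = - (N i k m r * (Y m * Z k))"
        using N_skew[OF r, of i m k] by simp
    qed
    finally show ?thesis by simp
  qed
  have E1: "e i r (\<lambda>r. \<Sum>k\<in>UNIV. X k r * X k r) = (\<Sum>k\<in>UNIV. 2 * (X k r * B i k r))" if r: "r \<in> U" for i r
  proof -
    have "e i r (\<lambda>r. \<Sum>k\<in>UNIV. X k r * X k r) = (\<Sum>k\<in>UNIV. 2 * (X k r * e i r (X k)))"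
      by (subst E_sum[OF r]) (auto intro!: sm X simp: E_mult[OF r X X])
    also have "\<dots> = (\<Sum>k\<in>UNIV. 2 * (X k r * B i k r)) - 2 * (\<Sum>k\<in>UNIV. \<Sum>m\<in>UNIV. N i m k r * (X k r * X m r))"
      by (simp add: B_def distrib_left sum.distrib sum_distrib_left mult_ac)
    also have "(\<Sum>k\<in>UNIV. \<Sum>m\<in>UNIV. N i m k r * (X k r * X m r)) = 0"
      using skew0[OF r, of i "\<lambda>k. X k r" "\<lambda>k. X k r"] by simp
    finally show ?thesis by simp
  qed
  have E2: "e i q (\<lambda>r. e i r (\<lambda>r. \<Sum>k\<in>UNIV. X k r * X k r)) = (\<Sum>k\<in>UNIV. 2 * (X k q * e i q (B i k) + B i k q * e i q (X k)))" for i
  proof -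
    have "e i q (\<lambda>r. e i r (\<lambda>r. \<Sum>k\<in>UNIV. X k r * X k r)) = e i q (\<lambda>r. \<Sum>k\<in>UNIV. 2 * (X k r * B i k r))"
      by (rule E_cong[OF q]) (auto intro!: sm X simp: E1)
    also have "\<dots> = (\<Sum>k\<in>UNIV. e i q (\<lambda>r. 2 * (X k r * B i k r)))"
      by (rule E_sum[OF q]) (intro sm X B_smooth)
    also have "\<dots> = (\<Sum>k\<in>UNIV. 2 * (X k q * e i q (B i k) + B i k q * e i q (X k)))"
      by (simp add: E_cmult[OF q] sm X B_smooth E_mult[OF q X B_smooth])
    finally show ?thesis .
  qed
  have XH: "(\<Sum>k\<in>UNIV. X k q * e i q (B i k)) = (\<Sum>k\<in>UNIV. X k q * H i i k q)
     - (\<Sum>k\<in>UNIV. \<Sum>m\<in>UNIV. N i m i q * (X k q * B m k q)) - (\<Sum>k\<in>UNIV. \<Sum>m\<in>UNIV. N i m k q * (X k q * B i m q))" for i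
    by (simp add: H_def distrib_left sum.distrib sum_distrib_left mult_ac)
  have BE: "(\<Sum>k\<in>UNIV. B i k q * e i q (X k)) = (\<Sum>k\<in>UNIV. B i k q * B i k q)
     - (\<Sum>k\<in>UNIV. \<Sum>m\<in>UNIV. N i m k q * (B i k q * X m q))" for i
    by (simp add: B_def[of e N X i _ q] distrib_left sum.distrib sum_distrib_left right_diff_distrib mult_ac)
  have one: "e i q (\<lambda>r. e i r (\<lambda>r. \<Sum>k\<in>UNIV. X k r * X k r)) = 2 * (\<Sum>k\<in>UNIV. B i k q * B i k q) + 2 * (\<Sum>k\<in>UNIV. X k q * H i i k q)
     - 2 * (\<Sum>m\<in>UNIV. N i m i q * (\<Sum>k\<in>UNIV. X k q * B m k q))" for i
  proof -
    have "(\<Sum>k\<in>UNIV. \<Sum>m\<in>UNIV. N i m i q * (X k q * B m k q)) = (\<Sum>m\<in>UNIV. N i m i q * (\<Sum>k\<in>UNIV. X k q * B m k q))"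
      by (subst sum.swap) (simp add: sum_distrib_left)
    then show ?thesis
      unfolding E2 using XH[of i] BE[of i] skew0[OF q, of i "\<lambda>k. X k q" "\<lambda>k. B i k q"]
      by (simp add: sum_distrib_left[symmetric] sum.distrib)
  qed
  have lc: "(\<Sum>l\<in>UNIV. lap_coeff l q * e l q (\<lambda>r. \<Sum>k\<in>UNIV. X k r * X k r)) = 2 * (\<Sum>i\<in>UNIV. \<Sum>m\<in>UNIV. N i m i q * (\<Sum>k\<in>UNIV. X k q * B m k q))"
  proof -
    have "(\<Sum>l\<in>UNIV. lap_coeff l q * e l q (\<lambda>r. \<Sum>k\<in>UNIV. X k r * X k r))
       = (\<Sum>l\<in>UNIV. \<Sum>i\<in>UNIV. 2 * (N i l i q * (\<Sum>k\<in>UNIV. X k q * B l k q)))"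
      by (simp add: E1[OF q] lap_coeff_def sum_distrib_right sum_distrib_left[symmetric] mult.left_commute)
    also have "\<dots> = (\<Sum>i\<in>UNIV. \<Sum>l\<in>UNIV. 2 * (N i l i q * (\<Sum>k\<in>UNIV. X k q * B l k q)))" by (rule sum.swap)
    finally show ?thesis by (simp only: sum_distrib_left)
  qed
  have "(\<Sum>i\<in>UNIV. \<Sum>k\<in>UNIV. X k q * H i i k q) = (\<Sum>k\<in>UNIV. X k q * (\<Sum>i\<in>UNIV. H i i k q))"
    by (subst sum.swap) (simp add: sum_distrib_left)
  also have "\<dots> = 24 * t\<^sup>2 * (\<Sum>k\<in>UNIV. X k q * X k q)"
    by (simp add: rough sum_distrib_left mult_ac)
  finally show ?thesis
    unfolding frame_laplacian_def[OF atlas] lc one by (simp add: sum_subtractf sum.distrib sum_distrib_left[symmetric])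
qed

end
end

section \<open>The spin module as scalars plus vectors\<close>

lemma scaleR_matrix_vector: "(c *\<^sub>R M) *v x = c *\<^sub>R (M *v x)" for M :: "'k::real_normed_field^'n^'m"
  by (simp add: matrix_vector_mult_def vec_eq_iff scaleR_sum_right)

lemma matrix_vector_mult_scaleR_right: "M *v (c *\<^sub>R x) = c *\<^sub>R (M *v x)" for M :: "'k::real_normed_field^'n^'m"
  by (simp add: matrix_vector_mult_def vec_eq_iff scaleR_sum_right)

lemma vector_smult_scaleR: "c *s (r *\<^sub>R x) = r *\<^sub>R (c *s x)" for x :: "'k::real_normed_field^'n"
  by (simp add: vec_eq_iff)

context
  fixes gam :: "7 \<Rightarrow> 'k::{real_normed_field,euclidean_space}^8^8"
  assumes spin: "spin_representation gam"
begin

definition gv :: "7 \<Rightarrow> 'k^8 \<Rightarrow> 'k^8" where "gv i x = gam i *v x"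

lemma gv_linear: "gv i (x + y) = gv i x + gv i y" "gv i (- x) = - gv i x" "gv i (c *s x) = c *s gv i x"
  "gv i (r *\<^sub>R x) = r *\<^sub>R gv i x" "gv i (x - y) = gv i x - gv i y" "gv i 0 = 0"
  by (simp_all add: gv_def matrix_vector_right_distrib vec.neg vector_scalar_commute matrix_vector_mult_scaleR_right vec.diff)

lemma gv_sum: "gv i (sum f I) = (\<Sum>j\<in>I. gv i (f j))"
  by (simp add: gv_def vec.sum)

lemma gv_anticomm: "gv i (gv j x) + gv j (gv i x) = (if i = j then - 2 *\<^sub>R x else 0)"
proof -
  have "gv i (gv j x) + gv j (gv i x) = (gam i ** gam j + gam j ** gam i) *v x"
    by (simp add: gv_def matrix_vector_mul_assoc matrix_vector_mult_add_rdistrib)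
  also have "\<dots> = (if i = j then - 2 *\<^sub>R mat 1 else 0) *v x"
    using spin by (simp only: spin_representation_def)
  also have "\<dots> = (if i = j then - 2 *\<^sub>R x else 0)"
    by (cases "i = j") (simp_all only: simp_thms if_True if_False scaleR_matrix_vector matrix_vector_mul_lid matrix_vector_mult_0)
  finally show ?thesis .
qed

lemma gv_sq: "gv i (gv i x) = - x"
proof -
  have "2 *\<^sub>R gv i (gv i x) = 2 *\<^sub>R (- x)" using gv_anticomm[of i i x] by (simp add: scaleR_2)
  then show ?thesis by (simp only: scaleR_cancel_left) simp
qed

lemma gv_swap: "i \<noteq> j \<Longrightarrow> gv i (gv j x) = - gv j (gv i x)"
  using gv_anticomm[of i j x] by (simp add: add_eq_0_iff2)

lemma gv_vol: "gv 1 (gv 2 (gv 3 (gv 4 (gv 5 (gv 6 (gv 7 x)))))) = x"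
  using spin by (simp add: gv_def matrix_vector_mul_assoc matrix_mul_assoc spin_representation_def)

lemmas gv_sort = gv_swap[of 2 1, simplified] gv_swap[of 3 1, simplified] gv_swap[of 3 2, simplified]
  gv_swap[of 4 1, simplified] gv_swap[of 4 2, simplified] gv_swap[of 4 3, simplified]
  gv_swap[of 5 1, simplified] gv_swap[of 5 2, simplified] gv_swap[of 5 3, simplified] gv_swap[of 5 4, simplified]
  gv_swap[of 6 1, simplified] gv_swap[of 6 2, simplified] gv_swap[of 6 3, simplified] gv_swap[of 6 4, simplified] gv_swap[of 6 5, simplified]
  gv_swap[of 7 1, simplified] gv_swap[of 7 2, simplified] gv_swap[of 7 3, simplified] gv_swap[of 7 4, simplified] gv_swap[of 7 5, simplified] gv_swap[of 7 6, simplified]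

lemma gv_eq_0: "gv i x = 0 \<Longrightarrow> x = 0"
  using gv_sq[of i x] by (simp add: gv_linear)

text \<open>The spinors of the invariant line. Three of the terms \<open>e\<^sub>i e\<^sub>j e\<^sub>k\<close> of the three-form act as commuting
  involutions, and the simultaneous eigenspace for these signs is the line fixed by the
  stabiliser.\<close>

definition adapted_vec :: "'k^8 \<Rightarrow> bool" where
  "adapted_vec x \<longleftrightarrow> gv 1 (gv 2 (gv 7 x)) = - x \<and> gv 1 (gv 3 (gv 5 x)) = - x \<and> gv 2 (gv 3 (gv 6 x)) = x"

text \<open>Project any vector to the eigenspaces one after the other; if a projection vanishes, multiplication
  with a vector that anticommutes with the involution moves the eigenspace into place.\<close>

lemma adapted_vec_exists: "\<exists>x. x \<noteq> 0 \<and> adapted_vec x"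
proof -
  define x0 :: "'k^8" where "x0 = axis 1 1"
  have x0: "x0 \<noteq> 0" by (simp add: x0_def axis_eq_0_iff)
  obtain x1 where x1: "x1 \<noteq> 0" "gv 1 (gv 2 (gv 7 x1)) = - x1"
  proof (cases "x0 - gv 1 (gv 2 (gv 7 x0)) = 0")
    case False
    then show ?thesis by (rule that[of "x0 - gv 1 (gv 2 (gv 7 x0))"]) (simp add: gv_linear gv_sort gv_sq)
  next
    case True
    then have t: "gv 1 (gv 2 (gv 7 x0)) = x0" by simp
    have "gv 1 (gv 2 (gv 7 (gv 3 x0))) = - gv 3 (gv 1 (gv 2 (gv 7 x0)))"
      by (simp add: gv_linear gv_sort gv_sq)
    then show ?thesis using that[of "gv 3 x0"] x0 gv_eq_0 t by auto
  qed
  obtain x2 where x2: "x2 \<noteq> 0" "gv 1 (gv 2 (gv 7 x2)) = - x2" "gv 1 (gv 3 (gv 5 x2)) = - x2"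
  proof (cases "x1 - gv 1 (gv 3 (gv 5 x1)) = 0")
    case False
    moreover have "gv 1 (gv 2 (gv 7 (gv 1 (gv 3 (gv 5 x1))))) = gv 1 (gv 3 (gv 5 (gv 1 (gv 2 (gv 7 x1)))))"
      by (simp add: gv_linear gv_sort gv_sq)
    moreover have "gv 1 (gv 3 (gv 5 (gv 1 (gv 3 (gv 5 x1))))) = x1"
      by (simp add: gv_linear gv_sort gv_sq)
    ultimately show ?thesis using x1(2) by (intro that[of "x1 - gv 1 (gv 3 (gv 5 x1))"]) (auto simp: gv_linear)
  next
    case True
    then have t: "gv 1 (gv 3 (gv 5 x1)) = x1" by simp
    have "gv 1 (gv 3 (gv 5 (gv 2 x1))) = - gv 2 (gv 1 (gv 3 (gv 5 x1)))"
      "gv 1 (gv 2 (gv 7 (gv 2 x1))) = gv 2 (gv 1 (gv 2 (gv 7 x1)))"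
      by (simp_all add: gv_linear gv_sort gv_sq)
    then show ?thesis using that[of "gv 2 x1"] x1 gv_eq_0 t by (auto simp: gv_linear)
  qed
  show ?thesis
  proof (cases "x2 + gv 2 (gv 3 (gv 6 x2)) = 0")
    case False
    moreover have "gv 1 (gv 2 (gv 7 (gv 2 (gv 3 (gv 6 x2))))) = gv 2 (gv 3 (gv 6 (gv 1 (gv 2 (gv 7 x2)))))"
      "gv 1 (gv 3 (gv 5 (gv 2 (gv 3 (gv 6 x2))))) = gv 2 (gv 3 (gv 6 (gv 1 (gv 3 (gv 5 x2)))))"
      "gv 2 (gv 3 (gv 6 (gv 2 (gv 3 (gv 6 x2))))) = x2"
      by (simp_all add: gv_linear gv_sort gv_sq)
    ultimately show ?thesis using x2(2,3)
      by (intro exI[of _ "x2 + gv 2 (gv 3 (gv 6 x2))"]) (auto simp: gv_linear adapted_vec_def)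
  next
    case True
    then have t: "gv 2 (gv 3 (gv 6 x2)) = - x2" by (simp add: add_eq_0_iff)
    have "gv 2 (gv 3 (gv 6 (gv 1 x2))) = - gv 1 (gv 2 (gv 3 (gv 6 x2)))"
      "gv 1 (gv 2 (gv 7 (gv 1 x2))) = gv 1 (gv 1 (gv 2 (gv 7 x2)))"
      "gv 1 (gv 3 (gv 5 (gv 1 x2))) = gv 1 (gv 1 (gv 3 (gv 5 x2)))"
      by (simp_all add: gv_linear gv_sort gv_sq)
    then show ?thesis using x2 gv_eq_0 t
      by (intro exI[of _ "gv 1 x2"]) (auto simp: gv_linear adapted_vec_def)
  qed
qed

text \<open>On the invariant line Clifford multiplication is octonion multiplication. Everything about the spin
  module that is used later follows from this rule.\<close>

lemma adapted_vec_mult: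
  assumes "adapted_vec x"
  shows "gv i (gv j x) = (\<Sum>k\<in>UNIV. w i j k *\<^sub>R gv k x) - d7 i j *\<^sub>R x"
proof -
  have a: "gv 1 (gv 2 (gv 7 x)) = - x" "gv 1 (gv 3 (gv 5 x)) = - x" "gv 2 (gv 3 (gv 6 x)) = x"
    using assms by (auto simp: adapted_vec_def)
  have 7: "gv 7 x = gv 1 (gv 2 x)"
    using arg_cong[OF a(1), of "\<lambda>y. gv 2 (gv 1 y)"] by (simp add: gv_linear gv_sq) (simp add: gv_linear gv_sort)
  have 5: "gv 5 x = gv 1 (gv 3 x)"
    using arg_cong[OF a(2), of "\<lambda>y. gv 3 (gv 1 y)"] by (simp add: gv_linear gv_sq) (simp add: gv_linear gv_sort)
  have 6: "gv 6 x = - gv 2 (gv 3 x)"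
    using arg_cong[OF a(3), of "\<lambda>y. gv 3 (gv 2 y)"] by (simp add: gv_linear gv_sq) (simp add: gv_linear gv_sort)
  have 4: "gv 4 x = - gv 1 (gv 2 (gv 3 x))"
  proof -
    have "gv 4 (gv 5 (gv 6 (gv 7 x))) = gv 1 (gv 2 (gv 3 x))"
      using arg_cong[OF gv_vol[of x], of "\<lambda>y. gv 3 (gv 2 (gv 1 y))"] 
      by (simp add: gv_linear gv_sq) (simp add: gv_linear gv_sort gv_sq)
    moreover have "gv 5 (gv 6 (gv 7 x)) = - x"
      by (simp add: 7 gv_sort gv_linear gv_sq) (simp add: 6 gv_sort gv_linear gv_sq; simp add: 5 gv_sort gv_linear gv_sq)
    ultimately have "- gv 4 x = gv 1 (gv 2 (gv 3 x))" by (simp add: gv_linear)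
    then show ?thesis by (metis minus_minus)
  qed
  show ?thesis
    using exhaust_7[of i] exhaust_7[of j]
    by (elim disjE; simp add: sum_7 w_table w_skew(3) d7_def gv_sq 4 5 6 7 gv_sort gv_linear)
qed

lemma adapted_vecI:
  assumes "\<And>i j. gv i (gv j x) = (\<Sum>k\<in>UNIV. w i j k *\<^sub>R gv k x) - d7 i j *\<^sub>R x"
  shows "adapted_vec x"
proof -
  have "gv 2 (gv 7 x) = gv 1 x" "gv 3 (gv 5 x) = gv 1 x" "gv 3 (gv 6 x) = - gv 2 x"
    by (simp_all add: assms sum_7 w_table d7_def)
  then show ?thesis by (simp add: adapted_vec_def gv_linear gv_sq)
qed

context
  fixes s0 :: "'k^8"
  assumes s0: "adapted_vec s0" "s0 \<noteq> 0"
begin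

text \<open>The isomorphism of scalars plus vectors with the spin module.\<close>

definition Phi :: "'k \<Rightarrow> 'k^7 \<Rightarrow> 'k^8" where
  "Phi f X = f *s s0 + (\<Sum>i\<in>UNIV. (X $ i) *s gv i s0)"

lemma Phi_linear: "Phi (f + f') (X + X') = Phi f X + Phi f' X'" "c *s Phi f X = Phi (c * f) (c *s X)"
  "r *\<^sub>R Phi f X = Phi (r *\<^sub>R f) (r *\<^sub>R X)"
    apply (simp add: Phi_def sum.distrib vec.scale_left_distrib algebra_simps)
   apply (simp add: Phi_def vec.scale_right_distrib vec.scale_sum_right)
  apply (simp add: Phi_def scaleR_add_right scaleR_sum_right vec_eq_iff)
  done

lemma gv_Phi: "gv j (Phi f X) = Phi (- (X $ j)) (\<chi> k. of_real (d7 j k) * f + (\<Sum>i\<in>UNIV. of_real (w j i k) * X $ i))"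
proof -
  have sc: "r *\<^sub>R (c *s y) = (of_real r * c) *s y" for r c and y :: "'k^8"
    by (simp add: vec_eq_iff scaleR_conv_of_real[where 'a='k])
  have "gv j (Phi f X) = f *s gv j s0 + (\<Sum>i\<in>UNIV. (X $ i) *s ((\<Sum>k\<in>UNIV. w j i k *\<^sub>R gv k s0) - d7 j i *\<^sub>R s0))"
    by (simp add: Phi_def gv_linear gv_sum adapted_vec_mult[OF s0(1)])
  also have "(\<Sum>i\<in>UNIV. (X $ i) *s ((\<Sum>k\<in>UNIV. w j i k *\<^sub>R gv k s0) - d7 j i *\<^sub>R s0))
    = (\<Sum>i\<in>UNIV. \<Sum>k\<in>UNIV. (of_real (w j i k) * X $ i) *s gv k s0) - (\<Sum>i\<in>UNIV. d7 j i *\<^sub>R (X $ i *s s0))"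
    by (simp add: vec.scale_right_diff_distrib vec.scale_sum_right sum_subtractf vector_smult_scaleR sc)
  also have "(\<Sum>i\<in>UNIV. d7 j i *\<^sub>R (X $ i *s s0)) = X $ j *s s0"
    by (simp add: d7_def if_distrib[of "\<lambda>r. r *\<^sub>R _"] cong: if_cong)
  also have "(\<Sum>i\<in>UNIV. \<Sum>k\<in>UNIV. (of_real (w j i k) * X $ i) *s gv k s0)
    = (\<Sum>k\<in>UNIV. (\<Sum>i\<in>UNIV. of_real (w j i k) * X $ i) *s gv k s0)"
    by (subst sum.swap) (simp add: vec.scale_sum_left)
  also have "f *s gv j s0 = (\<Sum>k\<in>UNIV. (of_real (d7 j k) * f) *s gv k s0)"
    by (simp add: d7_def if_distrib[of of_real] if_distrib[of "\<lambda>r. r * _"] if_distrib[of "\<lambda>r. r *s _"] cong: if_cong)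
  finally show ?thesis
    by (simp add: Phi_def vec.scale_left_distrib sum.distrib)
qed

text \<open>The involutions defining \<open>adapted_vec\<close> act on the vector part by a sign on the three indices of the
  respective term, so their eigenspaces are described by restriction to index sets.\<close>

definition restrict7 :: "7 set \<Rightarrow> 'k^7 \<Rightarrow> 'k^7" where
  "restrict7 L X = (\<chi> k. if k \<in> L then X $ k else 0)"

lemma triple_Phi:
  assumes T: "\<And>k. gv a (gv b (gv c (gv k s0))) = (if k \<in> L then - e else e) *\<^sub>R gv k s0"
    and T0: "gv a (gv b (gv c s0)) = (- e) *\<^sub>R s0"
  shows "gv a (gv b (gv c (Phi f X))) = e *\<^sub>R (Phi f X - 2 *\<^sub>R Phi f (restrict7 L X))"
proof -
  have "gv a (gv b (gv c (Phi f X))) = f *s ((- e) *\<^sub>R s0) + (\<Sum>k\<in>UNIV. X $ k *s ((if k \<in> L then - e else e) *\<^sub>R gv k s0))"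
    by (simp only: Phi_def gv_linear gv_sum T T0)
  moreover have "X $ k *s ((if k \<in> L then - e else e) *\<^sub>R gv k s0)
     = e *\<^sub>R (X $ k *s gv k s0 - 2 *\<^sub>R (restrict7 L X $ k *s gv k s0))" for k
    by (simp add: restrict7_def vec_eq_iff scaleR_2)
  moreover have "f *s ((- e) *\<^sub>R s0) = e *\<^sub>R (f *s s0 - 2 *\<^sub>R (f *s s0))"
    by (simp add: vec_eq_iff scaleR_2)
  ultimately show ?thesis
    by (simp add: Phi_def sum_subtractf scaleR_sum_right scaleR_right_distrib scaleR_right_diff_distrib)
qed

lemma triples_s0:
  "gv 1 (gv 2 (gv 7 (gv k s0))) = (if k \<in> {1, 2, 7} then - 1 else 1) *\<^sub>R gv k s0"
  "gv 1 (gv 3 (gv 5 (gv k s0))) = (if k \<in> {1, 3, 5} then - 1 else 1) *\<^sub>R gv k s0"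
  "gv 2 (gv 3 (gv 6 (gv k s0))) = (if k \<in> {2, 3, 6} then - (- 1) else - 1) *\<^sub>R gv k s0"
  by (use exhaust_7[of k] in \<open>elim disjE; simp add: adapted_vec_mult[OF s0(1)] sum_7 w_table w_skew(3) d7_def gv_linear\<close>)+

lemma triples_Phi:
  "gv 1 (gv 2 (gv 7 (Phi f X))) = 1 *\<^sub>R (Phi f X - 2 *\<^sub>R Phi f (restrict7 {1, 2, 7} X))"
  "gv 1 (gv 3 (gv 5 (Phi f X))) = 1 *\<^sub>R (Phi f X - 2 *\<^sub>R Phi f (restrict7 {1, 3, 5} X))"
  "gv 2 (gv 3 (gv 6 (Phi f X))) = (- 1) *\<^sub>R (Phi f X - 2 *\<^sub>R Phi f (restrict7 {2, 3, 6} X))"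
  using s0(1) by (intro triple_Phi triples_s0; simp add: adapted_vec_def)+

lemma Phi_0_imp: "Phi f X = 0 \<Longrightarrow> f = 0"
proof -
  assume P: "Phi f X = 0"
  have r: "Phi f (restrict7 L X) = 0" if "Phi f X = 0" "L = {1, 2, 7} \<or> L = {1, 3, 5} \<or> L = {2, 3, 6}" for L X
    using that triples_Phi[of f X] by (auto simp: gv_linear)
  have "Phi f (restrict7 {1, 2, 7} (restrict7 {1, 3, 5} (restrict7 {2, 3, 6} X))) = 0"
    by (intro r P) auto
  moreover have "restrict7 {1, 2, 7} (restrict7 {1, 3, 5} (restrict7 {2, 3, 6} X)) = 0"
    by (simp add: restrict7_def vec_eq_iff)
  ultimately have "f *s s0 = 0" by (simp add: Phi_def)
  then show "f = 0" using s0(2) by simp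
qed

lemma Phi_eq_0: 
  assumes "Phi f X = 0" shows "f = 0" "X = 0"
proof -
  have "X $ j = 0" for j
  proof -
    have "gv j (Phi f X) = 0" using assms by (simp add: gv_linear)
    from Phi_0_imp[OF this[unfolded gv_Phi]] show ?thesis by simp
  qed
  then show "f = 0" "X = 0" using Phi_0_imp[OF assms] by (simp_all add: vec_eq_iff)
qed

lemma Phi_diff: "Phi f X - Phi f' X' = Phi (f - f') (X - X')"
  using Phi_linear(1)[of "f - f'" f' "X - X'" X'] by simp

lemma Phi_inject: "Phi f X = Phi f' X' \<longleftrightarrow> f = f' \<and> X = X'"
proof
  assume "Phi f X = Phi f' X'"
  then have "Phi (f - f') (X - X') = 0" using Phi_diff[of f X f' X'] by simp
  from Phi_eq_0[OF this] show "f = f' \<and> X = X'" by simp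
qed simp

definition PhiP :: "'k \<times> ('k^7) \<Rightarrow> 'k^8" where "PhiP p = Phi (fst p) (snd p)"

lemma linear_PhiP: "linear PhiP"
  by (rule linearI) (simp_all add: PhiP_def Phi_linear)

lemma inj_PhiP: "inj PhiP"
  by (rule injI) (simp add: PhiP_def Phi_inject prod_eq_iff)

lemma surj_PhiP: "surj PhiP"
proof -
  have "dim (range PhiP) = dim (UNIV :: ('k \<times> ('k^7)) set)"
    by (rule dim_image_eq[OF linear_PhiP]) (use inj_PhiP in auto)
  then have "dim (range PhiP) = DIM('k^8)" by simp
  then have "span (range PhiP) = UNIV" using dim_eq_full[of "range PhiP"] by blast
  moreover have "subspace (range PhiP)"
    by (rule linear_subspace_image[OF linear_PhiP subspace_UNIV])
  ultimately show ?thesis using span_eq_iff[of "range PhiP"] by simp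
qed

definition fpart :: "'k^8 \<Rightarrow> 'k" where "fpart y = fst (inv PhiP y)"
definition Xpart :: "'k^8 \<Rightarrow> 'k^7" where "Xpart y = snd (inv PhiP y)"

lemma Phi_parts: "Phi (fpart y) (Xpart y) = y"
  using surj_f_inv_f[OF surj_PhiP, of y] by (simp add: PhiP_def fpart_def Xpart_def)

lemma parts_Phi: "fpart (Phi f X) = f" "Xpart (Phi f X) = X"
  using Phi_parts[of "Phi f X"] by (simp_all add: Phi_inject)

lemma parts_linear: "fpart (x + y) = fpart x + fpart y" "Xpart (x + y) = Xpart x + Xpart y"
  "fpart (c *s x) = c * fpart x" "Xpart (c *s x) = c *s Xpart x"
  "fpart (r *\<^sub>R x) = r *\<^sub>R fpart x" "Xpart (r *\<^sub>R x) = r *\<^sub>R Xpart x"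
proof -
  have "x + y = Phi (fpart x + fpart y) (Xpart x + Xpart y)" by (simp add: Phi_linear Phi_parts)
  then show "fpart (x + y) = fpart x + fpart y" "Xpart (x + y) = Xpart x + Xpart y" by (simp_all add: parts_Phi)
  have "c *s x = Phi (c * fpart x) (c *s Xpart x)" by (simp add: Phi_linear(2)[symmetric] Phi_parts)
  then show "fpart (c *s x) = c * fpart x" "Xpart (c *s x) = c *s Xpart x" by (simp_all add: parts_Phi)
  have "r *\<^sub>R x = Phi (r *\<^sub>R fpart x) (r *\<^sub>R Xpart x)" by (simp add: Phi_linear(3)[symmetric] Phi_parts)
  then show "fpart (r *\<^sub>R x) = r *\<^sub>R fpart x" "Xpart (r *\<^sub>R x) = r *\<^sub>R Xpart x" by (simp_all add: parts_Phi)
qed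

lemma bounded_linear_parts: "bounded_linear fpart" "bounded_linear Xpart"
  by (simp_all add: linear_linear linearI parts_linear)

text \<open>The vector part is supported on the three index sets of the involutions, which have no common index.\<close>

lemma adapted_vec_multiple:
  assumes "adapted_vec y"
  shows "y = fpart y *s s0"
proof -
  let ?f = "fpart y" let ?X = "Xpart y"
  have y: "y = Phi ?f ?X" by (simp add: Phi_parts)
  have r: "?X = restrict7 L ?X" if "L = {1, 2, 7} \<or> L = {1, 3, 5} \<or> L = {2, 3, 6}" for L
  proof -
    have "2 *\<^sub>R Phi ?f ?X = 2 *\<^sub>R Phi ?f (restrict7 L ?X)"
      using assms that triples_Phi[of ?f ?X] by (auto simp: adapted_vec_def Phi_parts scaleR_2 algebra_simps)
    then show ?thesis by (simp add: Phi_inject)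
  qed
  have "?X = restrict7 {1, 2, 7} (restrict7 {1, 3, 5} (restrict7 {2, 3, 6} ?X))"
    using r[of "{1, 2, 7}"] r[of "{1, 3, 5}"] r[of "{2, 3, 6}"] by metis
  also have "\<dots> = 0" by (simp add: restrict7_def vec_eq_iff)
  finally have "?X = 0" .
  with y show ?thesis by (simp add: Phi_def)
qed

text \<open>The bilinear and not the Hermitian square, so that its value on \<open>c s\<^sub>0\<close> is \<open>c\<^sup>2\<close> over the complex
  scalars as well.\<close>

definition qform :: "'k^8 \<Rightarrow> 'k" where
  "qform y = fpart y * fpart y + (\<Sum>k\<in>UNIV. Xpart y $ k * Xpart y $ k)"

lemma clifford_gv: "clifford gam x *v y = (\<Sum>i\<in>UNIV. (x $ i) *\<^sub>R gv i y)"
proof -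
  have "(\<Sum>i\<in>I. M i) *v y = (\<Sum>i\<in>I. M i *v y)" for I and M :: "7 \<Rightarrow> 'k^8^8"
    by (induction I rule: infinite_finite_induct) (auto simp: matrix_vector_mult_add_rdistrib matrix_vector_mult_0)
  then show ?thesis by (simp add: clifford_def scaleR_matrix_vector gv_def)
qed

lemma clifford_Phi:
  "clifford gam x *v Phi f X = Phi (- (\<Sum>j\<in>UNIV. of_real (x $ j) * X $ j))
     (\<chi> k. of_real (x $ k) * f + (\<Sum>i\<in>UNIV. of_real (cross7 x (axis i 1) $ k) * X $ i))"
proof -
  have c: "cross7 x (axis i 1) $ k = (\<Sum>j\<in>UNIV. x $ j * w j i k)" for i k
  proof -
    have "cross7 x (axis i 1) = cross7 (\<Sum>j\<in>UNIV. x $ j *\<^sub>R axis j 1) (axis i 1)"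
      by (simp only: axis_expansion)
    also have "\<dots> = (\<Sum>j\<in>UNIV. x $ j *\<^sub>R cross7 (axis j 1) (axis i 1))"
      by (simp only: cross7_sum cross7_linear)
    finally show ?thesis by (simp add: cross7_axis_nth)
  qed
  have "fpart (clifford gam x *v Phi f X) = - (\<Sum>j\<in>UNIV. of_real (x $ j) * X $ j)"
    unfolding clifford_gv linear_sum[OF bounded_linear.linear[OF bounded_linear_parts(1)]]
    by (simp add: parts_linear gv_Phi parts_Phi sum_negf scaleR_conv_of_real[where 'a='k])
  moreover have "Xpart (clifford gam x *v Phi f X) =
     (\<chi> k. of_real (x $ k) * f + (\<Sum>i\<in>UNIV. of_real (cross7 x (axis i 1) $ k) * X $ i))"
  proof -
    have "(\<Sum>j\<in>UNIV. of_real (x $ j) * (of_real (d7 j k) * f)) = of_real (x $ k) * f" for k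
      by (simp add: d7_def if_distrib[of of_real] if_distrib[of "\<lambda>r. r * _"] if_distrib[of "\<lambda>r. _ * r"] cong: if_cong)
    moreover have "(\<Sum>j\<in>UNIV. of_real (x $ j) * (\<Sum>i\<in>UNIV. of_real (w j i k) * X $ i))
       = (\<Sum>i\<in>UNIV. of_real (cross7 x (axis i 1) $ k) * X $ i)" for k
      unfolding c sum_distrib_left by (subst sum.swap) (simp add: sum_distrib_right mult.assoc)
    ultimately show ?thesis
      unfolding clifford_gv linear_sum[OF bounded_linear.linear[OF bounded_linear_parts(2)]]
      by (simp add: vec_eq_iff parts_linear gv_Phi parts_Phi scaleR_conv_of_real[where 'a='k] distrib_left sum.distrib)
  qed
  ultimately show ?thesis using Phi_parts[of "clifford gam x *v Phi f X"] by simp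
qed

lemma qform_clifford: "qform (clifford gam x *v y) = of_real (x \<bullet> x) * qform y"
proof -
  define f X where "f = fpart y" and "X = Xpart y"
  have y: "y = Phi f X" by (simp add: f_def X_def Phi_parts)
  define c where "c i k = cross7 x (axis i 1) $ k" for i k
  define Y where "Y k = (\<Sum>i\<in>UNIV. of_real (c i k) * X $ i)" for k
  define xX where "xX = (\<Sum>j\<in>UNIV. of_real (x $ j) * X $ j)"
  have xc: "(\<Sum>k\<in>UNIV. x $ k * c i k) = 0" for i
    using inner_cross7_self(1)[of x "axis i 1"] by (simp add: c_def inner_vec_def mult.commute)
  have cc: "(\<Sum>k\<in>UNIV. c i k * c j k) = (x \<bullet> x) * d7 i j - x $ i * x $ j" for i j
    using inner_cross7_same[of x "axis i 1" "axis j 1"] by (simp add: c_def inner_vec_def[of "cross7 _ _"] axis_inner_axis inner_axis) (simp add: axis_def d7_def)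
  have xY: "(\<Sum>k\<in>UNIV. of_real (x $ k) * Y k) = 0"
  proof -
    have "(\<Sum>k\<in>UNIV. of_real (x $ k) * Y k) = (\<Sum>i\<in>UNIV. of_real (\<Sum>k\<in>UNIV. x $ k * c i k) * X $ i)"
      unfolding Y_def sum_distrib_left by (subst sum.swap) (simp add: sum_distrib_right mult.assoc)
    then show ?thesis by (simp add: xc)
  qed
  have YY: "(\<Sum>k\<in>UNIV. Y k * Y k) = of_real (x \<bullet> x) * (\<Sum>i\<in>UNIV. X $ i * X $ i) - xX * xX"
  proof -
    have "(\<Sum>k\<in>UNIV. Y k * Y k) = (\<Sum>k\<in>UNIV. \<Sum>i\<in>UNIV. \<Sum>j\<in>UNIV. of_real (c i k * c j k) * (X $ i * X $ j))"
      by (simp add: Y_def sum_product mult_ac)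
    also have "\<dots> = (\<Sum>i\<in>UNIV. \<Sum>j\<in>UNIV. \<Sum>k\<in>UNIV. of_real (c i k * c j k) * (X $ i * X $ j))"
      by (rule sum_rot[symmetric])
    also have "\<dots> = (\<Sum>i\<in>UNIV. \<Sum>j\<in>UNIV. of_real (\<Sum>k\<in>UNIV. c i k * c j k) * (X $ i * X $ j))"
      by (simp add: sum_distrib_right)
    also have "\<dots> = (\<Sum>i\<in>UNIV. \<Sum>j\<in>UNIV. of_real (x \<bullet> x) * (of_real (d7 i j) * (X $ i * X $ j)) - (of_real (x $ i) * X $ i) * (of_real (x $ j) * X $ j))"
      by (simp add: cc algebra_simps)
    also have "\<dots> = of_real (x \<bullet> x) * (\<Sum>i\<in>UNIV. \<Sum>j\<in>UNIV. of_real (d7 i j) * (X $ i * X $ j)) - xX * xX"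
      by (simp add: sum_subtractf sum_distrib_left[symmetric] xX_def sum_product)
    also have "(\<Sum>i\<in>UNIV. \<Sum>j\<in>UNIV. of_real (d7 i j) * (X $ i * X $ j)) = (\<Sum>i\<in>UNIV. X $ i * X $ i)"
      by (simp add: d7_def if_distrib[of of_real] if_distrib[of "\<lambda>r. r * _"] cong: if_cong)
    finally show ?thesis .
  qed
  have "qform (clifford gam x *v y) = xX * xX + (\<Sum>k\<in>UNIV. (of_real (x $ k) * f + Y k) * (of_real (x $ k) * f + Y k))"
    by (simp add: y clifford_Phi qform_def parts_Phi xX_def Y_def c_def)
  also have "(\<Sum>k\<in>UNIV. (of_real (x $ k) * f + Y k) * (of_real (x $ k) * f + Y k))
    = (\<Sum>k\<in>UNIV. of_real (x $ k * x $ k) * (f * f)) + (\<Sum>k\<in>UNIV. 2 * f * (of_real (x $ k) * Y k)) + (\<Sum>k\<in>UNIV. Y k * Y k)"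
    unfolding sum.distrib[symmetric] by (intro sum.cong refl) (simp add: algebra_simps)
  also have "(\<Sum>k\<in>UNIV. 2 * f * (of_real (x $ k) * Y k)) = 0" by (simp only: sum_distrib_left[symmetric] xY) simp
  also have "(\<Sum>k\<in>UNIV. of_real (x $ k * x $ k) * (f * f)) = of_real (x \<bullet> x) * (f * f)"
    by (simp add: inner_vec_def sum_distrib_right)
  finally show ?thesis unfolding YY by (simp add: qform_def f_def X_def algebra_simps)
qed

lemma qform_Spin7: "a \<in> Spin7 gam \<Longrightarrow> qform (a *v y) = qform y"
  by (induction arbitrary: y rule: Spin7.induct)
     (auto simp: matrix_vector_mul_assoc[symmetric] qform_clifford dot_square_norm)

lemma clifford_clifford_s0:
  "clifford gam x *v (clifford gam y *v s0) = clifford gam (cross7 x y) *v s0 - (x \<bullet> y) *\<^sub>R s0"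
proof -
  have s: "Phi 1 0 = s0" by (simp add: Phi_def)
  have 1: "clifford gam y *v s0 = Phi 0 (\<chi> k. of_real (y $ k))" for y
    using clifford_Phi[of y 1 0] unfolding s by simp
  have c: "(\<Sum>i\<in>UNIV. cross7 x (axis i 1) $ k * y $ i) = cross7 x y $ k" for k
  proof -
    have "cross7 x y = cross7 x (\<Sum>j\<in>UNIV. y $ j *\<^sub>R axis j 1)"
      by (subst axis_expansion) (rule refl)
    also have "\<dots> = (\<Sum>j\<in>UNIV. y $ j *\<^sub>R cross7 x (axis j 1))"
      by (simp only: cross7_sum cross7_linear)
    finally show ?thesis by (simp add: mult.commute)
  qed
  have "clifford gam x *v (clifford gam y *v s0) = Phi (- of_real (x \<bullet> y)) (\<chi> k. of_real (cross7 x y $ k))"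
    unfolding 1 clifford_Phi by (simp add: Phi_inject inner_vec_def c[symmetric])
  also have "\<dots> = Phi 0 (\<chi> k. of_real (cross7 x y $ k)) - Phi (of_real (x \<bullet> y)) 0"
    by (simp add: Phi_diff)
  finally show ?thesis by (simp add: 1) (simp add: Phi_def vec_eq_iff scaleR_conv_of_real[where 'a='k])
qed

lemma clifford_axis: "clifford gam (axis i 1) *v y = gv i y"
  by (simp add: clifford_gv axis_def if_distrib[of "\<lambda>r. r *\<^sub>R _"] cong: if_cong)

text \<open>The lift maps the invariant line to itself, and the invariant quadratic form restricts the factor to a
  sign. So the factor is a sign character of the stabiliser, hence trivial.\<close>

lemma G2_lift_s0:
  assumes kap: "G2_lift gam kap" and h: "h \<in> G2"
  shows "kap h *v s0 = s0"
proof -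
  have hG: "h \<in> Gw" if "h \<in> G2" for h using that G2_eq by simp
  have act: "kap h *v (clifford gam x *v y) = clifford gam (h *v x) *v (kap h *v y)" if "h \<in> G2" for h x y
    using kap that by (simp add: G2_lift_def matrix_vector_mul_assoc)
  have ad: "adapted_vec (kap h *v s0)" if h: "h \<in> G2" for h
  proof (rule adapted_vecI)
    fix i j
    define y where "y = kap h *v s0"
    define x1 x2 where "x1 = transpose h *v axis i 1" and "x2 = transpose h *v axis j 1"
    have hx: "h *v x1 = axis i 1" "h *v x2 = axis j 1"
      using Gw_transpose[OF hG[OF h]] unfolding x1_def x2_def by (metis matrix_vector_mul_assoc matrix_vector_mul_lid)+
    have "gv i (gv j y) = kap h *v (clifford gam x1 *v (clifford gam x2 *v s0))"
      by (simp add: act[OF h] hx clifford_axis y_def)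
    also have "\<dots> = clifford gam (h *v cross7 x1 x2) *v y - (x1 \<bullet> x2) *\<^sub>R y"
      by (simp only: clifford_clifford_s0 matrix_vector_mult_diff_distrib act[OF h] matrix_vector_mult_scaleR_right y_def)
    also have "h *v cross7 x1 x2 = cross7 (axis i 1) (axis j 1)"
      using Gw_cross7[OF hG[OF h], of x1 x2] hx by simp
    also have "x1 \<bullet> x2 = d7 i j"
      using Gw_inner[OF hG[OF h], of x1 x2] hx by (simp add: axis_inner_axis)
    finally show "gv i (gv j (kap h *v s0)) = (\<Sum>k\<in>UNIV. w i j k *\<^sub>R gv k (kap h *v s0)) - d7 i j *\<^sub>R (kap h *v s0)"
      by (simp add: y_def clifford_gv cross7_axis_nth)
  qed
  define chi where "chi h = fpart (kap h *v s0)" for h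
  have k: "kap h *v s0 = chi h *s s0" if "h \<in> G2" for h
    using adapted_vec_multiple[OF ad[OF that]] by (simp add: chi_def)
  have "s0 = Phi 1 0" by (simp add: Phi_def)
  then have fs: "fpart s0 = 1" "Xpart s0 = 0" using parts_Phi[of 1 0] by simp_all
  have "chi h = 1"
  proof (rule Gw_character_trivial[of chi])
    show "chi (h ** h') = chi h * chi h'" if "h \<in> Gw" "h' \<in> Gw" for h h'
    proof -
      have g: "h \<in> G2" "h' \<in> G2" using that G2_eq by auto
      have "kap (h ** h') *v s0 = kap h *v (kap h' *v s0)"
        using kap g by (simp add: G2_lift_def matrix_vector_mul_assoc)
      also have "\<dots> = (chi h' * chi h) *s s0" by (simp add: k g vector_scalar_commute)
      finally show ?thesis by (simp add: chi_def[of "h ** h'"] parts_linear fs)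
    qed
    show "chi h * chi h = 1" if "h \<in> Gw" for h
    proof -
      have g: "h \<in> G2" using that G2_eq by auto
      then have "qform (kap h *v s0) = qform s0" using kap by (simp add: G2_lift_def qform_Spin7)
      then show ?thesis by (simp add: k[OF g] qform_def parts_linear fs)
    qed
  qed (rule hG[OF h])
  then show ?thesis using k[OF h] by simp
qed

lemma G2_lift_Phi:
  assumes kap: "G2_lift gam kap" and h: "h \<in> G2"
  shows "kap h *v Phi f X = Phi f (\<chi> j. \<Sum>k\<in>UNIV. of_real (h $ j $ k) * X $ k)"
proof -
  have act: "kap h *v (clifford gam x *v y) = clifford gam (h *v x) *v (kap h *v y)" for x y
    using kap h by (simp add: G2_lift_def matrix_vector_mul_assoc)
  have g: "kap h *v gv k s0 = (\<Sum>j\<in>UNIV. h $ j $ k *\<^sub>R gv j s0)" for k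
  proof -
    have "kap h *v gv k s0 = clifford gam (h *v axis k 1) *v s0"
      using act[of "axis k 1" s0] by (simp add: clifford_axis G2_lift_s0[OF assms])
    then show ?thesis by (simp add: clifford_gv matrix_vector_mult_basis column_def)
  qed
  have sc: "c *s (r *\<^sub>R y) = (of_real r * c) *s y" for r c and y :: "'k^8"
    by (simp add: vec_eq_iff scaleR_conv_of_real[where 'a='k])
  have "kap h *v Phi f X = f *s s0 + (\<Sum>k\<in>UNIV. X $ k *s (\<Sum>j\<in>UNIV. h $ j $ k *\<^sub>R gv j s0))"
    by (simp add: Phi_def matrix_vector_right_distrib vec.sum vector_scalar_commute g G2_lift_s0[OF assms])
  also have "(\<Sum>k\<in>UNIV. X $ k *s (\<Sum>j\<in>UNIV. h $ j $ k *\<^sub>R gv j s0))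
    = (\<Sum>j\<in>UNIV. (\<Sum>k\<in>UNIV. of_real (h $ j $ k) * X $ k) *s gv j s0)"
    by (simp add: vec.scale_sum_right sc vec.scale_sum_left) (rule sum.swap)
  finally show ?thesis by (simp add: Phi_def)
qed

end
end

section \<open>The Hodge dual of the three-form\<close>

lemma vector_7:
  "(vector [x1, x2, x3, x4, x5, x6, x7] :: 'a::zero^7) $ 1 = x1"
  "(vector [x1, x2, x3, x4, x5, x6, x7] :: 'a::zero^7) $ 2 = x2"
  "(vector [x1, x2, x3, x4, x5, x6, x7] :: 'a::zero^7) $ 3 = x3"
  "(vector [x1, x2, x3, x4, x5, x6, x7] :: 'a::zero^7) $ 4 = x4"
  "(vector [x1, x2, x3, x4, x5, x6, x7] :: 'a::zero^7) $ 5 = x5"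
  "(vector [x1, x2, x3, x4, x5, x6, x7] :: 'a::zero^7) $ 6 = x6"
  "(vector [x1, x2, x3, x4, x5, x6, x7] :: 'a::zero^7) $ 7 = x7"
  unfolding vector_def by auto

definition vol7 :: "real^7 \<Rightarrow> real^7 \<Rightarrow> real^7 \<Rightarrow> real^7 \<Rightarrow> real^7 \<Rightarrow> real^7 \<Rightarrow> real^7 \<Rightarrow> real" where
  "vol7 a b c d e f g = det (vector [a, b, c, d, e, f, g] :: real^7^7)"

lemma vol7_rows:
  fixes a b c d e f g :: "real^7"
  shows "(vector [x, b, c, d, e, f, g] :: real^7^7) = (\<chi> i. if i = 1 then x else vector [a, b, c, d, e, f, g] $ i)"
    "(vector [a, x, c, d, e, f, g] :: real^7^7) = (\<chi> i. if i = 2 then x else vector [a, b, c, d, e, f, g] $ i)"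
    "(vector [a, b, x, d, e, f, g] :: real^7^7) = (\<chi> i. if i = 3 then x else vector [a, b, c, d, e, f, g] $ i)"
  by (subst vec_eq_iff, simp add: forall_7 vector_7)+

lemma linear_vol7:
  "linear (\<lambda>x. vol7 x b c d e f g)" "linear (\<lambda>x. vol7 a x c d e f g)" "linear (\<lambda>x. vol7 a b x d e f g)"
proof -
  have *: "linear (\<lambda>x. det (\<chi> i. if i = k then x else r i))" for k :: 7 and r :: "7 \<Rightarrow> real^7"
  proof (rule linearI)
    show "det (\<chi> i. if i = k then x + y else r i) = det (\<chi> i. if i = k then x else r i) + det (\<chi> i. if i = k then y else r i)" for x y
      using det_row_add[of k "\<lambda>_. x" "\<lambda>_. y" r] by simp
    show "det (\<chi> i. if i = k then s *\<^sub>R x else r i) = s *\<^sub>R det (\<chi> i. if i = k then x else r i)" for s x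
      using det_row_mul[of k s "\<lambda>_. x" r] unfolding scalar_mult_eq_scaleR by simp
  qed
  show "linear (\<lambda>x. vol7 x b c d e f g)"
    using *[of 1 "\<lambda>i. vector [0, b, c, d, e, f, g] $ i"] by (simp only: vol7_def vol7_rows(1)[of _ b c d e f g 0, symmetric])
  show "linear (\<lambda>x. vol7 a x c d e f g)"
    using *[of 2 "\<lambda>i. vector [a, 0, c, d, e, f, g] $ i"] by (simp only: vol7_def vol7_rows(2)[of a _ c d e f g 0, symmetric])
  show "linear (\<lambda>x. vol7 a b x d e f g)"
    using *[of 3 "\<lambda>i. vector [a, b, 0, d, e, f, g] $ i"] by (simp only: vol7_def vol7_rows(3)[of a b _ d e f g 0, symmetric])
qed

lemma vol7_swap:
  "vol7 b a c d e f g = - vol7 a b c d e f g"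
  "vol7 a c b d e f g = - vol7 a b c d e f g"
  "vol7 a b d c e f g = - vol7 a b c d e f g"
  "vol7 a b c e d f g = - vol7 a b c d e f g"
  "vol7 a b c d f e g = - vol7 a b c d e f g"
  "vol7 a b c d e g f = - vol7 a b c d e f g"
proof -
  have *: "det (\<chi> i. M $ (Transposition.transpose p q i)) = - det M" if "p \<noteq> q" for M :: "real^7^7" and p q :: 7
    using det_permute_rows[OF permutes_swap_id[of p UNIV q], of M] that by (simp add: sign_swap_id)
  let ?M = "vector [a, b, c, d, e, f, g] :: real^7^7"
  have e: "(vector [b, a, c, d, e, f, g] :: real^7^7) = (\<chi> i. ?M $ Transposition.transpose 1 2 i)"
    "(vector [a, c, b, d, e, f, g] :: real^7^7) = (\<chi> i. ?M $ Transposition.transpose 2 3 i)"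
    "(vector [a, b, d, c, e, f, g] :: real^7^7) = (\<chi> i. ?M $ Transposition.transpose 3 4 i)"
    "(vector [a, b, c, e, d, f, g] :: real^7^7) = (\<chi> i. ?M $ Transposition.transpose 4 5 i)"
    "(vector [a, b, c, d, f, e, g] :: real^7^7) = (\<chi> i. ?M $ Transposition.transpose 5 6 i)"
    "(vector [a, b, c, d, e, g, f] :: real^7^7) = (\<chi> i. ?M $ Transposition.transpose 6 7 i)"
    by (subst vec_eq_iff, simp add: forall_7 vector_7 Transposition.transpose_def)+
  show "vol7 b a c d e f g = - vol7 a b c d e f g"
    "vol7 a c b d e f g = - vol7 a b c d e f g"
    "vol7 a b d c e f g = - vol7 a b c d e f g"
    "vol7 a b c e d f g = - vol7 a b c d e f g"
    "vol7 a b c d f e g = - vol7 a b c d e f g"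
    "vol7 a b c d e g f = - vol7 a b c d e f g"
    unfolding vol7_def e by (rule *; simp)+
qed

lemma vol7_mult: "vol7 (h *v a) (h *v b) (h *v c) (h *v d) (h *v e) (h *v f) (h *v g) = det h * vol7 a b c d e f g"
proof -
  have "(vector [h *v a, h *v b, h *v c, h *v d, h *v e, h *v f, h *v g] :: real^7^7)
     = vector [a, b, c, d, e, f, g] ** Finite_Cartesian_Product.transpose h"
    by (subst vec_eq_iff, simp add: forall_7 vector_7 vec_eq_iff matrix_vector_mult_def matrix_matrix_mult_def transpose_def mult.commute)
  then show ?thesis by (simp add: vol7_def det_mul det_transpose mult.commute)
qed

definition volx :: "7 \<Rightarrow> 7 \<Rightarrow> 7 \<Rightarrow> 7 \<Rightarrow> 7 \<Rightarrow> 7 \<Rightarrow> 7 \<Rightarrow> real" where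
  "volx a b c d e f g = vol7 (axis a 1) (axis b 1) (axis c 1) (axis d 1) (axis e 1) (axis f 1) (axis g 1)"

lemma volx_id: "volx 1 2 3 4 5 6 7 = 1"
proof -
  have "(vector [axis 1 1, axis 2 1, axis 3 1, axis 4 1, axis 5 1, axis 6 1, axis 7 1] :: real^7^7) = mat 1"
    by (subst vec_eq_iff, simp add: forall_7 vector_7 vec_eq_iff mat_def axis_def)
  then show ?thesis by (simp add: volx_def vol7_def)
qed

text \<open>In the index type the numeral \<open>7\<close> equals \<open>0\<close>. Ranking the indices as \<open>1, ..., 7\<close> allows sorting them in the
  usual order.\<close>

definition rank7 :: "7 \<Rightarrow> nat" where
  "rank7 i = (if i = 1 then 1 else if i = 2 then 2 else if i = 3 then 3 else if i = 4 then 4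
     else if i = 5 then 5 else if i = 6 then 6 else 7)"

lemma rank7_values: "rank7 1 = 1" "rank7 2 = 2" "rank7 3 = 3" "rank7 4 = 4" "rank7 5 = 5" "rank7 6 = 6" "rank7 7 = 7"
  by (simp_all add: rank7_def)

lemma volx_sort:
  "rank7 b < rank7 a \<Longrightarrow> volx a b c d e f g = - volx b a c d e f g"
  "rank7 c < rank7 b \<Longrightarrow> volx a b c d e f g = - volx a c b d e f g"
  "rank7 d < rank7 c \<Longrightarrow> volx a b c d e f g = - volx a b d c e f g"
  "rank7 e < rank7 d \<Longrightarrow> volx a b c d e f g = - volx a b c e d f g"
  "rank7 f < rank7 e \<Longrightarrow> volx a b c d e f g = - volx a b c d f e g"
  "rank7 g < rank7 f \<Longrightarrow> volx a b c d e f g = - volx a b c d e g f"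
  by (unfold volx_def) (rule vol7_swap)+

lemma volx_rep: "volx a a c d e f g = 0" "volx a b b d e f g = 0" "volx a b c c e f g = 0"
   "volx a b c d d f g = 0" "volx a b c d e e g = 0" "volx a b c d e f f = 0"
proof -
  have z: "x = - x \<Longrightarrow> x = 0" for x :: real by simp
  show "volx a a c d e f g = 0" "volx a b b d e f g = 0" "volx a b c c e f g = 0"
    "volx a b c d d f g = 0" "volx a b c d e e g = 0" "volx a b c d e f f = 0"
    by (unfold volx_def) (rule z, rule vol7_swap)+
qed

definition star_w :: "7 \<Rightarrow> 7 \<Rightarrow> 7 \<Rightarrow> 7 \<Rightarrow> real" where
  "star_w a b c d = (1/6) * (\<Sum>i\<in>UNIV. \<Sum>j\<in>UNIV. \<Sum>k\<in>UNIV. w i j k * volx i j k a b c d)"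

lemma star_w_lines: "star_w a b c d = volx 1 2 7 a b c d + volx 1 3 5 a b c d - volx 1 4 6 a b c d - volx 2 3 6 a b c d
     - volx 2 4 5 a b c d + volx 3 4 7 a b c d + volx 5 6 7 a b c d"
proof -
  have r: "volx j i k a b c d = - volx i j k a b c d" "volx i k j a b c d = - volx i j k a b c d" for i j k
    by (unfold volx_def) (rule vol7_swap)+
  note r' = r(1)[of 2 1] r(1)[of 3 1] r(1)[of 4 1] r(1)[of 5 1] r(1)[of 6 1] r(1)[of 7 1]
    r(1)[of 3 2] r(1)[of 4 2] r(1)[of 5 2] r(1)[of 6 2] r(1)[of 7 2] r(1)[of 4 3] r(1)[of 5 3] r(1)[of 6 3] r(1)[of 7 3]
    r(1)[of 5 4] r(1)[of 6 4] r(1)[of 7 4] r(1)[of 6 5] r(1)[of 7 5] r(1)[of 7 6]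
    r(2)[of _ 2 1] r(2)[of _ 3 1] r(2)[of _ 4 1] r(2)[of _ 5 1] r(2)[of _ 6 1] r(2)[of _ 7 1]
    r(2)[of _ 3 2] r(2)[of _ 4 2] r(2)[of _ 5 2] r(2)[of _ 6 2] r(2)[of _ 7 2] r(2)[of _ 4 3] r(2)[of _ 5 3] r(2)[of _ 6 3] r(2)[of _ 7 3]
    r(2)[of _ 5 4] r(2)[of _ 6 4] r(2)[of _ 7 4] r(2)[of _ 6 5] r(2)[of _ 7 5] r(2)[of _ 7 6]
  show ?thesis
    unfolding star_w_def by (simp add: sum_7 w_table w_skew(3) r')
qed

lemma star_w_swap: "star_w b a c d = - star_w a b c d" "star_w a c b d = - star_w a b c d" "star_w a b d c = - star_w a b c d"
proof -
  have r: "volx i j k b a c d = - volx i j k a b c d" "volx i j k a c b d = - volx i j k a b c d"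
    "volx i j k a b d c = - volx i j k a b c d" for i j k
    by (unfold volx_def) (rule vol7_swap)+
  show "star_w b a c d = - star_w a b c d" "star_w a c b d = - star_w a b c d" "star_w a b d c = - star_w a b c d"
    unfolding star_w_lines r by simp_all
qed

text \<open>Both sides are alternating, so only sorted indices have to be compared.\<close>

lemma star_w_sorted:
  assumes "rank7 a \<le> rank7 b" "rank7 b \<le> rank7 c" "rank7 c \<le> rank7 d"
  shows "star_w a b c d = psi a b c d"
  using exhaust_7[of a] exhaust_7[of b] exhaust_7[of c] exhaust_7[of d] assms
  by (elim disjE; simp add: rank7_values; simp add: star_w_lines volx_sort volx_rep rank7_values volx_id psi_def sum_7 w_table w_skew(3) d7_def)

lemma star_w_psi: "star_w a b c d = psi a b c d"
proof -
  have sw: "star_w a b c d = psi a b c d"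
    if "star_w b a c d = psi b a c d \<or> star_w a c b d = psi a c b d \<or> star_w a b d c = psi a b d c" for a b c d
    using that star_w_swap(1)[where a = a and b = b and c = c and d = d] star_w_swap(2)[where a = a and b = b and c = c and d = d]
      star_w_swap(3)[where a = a and b = b and c = c and d = d] psi_skew(1)[where i = a and j = b and k = c and l = d]
      psi_skew(2)[where i = a and j = b and k = c and l = d] psi_skew(3)[where i = a and j = b and k = c and l = d]
    by - (elim disjE; linarith)
  have 1: "star_w a b c d = psi a b c d" if "rank7 b \<le> rank7 c" "rank7 c \<le> rank7 d" for a b c d
  proof -
    consider "rank7 a \<le> rank7 b" | "rank7 b \<le> rank7 a" "rank7 a \<le> rank7 c" | "rank7 c \<le> rank7 a" "rank7 a \<le> rank7 d" | "rank7 d \<le> rank7 a"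
      by linarith
    then show ?thesis
    proof cases
      case 1 then show ?thesis using star_w_sorted that by blast
    next
      case 2 then show ?thesis using star_w_sorted[of b a c d] sw[where a = a and b = b and c = c and d = d] that by blast
    next
      case 3
      have "star_w b c a d = psi b c a d" using star_w_sorted that 3 by blast
      then have "star_w b a c d = psi b a c d" using sw[where a = b and b = a and c = c and d = d] by blast
      then show ?thesis using sw[where a = a and b = b and c = c and d = d] by blast
    next
      case 4
      have "star_w b c d a = psi b c d a" using star_w_sorted that 4 by blast
      then have "star_w b c a d = psi b c a d" using sw[where a = b and b = c and c = a and d = d] by blast
      then have "star_w b a c d = psi b a c d" using sw[where a = b and b = a and c = c and d = d] by blast
      then show ?thesis using sw[where a = a and b = b and c = c and d = d] by blast
    qed
  qed
  have 2: "star_w a b c d = psi a b c d" if "rank7 c \<le> rank7 d" for a b c d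
  proof -
    consider "rank7 b \<le> rank7 c" | "rank7 c \<le> rank7 b" "rank7 b \<le> rank7 d" | "rank7 d \<le> rank7 b" by linarith
    then show ?thesis
    proof cases
      assume h: "rank7 b \<le> rank7 c"
      then show ?thesis using that by (rule 1)
    next
      assume h: "rank7 c \<le> rank7 b" "rank7 b \<le> rank7 d"
      then have "star_w a c b d = psi a c b d" by (rule 1)
      then show ?thesis using sw[where a = a and b = b and c = c and d = d] by blast
    next
      assume h: "rank7 d \<le> rank7 b"
      have "star_w a c d b = psi a c d b" using that h by (rule 1)
      then have "star_w a c b d = psi a c b d" using sw[where a = a and b = c and c = b and d = d] by blast
      then show ?thesis using sw[where a = a and b = b and c = c and d = d] by blast
    qed
  qed
  show ?thesis
  proof (cases "rank7 c \<le> rank7 d")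
    case True then show ?thesis by (rule 2)
  next
    case False
    then have "star_w a b d c = psi a b d c" using 2[of d c a b] by simp
    then show ?thesis using sw[where a = a and b = b and c = c and d = d] by blast
  qed
qed

section \<open>Adapted frames\<close>

text \<open>Tangent vectors are functions on functions, a type without a scalar multiplication, so linear
  combinations are spelled out.\<close>

definition tcomb :: "(7 \<Rightarrow> real) \<Rightarrow> (7 \<Rightarrow> 'm tvec) \<Rightarrow> 'm tvec" where
  "tcomb a e = (\<lambda>f. \<Sum>i\<in>UNIV. a i * e i f)"

lemma tcomb_multilinear:
  fixes F :: "'m tvec \<Rightarrow> real"
  assumes T: "\<And>u v a b. u \<in> T \<Longrightarrow> v \<in> T \<Longrightarrow> lincomb a u b v \<in> T"
    and F: "\<And>u v a b. u \<in> T \<Longrightarrow> v \<in> T \<Longrightarrow> F (lincomb a u b v) = a * F u + b * F v"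
    and e: "\<And>i. e i \<in> T"
  shows "tcomb a e \<in> T" "F (tcomb a e) = (\<Sum>i\<in>UNIV. a i * F (e i))"
proof -
  have *: "(\<lambda>f. \<Sum>i\<in>I. a i * e i f) \<in> T \<and> F (\<lambda>f. \<Sum>i\<in>I. a i * e i f) = (\<Sum>i\<in>I. a i * F (e i))"
    if "finite I" for I
    using that
  proof (induction I rule: finite_induct)
    case empty
    have "(\<lambda>f. \<Sum>i\<in>{}. a i * e i f) = lincomb 0 (e 0) 0 (e 0)" by (simp add: lincomb_def)
    then show ?case using T[OF e e] F[OF e e] by simp
  next
    case (insert i I)
    have "(\<lambda>f. \<Sum>i\<in>insert i I. a i * e i f) = lincomb (a i) (e i) 1 (\<lambda>f. \<Sum>i\<in>I. a i * e i f)"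
      using insert by (simp add: lincomb_def)
    then show ?case using T[OF e] F[OF e] insert by simp
  qed
  show "tcomb a e \<in> T" "F (tcomb a e) = (\<Sum>i\<in>UNIV. a i * F (e i))"
    using *[of UNIV] by (simp_all add: tcomb_def)
qed

context
  fixes A :: "'m::t2_space chart set"
    and g :: "'m \<Rightarrow> 'm tvec \<Rightarrow> 'm tvec \<Rightarrow> real"
    and om :: "'m form3"
  assumes atlas: "oriented_atlas A" and metric: "riemannian_metric A g" and three: "three_form A om"
begin

lemma lincomb_tangent: "u \<in> tangent_space A p \<Longrightarrow> v \<in> tangent_space A p \<Longrightarrow> lincomb a u b v \<in> tangent_space A p"
  unfolding tangent_space_def lincomb_def by (simp add: algebra_simps) metis

lemma g_lin: "u \<in> tangent_space A p \<Longrightarrow> v \<in> tangent_space A p \<Longrightarrow> z \<in> tangent_space A p \<Longrightarrow>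
    g p (lincomb a u b v) z = a * g p u z + b * g p v z"
  and g_sym: "u \<in> tangent_space A p \<Longrightarrow> v \<in> tangent_space A p \<Longrightarrow> g p u v = g p v u"
proof -
  have m: "\<forall>p. \<forall>u\<in>tangent_space A p. \<forall>v\<in>tangent_space A p. \<forall>w\<in>tangent_space A p.
        (\<forall>a b. g p (lincomb a u b v) w = a * g p u w + b * g p v w) \<and> g p u v = g p v u"
    using metric unfolding riemannian_metric_def by (rule conjunct1)
  show "g p (lincomb a u b v) z = a * g p u z + b * g p v z"
    if "u \<in> tangent_space A p" "v \<in> tangent_space A p" "z \<in> tangent_space A p" using m that by simp
  show "g p u v = g p v u" if "u \<in> tangent_space A p" "v \<in> tangent_space A p"
    using bspec[OF bspec[OF bspec[OF spec[OF m] that(1)] that(2)] that(1)] by simp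
qed

lemma om_lin: "u \<in> tangent_space A p \<Longrightarrow> v \<in> tangent_space A p \<Longrightarrow> x \<in> tangent_space A p \<Longrightarrow> z \<in> tangent_space A p \<Longrightarrow>
    om p (lincomb a u b v) x z = a * om p u x z + b * om p v x z"
  and om_skew: "u \<in> tangent_space A p \<Longrightarrow> v \<in> tangent_space A p \<Longrightarrow> x \<in> tangent_space A p \<Longrightarrow> om p u v x = - om p v u x"
    "u \<in> tangent_space A p \<Longrightarrow> v \<in> tangent_space A p \<Longrightarrow> x \<in> tangent_space A p \<Longrightarrow> om p u v x = - om p u x v"
  using three unfolding three_form_def by blast+

context
  fixes p e assumes e: "\<And>i::7. e i \<in> tangent_space A p"
begin

lemma tcomb_tangent: "tcomb a e \<in> tangent_space A p"
  using tcomb_multilinear(1)[OF lincomb_tangent, of p "\<lambda>v. 0" e a] e by simp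

lemma g_tcomb: "z \<in> tangent_space A p \<Longrightarrow> g p (tcomb a e) z = (\<Sum>i\<in>UNIV. a i * g p (e i) z)"
  using tcomb_multilinear(2)[OF lincomb_tangent, of p "\<lambda>v. g p v z" e a] g_lin e by simp

lemma g_tcomb': "z \<in> tangent_space A p \<Longrightarrow> g p z (tcomb a e) = (\<Sum>i\<in>UNIV. a i * g p z (e i))"
  using g_tcomb[of z a] g_sym[of z p] tcomb_tangent[of a] e by simp

lemma om_tcomb1: "x \<in> tangent_space A p \<Longrightarrow> z \<in> tangent_space A p \<Longrightarrow> om p (tcomb a e) x z = (\<Sum>i\<in>UNIV. a i * om p (e i) x z)"
  using tcomb_multilinear(2)[OF lincomb_tangent, of p "\<lambda>v. om p v x z" e a] om_lin e by simp

lemma om_tcomb2: "x \<in> tangent_space A p \<Longrightarrow> z \<in> tangent_space A p \<Longrightarrow> om p x (tcomb a e) z = (\<Sum>i\<in>UNIV. a i * om p x (e i) z)"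
  using om_tcomb1[of x z a] om_skew(1)[of x p "tcomb a e" z] om_skew(1)[of x p "e _" z] tcomb_tangent[of a] e
  by (simp add: sum_negf)

lemma om_tcomb3: "x \<in> tangent_space A p \<Longrightarrow> z \<in> tangent_space A p \<Longrightarrow> om p x z (tcomb a e) = (\<Sum>i\<in>UNIV. a i * om p x z (e i))"
  using om_tcomb2[of x z a] om_skew(2)[of x p z "tcomb a e"] om_skew(2)[of x p z "e _"] tcomb_tangent[of a] e
  by (simp add: sum_negf)

end

lemma tangent_eqI:
  assumes v: "v \<in> tangent_space A p" and u: "u \<in> tangent_space A p" and V: "(V, \<phi>) \<in> A" "p \<in> V"
    and eq: "\<And>j. v (\<lambda>q. \<phi> q $ j) = u (\<lambda>q. \<phi> q $ j)"
  shows "v = u"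
proof
  fix f
  show "v f = u f"
  proof (cases "smooth_near A p f")
    case True
    then obtain U where U: "open U" "p \<in> U" "smooth_map A U f" by (auto simp: smooth_near_def)
    show ?thesis
      using tv_chart'[OF atlas v V U] tv_chart'[OF atlas u V U] eq by simp
  next
    case False
    then show ?thesis using tv_rough[OF atlas v] tv_rough[OF atlas u] by simp
  qed
qed

context
  fixes p e assumes on: "oriented_orthonormal A g p e"
begin

lemma on_tangent: "e i \<in> tangent_space A p"
  using on by (simp add: oriented_orthonormal_def)

lemma on_g: "g p (e i) (e j) = d7 i j"
  using on by (simp add: oriented_orthonormal_def d7_def)

lemma on_det: "(V, \<phi>) \<in> A \<Longrightarrow> p \<in> V \<Longrightarrow> det (\<chi> i j. e i (\<lambda>q. \<phi> q $ j)) > 0"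
  using on unfolding oriented_orthonormal_def by auto

text \<open>A frame is orthonormal and, by its positive determinant in a chart, spans the tangent space.\<close>

lemma frame_expand:
  assumes v: "v \<in> tangent_space A p"
  shows "v = tcomb (\<lambda>i. g p v (e i)) e"
proof -
  obtain V \<phi> where V: "(V, \<phi>) \<in> A" "p \<in> V" by (rule chart_exists[OF atlas])
  define M :: "real^7^7" where "M = (\<chi> i j. e i (\<lambda>q. \<phi> q $ j))"
  have "det M > 0" unfolding M_def by (rule on_det[OF V])
  then have "invertible (transpose M)" by (simp add: invertible_det_nz det_transpose)
  then obtain M' where M': "transpose M ** M' = mat 1" by (auto simp: invertible_def)
  define c where "c = M' *v (\<chi> j. v (\<lambda>q. \<phi> q $ j))"
  have c: "transpose M *v c = (\<chi> j. v (\<lambda>q. \<phi> q $ j))"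
    unfolding c_def by (simp only: matrix_vector_mul_assoc M' matrix_vector_mul_lid)
  have v_eq: "v = tcomb (\<lambda>i. c $ i) e"
  proof (rule tangent_eqI[OF v tcomb_tangent[OF on_tangent] V])
    fix j
    have "v (\<lambda>q. \<phi> q $ j) = (transpose M *v c) $ j" by (simp only: c vec_lambda_beta)
    also have "\<dots> = tcomb (\<lambda>i. c $ i) e (\<lambda>q. \<phi> q $ j)"
      by (simp only: matrix_vector_mult_def Finite_Cartesian_Product.transpose_def M_def tcomb_def vec_lambda_beta mult.commute)
    finally show "v (\<lambda>q. \<phi> q $ j) = tcomb (\<lambda>i. c $ i) e (\<lambda>q. \<phi> q $ j)" .
  qed
  have "g p v (e i) = c $ i" for i
    by (subst v_eq) (simp add: g_tcomb[OF on_tangent on_tangent] on_g)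
  then show ?thesis using v_eq by simp
qed

end

lemma frame_change_matrix:
  assumes on: "oriented_orthonormal A g p e" and on': "oriented_orthonormal A g p e'"
  defines "h \<equiv> (\<chi> j i. g p (e' i) (e j))"
  shows "orthogonal_matrix h" "det h = 1" "e' = frame_act e h" "e i = tcomb (\<lambda>j. h $ i $ j) e'"
proof -
  note T = on_tangent[OF on] and T' = on_tangent[OF on']
  have e': "e' i = tcomb (\<lambda>j. h $ j $ i) e" for i
    using frame_expand[OF on T'[of i]] by (simp add: h_def)
  show act: "e' = frame_act e h" by (rule ext) (simp add: e' frame_act_def tcomb_def)
  show "e i = tcomb (\<lambda>j. h $ i $ j) e'"
    using frame_expand[OF on' T[of i]] g_sym[OF T T'] by (simp add: h_def)
  have "d7 i j = (\<Sum>k\<in>UNIV. h $ k $ i * h $ k $ j)" for i j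
  proof -
    have "d7 i j = g p (tcomb (\<lambda>k. h $ k $ i) e) (tcomb (\<lambda>k. h $ k $ j) e)"
      using on_g[OF on', of i j] e'[of i] e'[of j] by simp
    also have "\<dots> = (\<Sum>k\<in>UNIV. h $ k $ i * h $ k $ j)"
      by (simp add: g_tcomb[OF T tcomb_tangent[OF T]] g_tcomb'[OF T T] on_g[OF on])
    finally show ?thesis .
  qed
  then have "transpose h ** h = mat 1"
    by (simp add: vec_eq_iff matrix_matrix_mult_def Finite_Cartesian_Product.transpose_def mat_def d7_def)
  then show orth: "orthogonal_matrix h" by (simp add: orthogonal_matrix)
  obtain V \<phi> where V: "(V, \<phi>) \<in> A" "p \<in> V" by (rule chart_exists[OF atlas])
  have "(\<chi> i j. e' i (\<lambda>q. \<phi> q $ j)) = transpose h ** (\<chi> i j. e i (\<lambda>q. \<phi> q $ j))"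
    by (simp add: vec_eq_iff act frame_act_def matrix_matrix_mult_def Finite_Cartesian_Product.transpose_def)
  then have "det (\<chi> i j. e' i (\<lambda>q. \<phi> q $ j)) = det h * det (\<chi> i j. e i (\<lambda>q. \<phi> q $ j))"
    by (simp add: det_mul det_transpose)
  then have "det h > 0" using on_det[OF on V] on_det[OF on' V] by (simp add: zero_less_mult_iff)
  then show "det h = 1" using det_orthogonal_matrix[OF orth] by auto
qed

lemma ad_on: "adapted_frame A g om p e \<Longrightarrow> oriented_orthonormal A g p e"
  by (simp add: adapted_frame_def)

lemma ad_om: "adapted_frame A g om p e \<Longrightarrow> om p (e i) (e j) (e k) = w i j k"
  by (simp add: adapted_frame_def w_def)

lemma om_frame:
  assumes T: "\<And>i. e i \<in> tangent_space A p"
  shows "om p (tcomb a e) (tcomb b e) (tcomb c e)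
     = (\<Sum>i\<in>UNIV. \<Sum>j\<in>UNIV. \<Sum>k\<in>UNIV. a i * (b j * (c k * om p (e i) (e j) (e k))))"
  by (simp add: om_tcomb1[OF T tcomb_tangent[OF T] tcomb_tangent[OF T]] om_tcomb2[OF T T tcomb_tangent[OF T]]
      om_tcomb3[OF T T T] sum_distrib_left)

lemma omega0_sum: "omega0 x y z = (\<Sum>i\<in>UNIV. \<Sum>j\<in>UNIV. \<Sum>k\<in>UNIV. x $ i * (y $ j * (z $ k * w i j k)))"
proof -
  have "cross7 x y = cross7 (\<Sum>i\<in>UNIV. x $ i *\<^sub>R axis i 1) (\<Sum>j\<in>UNIV. y $ j *\<^sub>R axis j 1)"
    by (simp only: axis_expansion)
  also have "\<dots> = (\<Sum>i\<in>UNIV. \<Sum>j\<in>UNIV. (x $ i * y $ j) *\<^sub>R cross7 (axis i 1) (axis j 1))"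
    by (simp only: cross7_sum(1)) (simp only: cross7_sum(2) cross7_linear scaleR_sum_right scaleR_scaleR mult.commute)
  finally have "cross7 x y = (\<Sum>i\<in>UNIV. \<Sum>j\<in>UNIV. (x $ i * y $ j) *\<^sub>R cross7 (axis i 1) (axis j 1))" .
  then show ?thesis
    by (simp add: omega0_cross7 inner_sum_left inner_vec_def[of "cross7 _ _"] cross7_axis_nth sum_distrib_left mult_ac)
qed

text \<open>Two adapted frames differ by an element of the stabiliser, which is where spinors in different frames can
  be compared.\<close>

lemma adapted_frame_change:
  assumes ad: "adapted_frame A g om p e" and ad': "adapted_frame A g om p e'"
  shows "\<exists>h\<in>G2. e' = frame_act e h"
proof -
  define h :: "real^7^7" where "h = (\<chi> j i. g p (e' i) (e j))"
  note fc = frame_change_matrix[OF ad_on[OF ad] ad_on[OF ad'], folded h_def]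
  have e': "e' i = tcomb (\<lambda>j. h $ j $ i) e" for i
    using fc(3) by (simp add: frame_act_def tcomb_def)
  have T: "e i \<in> tangent_space A p" for i by (rule on_tangent[OF ad_on[OF ad]])
  have col: "omega0 (h *v axis i 1) (h *v axis j 1) (h *v axis k 1) = w i j k" for i j k
  proof -
    have "w i j k = om p (tcomb (\<lambda>a. h $ a $ i) e) (tcomb (\<lambda>a. h $ a $ j) e) (tcomb (\<lambda>a. h $ a $ k) e)"
      using ad_om[OF ad', of i j k] by (simp add: e')
    also have "\<dots> = omega0 (h *v axis i 1) (h *v axis j 1) (h *v axis k 1)"
      by (simp add: om_frame[OF T] ad_om[OF ad] omega0_sum matrix_vector_mult_basis column_def)
    finally show ?thesis by simp
  qed
  have "omega0 (h *v x) (h *v y) (h *v z) = omega0 x y z" for x y z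
  proof -
    note L = matrix_vector_right_distrib matrix_vector_mult_scaleR cross7_linear inner_add_left inner_add_right
    have 0: "cross7 (h *v axis i 1) (h *v axis j 1) \<bullet> (h *v axis k 1) - cross7 (axis i 1) (axis j 1) \<bullet> axis k 1 = 0" for i j k
      using col[of i j k] by (simp add: omega0_cross7 w_def)
    have 1: "cross7 (h *v x) (h *v axis j 1) \<bullet> (h *v axis k 1) - cross7 x (axis j 1) \<bullet> axis k 1 = 0" for x j k
      by (rule lin_axes_zero[of "\<lambda>x. cross7 (h *v x) (h *v axis j 1) \<bullet> (h *v axis k 1) - cross7 x (axis j 1) \<bullet> axis k 1", OF _ 0])
        (rule linearI; simp add: L algebra_simps)
    have 2: "cross7 (h *v x) (h *v y) \<bullet> (h *v axis k 1) - cross7 x y \<bullet> axis k 1 = 0" for x y k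
      by (rule lin_axes_zero[of "\<lambda>y. cross7 (h *v x) (h *v y) \<bullet> (h *v axis k 1) - cross7 x y \<bullet> axis k 1", OF _ 1])
        (rule linearI; simp add: L algebra_simps)
    have "cross7 (h *v x) (h *v y) \<bullet> (h *v z) - cross7 x y \<bullet> z = 0"
      by (rule lin_axes_zero[of "\<lambda>z. cross7 (h *v x) (h *v y) \<bullet> (h *v z) - cross7 x y \<bullet> z", OF _ 2])
        (rule linearI; simp add: L algebra_simps)
    then show ?thesis by (simp add: omega0_cross7)
  qed
  then have "h \<in> G2" using fc(1,2) by (simp add: G2_def)
  then show ?thesis using fc(3) by blast
qed

lemma frame_act_adapted:
  assumes ad: "adapted_frame A g om p e" and h: "h \<in> G2"
  shows "adapted_frame A g om p (frame_act e h)"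
proof -
  have T: "e i \<in> tangent_space A p" for i by (rule on_tangent[OF ad_on[OF ad]])
  have act: "frame_act e h i = tcomb (\<lambda>j. h $ j $ i) e" for i by (simp add: frame_act_def tcomb_def)
  have orth: "transpose h ** h = mat 1" and det: "det h = 1" using h by (auto simp: G2_def orthogonal_matrix_def)
  have gg: "g p (frame_act e h i) (frame_act e h j) = (if i = j then 1 else 0)" for i j
  proof -
    have "g p (frame_act e h i) (frame_act e h j) = (\<Sum>k\<in>UNIV. h $ k $ i * h $ k $ j)"
      by (simp add: act g_tcomb[OF T tcomb_tangent[OF T]] g_tcomb'[OF T T] on_g[OF ad_on[OF ad]])
    also have "\<dots> = (transpose h ** h) $ i $ j"
      by (simp add: matrix_matrix_mult_def Finite_Cartesian_Product.transpose_def)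
    finally show ?thesis by (simp add: orth mat_def)
  qed
  have dd: "det (\<chi> i j. frame_act e h i (\<lambda>q. \<phi> q $ j)) > 0" if V: "(V, \<phi>) \<in> A" "p \<in> V" for V \<phi>
  proof -
    have "(\<chi> i j. frame_act e h i (\<lambda>q. \<phi> q $ j)) = transpose h ** (\<chi> i j. e i (\<lambda>q. \<phi> q $ j))"
      by (simp add: vec_eq_iff frame_act_def matrix_matrix_mult_def Finite_Cartesian_Product.transpose_def)
    then show ?thesis using on_det[OF ad_on[OF ad] V] det by (simp add: det_mul det_transpose)
  qed
  have "om p (frame_act e h i) (frame_act e h j) (frame_act e h k) = w i j k" for i j k
  proof -
    have "om p (frame_act e h i) (frame_act e h j) (frame_act e h k) = omega0 (h *v axis i 1) (h *v axis j 1) (h *v axis k 1)"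
      by (simp add: act om_frame[OF T] ad_om[OF ad] omega0_sum matrix_vector_mult_basis column_def)
    then show ?thesis using h by (simp add: G2_def w_def)
  qed
  then show ?thesis
    using gg dd tcomb_tangent[OF T] by (auto simp: adapted_frame_def oriented_orthonormal_def act w_def)
qed

text \<open>The Hodge star is defined by an arbitrary oriented orthonormal frame. The change to the adapted frame has
  determinant \<open>1\<close>, so the value agrees with the model computation \<open>star_w_psi\<close>.\<close>

lemma hodge_adapted:
  assumes ad: "adapted_frame A g om p e"
  shows "hodge_star A g om p (e a) (e b) (e c) (e d) = psi a b c d"
proof -
  define e' where "e' = (SOME e. oriented_orthonormal A g p e)"
  have on': "oriented_orthonormal A g p e'"
    unfolding e'_def by (rule someI[of "oriented_orthonormal A g p", OF ad_on[OF ad]])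
  note T' = on_tangent[OF on'] and T = on_tangent[OF ad_on[OF ad]]
  define h :: "real^7^7" where "h = (\<chi> j i. g p (e i) (e' j))"
  note fc = frame_change_matrix[OF on' ad_on[OF ad], folded h_def]
  have co: "(\<chi> a. g p (e i) (e' a)) = h *v axis i 1" for i
    by (simp add: h_def matrix_vector_mult_basis column_def vec_eq_iff)
  have e': "e' a = tcomb (\<lambda>i. h $ a $ i) e" for a by (rule fc(4))
  have om': "om p (e' i) (e' j) (e' k) = (\<Sum>x\<in>UNIV. \<Sum>y\<in>UNIV. \<Sum>z\<in>UNIV. h $ i $ x * (h $ j $ y * (h $ k $ z * w x y z)))" for i j k
    by (simp add: e' om_frame[OF T] ad_om[OF ad])
  let ?ha = "\<lambda>i. h *v axis i 1"
  have ex: "?ha x = (\<Sum>i\<in>UNIV. h $ i $ x *\<^sub>R axis i 1)" for x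
    using axis_expansion[of "?ha x", symmetric] by (simp add: matrix_vector_mult_basis column_def)
  have V: "(\<Sum>i\<in>UNIV. \<Sum>j\<in>UNIV. \<Sum>k\<in>UNIV. h $ i $ x * (h $ j $ y * (h $ k $ z * vol7 (axis i 1) (axis j 1) (axis k 1) r s u v)))
     = vol7 (?ha x) (?ha y) (?ha z) r s u v" for x y z r s u v
  proof -
    have 1: "vol7 (?ha x) (?ha y) (?ha z) r s u v = (\<Sum>i\<in>UNIV. h $ i $ x * vol7 (axis i 1) (?ha y) (?ha z) r s u v)"
      unfolding ex[of x] by (simp add: linear_sum[OF linear_vol7(1)] linear_scale[OF linear_vol7(1)])
    have 2: "vol7 (axis i 1) (?ha y) (?ha z) r s u v = (\<Sum>j\<in>UNIV. h $ j $ y * vol7 (axis i 1) (axis j 1) (?ha z) r s u v)" for i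
      unfolding ex[of y] by (simp add: linear_sum[OF linear_vol7(2)] linear_scale[OF linear_vol7(2)])
    have 3: "vol7 (axis i 1) (axis j 1) (?ha z) r s u v = (\<Sum>k\<in>UNIV. h $ k $ z * vol7 (axis i 1) (axis j 1) (axis k 1) r s u v)" for i j
      unfolding ex[of z] by (simp add: linear_sum[OF linear_vol7(3)] linear_scale[OF linear_vol7(3)])
    show ?thesis by (simp only: 1 2 3 sum_distrib_left)
  qed
  have "hodge_star A g om p (e a) (e b) (e c) (e d) =
     (1/6) * (\<Sum>i\<in>UNIV. \<Sum>j\<in>UNIV. \<Sum>k\<in>UNIV. om p (e' i) (e' j) (e' k) * vol7 (axis i 1) (axis j 1) (axis k 1) (?ha a) (?ha b) (?ha c) (?ha d))"
    unfolding hodge_star_def Let_def e'_def[symmetric] co vol7_def ..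
  also have "(\<Sum>i\<in>UNIV. \<Sum>j\<in>UNIV. \<Sum>k\<in>UNIV. om p (e' i) (e' j) (e' k) * vol7 (axis i 1) (axis j 1) (axis k 1) (?ha a) (?ha b) (?ha c) (?ha d))
     = (\<Sum>(i,j,k)\<in>UNIV. \<Sum>(x,y,z)\<in>UNIV. w x y z * (h $ i $ x * (h $ j $ y * (h $ k $ z * vol7 (axis i 1) (axis j 1) (axis k 1) (?ha a) (?ha b) (?ha c) (?ha d)))))"
    by (simp add: om' sum_distrib_right sum_distrib_left UNIV_Times_UNIV[symmetric] sum.cartesian_product[symmetric] mult_ac del: UNIV_Times_UNIV)
  also have "\<dots> = (\<Sum>(x,y,z)\<in>UNIV. \<Sum>(i,j,k)\<in>UNIV. w x y z * (h $ i $ x * (h $ j $ y * (h $ k $ z * vol7 (axis i 1) (axis j 1) (axis k 1) (?ha a) (?ha b) (?ha c) (?ha d)))))"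
    unfolding split_beta by (rule sum.swap)
  also have "\<dots> = (\<Sum>x\<in>UNIV. \<Sum>y\<in>UNIV. \<Sum>z\<in>UNIV. w x y z * vol7 (?ha x) (?ha y) (?ha z) (?ha a) (?ha b) (?ha c) (?ha d))"
    unfolding V[symmetric] sum_distrib_left
    by (simp add: UNIV_Times_UNIV[symmetric] sum.cartesian_product[symmetric] del: UNIV_Times_UNIV)
  also have "\<dots> = (\<Sum>x\<in>UNIV. \<Sum>y\<in>UNIV. \<Sum>z\<in>UNIV. w x y z * volx x y z a b c d)"
    by (simp add: vol7_mult fc(2) volx_def)
  finally show ?thesis using star_w_psi[of a b c d] by (simp add: star_w_def)
qed

end

section \<open>The characteristic connection in an adapted frame\<close>

lemma w_action_w: "w_action (w i) j k l = 3 * psi i j k l"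
proof -
  have "w_action (w i) j k l = (\<Sum>m\<in>UNIV. w i j m * w k l m) + (\<Sum>m\<in>UNIV. w i k m * w l j m) + (\<Sum>m\<in>UNIV. w i l m * w j k m)"
  proof -
    have "w m k l = w k l m" "w j m l = w l j m" for m
      by (rule w_cyc, rule w_cyc[symmetric])
    then show ?thesis by (simp only: w_action_def sum.distrib)
  qed
  then show ?thesis
    using psi_skew(2)[of i j l k] psi_skew(3)[of i l j k] psi_cyc(1)[of i j k l] psi_cyc(1)[of i k l j]
    by (simp add: sum_w_w_psi d7_simps(2)[of l] d7_simps(2)[of k j])
qed

text \<open>The Lie algebra of the stabiliser annihilates the invariant spinor and acts on the vector part as on vectors.
  This is why the spinor derivative splits.\<close>

lemma g2_spin_action:
  fixes gam :: "7 \<Rightarrow> 'k::{real_normed_field,euclidean_space}^8^8"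
  assumes spin: "spin_representation gam" and s0: "adapted_vec gam s0" "s0 \<noteq> 0"
    and P: "\<And>j k l. w_action P j k l = 0"
  shows "(\<Sum>i\<in>UNIV. \<Sum>j\<in>UNIV. P i j *\<^sub>R gv gam i (gv gam j (Phi gam s0 f X)))
     = 4 *\<^sub>R Phi gam s0 0 (\<chi> j. \<Sum>k\<in>UNIV. P k j *\<^sub>R X $ k)"
proof -
  let ?g = "gv gam" 
  note lin = gv_linear[OF spin] 
  have skew: "P j i = - P i j" for i j by (rule w_action_zero(1)[OF P])
  have 0: "(\<Sum>i\<in>UNIV. \<Sum>j\<in>UNIV. P i j *\<^sub>R ?g i (?g j s0)) = 0"
  proof -
    have "(\<Sum>i\<in>UNIV. \<Sum>j\<in>UNIV. P i j *\<^sub>R ?g i (?g j s0))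
       = (\<Sum>i\<in>UNIV. \<Sum>j\<in>UNIV. \<Sum>k\<in>UNIV. (P i j * w i j k) *\<^sub>R ?g k s0) - (\<Sum>i\<in>UNIV. \<Sum>j\<in>UNIV. (P i j * d7 i j) *\<^sub>R s0)"
      by (simp add: adapted_vec_mult[OF spin s0(1)] scaleR_right_diff_distrib scaleR_sum_right sum_subtractf)
    also have "(\<Sum>i\<in>UNIV. \<Sum>j\<in>UNIV. (P i j * d7 i j) *\<^sub>R s0) = (\<Sum>i\<in>UNIV. P i i *\<^sub>R s0)"
      by (simp only: scaleR_sum_left[symmetric] sum_d7)
    also have "\<dots> = 0"
    proof -
      have "P i i = 0" for i using skew[of i i] by simp
      then show ?thesis by simp
    qed
    also have "(\<Sum>i\<in>UNIV. \<Sum>j\<in>UNIV. \<Sum>k\<in>UNIV. (P i j * w i j k) *\<^sub>R ?g k s0)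
       = (\<Sum>k\<in>UNIV. (\<Sum>i\<in>UNIV. \<Sum>j\<in>UNIV. P i j * w i j k) *\<^sub>R ?g k s0)"
      by (subst sum_rot) (simp add: scaleR_sum_left)
    also have "\<dots> = 0" by (simp add: w_action_zero(2)[OF P])
    finally show ?thesis by simp
  qed
  have 1: "(\<Sum>i\<in>UNIV. \<Sum>j\<in>UNIV. P i j *\<^sub>R ?g i (?g j (?g k s0))) = 4 *\<^sub>R (\<Sum>j\<in>UNIV. P k j *\<^sub>R ?g j s0)" for k
  proof -
    have c: "?g i (?g j (?g k s0)) = ?g k (?g i (?g j s0)) + (2 * d7 i k) *\<^sub>R ?g j s0 - (2 * d7 j k) *\<^sub>R ?g i s0" for i j
    proof -
      have "?g j (?g k s0) = - ?g k (?g j s0) - (2 * d7 j k) *\<^sub>R s0"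
        using gv_anticomm[OF spin, of j k s0] by (auto simp: d7_def add_eq_0_iff2 eq_diff_eq)
      then have "?g i (?g j (?g k s0)) = - ?g i (?g k (?g j s0)) - (2 * d7 j k) *\<^sub>R ?g i s0" by (simp add: lin)
      moreover have "?g i (?g k (?g j s0)) = - ?g k (?g i (?g j s0)) - (2 * d7 i k) *\<^sub>R ?g j s0"
        using gv_anticomm[OF spin, of i k "?g j s0"] by (auto simp: d7_def add_eq_0_iff2 eq_diff_eq)
      ultimately show ?thesis by simp
    qed
    have "(\<Sum>i\<in>UNIV. \<Sum>j\<in>UNIV. P i j *\<^sub>R ?g i (?g j (?g k s0)))
      = ?g k (\<Sum>i\<in>UNIV. \<Sum>j\<in>UNIV. P i j *\<^sub>R ?g i (?g j s0))
        + (\<Sum>i\<in>UNIV. \<Sum>j\<in>UNIV. (P i j * (2 * d7 i k)) *\<^sub>R ?g j s0) - (\<Sum>i\<in>UNIV. \<Sum>j\<in>UNIV. (P i j * (2 * d7 j k)) *\<^sub>R ?g i s0)"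
      by (simp add: c gv_sum[OF spin] lin scaleR_right_diff_distrib scaleR_right_distrib sum.distrib sum_subtractf)
    also have "(\<Sum>i\<in>UNIV. \<Sum>j\<in>UNIV. (P i j * (2 * d7 i k)) *\<^sub>R ?g j s0) = (\<Sum>j\<in>UNIV. (2 * P k j) *\<^sub>R ?g j s0)"
      by (subst sum.swap) (simp only: scaleR_sum_left[symmetric] mult.left_commute[of _ 2] sum_distrib_left[symmetric] sum_d7)
    also have "(\<Sum>i\<in>UNIV. \<Sum>j\<in>UNIV. (P i j * (2 * d7 j k)) *\<^sub>R ?g i s0) = (\<Sum>i\<in>UNIV. (2 * P i k) *\<^sub>R ?g i s0)"
      by (simp only: scaleR_sum_left[symmetric] mult.left_commute[of _ 2] sum_distrib_left[symmetric] sum_d7)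
    also have "\<dots> = - (\<Sum>i\<in>UNIV. (2 * P k i) *\<^sub>R ?g i s0)"
      by (simp add: skew[of k] sum_negf)
    finally show ?thesis
      by (simp add: 0 lin scaleR_sum_right sum.distrib[symmetric] scaleR_left_distrib[symmetric])
  qed
  have "(\<Sum>i\<in>UNIV. \<Sum>j\<in>UNIV. P i j *\<^sub>R ?g i (?g j (Phi gam s0 f X)))
     = f *s (\<Sum>i\<in>UNIV. \<Sum>j\<in>UNIV. P i j *\<^sub>R ?g i (?g j s0))
       + (\<Sum>i\<in>UNIV. \<Sum>j\<in>UNIV. \<Sum>k\<in>UNIV. X $ k *s (P i j *\<^sub>R ?g i (?g j (?g k s0))))"
    by (simp add: Phi_def[OF spin s0] lin gv_sum[OF spin] scaleR_right_distrib sum.distrib scaleR_sum_right vec.scale_sum_right vector_smult_scaleR)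
  also have "(\<Sum>i\<in>UNIV. \<Sum>j\<in>UNIV. \<Sum>k\<in>UNIV. X $ k *s (P i j *\<^sub>R ?g i (?g j (?g k s0))))
     = (\<Sum>k\<in>UNIV. X $ k *s (\<Sum>i\<in>UNIV. \<Sum>j\<in>UNIV. P i j *\<^sub>R ?g i (?g j (?g k s0))))"
    by (subst sum_rot) (simp add: vec.scale_sum_right)
  also have "\<dots> = 4 *\<^sub>R (\<Sum>k\<in>UNIV. \<Sum>j\<in>UNIV. (P k j *\<^sub>R X $ k) *s ?g j s0)"
  proof -
    have "X $ k *s (4 *\<^sub>R (\<Sum>j\<in>UNIV. P k j *\<^sub>R ?g j s0)) = 4 *\<^sub>R (\<Sum>j\<in>UNIV. (P k j *\<^sub>R X $ k) *s ?g j s0)" for k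
      by (simp add: vec_eq_iff sum_component sum_distrib_left scaleR_sum_right)
    then show ?thesis by (simp only: 1 scaleR_sum_right[symmetric])
  qed
  also have "(\<Sum>k\<in>UNIV. \<Sum>j\<in>UNIV. (P k j *\<^sub>R X $ k) *s ?g j s0) = (\<Sum>j\<in>UNIV. (\<Sum>k\<in>UNIV. P k j *\<^sub>R X $ k) *s ?g j s0)"
    by (subst sum.swap) (simp add: vec.scale_sum_left)
  finally show ?thesis by (simp add: 0 Phi_def[OF spin s0])
qed

context
  fixes A :: "'m::t2_space chart set"
    and g :: "'m \<Rightarrow> 'm tvec \<Rightarrow> 'm tvec \<Rightarrow> real"
    and om :: "'m form3"
    and nabg nab :: "'m conn"
    and lam :: real
  assumes atlas: "oriented_atlas A"
    and metric: "riemannian_metric A g"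
    and G2s: "G2_structure A g om"
    and LC: "levi_civita A g nabg"
    and np: "nearly_parallel A g om nabg lam"
    and G2c: "G2_skew_connection A g om nab"
begin

lemma three: "three_form A om" using G2s by (simp add: G2_structure_def)

lemmas amt = atlas metric three

definition coeff :: "'m conn \<Rightarrow> (7 \<Rightarrow> 'm \<Rightarrow> 'm tvec) \<Rightarrow> 7 \<Rightarrow> 7 \<Rightarrow> 7 \<Rightarrow> 'm \<Rightarrow> real" where
  "coeff nb e i j k q = g q (nb q (e i q) (e j)) (e k q)"

lemma affine:
  assumes nb: "affine_connection A nb" and U: "open U" "q \<in> U" and Y: "vector_field A U Y"
  shows "v \<in> tangent_space A q \<Longrightarrow> nb q v Y \<in> tangent_space A q"
    "v \<in> tangent_space A q \<Longrightarrow> u \<in> tangent_space A q \<Longrightarrow> nb q (lincomb a v b u) Y = lincomb a (nb q v Y) b (nb q u Y)"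
  using nb U Y unfolding affine_connection_def by blast+

lemma affine_vf: "affine_connection A nb \<Longrightarrow> open U \<Longrightarrow> vector_field A U X \<Longrightarrow> vector_field A U Y \<Longrightarrow> vector_field A U (\<lambda>p. nb p (X p) Y)"
proof -
  assume nb: "affine_connection A nb" and v: "open U" "vector_field A U X" "vector_field A U Y"
  have "\<forall>U X Y. open U \<and> vector_field A U X \<and> vector_field A U Y \<longrightarrow> vector_field A U (\<lambda>p. nb p (X p) Y)"
    using nb unfolding affine_connection_def by (rule conjunct2)
  then show ?thesis using v by simp
qed

lemma affs: "affine_connection A nabg" "affine_connection A nab"
  using LC G2c by (auto simp: levi_civita_def G2_skew_connection_def)

context
  fixes U e
  assumes lf: "local_adapted_frame A g om U e"
begin

lemma lf_open: "open U" and lf_vf: "vector_field A U (e i)" and lf_ad: "q \<in> U \<Longrightarrow> adapted_frame A g om q (\<lambda>i. e i q)"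
  using lf by (auto simp: local_adapted_frame_def)

lemma lf_on: "q \<in> U \<Longrightarrow> oriented_orthonormal A g q (\<lambda>i. e i q)"
  using lf_ad by (simp add: adapted_frame_def)

lemma lf_tan: "q \<in> U \<Longrightarrow> e i q \<in> tangent_space A q"
  using vector_field_tangent[OF atlas lf_vf] .

lemma coeff_smooth: "affine_connection A nb \<Longrightarrow> smooth_map A U (coeff nb e i j k)"
proof -
  assume nb: "affine_connection A nb"
  have "\<forall>U X Y. open U \<and> vector_field A U X \<and> vector_field A U Y \<longrightarrow> smooth_map A U (\<lambda>p. g p (X p) (Y p))"
    using metric unfolding riemannian_metric_def by (elim conjE)
  then show ?thesis
    using affine_vf[OF nb lf_open lf_vf[of i] lf_vf[of j]] lf_open lf_vf[of k] unfolding coeff_def[abs_def] by simp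
qed

lemma conn_expand:
  assumes nb: "affine_connection A nb" and q: "q \<in> U"
  shows "nb q (e i q) (e j) = tcomb (\<lambda>k. coeff nb e i j k q) (\<lambda>k. e k q)"
  unfolding coeff_def
  by (rule frame_expand[OF amt lf_on[OF q] affine(1)[OF nb lf_open q lf_vf lf_tan[OF q]]])

text \<open>The covariant derivative of the three-form is, up to sign, the action of the connection
  coefficients, since its components in an adapted frame are constant.\<close>

lemma nabla_form3_frame:
  assumes nb: "affine_connection A nb" and q: "q \<in> U"
  shows "nabla_form3 nb om q (e i q) (e j) (e k) (e l) = - w_action (\<lambda>a b. coeff nb e i a b q) j k l"
proof -
  note T = lf_tan[OF q]
  have om: "om r (e a r) (e b r) (e c r) = w a b c" if "r \<in> U" for r a b c
    using ad_om[OF amt lf_ad[OF that]] by simp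
  have "e i q (\<lambda>r. om r (e j r) (e k r) (e l r)) = e i q (\<lambda>r. w j k l)"
    by (rule tv_local[OF atlas T lf_open q, symmetric]) (auto simp: om intro: smooth_map_const[OF atlas lf_open])
  then have 0: "e i q (\<lambda>r. om r (e j r) (e k r) (e l r)) = 0"
    using tv_const[OF atlas T] by simp
  show ?thesis
    unfolding nabla_form3_def conn_expand[OF nb q] 0
    by (simp add: om_tcomb1[OF amt T T T] om_tcomb2[OF amt T T T] om_tcomb3[OF amt T T T] om[OF q] w_action_def sum.distrib)
qed

lemma N_g2: "q \<in> U \<Longrightarrow> w_action (\<lambda>a b. coeff nab e i a b q) j k l = 0"
proof -
  assume q: "q \<in> U"
  have "nabla_form3 nab om q (e i q) (e j) (e k) (e l) = 0"
    using G2c lf_open q lf_vf lf_tan[OF q] unfolding G2_skew_connection_def by blast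
  then show ?thesis using nabla_form3_frame[OF affs(2) q, of i j k l] by simp
qed

lemma G_action:
  assumes q: "q \<in> U"
  shows "w_action (\<lambda>a b. coeff nabg e i a b q) j k l = lam / 4 * psi i j k l"
proof -
  have "nabla_form3 nabg om q (e i q) (e j) (e k) (e l) = - (lam / 4) * hodge_star A g om q (e i q) (e j q) (e k q) (e l q)"
    using np lf_open q lf_vf lf_tan[OF q] unfolding nearly_parallel_def by blast
  then show ?thesis
    using nabla_form3_frame[OF affs(1) q, of i j k l] hodge_adapted[OF amt lf_ad[OF q], of i j k l] by simp
qed

lemma lie_frame:
  assumes q: "q \<in> U"
  shows "lie_bracket A (e i) (e j) q = tcomb (\<lambda>k. coeff nabg e i j k q - coeff nabg e j i k q) (\<lambda>k. e k q)"
proof -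
  have "torsion A nabg (e i) (e j) q = 0"
    using LC lf_open q lf_vf unfolding levi_civita_def by blast
  then have "lie_bracket A (e i) (e j) q = nabg q (e i q) (e j) - nabg q (e j q) (e i)"
    by (simp add: torsion_def)
  then show ?thesis
    unfolding conn_expand[OF affs(1) q] by (simp add: fun_eq_iff tcomb_def left_diff_distrib sum_subtractf)
qed

lemma frame_bracket:
  assumes f: "smooth_map A U f" and q: "q \<in> U"
  shows "e i q (\<lambda>r. e j r f) - e j q (\<lambda>r. e i r f) = (\<Sum>k\<in>UNIV. (coeff nabg e i j k q - coeff nabg e j i k q) * e k q f)"
  using fun_cong[OF lie_frame[OF q, of i j], of f] smooth_nearI[OF atlas lf_open q f]
  by (simp add: lie_bracket_def tcomb_def)

text \<open>Lowering the Levi-Civita coefficients by \<open>\<lambda>/12\<close> times the three-form gives coefficients in the Lie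
  algebra of the stabiliser, because \<open>w\<close> acts on itself as \<open>3 psi\<close> and the nearly parallel equation prescribes
  \<open>\<lambda>/4 psi\<close>. The difference to \<open>\<nabla>\<close> is again such and totally skew, so it is zero.\<close>

lemma torsion_constant:
  assumes q: "q \<in> U"
  shows "coeff nab e i j k q - coeff nab e j i k q - (coeff nabg e i j k q - coeff nabg e j i k q) = - (lam / 6) * w i j k"
proof -
  note T = lf_tan[OF q]
  define Tn where "Tn i j k = coeff nab e i j k q - coeff nab e j i k q - (coeff nabg e i j k q - coeff nabg e j i k q)" for i j k
  have "torsion A nab (e i) (e j) q = tcomb (Tn i j) (\<lambda>k. e k q)" for i j
    unfolding torsion_def lie_frame[OF q] conn_expand[OF affs(2) q]
    by (simp add: fun_eq_iff tcomb_def Tn_def left_diff_distrib sum_subtractf)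
  then have gT: "g q (torsion A nab (e i) (e j) q) (e k q) = Tn i j k" for i j k
    by (simp add: g_tcomb[OF amt T T] on_g[OF amt lf_on[OF q]])
  have Tskew: "Tn i k j = - Tn i j k" for i j k
    using G2c lf_open q lf_vf gT[of i j k] gT[of i k j] unfolding G2_skew_connection_def by (metis minus_minus)
  define K where "K i j k = coeff nab e i j k q - (coeff nabg e i j k q - (lam / 12) * w i j k)" for i j k
  have act: "w_action (K i) j k l = 0" for i j k l
  proof -
    have "w_action (K i) j k l = w_action (\<lambda>a b. coeff nab e i a b q) j k l
        - (w_action (\<lambda>a b. coeff nabg e i a b q) j k l - lam / 12 * w_action (w i) j k l)"
      unfolding K_def[abs_def] by (simp only: w_action_linear)
    then show ?thesis
      using N_g2[OF q, of i j k l] G_action[OF q, of i j k l] unfolding w_action_w by (simp add: field_simps)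
  qed
  have Ks: "K i k j = - K i j k" for i j k by (rule w_action_zero(1)[OF act])
  have P: "K i j k - K j i k = Tn i j k + lam / 6 * w i j k" for i j k
    by (simp add: K_def Tn_def w_skew(1)[of j i])
  have Ks': "K k i j = - K j i k" for i j k
    using P[of i j k] P[of i k j] Tskew[of i k j] w_skew(2)[of i k j] Ks[of i k j] by simp
  have "K j i k = - K i j k" for i j k
    using Ks'[of j k i] Ks[of j k i] Ks[of i k j] by linarith
  then have "K i j k = 0" for i j k by (rule g2_valued_three_form_zero[OF _ act])
  then show ?thesis using P[of i j k] by (simp add: Tn_def)
qed

context
  fixes V \<phi> assumes V: "(V, \<phi>) \<in> A" "U \<subseteq> V"
begin

lemma frame_nondegenerate:
  assumes q: "q \<in> U" and a: "\<And>f. smooth_map A U f \<Longrightarrow> (\<Sum>k\<in>UNIV. a k * e k q f) = 0"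
  shows "a k = 0"
proof -
  define M :: "real^7^7" where "M = (\<chi> i j. e i q (\<lambda>r. \<phi> r $ j))"
  have "det M > 0" unfolding M_def using on_det[OF amt lf_on[OF q] V(1)] q V(2) by auto
  then have "invertible (transpose M)" by (simp add: invertible_det_nz det_transpose)
  moreover have "transpose M *v (\<chi> k. a k) = 0"
  proof -
    have "(\<Sum>k\<in>UNIV. a k * e k q (\<lambda>r. \<phi> r $ j)) = 0" for j
      by (rule a) (rule smooth_map_subset[OF atlas smooth_map_coordinate[OF atlas V(1)] V(2)])
    then show ?thesis
      by (simp only: vec_eq_iff matrix_vector_mult_def Finite_Cartesian_Product.transpose_def M_def vec_lambda_beta mult.commute zero_index) simp
  qed
  ultimately have "(\<chi> k. a k) = (0 :: real^7)"
    by (metis invertible_def matrix_vector_mul_assoc matrix_vector_mul_lid matrix_vector_mult_0_right)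
  then show ?thesis by (simp add: vec_eq_iff)
qed

lemmas calculus_facts = atlas lf_open lf_vf
  smooth_map_diff[OF atlas lf_open coeff_smooth[OF affs(1)] coeff_smooth[OF affs(1)]]
  coeff_smooth[OF affs(2)] frame_bracket frame_nondegenerate N_g2 torsion_constant

end
end

end

section \<open>Harmonic spinors\<close>

lemma frame_laplacian_cong:
  assumes atlas: "oriented_atlas A" and U: "open U" "q \<in> U" and e: "\<And>i. vector_field A U (e i)"
    and f: "smooth_map A U f" and eq: "\<And>r. r \<in> U \<Longrightarrow> f r = h r"
  shows "frame_laplacian e b f q = frame_laplacian e b h q"
proof -
  have 1: "e i r f = e i r h" if "r \<in> U" for i r
    by (rule tv_local[OF atlas vector_field_tangent[OF atlas e that] U(1) that f eq])
  have "e i q (\<lambda>r. e i r f) = e i q (\<lambda>r. e i r h)" for i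
    by (rule tv_local[OF atlas vector_field_tangent[OF atlas e U(2)] U])
       (auto intro: vector_field_smooth[OF atlas e U(1) order.refl f] 1)
  then show ?thesis using 1[OF U(2)] by (simp add: frame_laplacian_def[OF atlas])
qed

lemma frame_laplacian_const:
  assumes atlas: "oriented_atlas A" and U: "open U" "q \<in> U" and e: "\<And>i. vector_field A U (e i)"
  shows "frame_laplacian e b (\<lambda>r. c) q = 0"
proof -
  have 1: "e i r (\<lambda>r. a) = 0" if "r \<in> U" for i r a
    using tv_const[OF atlas vector_field_tangent[OF atlas e that]] .
  have "e i q (\<lambda>r. 0) = e i q (\<lambda>r. e i r (\<lambda>r. c))" for i
    by (rule tv_local[OF atlas vector_field_tangent[OF atlas e U(2)] U])
       (auto intro: smooth_map_const[OF atlas U(1)] simp: 1)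
  then show ?thesis using 1[OF U(2)] by (simp add: frame_laplacian_def[OF atlas])
qed

context
  fixes A :: "'m::t2_space chart set"
    and g :: "'m \<Rightarrow> 'm tvec \<Rightarrow> 'm tvec \<Rightarrow> real"
    and om :: "'m form3"
    and nabg nab :: "'m conn"
    and lam :: real
    and gam :: "7 \<Rightarrow> 'k::{real_normed_field,euclidean_space}^8^8"
    and kap :: "real^7^7 \<Rightarrow> 'k^8^8"
    and s0 :: "'k^8"
  assumes atlas: "oriented_atlas A"
    and metric: "riemannian_metric A g"
    and G2s: "G2_structure A g om"
    and LC: "levi_civita A g nabg"
    and np: "nearly_parallel A g om nabg lam"
    and G2c: "G2_skew_connection A g om nab"
    and spin: "spin_representation gam"
    and kap: "G2_lift gam kap"
    and s0: "adapted_vec gam s0" "s0 \<noteq> 0"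
begin

lemmas geo = atlas metric G2s LC np G2c
lemmas sp = spin s0
lemmas am3 = atlas metric three[OF geo]

text \<open>The scalars are real or complex; pairing with a fixed scalar \<open>b\<close> gives real functions, to which tangent
  vectors apply.\<close>

definition fcomp :: "('m, 'k) spinor \<Rightarrow> (7 \<Rightarrow> 'm \<Rightarrow> 'm tvec) \<Rightarrow> 'k \<Rightarrow> 'm \<Rightarrow> real" where
  "fcomp \<Psi> e b q = fpart gam s0 (\<Psi> q (\<lambda>i. e i q)) \<bullet> b"

definition Xcomp :: "('m, 'k) spinor \<Rightarrow> (7 \<Rightarrow> 'm \<Rightarrow> 'm tvec) \<Rightarrow> 'k \<Rightarrow> 7 \<Rightarrow> 'm \<Rightarrow> real" where
  "Xcomp \<Psi> e b k q = Xpart gam s0 (\<Psi> q (\<lambda>i. e i q)) $ k \<bullet> b"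

lemma bounded_linear_comps:
  "bounded_linear (\<lambda>y. fpart gam s0 y \<bullet> b)" "bounded_linear (\<lambda>y. Xpart gam s0 y $ k \<bullet> b)"
  using bounded_linear_compose[OF bounded_linear_inner_left bounded_linear_parts(1)[OF sp]]
    bounded_linear_compose[OF bounded_linear_inner_left bounded_linear_compose[OF bounded_linear_vec_nth bounded_linear_parts(2)[OF sp]]]
  by auto

context
  fixes \<Psi> :: "('m, 'k) spinor"
  assumes Psi: "spinor_field A g om kap \<Psi>"
begin

context
  fixes U e
  assumes lf: "local_adapted_frame A g om U e"
begin

lemma Psi_smooth: "smooth_map A U (\<lambda>q. \<Psi> q (\<lambda>i. e i q))"
  using Psi lf by (auto simp: spinor_field_def)

lemma comps_smooth: "smooth_map A U (fcomp \<Psi> e b)" "smooth_map A U (Xcomp \<Psi> e b k)"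
  unfolding fcomp_def[abs_def] Xcomp_def[abs_def]
  by (rule smooth_map_linear[OF atlas lf_open[OF geo lf] bounded_linear_comps(1) Psi_smooth]
      smooth_map_linear[OF atlas lf_open[OF geo lf] bounded_linear_comps(2) Psi_smooth])+

text \<open>The spin connection is a quarter of the Clifford action of the connection coefficients, which
  \<open>g2_spin_action\<close> turns into the covariant derivative of the vector part and nothing on the scalar part.\<close>

lemma spinor_nabla_parts:
  assumes q: "q \<in> U" and v: "v \<in> tangent_space A q"
    and P: "\<And>j k l. w_action (\<lambda>a b. g q (nab q v (e a)) (e b q)) j k l = 0"
  shows "fpart gam s0 (spinor_nabla g nab gam e q v \<Psi>) \<bullet> b = v (fcomp \<Psi> e b)"
    "Xpart gam s0 (spinor_nabla g nab gam e q v \<Psi>) $ j \<bullet> b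
      = v (Xcomp \<Psi> e b j) + (\<Sum>k\<in>UNIV. g q (nab q v (e k)) (e j q) * Xcomp \<Psi> e b k q)"
proof -
  define y where "y r = \<Psi> r (\<lambda>i. e i r)" for r
  define D where "D = (\<Sum>b\<in>Basis. v (\<lambda>r. y r \<bullet> b) *\<^sub>R b)"
  have ys: "smooth_map A U y" unfolding y_def[abs_def] by (rule Psi_smooth)
  note U = lf_open[OF geo lf]
  have LD: "L D = v (\<lambda>r. L (y r))" if L: "bounded_linear L" for L :: "'k^8 \<Rightarrow> real"
  proof -
    have s: "smooth_near A q (\<lambda>r. y r \<bullet> b)" for b
      by (rule smooth_nearI[OF atlas U q smooth_map_linear[OF atlas U bounded_linear_inner_left ys]])
    have "L (y r) = (\<Sum>b\<in>Basis. L b * (y r \<bullet> b))" for r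
      using linear_basis_expansion[OF bounded_linear.linear[OF L], of "y r"] by (simp add: mult.commute)
    then have "v (\<lambda>r. L (y r)) = v (\<lambda>r. \<Sum>b\<in>Basis. L b * (y r \<bullet> b))" by (simp only:)
    also have "\<dots> = (\<Sum>b\<in>Basis. v (\<lambda>r. L b * (y r \<bullet> b)))"
      by (rule tv_sum[OF atlas v]) (intro smooth_near_mult[OF atlas] smooth_near_const[OF atlas] s)
    also have "\<dots> = (\<Sum>b\<in>Basis. L b * v (\<lambda>r. y r \<bullet> b))"
      by (simp only: tv_cmult[OF atlas v s])
    also have "\<dots> = L D"
      unfolding D_def linear_sum[OF bounded_linear.linear[OF L]] linear_scale[OF bounded_linear.linear[OF L]]
      by (simp add: mult.commute)
    finally show ?thesis by simp
  qed
  define Z where "Z = (\<chi> j. \<Sum>k\<in>UNIV. g q (nab q v (e k)) (e j q) *\<^sub>R Xpart gam s0 (y q) $ k)"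
  have "(\<Sum>i\<in>UNIV. \<Sum>j\<in>UNIV. g q (nab q v (e i)) (e j q) *\<^sub>R ((gam i ** gam j) *v y q)) = 4 *\<^sub>R Phi gam s0 0 Z"
    using g2_spin_action[OF spin s0 P, of "fpart gam s0 (y q)" "Xpart gam s0 (y q)"]
    by (simp add: Phi_parts[OF sp] gv_def[OF spin] matrix_vector_mul_assoc Z_def)
  then have sn: "spinor_nabla g nab gam e q v \<Psi> = D + Phi gam s0 0 Z"
    by (simp add: spinor_nabla_def D_def y_def)
  show "fpart gam s0 (spinor_nabla g nab gam e q v \<Psi>) \<bullet> b = v (fcomp \<Psi> e b)"
    using LD[OF bounded_linear_comps(1)[of b]]
    by (simp add: sn parts_linear[OF sp] parts_Phi[OF sp] fcomp_def[abs_def] y_def)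
  show "Xpart gam s0 (spinor_nabla g nab gam e q v \<Psi>) $ j \<bullet> b
      = v (Xcomp \<Psi> e b j) + (\<Sum>k\<in>UNIV. g q (nab q v (e k)) (e j q) * Xcomp \<Psi> e b k q)"
    using LD[OF bounded_linear_comps(2)[of j b]]
    by (simp add: sn parts_linear[OF sp] parts_Phi[OF sp] Xcomp_def[abs_def] y_def Z_def inner_add_left inner_sum_left)
qed

lemma frame_nabla_parts:
  assumes q: "q \<in> U"
  shows "fpart gam s0 (spinor_nabla g nab gam e q (e i q) \<Psi>) \<bullet> b = e i q (fcomp \<Psi> e b)"
    "Xpart gam s0 (spinor_nabla g nab gam e q (e i q) \<Psi>) $ j \<bullet> b = cov_deriv e (coeff g nab e) (Xcomp \<Psi> e b) i j q"
proof -
  have P: "w_action (\<lambda>a b. g q (nab q (e i q) (e a)) (e b q)) j k l = 0" for j k l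
    by (rule N_g2[OF geo lf q, unfolded coeff_def[OF geo]])
  show "fpart gam s0 (spinor_nabla g nab gam e q (e i q) \<Psi>) \<bullet> b = e i q (fcomp \<Psi> e b)"
    by (rule spinor_nabla_parts(1)[OF q lf_tan[OF geo lf q] P])
  show "Xpart gam s0 (spinor_nabla g nab gam e q (e i q) \<Psi>) $ j \<bullet> b = cov_deriv e (coeff g nab e) (Xcomp \<Psi> e b) i j q"
    unfolding B_def coeff_def[OF geo] by (rule spinor_nabla_parts(2)[OF q lf_tan[OF geo lf q] P])
qed

lemma nabla_zero_all_directions:
  assumes q: "q \<in> U" and f: "\<And>i b. e i q (fcomp \<Psi> e b) = 0" 
    and X: "\<And>i j b. cov_deriv e (coeff g nab e) (Xcomp \<Psi> e b) i j q = 0" and v: "v \<in> tangent_space A q"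
  shows "spinor_nabla g nab gam e q v \<Psi> = 0"
proof -
  note T = lf_tan[OF geo lf q]
  define c where "c i = g q v (e i q)" for i
  have vc: "v = tcomb c (\<lambda>i. e i q)"
    using frame_expand[OF am3 lf_on[OF geo lf q] v] by (simp add: c_def[abs_def])
  have P: "g q (nab q v (e a)) (e b q) = (\<Sum>i\<in>UNIV. c i * coeff g nab e i a b q)" for a b
  proof -
    note aff = affine[OF geo affs(2)[OF geo] lf_open[OF geo lf] q lf_vf[OF geo lf, of a]]
    have "g q (nab q (tcomb c (\<lambda>i. e i q)) (e a)) (e b q) = (\<Sum>i\<in>UNIV. c i * g q (nab q (e i q) (e a)) (e b q))"
    proof (rule tcomb_multilinear(2)[where T = "tangent_space A q" and F = "\<lambda>u. g q (nab q u (e a)) (e b q)"])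
      fix u v' and x z :: real assume uv: "u \<in> tangent_space A q" "v' \<in> tangent_space A q"
      show "lincomb x u z v' \<in> tangent_space A q" by (rule lincomb_tangent[OF am3 uv])
      show "g q (nab q (lincomb x u z v') (e a)) (e b q) = x * g q (nab q u (e a)) (e b q) + z * g q (nab q v' (e a)) (e b q)"
        unfolding aff(2)[OF uv] by (rule g_lin[OF am3 aff(1)[OF uv(1)] aff(1)[OF uv(2)] T])
    qed (rule T)
    then show ?thesis by (simp add: vc[symmetric] coeff_def[OF geo])
  qed
  have w0: "w_action (\<lambda>a b. g q (nab q v (e a)) (e b q)) j k l = 0" for j k l
    unfolding P by (simp add: w_action_sum w_action_linear N_g2[OF geo lf q])
  note parts = spinor_nabla_parts[OF q v w0]
  have vf: "v h = (\<Sum>i\<in>UNIV. c i * e i q h)" for h by (subst vc) (simp add: tcomb_def)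
  have "fpart gam s0 (spinor_nabla g nab gam e q v \<Psi>) \<bullet> b = 0" for b
    unfolding parts(1) vf by (simp add: f)
  from this[of "fpart gam s0 (spinor_nabla g nab gam e q v \<Psi>)"]
  have 1: "fpart gam s0 (spinor_nabla g nab gam e q v \<Psi>) = 0" by simp
  have "Xpart gam s0 (spinor_nabla g nab gam e q v \<Psi>) $ j \<bullet> b = 0" for j b
  proof -
    have "(\<Sum>k\<in>UNIV. (\<Sum>i\<in>UNIV. c i * coeff g nab e i k j q) * Xcomp \<Psi> e b k q)
      = (\<Sum>i\<in>UNIV. c i * (\<Sum>k\<in>UNIV. coeff g nab e i k j q * Xcomp \<Psi> e b k q))"
      unfolding sum_distrib_left sum_distrib_right by (subst sum.swap) (simp add: mult.assoc)
    then have "Xpart gam s0 (spinor_nabla g nab gam e q v \<Psi>) $ j \<bullet> b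
      = (\<Sum>i\<in>UNIV. c i * cov_deriv e (coeff g nab e) (Xcomp \<Psi> e b) i j q)"
      unfolding parts(2) P vf by (simp add: B_def distrib_left sum.distrib)
    then show ?thesis by (simp add: X)
  qed
  then have "Xpart gam s0 (spinor_nabla g nab gam e q v \<Psi>) $ j \<bullet> Xpart gam s0 (spinor_nabla g nab gam e q v \<Psi>) $ j = 0" for j
    by blast
  then have 2: "Xpart gam s0 (spinor_nabla g nab gam e q v \<Psi>) = 0" by (simp add: vec_eq_iff)
  show ?thesis using Phi_parts[OF sp, of "spinor_nabla g nab gam e q v \<Psi>"] 1 2 by (simp add: Phi_def[OF sp])
qed

text \<open>Clifford multiplication of a vector with \<open>Y s\<^sub>0\<close> has scalar part minus the inner product and vector part the
  cross product.\<close>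

lemma dirac_parts:
  assumes q: "q \<in> U" and D: "dirac g nab gam e q \<Psi> = 0"
  shows "frame_div e (coeff g nab e) (Xcomp \<Psi> e b) q = 0"
    "e k q (fcomp \<Psi> e b) = - frame_curl e (coeff g nab e) (Xcomp \<Psi> e b) k q"
proof -
  define S where "S i = spinor_nabla g nab gam e q (e i q) \<Psi>" for i
  have S: "S i = Phi gam s0 (fpart gam s0 (S i)) (Xpart gam s0 (S i))" for i by (simp add: Phi_parts[OF sp])
  have D': "(\<Sum>i\<in>UNIV. gv gam i (S i)) = 0" using D by (simp add: dirac_def S_def gv_def[OF spin])
  have fg: "fpart gam s0 (gv gam i (S i)) = - (Xpart gam s0 (S i) $ i)"
    and Xg: "Xpart gam s0 (gv gam i (S i)) $ k = of_real (d7 i k) * fpart gam s0 (S i) + (\<Sum>j\<in>UNIV. of_real (w i j k) * Xpart gam s0 (S i) $ j)" for i k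
    by (subst S, simp add: gv_Phi[OF sp] parts_Phi[OF sp])+
  note lf1 = linear_sum[OF bounded_linear.linear[OF bounded_linear_parts(1)[OF sp]]]
    linear_sum[OF bounded_linear.linear[OF bounded_linear_parts(2)[OF sp]]]
    linear_0[OF bounded_linear.linear[OF bounded_linear_parts(1)[OF sp]]]
    linear_0[OF bounded_linear.linear[OF bounded_linear_parts(2)[OF sp]]]
  have "(\<Sum>i\<in>UNIV. fpart gam s0 (gv gam i (S i))) = 0"
    using arg_cong[OF D', of "fpart gam s0"] by (simp add: lf1)
  then have "(\<Sum>i\<in>UNIV. Xpart gam s0 (S i) $ i) = 0" by (simp add: fg sum_negf)
  then have "(\<Sum>i\<in>UNIV. Xpart gam s0 (S i) $ i \<bullet> b) = 0" by (simp add: inner_sum_left[symmetric])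
  then show "frame_div e (coeff g nab e) (Xcomp \<Psi> e b) q = 0"
    by (simp add: S_def frame_nabla_parts[OF q] dvg_def)
  have sc: "(of_real r * z) \<bullet> b = r * (z \<bullet> b)" for r and z :: 'k
    by (simp add: scaleR_conv_of_real[symmetric])
  have "(\<Sum>i\<in>UNIV. Xpart gam s0 (gv gam i (S i))) $ k = 0"
    using arg_cong[OF D', of "Xpart gam s0"] by (simp add: lf1)
  then have "(\<Sum>i\<in>UNIV. Xpart gam s0 (gv gam i (S i)) $ k) \<bullet> b = 0" by simp
  then have "(\<Sum>i\<in>UNIV. d7 i k * (fpart gam s0 (S i) \<bullet> b) + (\<Sum>j\<in>UNIV. w i j k * (Xpart gam s0 (S i) $ j \<bullet> b))) = 0"
    by (simp only: Xg inner_sum_left inner_add_left sc)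
  then show "e k q (fcomp \<Psi> e b) = - frame_curl e (coeff g nab e) (Xcomp \<Psi> e b) k q"
    by (simp add: S_def frame_nabla_parts[OF q] curl_def sum.distrib)
qed

end

definition some_frame :: "'m \<Rightarrow> 7 \<Rightarrow> 'm tvec" where
  "some_frame p = (SOME e. adapted_frame A g om p e)"

lemma some_frame_adapted: "adapted_frame A g om p (some_frame p)"
proof -
  obtain U e where "p \<in> U" "local_adapted_frame A g om U e" using G2s unfolding G2_structure_def by blast
  then have "adapted_frame A g om p (\<lambda>i. e i p)" using lf_ad[OF geo] by blast
  then show ?thesis unfolding some_frame_def by (rule someI[of "adapted_frame A g om p"])
qed

definition fglob :: "'k \<Rightarrow> 'm \<Rightarrow> real" where
  "fglob b p = fpart gam s0 (\<Psi> p (some_frame p)) \<bullet> b"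

definition nglob :: "'k \<Rightarrow> 'm \<Rightarrow> real" where
  "nglob b p = (\<Sum>k\<in>UNIV. (Xpart gam s0 (\<Psi> p (some_frame p)) $ k \<bullet> b) * (Xpart gam s0 (\<Psi> p (some_frame p)) $ k \<bullet> b))"

text \<open>The lift of the stabiliser fixes the scalar part and rotates the vector part.\<close>

lemma frame_independent:
  assumes ad: "adapted_frame A g om p e"
  shows "fpart gam s0 (\<Psi> p e) \<bullet> b = fglob b p"
    "(\<Sum>k\<in>UNIV. (Xpart gam s0 (\<Psi> p e) $ k \<bullet> b) * (Xpart gam s0 (\<Psi> p e) $ k \<bullet> b)) = nglob b p"
proof -
  obtain h where h: "h \<in> G2" "e = frame_act (some_frame p) h"
    using adapted_frame_change[OF am3 some_frame_adapted ad] by blast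
  define f X where "f = fpart gam s0 (\<Psi> p e)" and "X = Xpart gam s0 (\<Psi> p e)"
  have "kap h *v \<Psi> p e = \<Psi> p (some_frame p)"
    using Psi h some_frame_adapted[of p] by (simp add: spinor_field_def)
  then have "\<Psi> p (some_frame p) = kap h *v Phi gam s0 f X"
    by (simp add: f_def X_def Phi_parts[OF sp])
  then have eq: "\<Psi> p (some_frame p) = Phi gam s0 f (\<chi> j. \<Sum>k\<in>UNIV. of_real (h $ j $ k) * X $ k)"
    by (simp add: G2_lift_Phi[OF sp kap h(1)])
  show "fpart gam s0 (\<Psi> p e) \<bullet> b = fglob b p"
    by (simp add: fglob_def eq parts_Phi[OF sp] f_def)
  have sc: "(of_real r * z) \<bullet> b = r * (z \<bullet> b)" for r and z :: 'k
    by (simp add: scaleR_conv_of_real[symmetric])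
  define x :: "real^7" where "x = (\<chi> k. X $ k \<bullet> b)"
  have hx: "Xpart gam s0 (\<Psi> p (some_frame p)) $ j \<bullet> b = (h *v x) $ j" for j
    by (simp add: eq parts_Phi[OF sp] inner_sum_left sc x_def matrix_vector_mult_def)
  have "h \<in> Gw" using h(1) G2_eq by simp
  then have "(h *v x) \<bullet> (h *v x) = x \<bullet> x" by (rule Gw_inner)
  then show "(\<Sum>k\<in>UNIV. (Xpart gam s0 (\<Psi> p e) $ k \<bullet> b) * (Xpart gam s0 (\<Psi> p e) $ k \<bullet> b)) = nglob b p"
    by (simp add: nglob_def hx inner_vec_def x_def X_def)
qed

context
  assumes comp: "compact (UNIV :: 'm set)" and conn: "connected (UNIV :: 'm set)"
    and D: "\<And>U e p. local_adapted_frame A g om U e \<Longrightarrow> p \<in> U \<Longrightarrow> dirac g nab gam e p \<Psi> = 0"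
begin

text \<open>Over a chart domain the coordinate functions show that the frame vectors are linearly independent as
  derivations.\<close>

lemma small_frame:
  assumes lf: "local_adapted_frame A g om U0 e" and p: "p \<in> U0"
  obtains U V \<phi> where "p \<in> U" "U \<subseteq> U0" "local_adapted_frame A g om U e" "(V, \<phi>) \<in> A" "U \<subseteq> V"
proof -
  obtain V \<phi> where V: "(V, \<phi>) \<in> A" "p \<in> V" by (rule chart_exists[OF atlas])
  have "local_adapted_frame A g om (U0 \<inter> V) e"
    using lf chart(1)[OF atlas V(1)] vector_field_subset[OF atlas, of U0 _ "U0 \<inter> V"]
    by (auto simp: local_adapted_frame_def)
  then show ?thesis using that[of "U0 \<inter> V" V \<phi>] V p by auto
qed

lemma frame_exists:
  obtains U e V \<phi> where "p \<in> U" "local_adapted_frame A g om U e" "(V, \<phi>) \<in> A" "U \<subseteq> V"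
proof -
  obtain U0 e where "p \<in> U0" "local_adapted_frame A g om U0 e" using G2s unfolding G2_structure_def by blast
  then show ?thesis using small_frame that by metis
qed

lemma frame_det: 
  assumes lf: "local_adapted_frame A g om U e"
  shows "\<forall>(V, \<phi>)\<in>A. \<forall>q\<in>U \<inter> V. det (\<chi> i j. e i q (\<lambda>r. \<phi> r $ j)) \<noteq> 0"
  using on_det[OF am3 lf_on[OF geo lf]] by fastforce

lemma lap_coeff_smooth:
  assumes lf: "local_adapted_frame A g om U e"
  shows "smooth_map A U (trace_coeff (coeff g nab e) k)"
  unfolding lap_coeff_def[abs_def]
  by (rule smooth_map_sum[OF atlas lf_open[OF geo lf] coeff_smooth[OF geo lf affs(2)[OF geo]]])

lemma fglob_const: "\<exists>c. \<forall>p. fglob b p = c"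
proof (rule strong_max_principle[OF atlas comp conn])
  fix p
  obtain U e V \<phi> where U: "p \<in> U" and lf: "local_adapted_frame A g om U e" and V: "(V, \<phi>) \<in> A" "U \<subseteq> V"
    by (rule frame_exists)
  note o = lf_open[OF geo lf] and cf = calculus_facts[OF geo lf V]
  have eq: "fcomp \<Psi> e b r = fglob b r" if "r \<in> U" for r
    unfolding fcomp_def by (rule frame_independent(1)[OF lf_ad[OF geo lf that]])
  have s: "smooth_map A U (fglob b)"
    by (rule smooth_map_cong[OF atlas o eq comps_smooth(1)[OF lf]])
  have "frame_laplacian e (trace_coeff (coeff g nab e)) (fglob b) q = 0" if q: "q \<in> U" for q
  proof -
    have "frame_laplacian e (trace_coeff (coeff g nab e)) (fcomp \<Psi> e b) q = 0"
    proof -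
      have d: "frame_div e (coeff g nab e) (Xcomp \<Psi> e b) r = 0" if "r \<in> U" for r
        using dirac_parts(1)[OF lf that D[OF lf that]] .
      have c: "e k r (fcomp \<Psi> e b) = - frame_curl e (coeff g nab e) (Xcomp \<Psi> e b) k r" if "r \<in> U" for k r
        using dirac_parts(2)[OF lf that D[OF lf that]] .
      show ?thesis
        by (rule laplacian_curl[where c = "\<lambda>i j k q. coeff g nabg e i j k q - coeff g nabg e j i k q" and A = A and U = U
              and t = "- (lam / 6)" and X = "Xcomp \<Psi> e b"])
          (fact cf comps_smooth(2)[OF lf, of b] q d comps_smooth(1)[OF lf] c)+
    qed
    then show ?thesis
      using frame_laplacian_cong[OF atlas o q lf_vf[OF geo lf] comps_smooth(1)[OF lf] eq] by simp
  qed
  then show "\<exists>U e b'. open U \<and> p \<in> U \<and> smooth_map A U (fglob b) \<and> (\<forall>i. vector_field A U (e i)) \<and>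
       (\<forall>k. smooth_map A U (b' k)) \<and> (\<forall>q\<in>U. frame_laplacian e b' (fglob b) q \<ge> 0) \<and>
       (\<forall>(V, \<phi>)\<in>A. \<forall>q\<in>U \<inter> V. det (\<chi> i j. e i q (\<lambda>r. \<phi> r $ j)) \<noteq> 0)"
    using o U s lf_vf[OF geo lf] lap_coeff_smooth[OF lf] frame_det[OF lf]
    by (intro exI[of _ U] exI[of _ e] exI[of _ "trace_coeff (coeff g nab e)"]) auto
qed

lemma fcomp_derivative:
  assumes lf: "local_adapted_frame A g om U e" and q: "q \<in> U"
  shows "e i q (fcomp \<Psi> e b) = 0"
proof -
  obtain c where c: "\<And>p. fglob b p = c" using fglob_const by blast
  have "e i q (fcomp \<Psi> e b) = e i q (\<lambda>r. c)"
  proof (rule tv_local[OF atlas lf_tan[OF geo lf q] lf_open[OF geo lf] q comps_smooth(1)[OF lf]])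
    fix r assume "r \<in> U"
    then show "fcomp \<Psi> e b r = c"
      using frame_independent(1)[OF lf_ad[OF geo lf], of r b] c by (simp add: fcomp_def)
  qed
  then show ?thesis using tv_const[OF atlas lf_tan[OF geo lf q]] by simp
qed

lemma laplacian_nglob:
  assumes lf: "local_adapted_frame A g om U e" and V: "(V, \<phi>) \<in> A" "U \<subseteq> V" and q: "q \<in> U"
  shows "smooth_map A U (nglob b)"
    "frame_laplacian e (trace_coeff (coeff g nab e)) (nglob b) q
     = 2 * (\<Sum>i\<in>UNIV. \<Sum>k\<in>UNIV. cov_deriv e (coeff g nab e) (Xcomp \<Psi> e b) i k q * cov_deriv e (coeff g nab e) (Xcomp \<Psi> e b) i k q)
       + 48 * (- (lam / 6))\<^sup>2 * nglob b q"
proof -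
  note o = lf_open[OF geo lf] and cf = calculus_facts[OF geo lf V]
  have eq: "(\<Sum>k\<in>UNIV. Xcomp \<Psi> e b k r * Xcomp \<Psi> e b k r) = nglob b r" if "r \<in> U" for r
    unfolding Xcomp_def by (rule frame_independent(2)[OF lf_ad[OF geo lf that]])
  have s: "smooth_map A U (\<lambda>r. \<Sum>k\<in>UNIV. Xcomp \<Psi> e b k r * Xcomp \<Psi> e b k r)"
    by (intro smooth_map_sum[OF atlas o] smooth_map_mult[OF atlas o] comps_smooth(2)[OF lf])
  show "smooth_map A U (nglob b)" by (rule smooth_map_cong[OF atlas o eq s])
  have d: "frame_div e (coeff g nab e) (Xcomp \<Psi> e b) r = 0" if "r \<in> U" for r
    using dirac_parts(1)[OF lf that D[OF lf that]] .
  have c: "frame_curl e (coeff g nab e) (Xcomp \<Psi> e b) k r = 0" if "r \<in> U" for k r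
    using dirac_parts(2)[OF lf that D[OF lf that], of k b] fcomp_derivative[OF lf that, of k b] by simp
  have "frame_laplacian e (trace_coeff (coeff g nab e)) (nglob b) q
    = frame_laplacian e (trace_coeff (coeff g nab e)) (\<lambda>r. \<Sum>k\<in>UNIV. Xcomp \<Psi> e b k r * Xcomp \<Psi> e b k r) q"
    by (rule frame_laplacian_cong[OF atlas o q lf_vf[OF geo lf] s eq, symmetric])
  also have "\<dots> = 2 * (\<Sum>i\<in>UNIV. \<Sum>k\<in>UNIV. cov_deriv e (coeff g nab e) (Xcomp \<Psi> e b) i k q * cov_deriv e (coeff g nab e) (Xcomp \<Psi> e b) i k q)
       + 48 * (- (lam / 6))\<^sup>2 * (\<Sum>k\<in>UNIV. Xcomp \<Psi> e b k q * Xcomp \<Psi> e b k q)"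
    by (rule laplacian_norm[where c = "\<lambda>i j k q. coeff g nabg e i j k q - coeff g nabg e j i k q" and A = A and U = U])
      (fact cf comps_smooth(2)[OF lf, of b] q d c)+
  finally show "frame_laplacian e (trace_coeff (coeff g nab e)) (nglob b) q
     = 2 * (\<Sum>i\<in>UNIV. \<Sum>k\<in>UNIV. cov_deriv e (coeff g nab e) (Xcomp \<Psi> e b) i k q * cov_deriv e (coeff g nab e) (Xcomp \<Psi> e b) i k q)
       + 48 * (- (lam / 6))\<^sup>2 * nglob b q" unfolding eq[OF q] .
qed

lemma nglob_nonneg: "nglob b p \<ge> 0"
  unfolding nglob_def by (intro sum_nonneg) simp

lemma nglob_const: "\<exists>c. \<forall>p. nglob b p = c"
proof (rule strong_max_principle[OF atlas comp conn])
  fix p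
  obtain U e V \<phi> where U: "p \<in> U" and lf: "local_adapted_frame A g om U e" and V: "(V, \<phi>) \<in> A" "U \<subseteq> V"
    by (rule frame_exists)
  have "frame_laplacian e (trace_coeff (coeff g nab e)) (nglob b) q \<ge> 0" if q: "q \<in> U" for q
  proof -
    have "0 \<le> (\<Sum>i\<in>UNIV. \<Sum>k\<in>UNIV. cov_deriv e (coeff g nab e) (Xcomp \<Psi> e b) i k q * cov_deriv e (coeff g nab e) (Xcomp \<Psi> e b) i k q)"
      by (intro sum_nonneg) simp
    then show ?thesis
      unfolding laplacian_nglob(2)[OF lf V q] using nglob_nonneg[of b q]
      by (intro add_nonneg_nonneg mult_nonneg_nonneg) auto
  qed
  then show "\<exists>U e b'. open U \<and> p \<in> U \<and> smooth_map A U (nglob b) \<and> (\<forall>i. vector_field A U (e i)) \<and>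
       (\<forall>k. smooth_map A U (b' k)) \<and> (\<forall>q\<in>U. frame_laplacian e b' (nglob b) q \<ge> 0) \<and>
       (\<forall>(V, \<phi>)\<in>A. \<forall>q\<in>U \<inter> V. det (\<chi> i j. e i q (\<lambda>r. \<phi> r $ j)) \<noteq> 0)"
    using lf_open[OF geo lf] U laplacian_nglob(1)[OF lf V U] lf_vf[OF geo lf] lap_coeff_smooth[OF lf] frame_det[OF lf]
    by (intro exI[of _ U] exI[of _ e] exI[of _ "trace_coeff (coeff g nab e)"]) auto
qed

text \<open>The Bochner formula for a function that is now known to be constant is a vanishing sum of
  nonnegative terms.\<close>

lemma harmonic_vanishing:
  assumes lf0: "local_adapted_frame A g om U0 e" and q: "q \<in> U0"
  shows "cov_deriv e (coeff g nab e) (Xcomp \<Psi> e b) i k q = 0" "lam * nglob b q = 0"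
proof -
  obtain U V \<phi> where U: "q \<in> U" and lf: "local_adapted_frame A g om U e" and V: "(V, \<phi>) \<in> A" "U \<subseteq> V"
    using small_frame[OF lf0 q] by metis
  obtain c where c: "\<And>p. nglob b p = c" using nglob_const by blast
  define Q where "Q = (\<Sum>i\<in>UNIV. \<Sum>k\<in>UNIV. cov_deriv e (coeff g nab e) (Xcomp \<Psi> e b) i k q * cov_deriv e (coeff g nab e) (Xcomp \<Psi> e b) i k q)"
  have "nglob b = (\<lambda>r. c)" using c by auto
  then have "frame_laplacian e (trace_coeff (coeff g nab e)) (nglob b) q = 0"
    using frame_laplacian_const[OF atlas lf_open[OF geo lf] U lf_vf[OF geo lf]] by simp
  then have z: "2 * Q + 48 * (- (lam / 6))\<^sup>2 * nglob b q = 0"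
    unfolding laplacian_nglob(2)[OF lf V U] Q_def .
  have "Q \<ge> 0" unfolding Q_def by (intro sum_nonneg) simp
  moreover have "48 * (- (lam / 6))\<^sup>2 * nglob b q \<ge> 0" using nglob_nonneg[of b q] by simp
  ultimately have "Q = 0" "48 * (- (lam / 6))\<^sup>2 * nglob b q = 0" using z by linarith+
  then show "lam * nglob b q = 0" by auto
  have "(\<Sum>k\<in>UNIV. cov_deriv e (coeff g nab e) (Xcomp \<Psi> e b) i k q * cov_deriv e (coeff g nab e) (Xcomp \<Psi> e b) i k q) = 0" for i
    using \<open>Q = 0\<close> unfolding Q_def by (subst (asm) sum_nonneg_eq_0_iff) (auto intro: sum_nonneg)
  then have "cov_deriv e (coeff g nab e) (Xcomp \<Psi> e b) i k q * cov_deriv e (coeff g nab e) (Xcomp \<Psi> e b) i k q = 0"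
    by (subst (asm) sum_nonneg_eq_0_iff) auto
  then show "cov_deriv e (coeff g nab e) (Xcomp \<Psi> e b) i k q = 0" by simp
qed

lemma harmonic_nabla_zero:
  assumes lf: "local_adapted_frame A g om U e" and q: "q \<in> U" and v: "v \<in> tangent_space A q"
  shows "spinor_nabla g nab gam e q v \<Psi> = 0"
  by (rule nabla_zero_all_directions[OF lf q fcomp_derivative[OF lf q] harmonic_vanishing(1)[OF lf q] v])

text \<open>If \<open>\<lambda>\<close> is not zero the vector part vanishes, and the scalar part is constant.\<close>

lemma harmonic_constant:
  assumes lam: "lam \<noteq> 0"
  shows "\<exists>c. \<forall>p e. adapted_frame A g om p e \<longrightarrow> \<Psi> p e = c *s s0"
proof -
  obtain p0 :: 'm where True by blast
  define c where "c = fpart gam s0 (\<Psi> p0 (some_frame p0))"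
  have "\<Psi> p e = c *s s0" if ad: "adapted_frame A g om p e" for p e
  proof -
    have "fpart gam s0 (\<Psi> p e) \<bullet> b = c \<bullet> b" for b
    proof -
      obtain c' where "\<And>p. fglob b p = c'" using fglob_const by blast
      then show ?thesis using frame_independent(1)[OF ad, of b] by (simp add: c_def) (simp add: fglob_def)
    qed
    then have 1: "fpart gam s0 (\<Psi> p e) = c" using vector_eq_rdot by blast
    have "Xpart gam s0 (\<Psi> p e) $ k \<bullet> b = 0" for k b
    proof -
      obtain U e' V \<phi> where "p \<in> U" "local_adapted_frame A g om U e'" "(V, \<phi>) \<in> A" "U \<subseteq> V"
        by (rule frame_exists)
      then have "nglob b p = 0" using harmonic_vanishing(2) lam by fastforce
      then have "(\<Sum>k\<in>UNIV. (Xpart gam s0 (\<Psi> p e) $ k \<bullet> b) * (Xpart gam s0 (\<Psi> p e) $ k \<bullet> b)) = 0"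
        using frame_independent(2)[OF ad] by simp
      then have "(Xpart gam s0 (\<Psi> p e) $ k \<bullet> b) * (Xpart gam s0 (\<Psi> p e) $ k \<bullet> b) = 0"
        by (subst (asm) sum_nonneg_eq_0_iff) auto
      then show ?thesis by simp
    qed
    then have "Xpart gam s0 (\<Psi> p e) $ k \<bullet> Xpart gam s0 (\<Psi> p e) $ k = 0" for k by blast
    then have 2: "Xpart gam s0 (\<Psi> p e) = 0" by (simp add: vec_eq_iff)
    show ?thesis using Phi_parts[OF sp, of "\<Psi> p e"] 1 2 by (simp add: Phi_def[OF sp])
  qed
  then show ?thesis by blast
qed

end
end

definition Psi0 :: "'k \<Rightarrow> ('m, 'k) spinor" where
  "Psi0 c p e = (if adapted_frame A g om p e then c *s s0 else 0)"

lemma Psi0_parallel: "parallel_spinor A g om nab gam kap (Psi0 c)"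
proof -
  have kc: "kap h *v (c *s s0) = c *s s0" if "h \<in> G2" for h
    using G2_lift_s0[OF sp kap that] by (simp add: vector_scalar_commute)
  have sf: "spinor_field A g om kap (Psi0 c)"
    unfolding spinor_field_def
  proof (intro conjI allI ballI impI)
    show "Psi0 c p e = 0" if "\<not> adapted_frame A g om p e" for p e using that by (simp add: Psi0_def)
    show "kap h *v Psi0 c p (frame_act e h) = Psi0 c p e" if "h \<in> G2" "adapted_frame A g om p e" for p e h
      using that frame_act_adapted[OF am3 that(2,1)] kc[OF that(1)] by (simp add: Psi0_def)
    fix U e assume lf: "local_adapted_frame A g om U e"
    show "smooth_map A U (\<lambda>p. Psi0 c p (\<lambda>i. e i p))"
      by (rule smooth_map_cong[OF atlas lf_open[OF geo lf] _ smooth_map_const[OF atlas lf_open[OF geo lf], of "c *s s0"]])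
         (simp add: Psi0_def lf_ad[OF geo lf])
  qed
  have cs0: "c *s s0 = Phi gam s0 c 0" by (simp add: Phi_def[OF sp])
  show ?thesis unfolding parallel_spinor_def
  proof (intro conjI allI impI ballI sf)
    fix U e q v assume lf: "local_adapted_frame A g om U e" and q: "q \<in> U" and v: "v \<in> tangent_space A q"
    have val: "Psi0 c r (\<lambda>i. e i r) = Phi gam s0 c 0" if "r \<in> U" for r
      using lf_ad[OF geo lf that] by (simp add: Psi0_def cs0)
    have X0: "Xcomp (Psi0 c) e b j r = 0" if "r \<in> U" for b j r
      by (simp add: Xcomp_def val[OF that] parts_Phi[OF sp])
    have Xd: "e i q (Xcomp (Psi0 c) e b j) = 0" for i b j
      using tv_local[OF atlas lf_tan[OF geo lf q] lf_open[OF geo lf] q comps_smooth(2)[OF sf lf] X0]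
        tv_const[OF atlas lf_tan[OF geo lf q]] by simp
    show "spinor_nabla g nab gam e q v (Psi0 c) = 0"
    proof (rule nabla_zero_all_directions[OF sf lf q _ _ v])
      show "cov_deriv e (coeff g nab e) (Xcomp (Psi0 c) e b) i j q = 0" for i j b
        by (simp add: B_def Xd X0[OF q])
      show "e i q (fcomp (Psi0 c) e b) = 0" for i b
      proof -
        have "e i q (fcomp (Psi0 c) e b) = e i q (\<lambda>r. c \<bullet> b)"
          by (rule tv_local[OF atlas lf_tan[OF geo lf q] lf_open[OF geo lf] q comps_smooth(1)[OF sf lf]])
             (simp add: fcomp_def val parts_Phi[OF sp])
        then show ?thesis using tv_const[OF atlas lf_tan[OF geo lf q]] by simp
      qed
    qed
  qed
qed

end

theorem theorem5p6:
  fixes A :: "'m::{t2_space,second_countable_topology} chart set"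
    and g :: "'m \<Rightarrow> 'm tvec \<Rightarrow> 'm tvec \<Rightarrow> real"
    and om :: "'m form3"
    and nabg nab :: "'m conn"
    and lam :: real
    and gam :: "7 \<Rightarrow> 'k::{real_normed_field,euclidean_space}^8^8"
    and kap :: "real^7^7 \<Rightarrow> 'k^8^8"
  assumes "oriented_atlas A"
    and "compact (UNIV :: 'm set)"
    and "connected (UNIV :: 'm set)"
    and "riemannian_metric A g"
    and "G2_structure A g om"
    and "levi_civita A g nabg"
    and "nearly_parallel A g om nabg lam"
    and "G2_skew_connection A g om nab"
    and "spin_representation gam"
    and "G2_lift gam kap"
  shows "(\<forall>\<Psi>. harmonic_spinor A g om nab gam kap \<Psi> \<longrightarrow> parallel_spinor A g om nab gam kap \<Psi>) \<and>
    (lam \<noteq> 0 \<longrightarrow>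
      vector_space.dim spinor_scale {\<Psi>. parallel_spinor A g om nab gam kap \<Psi>} = 1)"
proof -
  obtain s0 where s0: "s0 \<noteq> 0" "adapted_vec gam s0" using adapted_vec_exists[OF assms(9)] by blast
  note all = assms(1,4-10) s0(2,1)
  have harm: "parallel_spinor A g om nab gam kap \<Psi>" if "harmonic_spinor A g om nab gam kap \<Psi>" for \<Psi> :: "('m, 'k) spinor"
    using that harmonic_nabla_zero[OF all _ assms(2,3), of \<Psi>]
    unfolding harmonic_spinor_def parallel_spinor_def by blast
  have "vector_space.dim spinor_scale {\<Psi> :: ('m, 'k) spinor. parallel_spinor A g om nab gam kap \<Psi>} = 1" if lam: "lam \<noteq> 0"
  proof -
    interpret vs: vector_space "spinor_scale :: 'k \<Rightarrow> ('m, 'k) spinor \<Rightarrow> ('m, 'k) spinor"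
      by (rule vector_space_spinor_scale)
    define P where "P = Psi0 A g om s0"
    have sc: "spinor_scale c (P 1) = P c" for c
      by (simp add: P_def Psi0_def[OF all] spinor_scale_def fun_eq_iff)
    have par: "parallel_spinor A g om nab gam kap (P c)" for c
      unfolding P_def by (rule Psi0_parallel[OF all])
    have "\<Psi> \<in> range (\<lambda>c. spinor_scale c (P 1))" if ps: "parallel_spinor A g om nab gam kap \<Psi>" for \<Psi>
    proof -
      have sf: "spinor_field A g om kap \<Psi>" using ps by (simp add: parallel_spinor_def)
      have D: "dirac g nab gam e p \<Psi> = 0" if "local_adapted_frame A g om U e" "p \<in> U" for U e p
        using ps that lf_tan[OF assms(1,4-8) that] by (simp add: parallel_spinor_def dirac_def)
      have "\<exists>c. \<forall>p e. adapted_frame A g om p e \<longrightarrow> \<Psi> p e = c *s s0"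
        by (rule harmonic_constant[OF all sf assms(2,3) _ lam]) (rule D)
      then obtain c where "\<forall>p e. adapted_frame A g om p e \<longrightarrow> \<Psi> p e = c *s s0" ..
      then have "\<Psi> = P c" using sf by (auto simp: fun_eq_iff P_def Psi0_def[OF all] spinor_field_def)
      then show ?thesis by (simp add: sc)
    qed
    then have eq: "{\<Psi>. parallel_spinor A g om nab gam kap \<Psi>} = range (\<lambda>c. spinor_scale c (P 1))"
      using par by (auto simp: sc)
    have "P 1 \<noteq> 0"
    proof
      assume "P 1 = 0"
      then have "P 1 p (some_frame A g om p) = 0" for p by (simp add: zero_fun_def)
      moreover have "spinor_field A g om kap (P 1)" using par[of 1] by (simp add: parallel_spinor_def)
      ultimately show False using some_frame_adapted[OF all] s0(1) by (simp add: P_def Psi0_def[OF all])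
    qed
    then have "vs.independent {P 1}" by simp
    then have "vs.dim (vs.span {P 1}) = card {P 1}" by (rule vs.dim_span_eq_card_independent)
    then show ?thesis unfolding eq vs.span_singleton by simp
  qed
  with harm show ?thesis by blast
qed

end
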